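(* Let $R$ be a unital commutative ring such that all finitely-generated stably-free $R$-modules are free, and let $\mathscr{O}$ be a binary operad in $R$-modules. The inclusion $\mathrm{Der}^{(1)}_{\mathrm{Lie}}(\mathscr{O}(-))\subset\mathrm{Der}^+(\mathscr{O}(-))$ and the generalized divergence $\mathsf{Div}^{\mathscr{O}}_-:\mathrm{Der}^+(\mathscr{O}(-))\to|\mathrm{Der}_\bullet^+(\mathscr{O}(R\oplus-))|$ induce a natural sequence of functors from $\mathcal{S}(R)$ to $R$-modules $$\mathrm{Der}^{(1)}_{\mathrm{Lie}}(\mathscr{O}(-))\to\mathrm{Der}^+(\mathscr{O}(-))\to|\mathrm{Der}_\bullet^+(\mathscr{O}(R\oplus-))|/\mathbf{Im}^{\mathscr{O}}(-)$$ that is short exact up to torsion. More precisely: 1. $\mathrm{Der}^{(1)}_{\mathrm{Lie}}(\mathscr{O}(-))\to\mathrm{Der}^+(\mathscr{O}(-))$ is a natural monomorphism; 2. the natural morphism $\mathrm{Der}^+(\mathscr{O}(-))\to|\mathrm{Der}_\bullet^+(\mathscr{O}(R\oplus-))|/\mathbf{Im}^{\mathscr{O}}(-)$ is $1$-surjective; 3. the middle homology is $6$-torsion.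
   Context: Operads are symmetric operads in $R$-modules. A binary operad is an operad admitting a surjective morphism of operads from the free operad on a set $B$ of generators of arity $2$ (no symmetry imposed); in particular $\mathscr{O}(0)=0$ and $\mathscr{O}(1)$ is generated by the unit. Free algebras. $\mathscr{O}(V)=\bigoplus_n\mathscr{O}_n(V)$, $\mathscr{O}_n(V)=\mathscr{O}(n)\otimes_{\mathfrak{S}_n}V^{\otimes n}$, is the free $\mathscr{O}$-algebra on $V$; $\mathscr{O}(V;W)=\bigoplus_{n\ge1}\mathscr{O}(n)\otimes_{\mathfrak{S}_{n-1}}(V^{\otimes n-1}\otimes W)$ is the summand of $\mathscr{O}(V\oplus W)$ of terms linear in $W$. The category $\mathcal{S}(R)$ has objects the free $R$-modules of finite rank and morphisms $V\to W$ the pairs $(i:V\to W,\ r:W\to V)$ of $R$-linear maps with $r\circ i=\mathrm{id}_V$. Derivations. For $V$ free of finite rank, $\mathrm{Der}(\mathscr{O}(V))$ is the module of derivations of the $\mathscr{O}$-algebra $\mathscr{O}(V)$; restriction to $V$ gives $\mathrm{Der}(\mathscr{O}(V))\cong\mathrm{Hom}_R(V,\mathscr{O}(V))\cong\mathscr{O}(V)\otimes V^\sharp$, where $V^\sharp=\mathrm{Hom}_R(V,R)$. It is graded with $\mathrm{Hom}_R(V,\mathscr{O}_n(V))$ in degree $n-1$; $\mathrm{Der}^+$ is the part of positive degree. It is a functor on $\mathcal{S}(R)$: $(i,r)$ sends $d$ to the derivation whose restriction to $W$ is $\mathscr{O}(i)\circ d|_V\circ r$. The preLie product is $(d\lhd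 e)|_V=e\circ(d|_V)$, with Lie bracket $[d,e]=d\lhd e-e\lhd d$. $\mathrm{Der}^{(1)}_{\mathrm{Lie}}(\mathscr{O}(V))$ is the sub Lie algebra of $\mathrm{Der}(\mathscr{O}(V))$ generated by the degree one part $\mathrm{Hom}_R(V,\mathscr{O}_2(V))$. Pointed derivations. $\mathrm{Der}_\bullet(\mathscr{O}(R\oplus V)):=\mathrm{Hom}_R(R,\mathscr{O}(V;R))\cong\mathscr{O}(V;R)$, a submodule of $\mathrm{Der}(\mathscr{O}(R\oplus V))$ via $R\oplus V\twoheadrightarrow R$ and $\mathscr{O}(V;R)\subset\mathscr{O}(R\oplus V)$; $\lhd$ restricts to an associative unital product on it. $\mathrm{Der}^+_\bullet(\mathscr{O}(R\oplus V))$ is its intersection with $\mathrm{Der}^+(\mathscr{O}(R\oplus V))$. For an associative (possibly non-unital) algebra $A$, $|A|=A/[A,A]$ with $[A,A]$ the submodule generated by commutators. Divergence. Let $\delta_V:\mathscr{O}(V)\to\mathscr{O}(V;V)$ send $\mu(v_1,\dots,v_n)$ to $\sum_i\mu(v_1,\dots,\overline{v_i},\dots,v_n)$, with $\overline{v_i}$ in the linear argument. $\Phi^{\mathscr{O}}_V:\mathrm{Der}(\mathscr{O}(V))\cong\mathscr{O}(V)\otimes V^\sharp\to\mathscr{O}(V;R)\cong\mathrm{Der}_\bullet(\mathscr{O}(R\oplus V))$ is $x\otimes f\mapsto\mathscr{O}(V;f)(\delta_V(x))$; it preserves degree. $\mathsf{Div}^{\mathscr{O}}_V:\mathrm{Der}^+(\mathscr{O}(V))\to|\mathrm{Der}^+_\bullet(\mathscr{O}(R\oplus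 V))|$ is the restriction of $\Phi^{\mathscr{O}}_V$ followed by the quotient map. $\mathbf{Im}^{\mathscr{O}}(V):=\mathsf{Div}^{\mathscr{O}}_V(\mathrm{Der}^{(1)}_{\mathrm{Lie}}(\mathscr{O}(V)))$. Torsion. For a functor $F:\mathcal{S}(R)\to R\text{-modules}$ and $n\in\mathbb{N}$, $F$ is $n$-torsion if for every $V$ the map $F(j_n):F(V)\to F(V\oplus R^n)$ is zero, where $j_n:V\to V\oplus R^n$ is the canonical split inclusion in $\mathcal{S}(R)$. A natural transformation is $n$-surjective if its cokernel is $n$-torsion. "Short exact up to torsion" is made precise by items 1–3. *)

theory Defs
  imports "HOL-Algebra.Module" "HOL-Algebra.AbelCoset" "HOL-Combinatorics.Permutations"
begin

section \<open>Modules over a commutative ring\<close>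

text \<open>Modules are \<^locale>\<open>module\<close>s of HOL-Algebra. Their record type extends that of rings; the fields
  \<^const>\<open>monoid.mult\<close> and \<^const>\<open>one\<close> play no role for modules and are left \<^const>\<open>undefined\<close>.\<close>

definition lin_maps :: "'r ring \<Rightarrow> ('r, 'a) module \<Rightarrow> ('r, 'b) module \<Rightarrow> ('a \<Rightarrow> 'b) set" where
  "lin_maps R M N = {h \<in> carrier M \<rightarrow> carrier N.
     (\<forall>x\<in>carrier M. \<forall>y\<in>carrier M. h (x \<oplus>\<^bsub>M\<^esub> y) = h x \<oplus>\<^bsub>N\<^esub> h y) \<and>
     (\<forall>a\<in>carrier R. \<forall>x\<in>carrier M. h (a \<odot>\<^bsub>M\<^esub> x) = a \<odot>\<^bsub>N\<^esub> h x)}"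

definition mod_iso :: "'r ring \<Rightarrow> ('r, 'a) module \<Rightarrow> ('r, 'b) module \<Rightarrow> bool" where
  "mod_iso R M N \<longleftrightarrow> (\<exists>h\<in>lin_maps R M N. bij_betw h (carrier M) (carrier N))"

definition mspan :: "'r ring \<Rightarrow> ('r, 'a) module \<Rightarrow> 'a set \<Rightarrow> 'a set" where
  "mspan R M S = \<Inter>{N. submodule N R M \<and> S \<subseteq> N}"

definition self_module :: "'r ring \<Rightarrow> ('r, 'r) module" where
  "self_module R = \<lparr>carrier = carrier R, monoid.mult = undefined, one = undefined,
     zero = \<zero>\<^bsub>R\<^esub>, add = (\<oplus>\<^bsub>R\<^esub>), smult = (\<otimes>\<^bsub>R\<^esub>)\<rparr>"

definition power_module :: "'r ring \<Rightarrow> nat \<Rightarrow> ('r, nat \<Rightarrow> 'r) module" where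
  "power_module R n = \<lparr>carrier = {..<n} \<rightarrow>\<^sub>E carrier R, monoid.mult = undefined, one = undefined,
     zero = (\<lambda>i\<in>{..<n}. \<zero>\<^bsub>R\<^esub>), add = (\<lambda>x y. \<lambda>i\<in>{..<n}. x i \<oplus>\<^bsub>R\<^esub> y i),
     smult = (\<lambda>a x. \<lambda>i\<in>{..<n}. a \<otimes>\<^bsub>R\<^esub> x i)\<rparr>"

definition dsum :: "('r, 'a) module \<Rightarrow> ('r, 'b) module \<Rightarrow> ('r, 'a \<times> 'b) module" where
  "dsum M N = \<lparr>carrier = carrier M \<times> carrier N, monoid.mult = undefined, one = undefined,
     zero = (\<zero>\<^bsub>M\<^esub>, \<zero>\<^bsub>N\<^esub>), add = (\<lambda>x y. (fst x \<oplus>\<^bsub>M\<^esub> fst y, snd x \<oplus>\<^bsub>N\<^esub> snd y)),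
     smult = (\<lambda>a x. (a \<odot>\<^bsub>M\<^esub> fst x, a \<odot>\<^bsub>N\<^esub> snd x))\<rparr>"

definition quot :: "'r ring \<Rightarrow> ('r, 'a) module \<Rightarrow> 'a set \<Rightarrow> ('r, 'a set) module" where
  "quot R M N = \<lparr>carrier = a_rcosets\<^bsub>M\<^esub> N, monoid.mult = undefined, one = undefined,
     zero = N, add = (<+>\<^bsub>M\<^esub>), smult = (\<lambda>a C. N <+>\<^bsub>M\<^esub> (\<lambda>x. a \<odot>\<^bsub>M\<^esub> x) ` C)\<rparr>"

text \<open>The map into \<open>M'/N'\<close> induced by \<open>h\<close> on the cosets of a submodule that \<open>h\<close> carries into \<open>N'\<close>.\<close>
definition quot_map :: "('r, 'b) module \<Rightarrow> 'b set \<Rightarrow> ('a \<Rightarrow> 'b) \<Rightarrow> 'a set \<Rightarrow> 'b set" where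
  "quot_map M' N' h C = N' <+>\<^bsub>M'\<^esub> h ` C"

definition submod :: "('r, 'a) module \<Rightarrow> 'a set \<Rightarrow> ('r, 'a) module" where
  "submod M N = M\<lparr>carrier := N\<rparr>"

definition coker :: "'r ring \<Rightarrow> ('r, 'a) module \<Rightarrow> ('r, 'b) module \<Rightarrow> ('a \<Rightarrow> 'b) \<Rightarrow> ('r, 'b set) module" where
  "coker R A B f = quot R B (f ` carrier A)"

text \<open>The homology at \<open>B\<close> of \<open>A \<rightarrow> B \<rightarrow> C\<close>.\<close>
definition homology :: "'r ring \<Rightarrow> ('r, 'a) module \<Rightarrow> ('r, 'b) module \<Rightarrow> ('r, 'c) module \<Rightarrow>
    ('a \<Rightarrow> 'b) \<Rightarrow> ('b \<Rightarrow> 'c) \<Rightarrow> ('r, 'b set) module" where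
  "homology R A B C f g = quot R (submod B {b \<in> carrier B. g b = \<zero>\<^bsub>C\<^esub>}) (f ` carrier A)"

definition free_fin_rank :: "'r ring \<Rightarrow> ('r, 'a) module \<Rightarrow> bool" where
  "free_fin_rank R M \<longleftrightarrow> module R M \<and> (\<exists>n. mod_iso R (power_module R n) M)"

definition fg_stably_free :: "'r ring \<Rightarrow> ('r, 'a) module \<Rightarrow> bool" where
  "fg_stably_free R M \<longleftrightarrow>
     module R M \<and> (\<exists>m n. mod_iso R (dsum M (power_module R m)) (power_module R n))"

text \<open>A finitely generated stably free module is isomorphic to a direct summand of some
  \<open>R\<^sup>n\<close>, so it suffices to let \<open>M\<close> range over modules whose carrier consists of elements of
  the type underlying \<open>R\<^sup>n\<close>; and finitely generated free means free of finite rank.\<close>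
definition fg_stably_free_are_free :: "'r ring \<Rightarrow> bool" where
  "fg_stably_free_are_free R \<longleftrightarrow>
     (\<forall>M :: ('r, nat \<Rightarrow> 'r) module. fg_stably_free R M \<longrightarrow> free_fin_rank R M)"

text \<open>The free module on a set \<open>X\<close>: finitely supported functions vanishing off \<open>X\<close>.\<close>
definition free_module :: "'r ring \<Rightarrow> 'x set \<Rightarrow> ('r, 'x \<Rightarrow> 'r) module" where
  "free_module R X = \<lparr>carrier = {f. (\<forall>x. f x \<in> carrier R) \<and> (\<forall>x. x \<notin> X \<longrightarrow> f x = \<zero>\<^bsub>R\<^esub>) \<and>
       finite {x. f x \<noteq> \<zero>\<^bsub>R\<^esub>}}, monoid.mult = undefined, one = undefined,
     zero = (\<lambda>x. \<zero>\<^bsub>R\<^esub>), add = (\<lambda>f g x. f x \<oplus>\<^bsub>R\<^esub> g x), smult = (\<lambda>a f x. a \<otimes>\<^bsub>R\<^esub> f x)\<rparr>"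

definition basis :: "'r ring \<Rightarrow> 'x \<Rightarrow> 'x \<Rightarrow> 'r" where
  "basis R x = (\<lambda>y. if y = x then \<one>\<^bsub>R\<^esub> else \<zero>\<^bsub>R\<^esub>)"

definition supp :: "'r ring \<Rightarrow> ('x \<Rightarrow> 'r) \<Rightarrow> 'x set" where
  "supp R f = {x. f x \<noteq> \<zero>\<^bsub>R\<^esub>}"

text \<open>Linear, respectively multilinear, extension to free modules of a map \<open>h\<close> given on basis
  elements, respectively on lists of basis elements.\<close>
definition lin_ext :: "'r ring \<Rightarrow> ('r, 'a) module \<Rightarrow> ('x \<Rightarrow> 'a) \<Rightarrow> ('x \<Rightarrow> 'r) \<Rightarrow> 'a" where
  "lin_ext R M h f = (\<Oplus>\<^bsub>M\<^esub>x\<in>supp R f. f x \<odot>\<^bsub>M\<^esub> h x)"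

definition multilin_ext :: "'r ring \<Rightarrow> ('r, 'a) module \<Rightarrow> ('x list \<Rightarrow> 'a) \<Rightarrow> ('x \<Rightarrow> 'r) list \<Rightarrow> 'a" where
  "multilin_ext R M h fs = (\<Oplus>\<^bsub>M\<^esub>xs\<in>listset (map (supp R) fs).
     (\<Otimes>\<^bsub>R\<^esub>i\<in>{..<length fs}. (fs ! i) (xs ! i)) \<odot>\<^bsub>M\<^esub> h xs)"


section \<open>Operads\<close>

text \<open>An operation is a pair of an arity \<open>n\<close> and an element of \<open>O(n)\<close>. The field \<open>cmp\<close> is the full
  composition \<open>\<gamma>(x; y\<^sub>1, \<dots>, y\<^sub>k)\<close>, with value in \<open>O(n\<^sub>1 + \<dots> + n\<^sub>k)\<close> if \<open>y\<^sub>i\<close> has arity \<open>n\<^sub>i\<close>.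
  Permutations act on the right.\<close>
record ('r, 'o) operad =
  Op :: "nat \<Rightarrow> ('r, 'o) module"
  act :: "nat \<Rightarrow> (nat \<Rightarrow> nat) \<Rightarrow> 'o \<Rightarrow> 'o"
  unt :: 'o
  cmp :: "nat \<times> 'o \<Rightarrow> (nat \<times> 'o) list \<Rightarrow> 'o"

definition ops :: "('r, 'o) operad \<Rightarrow> (nat \<times> 'o) set" where
  "ops P = {x. snd x \<in> carrier (Op P (fst x))}"

definition total_arity :: "(nat \<times> 'o) list \<Rightarrow> nat" where
  "total_arity ys = sum_list (map fst ys)"

definition comp_op :: "('r, 'o) operad \<Rightarrow> nat \<times> 'o \<Rightarrow> (nat \<times> 'o) list \<Rightarrow> nat \<times> 'o" where
  "comp_op P x ys = (total_arity ys, cmp P x ys)"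

text \<open>\<open>blocks 0 [n\<^sub>1, \<dots>, n\<^sub>k]\<close> cuts \<open>[0..<n\<^sub>1 + \<dots> + n\<^sub>k]\<close> into consecutive blocks of these lengths.\<close>
fun blocks :: "nat \<Rightarrow> nat list \<Rightarrow> nat list list" where
  "blocks a [] = []"
| "blocks a (n # ns) = [a..<a + n] # blocks (a + n) ns"

definition perm_of :: "nat list \<Rightarrow> nat \<Rightarrow> nat" where
  "perm_of l i = (if i < length l then l ! i else i)"

text \<open>The convention for the right action is \<open>(\<mu>\<sigma>)(x\<^sub>\<sigma>\<^sub>(\<^sub>1\<^sub>), \<dots>, x\<^sub>\<sigma>\<^sub>(\<^sub>n\<^sub>)) = \<mu>(x\<^sub>1, \<dots>, x\<^sub>n)\<close>, that is,
  \<open>\<mu>\<sigma>\<close> evaluated on \<^term>\<open>permute_list \<sigma> xs\<close> is \<open>\<mu>\<close> evaluated on \<open>xs\<close>. Accordingly the two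
  equivariance axioms involve the permutation of the concatenated inputs which permutes the
  blocks by \<open>\<sigma>\<close>, respectively which permutes each block by its own permutation.\<close>
locale operad = cring R for R :: "'r ring" (structure) and P :: "('r, 'o) operad" +
  assumes module_Op: "module R (Op P n)"
    and act_linear: "\<sigma> permutes {..<n} \<Longrightarrow> act P n \<sigma> \<in> lin_maps R (Op P n) (Op P n)"
    and act_id: "\<mu> \<in> carrier (Op P n) \<Longrightarrow> act P n id \<mu> = \<mu>"
    and act_comp: "\<lbrakk>\<mu> \<in> carrier (Op P n); \<sigma> permutes {..<n}; \<tau> permutes {..<n}\<rbrakk> \<Longrightarrow>
      act P n (\<sigma> \<circ> \<tau>) \<mu> = act P n \<tau> (act P n \<sigma> \<mu>)"
    and unt_closed: "unt P \<in> carrier (Op P 1)"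
    and cmp_linear_outer: "ys \<in> lists (ops P) \<Longrightarrow>
      (\<lambda>\<mu>. cmp P (length ys, \<mu>) ys) \<in> lin_maps R (Op P (length ys)) (Op P (total_arity ys))"
    and cmp_linear_inner: "\<lbrakk>x \<in> ops P; ys \<in> lists (ops P); length ys = fst x; i < fst x\<rbrakk> \<Longrightarrow>
      (\<lambda>\<nu>. cmp P x (ys[i := (fst (ys ! i), \<nu>)])) \<in> lin_maps R (Op P (fst (ys ! i))) (Op P (total_arity ys))"
    and cmp_unt_left: "y \<in> ops P \<Longrightarrow> cmp P (1, unt P) [y] = snd y"
    and cmp_unt_right: "x \<in> ops P \<Longrightarrow> cmp P x (replicate (fst x) (1, unt P)) = snd x"
    and cmp_assoc: "\<lbrakk>x \<in> ops P; ys \<in> lists (ops P); length ys = fst x;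
        zss \<in> lists (lists (ops P)); map length zss = map fst ys\<rbrakk> \<Longrightarrow>
      cmp P (comp_op P x ys) (concat zss) = cmp P x (map2 (comp_op P) ys zss)"
    and cmp_equivariant_outer: "\<lbrakk>(k, \<mu>) \<in> ops P; ys \<in> lists (ops P); length ys = k;
        \<sigma> permutes {..<k}\<rbrakk> \<Longrightarrow>
      cmp P (k, act P k \<sigma> \<mu>) (permute_list \<sigma> ys) =
      act P (total_arity ys) (perm_of (concat (permute_list \<sigma> (blocks 0 (map fst ys))))) (cmp P (k, \<mu>) ys)"
    and cmp_equivariant_inner: "\<lbrakk>x \<in> ops P; ys \<in> lists (ops P); length ys = fst x;
        length \<sigma>s = fst x; \<forall>i<fst x. (\<sigma>s ! i) permutes {..<fst (ys ! i)}\<rbrakk> \<Longrightarrow>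
      cmp P x (map2 (\<lambda>\<sigma> y. (fst y, act P (fst y) \<sigma> (snd y))) \<sigma>s ys) =
      act P (total_arity ys) (perm_of (concat (map2 permute_list \<sigma>s (blocks 0 (map fst ys))))) (cmp P x ys)"

definition operad_hom :: "'r ring \<Rightarrow> ('r, 'o) operad \<Rightarrow> ('r, 'p) operad \<Rightarrow> (nat \<Rightarrow> 'o \<Rightarrow> 'p) \<Rightarrow> bool" where
  "operad_hom R P Q \<phi> \<longleftrightarrow>
     (\<forall>n. \<phi> n \<in> lin_maps R (Op P n) (Op Q n)) \<and>
     (\<forall>n \<sigma> \<mu>. \<sigma> permutes {..<n} \<longrightarrow> \<mu> \<in> carrier (Op P n) \<longrightarrow>
        \<phi> n (act P n \<sigma> \<mu>) = act Q n \<sigma> (\<phi> n \<mu>)) \<and>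
     \<phi> 1 (unt P) = unt Q \<and>
     (\<forall>x\<in>ops P. \<forall>ys\<in>lists (ops P). length ys = fst x \<longrightarrow>
        \<phi> (total_arity ys) (cmp P x ys) =
        cmp Q (fst x, \<phi> (fst x) (snd x)) (map (\<lambda>y. (fst y, \<phi> (fst y) (snd y))) ys))"

subsection \<open>Free operads on binary generators\<close>

text \<open>The free operad on a set \<open>B\<close> of generators of arity \<open>2\<close> without symmetry has as basis in
  arity \<open>n\<close> the planar binary trees with internal vertices labelled by \<open>B\<close> and leaves
  labelled bijectively by \<open>{..<n}\<close>, the label of a leaf being the input it stands for.\<close>
datatype 'b btree = Leaf nat | Node 'b "'b btree" "'b btree"

fun leaves :: "'b btree \<Rightarrow> nat list" where
  "leaves (Leaf i) = [i]"
| "leaves (Node b l r) = leaves l @ leaves r"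

text \<open>Replace the leaf labelled \<open>i\<close> by the tree \<open>s i\<close>.\<close>
fun subst_leaves :: "(nat \<Rightarrow> 'b btree) \<Rightarrow> 'b btree \<Rightarrow> 'b btree" where
  "subst_leaves s (Leaf i) = s i"
| "subst_leaves s (Node b l r) = Node b (subst_leaves s l) (subst_leaves s r)"

definition relabel :: "(nat \<Rightarrow> nat) \<Rightarrow> 'b btree \<Rightarrow> 'b btree" where
  "relabel g = subst_leaves (\<lambda>i. Leaf (g i))"

definition btrees :: "'b set \<Rightarrow> nat \<Rightarrow> 'b btree set" where
  "btrees B n = {t. set_btree t \<subseteq> B \<and> distinct (leaves t) \<and> set (leaves t) = {..<n}}"

definition graft :: "nat list \<Rightarrow> 'b btree \<Rightarrow> 'b btree list \<Rightarrow> 'b btree" where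
  "graft ns t ss = subst_leaves (\<lambda>i. relabel (\<lambda>j. sum_list (take i ns) + j) (ss ! i)) t"

text \<open>On basis elements \<open>\<sigma>\<close> sends \<open>t\<close> to \<open>relabel (inv \<sigma>) t\<close>.\<close>
definition free_binary_operad :: "'r ring \<Rightarrow> 'b set \<Rightarrow> ('r, 'b btree \<Rightarrow> 'r) operad" where
  "free_binary_operad R B = \<lparr>Op = (\<lambda>n. free_module R (btrees B n)),
     act = (\<lambda>n \<sigma> f t. f (relabel \<sigma> t)),
     unt = basis R (Leaf 0),
     cmp = (\<lambda>x ys. multilin_ext R (free_module R (btrees B (total_arity ys)))
        (\<lambda>ts. basis R (graft (map fst ys) (hd ts) (tl ts))) (snd x # map snd ys))\<rparr>"

text \<open>A morphism out of the free operad on \<open>B\<close> is determined by the map \<open>B \<rightarrow> O(2)\<close>, and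
  \<open>B\<close> may be replaced by the image of this map without affecting surjectivity; hence no generality is
  lost in taking \<open>B\<close> in the type underlying \<open>O\<close>.\<close>
definition binary_operad :: "'r ring \<Rightarrow> ('r, 'o) operad \<Rightarrow> bool" where
  "binary_operad R P \<longleftrightarrow> operad R P \<and>
     (\<exists>(B :: 'o set) \<phi>. operad_hom R (free_binary_operad R B) P \<phi> \<and>
        (\<forall>n. \<phi> n ` carrier (Op (free_binary_operad R B) n) = carrier (Op P n)))"


section \<open>Free algebras\<close>

text \<open>The module \<open>\<Oplus>\<^sub>n O(n) \<otimes>\<^sub>S\<^sub>n V\<^sup>\<otimes>\<^sup>n\<close> is presented by its generators \<open>\<mu> \<otimes> v\<^sub>1 \<otimes> \<dots> \<otimes> v\<^sub>n\<close>, encoded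
  as \<open>((n, \<mu>), [v\<^sub>1, \<dots>, v\<^sub>n])\<close>, and the defining relations of the tensor products.\<close>

type_synonym ('o, 'v) fa_gen = "(nat \<times> 'o) \<times> 'v list"
type_synonym ('r, 'o, 'v) fa = "(('o, 'v) fa_gen \<Rightarrow> 'r) set"

definition fa_gens :: "('r, 'o) operad \<Rightarrow> ('r, 'v) module \<Rightarrow> ('o, 'v) fa_gen set" where
  "fa_gens P V = {(x, vs). x \<in> ops P \<and> vs \<in> lists (carrier V) \<and> length vs = fst x}"

definition fa_rels :: "'r ring \<Rightarrow> ('r, 'o) operad \<Rightarrow> ('r, 'v) module \<Rightarrow> (('o, 'v) fa_gen \<Rightarrow> 'r) set" where
  "fa_rels R P V = (let F = free_module R (fa_gens P V); e = basis R in
     {e ((n, \<mu> \<oplus>\<^bsub>Op P n\<^esub> \<mu>'), vs) \<ominus>\<^bsub>F\<^esub> (e ((n, \<mu>), vs) \<oplus>\<^bsub>F\<^esub> e ((n, \<mu>'), vs)) | n \<mu> \<mu>' vs.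
        ((n, \<mu>), vs) \<in> fa_gens P V \<and> ((n, \<mu>'), vs) \<in> fa_gens P V} \<union>
     {e ((n, a \<odot>\<^bsub>Op P n\<^esub> \<mu>), vs) \<ominus>\<^bsub>F\<^esub> a \<odot>\<^bsub>F\<^esub> e ((n, \<mu>), vs) | a n \<mu> vs.
        a \<in> carrier R \<and> ((n, \<mu>), vs) \<in> fa_gens P V} \<union>
     {e (x, vs[i := v \<oplus>\<^bsub>V\<^esub> w]) \<ominus>\<^bsub>F\<^esub> (e (x, vs[i := v]) \<oplus>\<^bsub>F\<^esub> e (x, vs[i := w])) | x vs i v w.
        (x, vs) \<in> fa_gens P V \<and> i < length vs \<and> v \<in> carrier V \<and> w \<in> carrier V} \<union>
     {e (x, vs[i := a \<odot>\<^bsub>V\<^esub> v]) \<ominus>\<^bsub>F\<^esub> a \<odot>\<^bsub>F\<^esub> e (x, vs[i := v]) | a x vs i v.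
        a \<in> carrier R \<and> (x, vs) \<in> fa_gens P V \<and> i < length vs \<and> v \<in> carrier V} \<union>
     {e ((n, act P n \<sigma> \<mu>), permute_list \<sigma> vs) \<ominus>\<^bsub>F\<^esub> e ((n, \<mu>), vs) | n \<sigma> \<mu> vs.
        ((n, \<mu>), vs) \<in> fa_gens P V \<and> \<sigma> permutes {..<n}})"

definition fa_null :: "'r ring \<Rightarrow> ('r, 'o) operad \<Rightarrow> ('r, 'v) module \<Rightarrow> (('o, 'v) fa_gen \<Rightarrow> 'r) set" where
  "fa_null R P V = mspan R (free_module R (fa_gens P V)) (fa_rels R P V)"

definition free_alg :: "'r ring \<Rightarrow> ('r, 'o) operad \<Rightarrow> ('r, 'v) module \<Rightarrow> ('r, ('r, 'o, 'v) fa) module" where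
  "free_alg R P V = quot R (free_module R (fa_gens P V)) (fa_null R P V)"

text \<open>The class \<open>\<mu>(v\<^sub>1, \<dots>, v\<^sub>n)\<close>.\<close>
definition fa_term :: "'r ring \<Rightarrow> ('r, 'o) operad \<Rightarrow> ('r, 'v) module \<Rightarrow> nat \<times> 'o \<Rightarrow> 'v list \<Rightarrow> ('r, 'o, 'v) fa" where
  "fa_term R P V x vs = fa_null R P V +>\<^bsub>free_module R (fa_gens P V)\<^esub> basis R (x, vs)"

text \<open>The canonical map \<open>V \<rightarrow> O(V)\<close>, \<open>v \<mapsto> 1 \<otimes> v\<close>.\<close>
definition fa_var :: "'r ring \<Rightarrow> ('r, 'o) operad \<Rightarrow> ('r, 'v) module \<Rightarrow> 'v \<Rightarrow> ('r, 'o, 'v) fa" where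
  "fa_var R P V v = fa_term R P V (1, unt P) [v]"

definition fa_deg :: "'r ring \<Rightarrow> ('r, 'o) operad \<Rightarrow> ('r, 'v) module \<Rightarrow> nat \<Rightarrow> ('r, 'o, 'v) fa set" where
  "fa_deg R P V n = mspan R (free_alg R P V)
     {fa_term R P V x vs | x vs. (x, vs) \<in> fa_gens P V \<and> fst x = n}"

definition fa_rep :: "('r, 'o, 'v) fa \<Rightarrow> ('o, 'v) fa_gen \<Rightarrow> 'r" where
  "fa_rep X = (SOME f. f \<in> X)"

text \<open>The structure map of the \<open>O\<close>-algebra \<open>O(V)\<close>: \<open>(x; X\<^sub>1, \<dots>, X\<^sub>k) \<mapsto> x(X\<^sub>1, \<dots>, X\<^sub>k)\<close>.\<close>
definition fa_op :: "'r ring \<Rightarrow> ('r, 'o) operad \<Rightarrow> ('r, 'v) module \<Rightarrow> nat \<times> 'o \<Rightarrow>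
    ('r, 'o, 'v) fa list \<Rightarrow> ('r, 'o, 'v) fa" where
  "fa_op R P V x Xs = multilin_ext R (free_alg R P V)
     (\<lambda>gs. fa_term R P V (comp_op P x (map fst gs)) (concat (map snd gs))) (map fa_rep Xs)"

text \<open>\<open>O(h) : O(V) \<rightarrow> O(W)\<close> for a linear map \<open>h\<close>.\<close>
definition fa_map :: "'r ring \<Rightarrow> ('r, 'o) operad \<Rightarrow> ('r, 'w) module \<Rightarrow> ('v \<Rightarrow> 'w) \<Rightarrow>
    ('r, 'o, 'v) fa \<Rightarrow> ('r, 'o, 'w) fa" where
  "fa_map R P W h X = lin_ext R (free_alg R P W) (\<lambda>(x, vs). fa_term R P W x (map h vs)) (fa_rep X)"

text \<open>\<open>O(V; W)\<close>, realised as the submodule of \<open>O(W \<oplus> V)\<close> of terms linear in \<open>W\<close>. The linear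
  variable is put first in view of \<open>O(V; R) \<subseteq> O(R \<oplus> V)\<close>.\<close>
definition fa_lin :: "'r ring \<Rightarrow> ('r, 'o) operad \<Rightarrow> ('r, 'v) module \<Rightarrow> ('r, 'w) module \<Rightarrow> ('r, 'o, 'w \<times> 'v) fa set" where
  "fa_lin R P V W = mspan R (free_alg R P (dsum W V))
     {fa_term R P (dsum W V) x ((map (\<lambda>v. (\<zero>\<^bsub>W\<^esub>, v)) vs)[i := (w, \<zero>\<^bsub>V\<^esub>)]) | x vs i w.
        (x, vs) \<in> fa_gens P V \<and> i < length vs \<and> w \<in> carrier W}"

text \<open>\<open>\<delta>\<^sub>V : O(V) \<rightarrow> O(V; V)\<close>.\<close>
definition fa_delta :: "'r ring \<Rightarrow> ('r, 'o) operad \<Rightarrow> ('r, 'v) module \<Rightarrow> ('r, 'o, 'v) fa \<Rightarrow> ('r, 'o, 'v \<times> 'v) fa" where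
  "fa_delta R P V X = lin_ext R (free_alg R P (dsum V V))
     (\<lambda>(x, vs). \<Oplus>\<^bsub>free_alg R P (dsum V V)\<^esub>i\<in>{..<length vs}.
        fa_term R P (dsum V V) x ((map (\<lambda>v. (\<zero>\<^bsub>V\<^esub>, v)) vs)[i := (vs ! i, \<zero>\<^bsub>V\<^esub>)])) (fa_rep X)"


section \<open>Derivations\<close>

text \<open>Derivations are taken extensional, so that they are determined by their values on \<open>O(V)\<close>.\<close>
definition Der :: "'r ring \<Rightarrow> ('r, 'o) operad \<Rightarrow> ('r, 'v) module \<Rightarrow>
    ('r, ('r, 'o, 'v) fa \<Rightarrow> ('r, 'o, 'v) fa) module" where
  "Der R P V = (let A = free_alg R P V in
     \<lparr>carrier = {d \<in> lin_maps R A A \<inter> extensional (carrier A).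
        \<forall>x\<in>ops P. \<forall>Xs\<in>lists (carrier A). length Xs = fst x \<longrightarrow>
          d (fa_op R P V x Xs) = (\<Oplus>\<^bsub>A\<^esub>i\<in>{..<length Xs}. fa_op R P V x (Xs[i := d (Xs ! i)]))},
      monoid.mult = undefined, one = undefined,
      zero = (\<lambda>X\<in>carrier A. \<zero>\<^bsub>A\<^esub>), add = (\<lambda>d e. \<lambda>X\<in>carrier A. d X \<oplus>\<^bsub>A\<^esub> e X),
      smult = (\<lambda>a d. \<lambda>X\<in>carrier A. a \<odot>\<^bsub>A\<^esub> d X)\<rparr>)"

text \<open>The inverse of the restriction isomorphism \<open>Der(O(V)) \<cong> Hom(V, O(V))\<close>.\<close>
definition der_ext :: "'r ring \<Rightarrow> ('r, 'o) operad \<Rightarrow> ('r, 'v) module \<Rightarrow> ('v \<Rightarrow> ('r, 'o, 'v) fa) \<Rightarrow>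
    ('r, 'o, 'v) fa \<Rightarrow> ('r, 'o, 'v) fa" where
  "der_ext R P V h = (THE d. d \<in> carrier (Der R P V) \<and> (\<forall>v\<in>carrier V. d (fa_var R P V v) = h v))"

definition Der_deg :: "'r ring \<Rightarrow> ('r, 'o) operad \<Rightarrow> ('r, 'v) module \<Rightarrow> nat \<Rightarrow>
    (('r, 'o, 'v) fa \<Rightarrow> ('r, 'o, 'v) fa) set" where
  "Der_deg R P V k = {d \<in> carrier (Der R P V). \<forall>v\<in>carrier V. d (fa_var R P V v) \<in> fa_deg R P V (k + 1)}"

definition Der_plus :: "'r ring \<Rightarrow> ('r, 'o) operad \<Rightarrow> ('r, 'v) module \<Rightarrow>
    ('r, ('r, 'o, 'v) fa \<Rightarrow> ('r, 'o, 'v) fa) module" where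
  "Der_plus R P V = submod (Der R P V) (mspan R (Der R P V) (\<Union>k\<in>{1..}. Der_deg R P V k))"

definition prelie :: "'r ring \<Rightarrow> ('r, 'o) operad \<Rightarrow> ('r, 'v) module \<Rightarrow>
    (('r, 'o, 'v) fa \<Rightarrow> ('r, 'o, 'v) fa) \<Rightarrow> (('r, 'o, 'v) fa \<Rightarrow> ('r, 'o, 'v) fa) \<Rightarrow>
    ('r, 'o, 'v) fa \<Rightarrow> ('r, 'o, 'v) fa" where
  "prelie R P V d e = der_ext R P V (\<lambda>v. e (d (fa_var R P V v)))"

definition bracket :: "'r ring \<Rightarrow> ('r, 'o) operad \<Rightarrow> ('r, 'v) module \<Rightarrow>
    (('r, 'o, 'v) fa \<Rightarrow> ('r, 'o, 'v) fa) \<Rightarrow> (('r, 'o, 'v) fa \<Rightarrow> ('r, 'o, 'v) fa) \<Rightarrow>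
    ('r, 'o, 'v) fa \<Rightarrow> ('r, 'o, 'v) fa" where
  "bracket R P V d e = prelie R P V d e \<ominus>\<^bsub>Der R P V\<^esub> prelie R P V e d"

definition Der_Lie :: "'r ring \<Rightarrow> ('r, 'o) operad \<Rightarrow> ('r, 'v) module \<Rightarrow>
    ('r, ('r, 'o, 'v) fa \<Rightarrow> ('r, 'o, 'v) fa) module" where
  "Der_Lie R P V = submod (Der R P V)
     (\<Inter>{L. submodule L R (Der R P V) \<and> (\<forall>d\<in>L. \<forall>e\<in>L. bracket R P V d e \<in> L) \<and> Der_deg R P V 1 \<subseteq> L})"

subsection \<open>Pointed derivations\<close>

abbreviation pt :: "'r ring \<Rightarrow> ('r, 'v) module \<Rightarrow> ('r, 'r \<times> 'v) module" where
  "pt R V \<equiv> dsum (self_module R) V"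

definition Der_pt :: "'r ring \<Rightarrow> ('r, 'o) operad \<Rightarrow> ('r, 'v) module \<Rightarrow>
    ('r, ('r, 'o, 'r \<times> 'v) fa \<Rightarrow> ('r, 'o, 'r \<times> 'v) fa) module" where
  "Der_pt R P V = submod (Der R P (pt R V)) {d \<in> carrier (Der R P (pt R V)).
     (\<forall>v\<in>carrier V. d (fa_var R P (pt R V) (\<zero>\<^bsub>R\<^esub>, v)) = \<zero>\<^bsub>free_alg R P (pt R V)\<^esub>) \<and>
     (\<forall>a\<in>carrier R. d (fa_var R P (pt R V) (a, \<zero>\<^bsub>V\<^esub>)) \<in> fa_lin R P V (self_module R))}"

definition Der_pt_plus :: "'r ring \<Rightarrow> ('r, 'o) operad \<Rightarrow> ('r, 'v) module \<Rightarrow>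
    ('r, ('r, 'o, 'r \<times> 'v) fa \<Rightarrow> ('r, 'o, 'r \<times> 'v) fa) module" where
  "Der_pt_plus R P V = submod (Der R P (pt R V)) (carrier (Der_pt R P V) \<inter> carrier (Der_plus R P (pt R V)))"

text \<open>For the associative product \<open>\<lhd>\<close> of pointed derivations, \<^const>\<open>bracket\<close> is the commutator.\<close>
definition Der_pt_comm :: "'r ring \<Rightarrow> ('r, 'o) operad \<Rightarrow> ('r, 'v) module \<Rightarrow>
    (('r, 'o, 'r \<times> 'v) fa \<Rightarrow> ('r, 'o, 'r \<times> 'v) fa) set" where
  "Der_pt_comm R P V = mspan R (Der_pt_plus R P V)
     {bracket R P (pt R V) d e | d e. d \<in> carrier (Der_pt_plus R P V) \<and> e \<in> carrier (Der_pt_plus R P V)}"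

text \<open>\<open>|Der\<^sup>+\<^sub>\<bullet>(O(R \<oplus> V))|\<close>.\<close>
definition trace_Der :: "'r ring \<Rightarrow> ('r, 'o) operad \<Rightarrow> ('r, 'v) module \<Rightarrow>
    ('r, (('r, 'o, 'r \<times> 'v) fa \<Rightarrow> ('r, 'o, 'r \<times> 'v) fa) set) module" where
  "trace_Der R P V = quot R (Der_pt_plus R P V) (Der_pt_comm R P V)"

subsection \<open>Divergence\<close>

text \<open>The derivation corresponding to \<open>x \<otimes> f \<in> O(V) \<otimes> Hom(V, R)\<close>.\<close>
definition der_tensor :: "'r ring \<Rightarrow> ('r, 'o) operad \<Rightarrow> ('r, 'v) module \<Rightarrow> ('r, 'o, 'v) fa \<Rightarrow> ('v \<Rightarrow> 'r) \<Rightarrow>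
    ('r, 'o, 'v) fa \<Rightarrow> ('r, 'o, 'v) fa" where
  "der_tensor R P V x f = der_ext R P V (\<lambda>v. f v \<odot>\<^bsub>free_alg R P V\<^esub> x)"

text \<open>The pointed derivation corresponding to \<open>y \<in> O(V; R)\<close>.\<close>
definition der_point :: "'r ring \<Rightarrow> ('r, 'o) operad \<Rightarrow> ('r, 'v) module \<Rightarrow> ('r, 'o, 'r \<times> 'v) fa \<Rightarrow>
    ('r, 'o, 'r \<times> 'v) fa \<Rightarrow> ('r, 'o, 'r \<times> 'v) fa" where
  "der_point R P V y = der_ext R P (pt R V) (\<lambda>u. fst u \<odot>\<^bsub>free_alg R P (pt R V)\<^esub> y)"

definition Phi :: "'r ring \<Rightarrow> ('r, 'o) operad \<Rightarrow> ('r, 'v) module \<Rightarrow> (('r, 'o, 'v) fa \<Rightarrow> ('r, 'o, 'v) fa) \<Rightarrow>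
    ('r, 'o, 'r \<times> 'v) fa \<Rightarrow> ('r, 'o, 'r \<times> 'v) fa" where
  "Phi R P V = (THE \<Phi>. \<Phi> \<in> lin_maps R (Der R P V) (Der_pt R P V) \<inter> extensional (carrier (Der R P V)) \<and>
     (\<forall>x\<in>carrier (free_alg R P V). \<forall>f\<in>lin_maps R V (self_module R).
        \<Phi> (der_tensor R P V x f) =
        der_point R P V (fa_map R P (pt R V) (\<lambda>(v, w). (f v, w)) (fa_delta R P V x))))"

definition Div :: "'r ring \<Rightarrow> ('r, 'o) operad \<Rightarrow> ('r, 'v) module \<Rightarrow> (('r, 'o, 'v) fa \<Rightarrow> ('r, 'o, 'v) fa) \<Rightarrow>
    (('r, 'o, 'r \<times> 'v) fa \<Rightarrow> ('r, 'o, 'r \<times> 'v) fa) set" where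
  "Div R P V d = Der_pt_comm R P V +>\<^bsub>Der_pt_plus R P V\<^esub> Phi R P V d"

definition Im_Div :: "'r ring \<Rightarrow> ('r, 'o) operad \<Rightarrow> ('r, 'v) module \<Rightarrow>
    (('r, 'o, 'r \<times> 'v) fa \<Rightarrow> ('r, 'o, 'r \<times> 'v) fa) set set" where
  "Im_Div R P V = Div R P V ` carrier (Der_Lie R P V)"

definition trace_mod_Im :: "'r ring \<Rightarrow> ('r, 'o) operad \<Rightarrow> ('r, 'v) module \<Rightarrow>
    ('r, (('r, 'o, 'r \<times> 'v) fa \<Rightarrow> ('r, 'o, 'r \<times> 'v) fa) set set) module" where
  "trace_mod_Im R P V = quot R (trace_Der R P V) (Im_Div R P V)"

definition Div_mod_Im :: "'r ring \<Rightarrow> ('r, 'o) operad \<Rightarrow> ('r, 'v) module \<Rightarrow> (('r, 'o, 'v) fa \<Rightarrow> ('r, 'o, 'v) fa) \<Rightarrow>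
    (('r, 'o, 'r \<times> 'v) fa \<Rightarrow> ('r, 'o, 'r \<times> 'v) fa) set set" where
  "Div_mod_Im R P V d = Im_Div R P V +>\<^bsub>trace_Der R P V\<^esub> Div R P V d"


section \<open>Functors on \<open>S(R)\<close>\<close>

definition SR_hom :: "'r ring \<Rightarrow> ('r, 'v) module \<Rightarrow> ('r, 'w) module \<Rightarrow> (('v \<Rightarrow> 'w) \<times> ('w \<Rightarrow> 'v)) set" where
  "SR_hom R V W = {(i, r). i \<in> lin_maps R V W \<and> r \<in> lin_maps R W V \<and> (\<forall>v\<in>carrier V. r (i v) = v)}"

definition SR_comp :: "('v \<Rightarrow> 'w) \<times> ('w \<Rightarrow> 'v) \<Rightarrow> ('u \<Rightarrow> 'v) \<times> ('v \<Rightarrow> 'u) \<Rightarrow> ('u \<Rightarrow> 'w) \<times> ('w \<Rightarrow> 'u)" where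
  "SR_comp g f = (fst g \<circ> fst f, snd f \<circ> snd g)"

definition SR_incl :: "'r ring \<Rightarrow> nat \<Rightarrow> ('v \<Rightarrow> 'v \<times> (nat \<Rightarrow> 'r)) \<times> ('v \<times> (nat \<Rightarrow> 'r) \<Rightarrow> 'v)" where
  "SR_incl R n = (\<lambda>v. (v, \<zero>\<^bsub>power_module R n\<^esub>), fst)"

text \<open>The objects of \<open>S(R)\<close> may have carriers in different types. A functor is therefore a
  polymorphic family of modules and maps, and each predicate below takes as arguments the instances
  of it that it needs: \<open>F1\<close>, \<open>F2\<close>, \<open>F3\<close> are one and the same functor on objects carried by three
  arbitrary types, and \<open>mij\<close> is its action on morphisms from objects of the \<open>i\<close>-th type to objects of the
  \<open>j\<close>-th one.\<close>
definition SR_functor where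
  "SR_functor (R :: 'r ring)
     (F1 :: ('r, 'u) module \<Rightarrow> ('r, 'a) module)
     (F2 :: ('r, 'v) module \<Rightarrow> ('r, 'b) module)
     (F3 :: ('r, 'w) module \<Rightarrow> ('r, 'c) module)
     m11 m12 m23 m13 \<longleftrightarrow>
     (\<forall>U. free_fin_rank R U \<longrightarrow> module R (F1 U) \<and>
        (\<forall>x\<in>carrier (F1 U). m11 U U (id, id) x = x)) \<and>
     (\<forall>U V. \<forall>f\<in>SR_hom R U V. free_fin_rank R U \<longrightarrow> free_fin_rank R V \<longrightarrow>
        m12 U V f \<in> lin_maps R (F1 U) (F2 V)) \<and>
     (\<forall>U V W. \<forall>f\<in>SR_hom R U V. \<forall>g\<in>SR_hom R V W.
        free_fin_rank R U \<longrightarrow> free_fin_rank R V \<longrightarrow> free_fin_rank R W \<longrightarrow>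
        (\<forall>x\<in>carrier (F1 U). m13 U W (SR_comp g f) x = m23 V W g (m12 U V f x)))"

text \<open>Naturality of \<open>\<eta> : F \<rightarrow> G\<close> with respect to morphisms \<open>V \<rightarrow> W\<close>.\<close>
definition SR_natural where
  "SR_natural (R :: 'r ring)
     (F1 :: ('r, 'v) module \<Rightarrow> ('r, 'a) module) (F2 :: ('r, 'w) module \<Rightarrow> ('r, 'b) module) mF
     (G1 :: ('r, 'v) module \<Rightarrow> ('r, 'c) module) (G2 :: ('r, 'w) module \<Rightarrow> ('r, 'd) module) mG
     \<eta>1 \<eta>2 \<longleftrightarrow>
     (\<forall>V. free_fin_rank R V \<longrightarrow> \<eta>1 V \<in> lin_maps R (F1 V) (G1 V)) \<and>
     (\<forall>V W. \<forall>f\<in>SR_hom R V W. free_fin_rank R V \<longrightarrow> free_fin_rank R W \<longrightarrow>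
        (\<forall>x\<in>carrier (F1 V). \<eta>2 W (mF V W f x) = mG V W f (\<eta>1 V x)))"

definition n_torsion where
  "n_torsion (R :: 'r ring) n
     (F1 :: ('r, 'v) module \<Rightarrow> ('r, 'a) module)
     (F2 :: ('r, 'v \<times> (nat \<Rightarrow> 'r)) module \<Rightarrow> ('r, 'b) module) m \<longleftrightarrow>
     (\<forall>V. free_fin_rank R V \<longrightarrow> (let W = dsum V (power_module R n) in
        \<forall>x\<in>carrier (F1 V). m V W (SR_incl R n) x = \<zero>\<^bsub>F2 W\<^esub>))"

definition n_surjective where
  "n_surjective (R :: 'r ring) n
     (F1 :: ('r, 'v) module \<Rightarrow> ('r, 'a) module)
     (F2 :: ('r, 'v \<times> (nat \<Rightarrow> 'r)) module \<Rightarrow> ('r, 'b) module)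
     (G1 :: ('r, 'v) module \<Rightarrow> ('r, 'c) module)
     (G2 :: ('r, 'v \<times> (nat \<Rightarrow> 'r)) module \<Rightarrow> ('r, 'd) module) mG \<eta>1 \<eta>2 \<longleftrightarrow>
     n_torsion R n (\<lambda>V. coker R (F1 V) (G1 V) (\<eta>1 V)) (\<lambda>W. coker R (F2 W) (G2 W) (\<eta>2 W))
       (\<lambda>V W f. quot_map (G2 W) (\<eta>2 W ` carrier (F2 W)) (mG V W f))"

text \<open>The functor structures. On \<open>Der\<close>, \<open>(i, r)\<close> sends \<open>d\<close> to the derivation extending
  \<open>O(i) \<circ> d|\<^sub>V \<circ> r\<close>; \<^const>\<open>Der_plus\<close> and \<^const>\<open>Der_Lie\<close> are subfunctors.\<close>
definition Der_map :: "'r ring \<Rightarrow> ('r, 'o) operad \<Rightarrow> ('r, 'v) module \<Rightarrow> ('r, 'w) module \<Rightarrow>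
    ('v \<Rightarrow> 'w) \<times> ('w \<Rightarrow> 'v) \<Rightarrow> (('r, 'o, 'v) fa \<Rightarrow> ('r, 'o, 'v) fa) \<Rightarrow> ('r, 'o, 'w) fa \<Rightarrow> ('r, 'o, 'w) fa" where
  "Der_map R P V W f d = der_ext R P W (\<lambda>w. fa_map R P W (fst f) (d (fa_var R P V (snd f w))))"

definition trace_map :: "'r ring \<Rightarrow> ('r, 'o) operad \<Rightarrow> ('r, 'v) module \<Rightarrow> ('r, 'w) module \<Rightarrow>
    ('v \<Rightarrow> 'w) \<times> ('w \<Rightarrow> 'v) \<Rightarrow> (('r, 'o, 'r \<times> 'v) fa \<Rightarrow> ('r, 'o, 'r \<times> 'v) fa) set \<Rightarrow>
    (('r, 'o, 'r \<times> 'w) fa \<Rightarrow> ('r, 'o, 'r \<times> 'w) fa) set" where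
  "trace_map R P V W f = quot_map (Der_pt_plus R P W) (Der_pt_comm R P W)
     (Der_map R P (pt R V) (pt R W) (map_prod id (fst f), map_prod id (snd f)))"

definition trace_mod_Im_map :: "'r ring \<Rightarrow> ('r, 'o) operad \<Rightarrow> ('r, 'v) module \<Rightarrow> ('r, 'w) module \<Rightarrow>
    ('v \<Rightarrow> 'w) \<times> ('w \<Rightarrow> 'v) \<Rightarrow> (('r, 'o, 'r \<times> 'v) fa \<Rightarrow> ('r, 'o, 'r \<times> 'v) fa) set set \<Rightarrow>
    (('r, 'o, 'r \<times> 'w) fa \<Rightarrow> ('r, 'o, 'r \<times> 'w) fa) set set" where
  "trace_mod_Im_map R P V W f = quot_map (trace_Der R P W) (Im_Div R P W) (trace_map R P V W f)"

definition Der_incl :: "'r ring \<Rightarrow> ('r, 'o) operad \<Rightarrow> ('r, 'v) module \<Rightarrow> (('r, 'o, 'v) fa \<Rightarrow> ('r, 'o, 'v) fa) \<Rightarrow>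
    ('r, 'o, 'v) fa \<Rightarrow> ('r, 'o, 'v) fa" where
  "Der_incl R P V d = d"

definition mid_homology :: "'r ring \<Rightarrow> ('r, 'o) operad \<Rightarrow> ('r, 'v) module \<Rightarrow>
    ('r, (('r, 'o, 'v) fa \<Rightarrow> ('r, 'o, 'v) fa) set) module" where
  "mid_homology R P V = homology R (Der_Lie R P V) (Der_plus R P V) (trace_mod_Im R P V)
     (Der_incl R P V) (Div_mod_Im R P V)"

definition mid_homology_map :: "'r ring \<Rightarrow> ('r, 'o) operad \<Rightarrow> ('r, 'v) module \<Rightarrow> ('r, 'w) module \<Rightarrow>
    ('v \<Rightarrow> 'w) \<times> ('w \<Rightarrow> 'v) \<Rightarrow> (('r, 'o, 'v) fa \<Rightarrow> ('r, 'o, 'v) fa) set \<Rightarrow>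
    (('r, 'o, 'w) fa \<Rightarrow> ('r, 'o, 'w) fa) set" where
  "mid_homology_map R P V W f =
     quot_map (Der_plus R P W) (Der_incl R P W ` carrier (Der_Lie R P W)) (Der_map R P V W f)"

end

theory Submission
  imports Defs
begin

text \<open>Fix a module \<open>V\<close> that is free of finite rank. The operad is a quotient of a free operad on binary generators, so
  \<open>O(V)\<close> is generated by \<open>V\<close> under the binary operations \<open>b \<in> O(2)\<close> (\<open>term_induct\<close>, \<open>alg_induct\<close>), and a
  derivation of \<open>O(V)\<close> is a linear map that satisfies the Leibniz rule for these (\<open>binary_derivation\<close>). Write \<open>x \<otimes>
  f\<close> for the derivation that sends \<open>v\<close> to \<open>f(v) x\<close>. A dual basis of \<open>V\<close> expresses every derivation as a sum of
  such elementary ones, and \<open>[x \<otimes> f, y \<otimes> g] = (y \<otimes> g)(x) \<otimes> f - (x \<otimes> f)(y) \<otimes> g\<close>, so that brackets substitute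
  elements of \<open>O(V)\<close> for variables inside each other (\<open>bracket_ten\<close>).

  The functor laws, the naturality of the divergence and its \<open>1\<close>-surjectivity are direct. For the last one, let
  \<open>p\<close> be a pointed derivation and \<open>y\<close> a new variable with dual functional \<open>g\<close>. Substitute \<open>y\<close> for the base point
  \<open>\<star>\<close> in the value \<open>p(\<star>)\<close> and call the result \<open>s\<^sub>y p(\<star>)\<close>. The variable \<open>y\<close> occurs exactly once in each term, hence
  the divergence of \<open>s\<^sub>y p(\<star>) \<otimes> g\<close> is \<open>p\<close> (\<open>Phi_lift\<close>).

  The heart of the matter is the torsion of the homology in the middle: a derivation \<open>d\<close> of positive degree whose
  divergence is a sum of commutators has to land in the Lie algebra \<open>L\<close> generated in degree one as soon as there
  are enough new variables \<open>y\<^sub>0, y\<^sub>1, \<dots>\<close>, with dual functionals \<open>g\<^sub>0, g\<^sub>1, \<dots>\<close>. Three facts show this, each with at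
  most four new variables.

  First, if \<open>l\<close> and \<open>r\<close> do not involve the new variables, then \<open>b(l, r) \<otimes> g\<^sub>i\<close> is the iterated bracket \<open>[[b(y\<^sub>j,
  y\<^sub>k) \<otimes> g\<^sub>i, l \<otimes> g\<^sub>j], r \<otimes> g\<^sub>k]\<close> with an inner factor of degree one. By induction \<open>l \<otimes> g\<^sub>j\<close> and \<open>r \<otimes> g\<^sub>k\<close>
  normalise \<open>L\<close>, the base case being derivations of degree zero; so \<open>b(l, r) \<otimes> g\<^sub>i\<close> belongs to \<open>L\<close>
  (\<open>product_Lie\<close>).

  Second, for any functional \<open>f\<close> on the old variables, \<open>x = b(l, r)\<close> satisfies \<open>x \<otimes> f \<equiv> x' \<otimes> g\<^sub>0\<close> modulo \<open>L\<close>,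
  where \<open>x'\<close> is the sum over the leaves \<open>v\<close> of \<open>x\<close> of the elements obtained by replacing this leaf by \<open>f(v) y\<^sub>0\<close>
  (\<open>product_congruent\<close>). But \<open>x'\<close> is the divergence of \<open>x \<otimes> f\<close> with its base point renamed to \<open>y\<^sub>0\<close>. Hence modulo
  \<open>L\<close> the image of \<open>d\<close> only depends on the pointed derivation \<open>p = \<Phi>(d)\<close>: it is congruent to \<open>U\<^sub>0 p(\<star>)\<close>, where
  \<open>U\<^sub>a m = s\<^sub>a m \<otimes> g\<^sub>a\<close> and \<open>s\<^sub>a\<close> substitutes \<open>y\<^sub>a\<close> for the base point (\<open>congruent_Phi\<close>).

  Third, \<open>U\<^sub>0 c(\<star>)\<close> belongs to \<open>L\<close> if \<open>c = [p, q]\<close> for pointed derivations \<open>p\<close> and \<open>q\<close> of positive degree. For \<open>a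
  \<noteq> b\<close> the derivations \<open>s\<^sub>b p(\<star>) \<otimes> g\<^sub>a\<close> and \<open>s\<^sub>a q(\<star>) \<otimes> g\<^sub>b\<close> belong to \<open>L\<close> by the first fact, and their bracket is
  \<open>U\<^sub>a q(p(\<star>)) - U\<^sub>b p(q(\<star>))\<close> (\<open>swap_Lie\<close>). Thus exchanging \<open>p\<close> and \<open>q\<close> is possible at the price of changing the
  letter, and with three letters one can return to the original letter after an odd number of steps
  (\<open>commutator_Lie\<close>).

  A derivation whose divergence is only congruent, modulo commutators, to that of some \<open>e \<in> L\<close> is reduced to this
  case by subtracting \<open>e\<close> (\<open>kernel_into_Lie\<close>).\<close>

section \<open>Linear maps, submodules and spans\<close>

lemma lin_mapsI:
  assumes "\<And>x. x \<in> carrier M \<Longrightarrow> h x \<in> carrier N"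
    and "\<And>x y. x \<in> carrier M \<Longrightarrow> y \<in> carrier M \<Longrightarrow> h (x \<oplus>\<^bsub>M\<^esub> y) = h x \<oplus>\<^bsub>N\<^esub> h y"
    and "\<And>a x. a \<in> carrier R \<Longrightarrow> x \<in> carrier M \<Longrightarrow> h (a \<odot>\<^bsub>M\<^esub> x) = a \<odot>\<^bsub>N\<^esub> h x"
  shows "h \<in> lin_maps R M N"
  using assms by (auto simp: lin_maps_def)

lemma lin_maps_closed: "h \<in> lin_maps R M N \<Longrightarrow> x \<in> carrier M \<Longrightarrow> h x \<in> carrier N"
  and lin_maps_add: "h \<in> lin_maps R M N \<Longrightarrow> x \<in> carrier M \<Longrightarrow> y \<in> carrier M \<Longrightarrow>
        h (x \<oplus>\<^bsub>M\<^esub> y) = h x \<oplus>\<^bsub>N\<^esub> h y"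
  and lin_maps_smult: "h \<in> lin_maps R M N \<Longrightarrow> a \<in> carrier R \<Longrightarrow> x \<in> carrier M \<Longrightarrow>
        h (a \<odot>\<^bsub>M\<^esub> x) = a \<odot>\<^bsub>N\<^esub> h x"
  by (auto simp: lin_maps_def)

lemma module_facts:
  assumes "module R M"
  shows module_cring: "cring R"
    and module_ab: "abelian_group M"
    and mod_zero: "\<zero>\<^bsub>M\<^esub> \<in> carrier M"
    and mod_add: "\<And>x y. x \<in> carrier M \<Longrightarrow> y \<in> carrier M \<Longrightarrow> x \<oplus>\<^bsub>M\<^esub> y \<in> carrier M"
    and mod_smult: "\<And>a x. a \<in> carrier R \<Longrightarrow> x \<in> carrier M \<Longrightarrow> a \<odot>\<^bsub>M\<^esub> x \<in> carrier M"
    and mod_minus: "\<And>x y. x \<in> carrier M \<Longrightarrow> y \<in> carrier M \<Longrightarrow> x \<ominus>\<^bsub>M\<^esub> y \<in> carrier M"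
proof -
  interpret module R M by fact
  show "cring R" "abelian_group M" by unfold_locales
  show "\<zero>\<^bsub>M\<^esub> \<in> carrier M"
    "\<And>x y. x \<in> carrier M \<Longrightarrow> y \<in> carrier M \<Longrightarrow> x \<oplus>\<^bsub>M\<^esub> y \<in> carrier M"
    "\<And>a x. a \<in> carrier R \<Longrightarrow> x \<in> carrier M \<Longrightarrow> a \<odot>\<^bsub>M\<^esub> x \<in> carrier M"
    "\<And>x y. x \<in> carrier M \<Longrightarrow> y \<in> carrier M \<Longrightarrow> x \<ominus>\<^bsub>M\<^esub> y \<in> carrier M" by auto
qed

lemma minus_eq_smult:
  assumes "module R M" "x \<in> carrier M"
  shows "\<ominus>\<^bsub>M\<^esub> x = (\<ominus>\<^bsub>R\<^esub> \<one>\<^bsub>R\<^esub>) \<odot>\<^bsub>M\<^esub> x"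
proof -
  interpret module R M by fact
  show ?thesis using assms(2) by (simp add: smult_l_minus)
qed

lemma diff_eq_smult:
  assumes "module R M" "y \<in> carrier M"
  shows "x \<ominus>\<^bsub>M\<^esub> y = x \<oplus>\<^bsub>M\<^esub> (\<ominus>\<^bsub>R\<^esub> \<one>\<^bsub>R\<^esub>) \<odot>\<^bsub>M\<^esub> y"
  using minus_eq_smult[OF assms] by (simp add: a_minus_def)

lemma lin_maps_zero:
  assumes "module R M" "module R N" "h \<in> lin_maps R M N"
  shows "h \<zero>\<^bsub>M\<^esub> = \<zero>\<^bsub>N\<^esub>"
proof -
  interpret M: module R M by fact
  interpret N: module R N by fact
  have "h \<zero>\<^bsub>M\<^esub> = h (\<zero>\<^bsub>R\<^esub> \<odot>\<^bsub>M\<^esub> \<zero>\<^bsub>M\<^esub>)" by simp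
  also have "\<dots> = \<zero>\<^bsub>R\<^esub> \<odot>\<^bsub>N\<^esub> h \<zero>\<^bsub>M\<^esub>" using assms(3) by (intro lin_maps_smult) auto
  also have "\<dots> = \<zero>\<^bsub>N\<^esub>" using lin_maps_closed[OF assms(3)] by simp
  finally show ?thesis .
qed

lemma lin_maps_diff:
  assumes "module R M" "module R N" "h \<in> lin_maps R M N" "x \<in> carrier M" "y \<in> carrier M"
  shows "h (x \<ominus>\<^bsub>M\<^esub> y) = h x \<ominus>\<^bsub>N\<^esub> h y"
proof -
  interpret M: module R M by fact
  interpret N: module R N by fact
  have "\<ominus>\<^bsub>R\<^esub> \<one>\<^bsub>R\<^esub> \<in> carrier R" by simp
  then show ?thesis
    using assms lin_maps_closed[OF assms(3)]
    by (simp add: diff_eq_smult lin_maps_add[OF assms(3)] lin_maps_smult[OF assms(3)] M.smult_closed)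
qed

text \<open>Power modules, free modules and modules of derivations consist of functions with pointwise operations.
  Their axioms hold because they hold after evaluation.\<close>
lemma module_separated:
  assumes R: "cring R" and N: "\<And>i. i \<in> I \<Longrightarrow> module R (N i)" and h: "\<And>i. i \<in> I \<Longrightarrow> h i \<in> lin_maps R M (N i)"
    and z: "\<zero>\<^bsub>M\<^esub> \<in> carrier M" "\<And>i. i \<in> I \<Longrightarrow> h i \<zero>\<^bsub>M\<^esub> = \<zero>\<^bsub>N i\<^esub>"
    and add: "\<And>x y. x \<in> carrier M \<Longrightarrow> y \<in> carrier M \<Longrightarrow> x \<oplus>\<^bsub>M\<^esub> y \<in> carrier M"
    and smult: "\<And>a x. a \<in> carrier R \<Longrightarrow> x \<in> carrier M \<Longrightarrow> a \<odot>\<^bsub>M\<^esub> x \<in> carrier M"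
    and inj: "\<And>x y. x \<in> carrier M \<Longrightarrow> y \<in> carrier M \<Longrightarrow> (\<And>i. i \<in> I \<Longrightarrow> h i x = h i y) \<Longrightarrow> x = y"
  shows "module R M"
proof -
  interpret R: cring R by (rule R)
  note s = lin_maps_closed[OF h] lin_maps_add[OF h] lin_maps_smult[OF h] z add smult
  have nb: "abelian_group (N i)" if "i \<in> I" for i by (rule module_ab[OF N[OF that]])
  note ag = abelian_monoid.a_assoc[OF abelian_group.axioms(1)[OF nb]] abelian_monoid.a_comm[OF abelian_group.axioms(1)[OF nb]]
    abelian_monoid.l_zero[OF abelian_group.axioms(1)[OF nb]]
  show ?thesis
  proof (rule moduleI[OF R])
    show "abelian_group M"
    proof (rule abelian_groupI)
      fix x assume x: "x \<in> carrier M"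
      have "h i ((\<ominus>\<^bsub>R\<^esub> \<one>\<^bsub>R\<^esub>) \<odot>\<^bsub>M\<^esub> x \<oplus>\<^bsub>M\<^esub> x) = h i \<zero>\<^bsub>M\<^esub>" if i: "i \<in> I" for i
        using x s(1)[OF i x] abelian_group.l_neg[OF nb[OF i] s(1)[OF i x]] i by (simp add: s minus_eq_smult[OF N[OF i], symmetric])
      then have "(\<ominus>\<^bsub>R\<^esub> \<one>\<^bsub>R\<^esub>) \<odot>\<^bsub>M\<^esub> x \<oplus>\<^bsub>M\<^esub> x = \<zero>\<^bsub>M\<^esub>" using x by (intro inj) (simp_all add: s)
      then show "\<exists>y\<in>carrier M. y \<oplus>\<^bsub>M\<^esub> x = \<zero>\<^bsub>M\<^esub>" using smult[OF _ x] R.a_inv_closed[OF R.one_closed] by blast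
    qed (auto intro!: inj simp: s ag)
  qed (auto intro!: inj simp: s module.smult_l_distr[OF N] module.smult_r_distr[OF N] module.smult_assoc1[OF N] module.smult_one[OF N])
qed

lemma lin_maps_comp:
  "f \<in> lin_maps R M N \<Longrightarrow> g \<in> lin_maps R N K \<Longrightarrow> (\<lambda>x. g (f x)) \<in> lin_maps R M K"
  by (auto simp: lin_maps_def Pi_iff)

lemma lin_maps_id: "(\<lambda>x. x) \<in> lin_maps R M M"
  by (auto simp: lin_maps_def)

lemma lin_maps_cong:
  assumes "module R M" "f \<in> lin_maps R M N" "\<And>x. x \<in> carrier M \<Longrightarrow> g x = f x"
  shows "g \<in> lin_maps R M N"
  using assms module_facts[OF assms(1)]
  by (auto simp: lin_maps_def Pi_iff)

lemma lin_maps_const_zero: "module R N \<Longrightarrow> (\<lambda>x. \<zero>\<^bsub>N\<^esub>) \<in> lin_maps R M N"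
proof -
  assume "module R N"
  then interpret N: module R N .
  show ?thesis by (auto simp: lin_maps_def)
qed

lemma lin_maps_plus:
  assumes "module R N" "f \<in> lin_maps R M N" "g \<in> lin_maps R M N"
  shows "(\<lambda>x. f x \<oplus>\<^bsub>N\<^esub> g x) \<in> lin_maps R M N"
proof -
  interpret N: module R N by fact
  show ?thesis
    using assms(2,3)
    by (intro lin_mapsI) (auto simp: lin_maps_closed lin_maps_add lin_maps_smult N.a_ac N.smult_r_distr)
qed

lemma lin_maps_scale:
  assumes "module R N" "f \<in> lin_maps R M N" "a \<in> carrier R"
  shows "(\<lambda>x. a \<odot>\<^bsub>N\<^esub> f x) \<in> lin_maps R M N"
proof -
  interpret N: module R N by fact
  show ?thesis
    using assms(2,3)
    by (intro lin_mapsI) (auto simp: lin_maps_closed lin_maps_add lin_maps_smult N.smult_r_distr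
        N.smult_assoc1[symmetric] N.R.m_comm)
qed

lemma lin_maps_minus:
  assumes "module R N" "f \<in> lin_maps R M N" "g \<in> lin_maps R M N"
  shows "(\<lambda>x. f x \<ominus>\<^bsub>N\<^esub> g x) \<in> lin_maps R M N"
proof -
  interpret N: module R N by fact
  have [simp]: "\<ominus>\<^bsub>R\<^esub> \<one>\<^bsub>R\<^esub> \<in> carrier R" by simp
  show ?thesis
    using assms(2,3)
    by (intro lin_mapsI) (auto simp: lin_maps_closed lin_maps_add lin_maps_smult N.a_ac N.smult_r_distr
        N.minus_add a_minus_def N.smult_r_minus)
qed

lemma lin_maps_finsum:
  assumes "module R N" "\<And>i. i \<in> I \<Longrightarrow> f i \<in> lin_maps R M N"
  shows "(\<lambda>x. \<Oplus>\<^bsub>N\<^esub>i\<in>I. f i x) \<in> lin_maps R M N"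
proof (cases "finite I")
  case True
  interpret N: module R N by fact
  note c = lin_maps_closed[OF assms(2)]
  show ?thesis
  proof (rule lin_mapsI)
    fix x y assume xy: "x \<in> carrier M" "y \<in> carrier M"
    have "(\<Oplus>\<^bsub>N\<^esub>i\<in>I. f i (x \<oplus>\<^bsub>M\<^esub> y)) = (\<Oplus>\<^bsub>N\<^esub>i\<in>I. f i x \<oplus>\<^bsub>N\<^esub> f i y)"
      using xy c by (intro N.finsum_cong') (auto simp: lin_maps_add[OF assms(2)])
    also have "\<dots> = (\<Oplus>\<^bsub>N\<^esub>i\<in>I. f i x) \<oplus>\<^bsub>N\<^esub> (\<Oplus>\<^bsub>N\<^esub>i\<in>I. f i y)"
      using xy c by (intro N.finsum_addf) auto
    finally show "(\<Oplus>\<^bsub>N\<^esub>i\<in>I. f i (x \<oplus>\<^bsub>M\<^esub> y)) = (\<Oplus>\<^bsub>N\<^esub>i\<in>I. f i x) \<oplus>\<^bsub>N\<^esub> (\<Oplus>\<^bsub>N\<^esub>i\<in>I. f i y)" .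
  next
    fix a x assume ax: "a \<in> carrier R" "x \<in> carrier M"
    have "(\<Oplus>\<^bsub>N\<^esub>i\<in>I. f i (a \<odot>\<^bsub>M\<^esub> x)) = (\<Oplus>\<^bsub>N\<^esub>i\<in>I. a \<odot>\<^bsub>N\<^esub> f i x)"
      using ax c by (intro N.finsum_cong') (auto simp: lin_maps_smult[OF assms(2)])
    also have "\<dots> = a \<odot>\<^bsub>N\<^esub> (\<Oplus>\<^bsub>N\<^esub>i\<in>I. f i x)"
      using True ax c by (intro N.finsum_smult_ldistr[symmetric]) auto
    finally show "(\<Oplus>\<^bsub>N\<^esub>i\<in>I. f i (a \<odot>\<^bsub>M\<^esub> x)) = a \<odot>\<^bsub>N\<^esub> (\<Oplus>\<^bsub>N\<^esub>i\<in>I. f i x)" .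
  qed (use c in \<open>auto intro!: N.finsum_closed\<close>)
next
  case False
  interpret N: module R N by fact
  show ?thesis using False lin_maps_const_zero[OF assms(1)] by (simp add: N.finsum_infinite)
qed

lemma lin_maps_finsum_apply:
  assumes "module R M" "module R N" "h \<in> lin_maps R M N" "finite I" "\<And>i. i \<in> I \<Longrightarrow> f i \<in> carrier M"
  shows "h (\<Oplus>\<^bsub>M\<^esub>i\<in>I. f i) = (\<Oplus>\<^bsub>N\<^esub>i\<in>I. h (f i))"
  using assms(4,5)
proof (induction I rule: finite_induct)
  interpret M: module R M by fact
  interpret N: module R N by fact
  {
    case empty
    then show ?case using lin_maps_zero[OF assms(1-3)] by simp
  next
    case (insert i I)
    have "(\<Oplus>\<^bsub>M\<^esub>i\<in>insert i I. f i) = f i \<oplus>\<^bsub>M\<^esub> (\<Oplus>\<^bsub>M\<^esub>i\<in>I. f i)"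
      using insert by (intro M.finsum_insert) auto
    moreover have "(\<Oplus>\<^bsub>N\<^esub>i\<in>insert i I. h (f i)) = h (f i) \<oplus>\<^bsub>N\<^esub> (\<Oplus>\<^bsub>N\<^esub>i\<in>I. h (f i))"
      using insert lin_maps_closed[OF assms(3)] by (intro N.finsum_insert) auto
    moreover have "(\<Oplus>\<^bsub>M\<^esub>i\<in>I. f i) \<in> carrier M" using insert by (intro M.finsum_closed) auto
    ultimately show ?case using insert lin_maps_add[OF assms(3)] by simp
  }
qed

lemma submoduleI':
  assumes "module R M" "H \<subseteq> carrier M" "\<zero>\<^bsub>M\<^esub> \<in> H" "\<And>a b. a \<in> H \<Longrightarrow> b \<in> H \<Longrightarrow> a \<oplus>\<^bsub>M\<^esub> b \<in> H"
    "\<And>a x. a \<in> carrier R \<Longrightarrow> x \<in> H \<Longrightarrow> a \<odot>\<^bsub>M\<^esub> x \<in> H"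
  shows "submodule H R M"
proof -
  interpret module R M by fact
  show ?thesis
  proof (rule submoduleI)
    fix a assume "a \<in> H"
    then show "\<ominus>\<^bsub>M\<^esub> a \<in> H" using assms minus_eq_smult[OF assms(1)] by (metis R.add.inv_closed R.one_closed subsetD)
  qed (use assms in auto)
qed

lemma submodule_facts:
  assumes "module R M" "submodule H R M"
  shows sub_incl: "H \<subseteq> carrier M" and sub_zero: "\<zero>\<^bsub>M\<^esub> \<in> H"
    and sub_add: "\<And>x y. x \<in> H \<Longrightarrow> y \<in> H \<Longrightarrow> x \<oplus>\<^bsub>M\<^esub> y \<in> H"
    and sub_smult: "\<And>a x. a \<in> carrier R \<Longrightarrow> x \<in> H \<Longrightarrow> a \<odot>\<^bsub>M\<^esub> x \<in> H"
    and sub_diff: "\<And>x y. x \<in> H \<Longrightarrow> y \<in> H \<Longrightarrow> x \<ominus>\<^bsub>M\<^esub> y \<in> H"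
    and sub_neg: "\<And>x. x \<in> H \<Longrightarrow> \<ominus>\<^bsub>M\<^esub> x \<in> H"
proof -
  interpret module R M by fact
  note E = submoduleE[OF assms(2)]
  show "H \<subseteq> carrier M" by (rule E)
  show add: "\<And>x y. x \<in> H \<Longrightarrow> y \<in> H \<Longrightarrow> x \<oplus>\<^bsub>M\<^esub> y \<in> H" by (rule E)
  show "\<And>a x. a \<in> carrier R \<Longrightarrow> x \<in> H \<Longrightarrow> a \<odot>\<^bsub>M\<^esub> x \<in> H" by (rule E)
  show neg: "\<And>x. x \<in> H \<Longrightarrow> \<ominus>\<^bsub>M\<^esub> x \<in> H" by (rule E)
  then show "\<And>x y. x \<in> H \<Longrightarrow> y \<in> H \<Longrightarrow> x \<ominus>\<^bsub>M\<^esub> y \<in> H" using add by (simp add: a_minus_def)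
  obtain x where "x \<in> H" using E(2) by auto
  then show "\<zero>\<^bsub>M\<^esub> \<in> H" using add[OF _ neg] E(1) by (metis r_neg subsetD)
qed

lemma sub_zeroE:
  assumes "module R M" "x \<in> carrier M" "y \<in> carrier M" "x \<ominus>\<^bsub>M\<^esub> y = \<zero>\<^bsub>M\<^esub>"
  shows "x = y"
proof -
  interpret module R M by fact
  show ?thesis using assms(2-4) by (metis M.minus_equality M.minus_minus M.a_inv_closed a_minus_def)
qed

lemma submodule_Int:
  assumes "module R M" "submodule H R M" "submodule K R M"
  shows "submodule (H \<inter> K) R M"
  using submodule_facts[OF assms(1,2)] submodule_facts[OF assms(1,3)]
  by (intro submoduleI'[OF assms(1)]) auto

lemma submodule_Inter:
  assumes "module R M" "\<And>H. H \<in> S \<Longrightarrow> submodule H R M" "S \<noteq> {}"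
  shows "submodule (\<Inter>S) R M"
proof (rule submoduleI'[OF assms(1)])
  note f = submodule_facts[OF assms(1) assms(2)]
  show "\<Inter>S \<subseteq> carrier M" using f(1) assms(3) by fastforce
qed (auto intro: submodule_facts[OF assms(1) assms(2)])

lemma submodule_preimage:
  assumes "module R M" "module R N" "h \<in> lin_maps R M N" "submodule H R N"
  shows "submodule {x \<in> carrier M. h x \<in> H} R M"
  using submodule_facts[OF assms(2,4)] lin_maps_zero[OF assms(1-3)] module_facts[OF assms(1)]
  by (intro submoduleI'[OF assms(1)]) (auto simp: lin_maps_add[OF assms(3)] lin_maps_smult[OF assms(3)])

lemma submodule_zero:
  assumes "module R M"
  shows "submodule {\<zero>\<^bsub>M\<^esub>} R M"
proof -
  interpret module R M by fact
  show ?thesis by (intro submoduleI'[OF assms]) auto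
qed

lemma submodule_image:
  assumes "module R M" "module R N" "h \<in> lin_maps R M N" "submodule H R M"
  shows "submodule (h ` H) R N"
proof (rule submoduleI'[OF assms(2)])
  note f = submodule_facts[OF assms(1,4)]
  show "h ` H \<subseteq> carrier N" using f(1) lin_maps_closed[OF assms(3)] by auto
  show "\<zero>\<^bsub>N\<^esub> \<in> h ` H" using f(2) lin_maps_zero[OF assms(1-3)] by (metis imageI)
next
  note f = submodule_facts[OF assms(1,4)]
  fix a b assume "a \<in> h ` H" "b \<in> h ` H"
  then obtain x y where xy: "x \<in> H" "y \<in> H" "a = h x" "b = h y" by auto
  then have "a \<oplus>\<^bsub>N\<^esub> b = h (x \<oplus>\<^bsub>M\<^esub> y)" using lin_maps_add[OF assms(3)] f(1) by (simp add: subset_iff)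
  then show "a \<oplus>\<^bsub>N\<^esub> b \<in> h ` H" using f(3)[OF xy(1,2)] by simp
next
  note f = submodule_facts[OF assms(1,4)]
  fix a b assume a: "a \<in> carrier R" and "b \<in> h ` H"
  then obtain x where x: "x \<in> H" "b = h x" by auto
  then have "a \<odot>\<^bsub>N\<^esub> b = h (a \<odot>\<^bsub>M\<^esub> x)" using lin_maps_smult[OF assms(3) a] f(1) by (simp add: subset_iff)
  then show "a \<odot>\<^bsub>N\<^esub> b \<in> h ` H" using f(4)[OF a x(1)] by simp
qed

lemma submodule_carrier: "module R M \<Longrightarrow> submodule (carrier M) R M"
  by (rule module.carrier_is_submodule)

lemma submod_simps [simp]:
  "carrier (submod M N) = N" "(\<oplus>\<^bsub>submod M N\<^esub>) = (\<oplus>\<^bsub>M\<^esub>)" "\<zero>\<^bsub>submod M N\<^esub> = \<zero>\<^bsub>M\<^esub>"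
  "(\<odot>\<^bsub>submod M N\<^esub>) = (\<odot>\<^bsub>M\<^esub>)"
  by (simp_all add: submod_def)

lemma module_submod: "module R M \<Longrightarrow> submodule N R M \<Longrightarrow> module R (submod M N)"
  unfolding submod_def by (rule submodule.submodule_is_module)

lemma submod_diff:
  assumes "module R M" "submodule N R M" "x \<in> N" "y \<in> N"
  shows "x \<ominus>\<^bsub>submod M N\<^esub> y = x \<ominus>\<^bsub>M\<^esub> y"
proof -
  have "y \<in> carrier M" using submodule_facts[OF assms(1,2)] assms by auto
  then show ?thesis using assms diff_eq_smult[OF assms(1)] diff_eq_smult[OF module_submod[OF assms(1,2)]] by simp
qed

lemma submodule_submod:
  assumes "module R M" "submodule N R M" "submodule H R M" "H \<subseteq> N"
  shows "submodule H R (submod M N)"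
  using submodule_facts[OF assms(1,3)] assms(4) by (intro submoduleI'[OF module_submod[OF assms(1,2)]]) auto

lemma submodule_submodD:
  assumes "module R M" "submodule N R M" "submodule H R (submod M N)"
  shows "submodule H R M"
  using submodule_facts[OF module_submod[OF assms(1,2)] assms(3)] submodule_facts[OF assms(1,2)]
  by (intro submoduleI'[OF assms(1)]) auto

lemma lin_maps_submod:
  assumes "h \<in> lin_maps R M M'" "N \<subseteq> carrier M" "h ` N \<subseteq> N'"
  shows "h \<in> lin_maps R (submod M N) (submod M' N')"
  using assms by (auto simp: lin_maps_def Pi_iff subset_iff image_iff)

lemma submodule_mspan:
  assumes "module R M" "S \<subseteq> carrier M"
  shows "submodule (mspan R M S) R M"
  unfolding mspan_def using submodule_carrier[OF assms(1)] assms
  by (intro submodule_Inter) auto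

lemma mspan_incl: "S \<subseteq> mspan R M S" unfolding mspan_def by auto

lemma mspan_memI: "x \<in> S \<Longrightarrow> x \<in> mspan R M S" by (rule subsetD[OF mspan_incl])

lemma mspan_least: "submodule H R M \<Longrightarrow> S \<subseteq> H \<Longrightarrow> mspan R M S \<subseteq> H"
  unfolding mspan_def by auto

lemma lin_maps_mspan_into:
  assumes "module R M" "module R N" "h \<in> lin_maps R M N" "S \<subseteq> carrier M" "submodule H R N"
    "\<And>s. s \<in> S \<Longrightarrow> h s \<in> H" "x \<in> mspan R M S"
  shows "h x \<in> H"
proof -
  have "mspan R M S \<subseteq> {x \<in> carrier M. h x \<in> H}"
    using assms by (intro mspan_least submodule_preimage[OF assms(1-3,5)]) auto
  then show ?thesis using assms(7) by auto
qed

lemma lin_maps_mspan_eq: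
  assumes "module R M" "module R N" "h \<in> lin_maps R M N" "k \<in> lin_maps R M N" "S \<subseteq> carrier M"
    "\<And>s. s \<in> S \<Longrightarrow> h s = k s" "x \<in> mspan R M S"
  shows "h x = k x"
proof -
  interpret N: module R N by fact
  have x: "x \<in> carrier M" using submodule_facts(1)[OF assms(1) submodule_mspan[OF assms(1,5)]] assms(7) by auto
  have "h x \<ominus>\<^bsub>N\<^esub> k x \<in> {\<zero>\<^bsub>N\<^esub>}"
  proof (rule lin_maps_mspan_into[OF assms(1,2) lin_maps_minus[OF assms(2-4)] assms(5) submodule_zero[OF assms(2)] _ assms(7)])
    fix s assume "s \<in> S"
    then show "h s \<ominus>\<^bsub>N\<^esub> k s \<in> {\<zero>\<^bsub>N\<^esub>}"
      using assms(5,6) lin_maps_closed[OF assms(4)] by (auto simp: a_minus_def N.r_neg)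
  qed
  then show ?thesis using x lin_maps_closed[OF assms(3)] lin_maps_closed[OF assms(4)] by (auto intro: sub_zeroE[OF assms(2)])
qed

section \<open>Quotient modules\<close>

lemma abelian_subgroup_submodule:
  assumes "module R M" "submodule N R M"
  shows "abelian_subgroup N M"
proof -
  interpret module R M by fact
  interpret N: submodule N R M by fact
  show ?thesis
    by (intro abelian_subgroupI3 additive_subgroupI N.subgroup_axioms) unfold_locales
qed

lemma coset_facts:
  assumes "module R M" "submodule N R M"
  shows coset_add: "\<And>x y. x \<in> carrier M \<Longrightarrow> y \<in> carrier M \<Longrightarrow>
          (N +>\<^bsub>M\<^esub> x) <+>\<^bsub>M\<^esub> (N +>\<^bsub>M\<^esub> y) = N +>\<^bsub>M\<^esub> (x \<oplus>\<^bsub>M\<^esub> y)"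
    and coset_self: "\<And>x. x \<in> carrier M \<Longrightarrow> x \<in> N +>\<^bsub>M\<^esub> x"
    and coset_zero: "N +>\<^bsub>M\<^esub> \<zero>\<^bsub>M\<^esub> = N"
    and coset_eq_iff: "\<And>x y. x \<in> carrier M \<Longrightarrow> y \<in> carrier M \<Longrightarrow>
          N +>\<^bsub>M\<^esub> x = N +>\<^bsub>M\<^esub> y \<longleftrightarrow> x \<ominus>\<^bsub>M\<^esub> y \<in> N"
    and coset_eq_self_iff: "\<And>x. x \<in> carrier M \<Longrightarrow> N +>\<^bsub>M\<^esub> x = N \<longleftrightarrow> x \<in> N"
    and coset_sub: "\<And>x. x \<in> carrier M \<Longrightarrow> N +>\<^bsub>M\<^esub> x \<subseteq> carrier M"
    and coset_eqI: "\<And>x y. x \<in> carrier M \<Longrightarrow> y \<in> N +>\<^bsub>M\<^esub> x \<Longrightarrow> N +>\<^bsub>M\<^esub> y = N +>\<^bsub>M\<^esub> x"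
proof -
  interpret module R M by fact
  interpret S: abelian_subgroup N M using assms by (rule abelian_subgroup_submodule)
  note sub = submodule_facts[OF assms]
  show "\<And>x y. x \<in> carrier M \<Longrightarrow> y \<in> carrier M \<Longrightarrow>
          (N +>\<^bsub>M\<^esub> x) <+>\<^bsub>M\<^esub> (N +>\<^bsub>M\<^esub> y) = N +>\<^bsub>M\<^esub> (x \<oplus>\<^bsub>M\<^esub> y)" by (rule S.a_rcos_sum)
  show self: "\<And>x. x \<in> carrier M \<Longrightarrow> x \<in> N +>\<^bsub>M\<^esub> x" by (rule S.a_rcos_self)
  show z: "N +>\<^bsub>M\<^esub> \<zero>\<^bsub>M\<^esub> = N" using sub(1) by (rule a_coset_add_zero)
  show cs: "\<And>x. x \<in> carrier M \<Longrightarrow> N +>\<^bsub>M\<^esub> x \<subseteq> carrier M" using sub(1) by (rule a_r_coset_subset_G)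
  show ci: "\<And>x y. x \<in> carrier M \<Longrightarrow> y \<in> N +>\<^bsub>M\<^esub> x \<Longrightarrow> N +>\<^bsub>M\<^esub> y = N +>\<^bsub>M\<^esub> x"
    using S.a_repr_independence' by metis
  show iff: "\<And>x y. x \<in> carrier M \<Longrightarrow> y \<in> carrier M \<Longrightarrow>
          N +>\<^bsub>M\<^esub> x = N +>\<^bsub>M\<^esub> y \<longleftrightarrow> x \<ominus>\<^bsub>M\<^esub> y \<in> N"
  proof -
    fix x y assume xy: "x \<in> carrier M" "y \<in> carrier M"
    have "x \<in> N +>\<^bsub>M\<^esub> y \<longleftrightarrow> x \<oplus>\<^bsub>M\<^esub> \<ominus>\<^bsub>M\<^esub> y \<in> N"
      using S.a_rcos_module[OF xy(2,1)] by auto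
    then show "N +>\<^bsub>M\<^esub> x = N +>\<^bsub>M\<^esub> y \<longleftrightarrow> x \<ominus>\<^bsub>M\<^esub> y \<in> N"
      using self xy ci by (metis a_minus_def)
  qed
  show "\<And>x. x \<in> carrier M \<Longrightarrow> N +>\<^bsub>M\<^esub> x = N \<longleftrightarrow> x \<in> N"
    using iff[OF _ M.zero_closed] z M.add.inv_one by (simp add: a_minus_def) (simp add: a_inv_def)
qed

lemma set_add_image:
  "N <+>\<^bsub>M\<^esub> S = (\<Union>s\<in>S. N +>\<^bsub>M\<^esub> s)"
  unfolding set_add_def' a_r_coset_def' by auto

lemma set_add_coset_image:
  assumes "module R M" "module R M'" "submodule N R M" "submodule N' R M'" "h \<in> lin_maps R M M'"
    "h ` N \<subseteq> N'" "x \<in> carrier M"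
  shows "N' <+>\<^bsub>M'\<^esub> h ` (N +>\<^bsub>M\<^esub> x) = N' +>\<^bsub>M'\<^esub> h x"
proof -
  note c = coset_facts[OF assms(1,3)] and c' = coset_facts[OF assms(2,4)]
  have "N' +>\<^bsub>M'\<^esub> h y = N' +>\<^bsub>M'\<^esub> h x" if "y \<in> N +>\<^bsub>M\<^esub> x" for y
  proof -
    have y: "y \<in> carrier M" using c(6) assms(7) that by blast
    have "y \<ominus>\<^bsub>M\<^esub> x \<in> N" using c(4)[OF y assms(7)] c(7)[OF assms(7) that] by simp
    then have "h y \<ominus>\<^bsub>M'\<^esub> h x \<in> N'" using lin_maps_diff[OF assms(1,2,5) y assms(7)] assms(6) by (metis image_subset_iff)
    then show ?thesis using c'(4) lin_maps_closed[OF assms(5)] y assms(7) by simp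
  qed
  then have "(\<lambda>s. N' +>\<^bsub>M'\<^esub> s) ` h ` (N +>\<^bsub>M\<^esub> x) = (\<lambda>y. N' +>\<^bsub>M'\<^esub> h x) ` (N +>\<^bsub>M\<^esub> x)"
    unfolding image_image by (intro image_cong) auto
  moreover have "N +>\<^bsub>M\<^esub> x \<noteq> {}" using c(2)[OF assms(7)] by auto
  ultimately show ?thesis unfolding set_add_image by simp
qed

lemma quot_simps [simp]:
  "carrier (quot R M N) = a_rcosets\<^bsub>M\<^esub> N" "\<zero>\<^bsub>quot R M N\<^esub> = N" "C \<oplus>\<^bsub>quot R M N\<^esub> D = C <+>\<^bsub>M\<^esub> D"
  "a \<odot>\<^bsub>quot R M N\<^esub> C = N <+>\<^bsub>M\<^esub> (\<lambda>x. a \<odot>\<^bsub>M\<^esub> x) ` C"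
  by (simp_all add: quot_def)

lemma rcosets_iff: "C \<in> a_rcosets\<^bsub>M\<^esub> N \<longleftrightarrow> (\<exists>x\<in>carrier M. C = N +>\<^bsub>M\<^esub> x)"
  unfolding A_RCOSETS_def' a_r_coset_def' by auto

lemma smult_coset:
  fixes R :: "'r ring" and M :: "('r, 'a) module"
  assumes "module R M" "submodule N R M" "a \<in> carrier R" "x \<in> carrier M"
  shows "N <+>\<^bsub>M\<^esub> (\<lambda>x. a \<odot>\<^bsub>M\<^esub> x) ` (N +>\<^bsub>M\<^esub> x) = N +>\<^bsub>M\<^esub> (a \<odot>\<^bsub>M\<^esub> x)"
  using set_add_coset_image[OF assms(1,1,2,2) lin_maps_scale[OF assms(1) lin_maps_id assms(3)] _ assms(4)]
    submodule_facts(4)[OF assms(1,2,3)] by blast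

lemma module_quot:
  assumes "module R M" "submodule N R M"
  shows "module R (quot R M N)"
proof -
  interpret module R M by fact
  note c = coset_facts[OF assms] and s = smult_coset[OF assms]
  have zero: "N \<in> a_rcosets\<^bsub>M\<^esub> N" using c(3) rcosets_iff by blast
  show ?thesis
  proof (rule moduleI)
    show "cring R" by unfold_locales
    show "abelian_group (quot R M N)"
    proof (rule abelian_groupI)
      fix C assume "C \<in> carrier (quot R M N)"
      then obtain x where x: "x \<in> carrier M" "C = N +>\<^bsub>M\<^esub> x" by (auto simp: rcosets_iff)
      have "(N +>\<^bsub>M\<^esub> (\<ominus>\<^bsub>M\<^esub> x)) \<oplus>\<^bsub>quot R M N\<^esub> C = \<zero>\<^bsub>quot R M N\<^esub>"
        using x c(1)[of "\<ominus>\<^bsub>M\<^esub> x" x] c(3) by (simp add: M.l_neg)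
      moreover have "N +>\<^bsub>M\<^esub> (\<ominus>\<^bsub>M\<^esub> x) \<in> carrier (quot R M N)"
        using x M.a_inv_closed unfolding quot_simps rcosets_iff by blast
      ultimately show "\<exists>y\<in>carrier (quot R M N). y \<oplus>\<^bsub>quot R M N\<^esub> C = \<zero>\<^bsub>quot R M N\<^esub>" by blast
      show "\<zero>\<^bsub>quot R M N\<^esub> \<oplus>\<^bsub>quot R M N\<^esub> C = C"
        using c(1)[OF M.zero_closed x(1)] c(3) x by simp
    next
      show "\<zero>\<^bsub>quot R M N\<^esub> \<in> carrier (quot R M N)" using zero by simp
    next
      fix C D assume "C \<in> carrier (quot R M N)" "D \<in> carrier (quot R M N)"
      then obtain x y where x: "x \<in> carrier M" "C = N +>\<^bsub>M\<^esub> x" and y: "y \<in> carrier M" "D = N +>\<^bsub>M\<^esub> y"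
        unfolding quot_simps rcosets_iff by blast
      show "C \<oplus>\<^bsub>quot R M N\<^esub> D = D \<oplus>\<^bsub>quot R M N\<^esub> C"
        using c(1)[OF x(1) y(1)] c(1)[OF y(1) x(1)] x y M.a_comm by simp
      show "C \<oplus>\<^bsub>quot R M N\<^esub> D \<in> carrier (quot R M N)"
        using c(1)[OF x(1) y(1)] x y M.a_closed unfolding quot_simps rcosets_iff by blast
      fix E assume "E \<in> carrier (quot R M N)"
      then obtain z where z: "z \<in> carrier M" "E = N +>\<^bsub>M\<^esub> z" unfolding quot_simps rcosets_iff by blast
      show "C \<oplus>\<^bsub>quot R M N\<^esub> D \<oplus>\<^bsub>quot R M N\<^esub> E = C \<oplus>\<^bsub>quot R M N\<^esub> (D \<oplus>\<^bsub>quot R M N\<^esub> E)"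
        using x y z by (simp add: c(1) M.a_assoc)
    qed
  next
    fix a C assume a: "a \<in> carrier R" and "C \<in> carrier (quot R M N)"
    then obtain x where x: "x \<in> carrier M" "C = N +>\<^bsub>M\<^esub> x" unfolding quot_simps rcosets_iff by blast
    show "a \<odot>\<^bsub>quot R M N\<^esub> C \<in> carrier (quot R M N)"
      using a x s[OF a x(1)] smult_closed unfolding quot_simps rcosets_iff by blast
    fix b assume b: "b \<in> carrier R"
    show "(a \<oplus>\<^bsub>R\<^esub> b) \<odot>\<^bsub>quot R M N\<^esub> C = a \<odot>\<^bsub>quot R M N\<^esub> C \<oplus>\<^bsub>quot R M N\<^esub> b \<odot>\<^bsub>quot R M N\<^esub> C"
      using a b x by (simp add: s c(1) smult_l_distr)
    show "a \<otimes>\<^bsub>R\<^esub> b \<odot>\<^bsub>quot R M N\<^esub> C = a \<odot>\<^bsub>quot R M N\<^esub> (b \<odot>\<^bsub>quot R M N\<^esub> C)"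
      using a b x by (simp add: s smult_assoc1)
  next
    fix a C D assume a: "a \<in> carrier R" and "C \<in> carrier (quot R M N)" "D \<in> carrier (quot R M N)"
    then obtain x y where x: "x \<in> carrier M" "C = N +>\<^bsub>M\<^esub> x" and y: "y \<in> carrier M" "D = N +>\<^bsub>M\<^esub> y"
      unfolding quot_simps rcosets_iff by blast
    show "a \<odot>\<^bsub>quot R M N\<^esub> (C \<oplus>\<^bsub>quot R M N\<^esub> D) = a \<odot>\<^bsub>quot R M N\<^esub> C \<oplus>\<^bsub>quot R M N\<^esub> a \<odot>\<^bsub>quot R M N\<^esub> D"
      using a x y by (simp add: s c(1) smult_r_distr)
  next
    fix C assume "C \<in> carrier (quot R M N)"
    then obtain x where x: "x \<in> carrier M" "C = N +>\<^bsub>M\<^esub> x" unfolding quot_simps rcosets_iff by blast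
    show "\<one>\<^bsub>R\<^esub> \<odot>\<^bsub>quot R M N\<^esub> C = C" using x by (simp add: s)
  qed
qed

lemma coset_in_quot: "x \<in> carrier M \<Longrightarrow> N +>\<^bsub>M\<^esub> x \<in> carrier (quot R M N)"
  by (auto simp: rcosets_iff)

lemma quot_cases:
  assumes "C \<in> carrier (quot R M N)"
  obtains x where "x \<in> carrier M" "C = N +>\<^bsub>M\<^esub> x"
  using assms unfolding quot_simps rcosets_iff by blast

lemma lin_maps_coset:
  assumes "module R M" "submodule N R M"
  shows "(\<lambda>x. N +>\<^bsub>M\<^esub> x) \<in> lin_maps R M (quot R M N)"
  by (intro lin_mapsI coset_in_quot) (simp_all add: coset_add[OF assms] smult_coset[OF assms])

lemma quot_map_coset:
  assumes "module R M" "module R M'" "submodule N R M" "submodule N' R M'" "h \<in> lin_maps R M M'"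
    "h ` N \<subseteq> N'" "x \<in> carrier M"
  shows "quot_map M' N' h (N +>\<^bsub>M\<^esub> x) = N' +>\<^bsub>M'\<^esub> h x"
  unfolding quot_map_def by (rule set_add_coset_image[OF assms])

lemma lin_maps_quot_map:
  assumes "module R M" "module R M'" "submodule N R M" "submodule N' R M'" "h \<in> lin_maps R M M'"
    "h ` N \<subseteq> N'"
  shows "quot_map M' N' h \<in> lin_maps R (quot R M N) (quot R M' N')"
proof -
  note q = quot_map_coset[OF assms]
  note l = lin_maps_closed[OF assms(5)]
  note M = mod_add[OF assms(1)] mod_smult[OF assms(1)]
  show ?thesis
  proof (rule lin_mapsI)
    fix C assume "C \<in> carrier (quot R M N)"
    then obtain x where x: "x \<in> carrier M" "C = N +>\<^bsub>M\<^esub> x" by (rule quot_cases)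
    show "quot_map M' N' h C \<in> carrier (quot R M' N')" unfolding x(2) q[OF x(1)] using l[OF x(1)] by (rule coset_in_quot)
    fix a assume a: "a \<in> carrier R"
    show "quot_map M' N' h (a \<odot>\<^bsub>quot R M N\<^esub> C) = a \<odot>\<^bsub>quot R M' N'\<^esub> quot_map M' N' h C"
      using a x l by (simp add: q smult_coset[OF assms(1,3)] smult_coset[OF assms(2,4)] M lin_maps_smult[OF assms(5)])
  next
    fix C D assume "C \<in> carrier (quot R M N)" "D \<in> carrier (quot R M N)"
    then obtain x y where x: "x \<in> carrier M" "C = N +>\<^bsub>M\<^esub> x" and y: "y \<in> carrier M" "D = N +>\<^bsub>M\<^esub> y" by (metis quot_cases)
    show "quot_map M' N' h (C \<oplus>\<^bsub>quot R M N\<^esub> D) = quot_map M' N' h C \<oplus>\<^bsub>quot R M' N'\<^esub> quot_map M' N' h D"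
      using x y l by (simp add: q coset_add[OF assms(1,3)] coset_add[OF assms(2,4)] M lin_maps_add[OF assms(5)])
  qed
qed

section \<open>Free modules and multilinear extension\<close>

lemma free_module_simps [simp]:
  "\<zero>\<^bsub>free_module R X\<^esub> = (\<lambda>x. \<zero>\<^bsub>R\<^esub>)" "f \<oplus>\<^bsub>free_module R X\<^esub> g = (\<lambda>x. f x \<oplus>\<^bsub>R\<^esub> g x)"
  "a \<odot>\<^bsub>free_module R X\<^esub> f = (\<lambda>x. a \<otimes>\<^bsub>R\<^esub> f x)"
  by (simp_all add: free_module_def)

lemma free_module_carrier:
  "f \<in> carrier (free_module R X) \<longleftrightarrow> (\<forall>x. f x \<in> carrier R) \<and> supp R f \<subseteq> X \<and> finite (supp R f)"
  by (auto simp: free_module_def supp_def)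

lemma self_module_simps [simp]:
  "carrier (self_module R) = carrier R" "\<zero>\<^bsub>self_module R\<^esub> = \<zero>\<^bsub>R\<^esub>" "(\<oplus>\<^bsub>self_module R\<^esub>) = (\<oplus>\<^bsub>R\<^esub>)"
  "(\<odot>\<^bsub>self_module R\<^esub>) = (\<otimes>\<^bsub>R\<^esub>)"
  by (simp_all add: self_module_def)

text \<open>Fixes the type of the ground ring, which the locale of commutative rings leaves open up to record
  extension.\<close>
locale ground_ring = cring R for R :: "'r ring" (structure)
begin

lemma supp_add: "supp R (\<lambda>x. f x \<oplus> g x) \<subseteq> supp R f \<union> supp R g"
  by (auto simp: supp_def)

lemma supp_smult: "a \<in> carrier R \<Longrightarrow> supp R (\<lambda>x. a \<otimes> f x) \<subseteq> supp R f"
  by (auto simp: supp_def)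

lemma supp_basis: "supp R (basis R x) \<subseteq> {x}"
  by (auto simp: supp_def basis_def)

lemma module_self: "module R (self_module R)"
proof (rule moduleI)
  show "cring R" by unfold_locales
  show "abelian_group (self_module R)"
  proof (rule abelian_groupI)
    fix x assume "x \<in> carrier (self_module R)"
    then show "\<exists>y\<in>carrier (self_module R). y \<oplus>\<^bsub>self_module R\<^esub> x = \<zero>\<^bsub>self_module R\<^esub>"
      by (intro bexI[of _ "\<ominus> x"]) (auto simp: l_neg)
  qed (auto simp: a_ac)
qed (auto simp: l_distr r_distr m_assoc)

lemma module_free_module: "module R (free_module R X)"
proof (rule module_separated[where I = UNIV and N = "\<lambda>_. self_module R" and h = "\<lambda>x f. f x"])
  show "cring R" by unfold_locales
  show "f \<oplus>\<^bsub>free_module R X\<^esub> g \<in> carrier (free_module R X)"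
    if "f \<in> carrier (free_module R X)" "g \<in> carrier (free_module R X)" for f g
    using that supp_add[of f g] unfolding free_module_carrier free_module_simps
    by (metis (no_types, lifting) a_closed finite_UnI finite_subset le_sup_iff order_trans)
  show "a \<odot>\<^bsub>free_module R X\<^esub> f \<in> carrier (free_module R X)"
    if "a \<in> carrier R" "f \<in> carrier (free_module R X)" for f a
    using that supp_smult[of a f] unfolding free_module_carrier free_module_simps
    by (metis (no_types, lifting) m_closed finite_subset order_trans)
  show "(\<lambda>f. f x) \<in> lin_maps R (free_module R X) (self_module R)" for x
    by (intro lin_mapsI) (auto simp: free_module_carrier)
qed (auto simp: module_self free_module_carrier supp_def)

lemma basis_closed: "x \<in> X \<Longrightarrow> basis R x \<in> carrier (free_module R X)"
  using supp_basis[of x] by (auto simp: free_module_carrier basis_def intro: finite_subset)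

lemma lin_ext_superset:
  assumes "module R M" "f \<in> carrier (free_module R X)" "h \<in> X \<rightarrow> carrier M" "finite S" "supp R f \<subseteq> S" "S \<subseteq> X"
  shows "lin_ext R M h f = (\<Oplus>\<^bsub>M\<^esub>x\<in>S. f x \<odot>\<^bsub>M\<^esub> h x)"
proof -
  interpret M: module R M by fact
  show ?thesis unfolding lin_ext_def
    using assms by (intro M.add.finprod_mono_neutral_cong_left)
      (auto simp: free_module_carrier supp_def Pi_iff subset_iff)
qed

lemma lin_ext_closed:
  assumes "module R M" "f \<in> carrier (free_module R X)" "h \<in> X \<rightarrow> carrier M"
  shows "lin_ext R M h f \<in> carrier M"
proof -
  interpret M: module R M by fact
  show ?thesis unfolding lin_ext_def
    using assms by (intro M.finsum_closed) (auto simp: free_module_carrier Pi_iff subset_iff)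
qed

text \<open>Sums over a support are compared by enlarging all supports to a common finite set.\<close>
lemma lin_ext_linear:
  assumes "module R M" "h \<in> X \<rightarrow> carrier M"
  shows "lin_ext R M h \<in> lin_maps R (free_module R X) M"
proof -
  interpret M: module R M by fact
  interpret F: module R "free_module R X" by (rule module_free_module)
  have hc: "f x \<odot>\<^bsub>M\<^esub> h x \<in> carrier M" if "f \<in> carrier (free_module R X)" "x \<in> X" for f x
    using that assms(2) by (auto simp: free_module_carrier)
  show ?thesis
  proof (rule lin_mapsI)
    fix f g assume fg: "f \<in> carrier (free_module R X)" "g \<in> carrier (free_module R X)"
    let ?S = "supp R f \<union> supp R g"
    have S: "finite ?S" "?S \<subseteq> X" using fg by (auto simp: free_module_carrier)
    have fgc: "(\<lambda>x. f x \<oplus> g x) \<in> carrier (free_module R X)" using F.a_closed[OF fg] by simp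
    have "lin_ext R M h (\<lambda>x. f x \<oplus> g x) = (\<Oplus>\<^bsub>M\<^esub>x\<in>?S. (f x \<oplus> g x) \<odot>\<^bsub>M\<^esub> h x)"
      by (rule lin_ext_superset[OF assms(1) fgc assms(2) S(1) supp_add S(2)])
    also have "\<dots> = (\<Oplus>\<^bsub>M\<^esub>x\<in>?S. f x \<odot>\<^bsub>M\<^esub> h x \<oplus>\<^bsub>M\<^esub> g x \<odot>\<^bsub>M\<^esub> h x)"
      using S(2) fg assms(2) hc by (intro M.finsum_cong') (auto simp: free_module_carrier M.smult_l_distr Pi_iff subset_iff)
    also have "\<dots> = (\<Oplus>\<^bsub>M\<^esub>x\<in>?S. f x \<odot>\<^bsub>M\<^esub> h x) \<oplus>\<^bsub>M\<^esub> (\<Oplus>\<^bsub>M\<^esub>x\<in>?S. g x \<odot>\<^bsub>M\<^esub> h x)"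
      using S(2) fg hc by (intro M.finsum_addf) blast+
    also have "\<dots> = lin_ext R M h f \<oplus>\<^bsub>M\<^esub> lin_ext R M h g"
      using lin_ext_superset[OF assms(1) fg(1) assms(2) S(1) _ S(2)] lin_ext_superset[OF assms(1) fg(2) assms(2) S(1) _ S(2)]
      by simp
    finally show "lin_ext R M h (f \<oplus>\<^bsub>free_module R X\<^esub> g) = lin_ext R M h f \<oplus>\<^bsub>M\<^esub> lin_ext R M h g" by simp
  next
    fix a f assume af: "a \<in> carrier R" and f: "f \<in> carrier (free_module R X)"
    have S: "finite (supp R f)" "supp R f \<subseteq> X" using f by (auto simp: free_module_carrier)
    have afc: "(\<lambda>x. a \<otimes> f x) \<in> carrier (free_module R X)" using F.smult_closed[OF af f] by simp
    have "lin_ext R M h (\<lambda>x. a \<otimes> f x) = (\<Oplus>\<^bsub>M\<^esub>x\<in>supp R f. (a \<otimes> f x) \<odot>\<^bsub>M\<^esub> h x)"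
      by (rule lin_ext_superset[OF assms(1) afc assms(2) S(1) supp_smult[OF af] S(2)])
    also have "\<dots> = (\<Oplus>\<^bsub>M\<^esub>x\<in>supp R f. a \<odot>\<^bsub>M\<^esub> (f x \<odot>\<^bsub>M\<^esub> h x))"
      using S(2) f af assms(2) hc[OF f] by (intro M.finsum_cong') (auto simp: free_module_carrier M.smult_assoc1 Pi_iff subset_iff)
    also have "\<dots> = a \<odot>\<^bsub>M\<^esub> lin_ext R M h f"
      unfolding lin_ext_def using S f af hc by (intro M.finsum_smult_ldistr[symmetric]) blast+
    finally show "lin_ext R M h (a \<odot>\<^bsub>free_module R X\<^esub> f) = a \<odot>\<^bsub>M\<^esub> lin_ext R M h f" by simp
  qed (use lin_ext_closed[OF assms(1) _ assms(2)] in auto)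
qed

lemma lin_ext_basis:
  assumes "module R M" "h \<in> X \<rightarrow> carrier M" "x \<in> X"
  shows "lin_ext R M h (basis R x) = h x"
proof -
  interpret M: module R M by fact
  have hx: "h x \<in> carrier M" using assms by auto
  have "lin_ext R M h (basis R x) = (\<Oplus>\<^bsub>M\<^esub>z\<in>{x}. basis R x z \<odot>\<^bsub>M\<^esub> h z)"
    using assms by (intro lin_ext_superset[OF assms(1) basis_closed[OF assms(3)] assms(2)] supp_basis) auto
  also have "\<dots> = h x" using hx by (subst M.finsum_insert) (auto simp: basis_def)
  finally show ?thesis .
qed

text \<open>The only sums in the definition of \<^const>\<open>mspan\<close> are binary, so a finitely supported function is peeled off one
  basis element at a time.\<close>
lemma free_module_mspan_basis: "carrier (free_module R X) = mspan R (free_module R X) (basis R ` X)"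
proof -
  let ?F = "free_module R X"
  interpret F: module R ?F by (rule module_free_module)
  have sub: "basis R ` X \<subseteq> carrier ?F" using basis_closed by auto
  note sp = submodule_facts[OF module_free_module submodule_mspan[OF module_free_module sub]]
  have "f \<in> mspan R ?F (basis R ` X)" if f: "f \<in> carrier ?F" for f
  proof -
    have eq: "lin_ext R ?F (basis R) f = (\<Oplus>\<^bsub>?F\<^esub>x\<in>supp R f. f x \<odot>\<^bsub>?F\<^esub> basis R x)" by (simp add: lin_ext_def)
    have fin: "finite (supp R f)" "supp R f \<subseteq> X" using f by (auto simp: free_module_carrier)
    have fs: "(\<Oplus>\<^bsub>?F\<^esub>x\<in>S. f x \<odot>\<^bsub>?F\<^esub> basis R x) = (\<lambda>z. if z \<in> S then f z else \<zero>) \<and>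
      (\<Oplus>\<^bsub>?F\<^esub>x\<in>S. f x \<odot>\<^bsub>?F\<^esub> basis R x) \<in> mspan R ?F (basis R ` X)"
      if "finite S" "S \<subseteq> X" for S
      using that
    proof (induction S rule: finite_induct)
      case empty
      then show ?case using sp(2) by simp
    next
      case (insert x S)
      have m: "f y \<odot>\<^bsub>?F\<^esub> basis R y \<in> mspan R ?F (basis R ` X)" if "y \<in> X" for y
        using that f by (intro sp(4) mspan_memI) (auto simp: free_module_carrier)
      then have m': "f y \<odot>\<^bsub>?F\<^esub> basis R y \<in> carrier ?F" if "y \<in> X" for y
        using that sp(1) by blast
      have e: "(\<Oplus>\<^bsub>?F\<^esub>x\<in>insert x S. f x \<odot>\<^bsub>?F\<^esub> basis R x) =
         f x \<odot>\<^bsub>?F\<^esub> basis R x \<oplus>\<^bsub>?F\<^esub> (\<Oplus>\<^bsub>?F\<^esub>x\<in>S. f x \<odot>\<^bsub>?F\<^esub> basis R x)"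
        using insert m' by (intro F.finsum_insert) (auto simp del: free_module_simps)
      have IH: "(\<Oplus>\<^bsub>?F\<^esub>x\<in>S. f x \<odot>\<^bsub>?F\<^esub> basis R x) = (\<lambda>z. if z \<in> S then f z else \<zero>)"
        "(\<Oplus>\<^bsub>?F\<^esub>x\<in>S. f x \<odot>\<^bsub>?F\<^esub> basis R x) \<in> mspan R ?F (basis R ` X)" using insert by auto
      have "f x \<odot>\<^bsub>?F\<^esub> basis R x \<oplus>\<^bsub>?F\<^esub> (\<lambda>z. if z \<in> S then f z else \<zero>) = (\<lambda>z. if z \<in> insert x S then f z else \<zero>)"
        using f insert by (auto simp: basis_def free_module_carrier fun_eq_iff)
      moreover have "f x \<odot>\<^bsub>?F\<^esub> basis R x \<oplus>\<^bsub>?F\<^esub> (\<Oplus>\<^bsub>?F\<^esub>x\<in>S. f x \<odot>\<^bsub>?F\<^esub> basis R x) \<in> mspan R ?F (basis R ` X)"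
        using insert by (intro sp(3) m IH(2)) auto
      ultimately show ?case using e IH by metis
    qed
    have "(\<lambda>z. if z \<in> supp R f then f z else \<zero>) = f" by (auto simp: supp_def)
    then show ?thesis using fs[OF fin] by auto
  qed
  then show ?thesis using sp(1) by auto
qed

text \<open>The defining sum of \<^const>\<open>multilin_ext\<close> ranges over lists of basis elements; splitting off the first factor
  turns it into an iteration of linear extensions.\<close>
lemma multilin_ext_Nil:
  assumes "module R M" "h [] \<in> carrier M"
  shows "multilin_ext R M h [] = h []"
proof -
  interpret M: module R M by fact
  show ?thesis using assms(2) unfolding multilin_ext_def by (simp add: M.finsum_insert)
qed

lemma listset_closed: "xs \<in> listset As \<longleftrightarrow> length xs = length As \<and> (\<forall>i<length As. xs ! i \<in> As ! i)"
proof (induction As arbitrary: xs)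
  case (Cons A As)
  then show ?case
    by (cases xs) (auto simp: set_Cons_def nth_Cons less_Suc_eq_0_disj split: nat.splits)
qed auto

lemma finite_listset: "(\<forall>A\<in>set As. finite A) \<Longrightarrow> finite (listset As)"
proof (induction As)
  case (Cons A As)
  have "set_Cons A (listset As) = (\<lambda>(x, xs). x # xs) ` (A \<times> listset As)" by (auto simp: set_Cons_def)
  then show ?case using Cons by simp
qed auto

lemma finsum_Sigma:
  assumes "abelian_group M" "finite A" "finite B" "\<And>x y. x \<in> A \<Longrightarrow> y \<in> B \<Longrightarrow> g x y \<in> carrier M"
  shows "(\<Oplus>\<^bsub>M\<^esub>z\<in>A \<times> B. g (fst z) (snd z)) = (\<Oplus>\<^bsub>M\<^esub>x\<in>A. \<Oplus>\<^bsub>M\<^esub>y\<in>B. g x y)"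
proof -
  interpret M: abelian_group M by fact
  show ?thesis using assms(2,4)
  proof (induction A rule: finite_induct)
    case (insert a A)
    have "insert a A \<times> B = (Pair a ` B) \<union> A \<times> B" by auto
    then have "(\<Oplus>\<^bsub>M\<^esub>z\<in>insert a A \<times> B. g (fst z) (snd z)) =
      (\<Oplus>\<^bsub>M\<^esub>z\<in>Pair a ` B. g (fst z) (snd z)) \<oplus>\<^bsub>M\<^esub> (\<Oplus>\<^bsub>M\<^esub>z\<in>A \<times> B. g (fst z) (snd z))"
      using insert.prems insert.hyps assms(3) by (simp only:) (rule M.finsum_Un_disjoint, auto)
    also have "(\<Oplus>\<^bsub>M\<^esub>z\<in>Pair a ` B. g (fst z) (snd z)) = (\<Oplus>\<^bsub>M\<^esub>y\<in>B. g a y)"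
      using insert by (subst M.finsum_reindex) (auto simp: inj_on_def)
    finally show ?case using insert assms(3) by (simp add: Pi_iff M.finsum_closed)
  qed simp
qed

lemma finprod_lessThan_shift:
  assumes "\<And>i. i < Suc n \<Longrightarrow> f i \<in> carrier R"
  shows "(\<Otimes>i\<in>{..<Suc n}. f i) = f 0 \<otimes> (\<Otimes>i\<in>{..<n}. f (Suc i))"
proof -
  have "{..<Suc n} = insert 0 (Suc ` {..<n})" by (auto simp: lessThan_Suc_eq_insert_0)
  then have "(\<Otimes>i\<in>{..<Suc n}. f i) = f 0 \<otimes> (\<Otimes>i\<in>Suc ` {..<n}. f i)"
    using assms by (simp add: finprod_insert Pi_iff)
  also have "(\<Otimes>i\<in>Suc ` {..<n}. f i) = (\<Otimes>i\<in>{..<n}. f (Suc i))"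
    using assms by (subst finprod_reindex) auto
  finally show ?thesis .
qed

lemma multilin_ext_Cons:
  assumes "module R M" "f \<in> carrier (free_module R X)" "fs \<in> lists (carrier (free_module R X))"
    "\<And>xs. xs \<in> lists X \<Longrightarrow> length xs = Suc (length fs) \<Longrightarrow> h xs \<in> carrier M"
  shows "multilin_ext R M h (f # fs) = lin_ext R M (\<lambda>x. multilin_ext R M (\<lambda>xs. h (x # xs)) fs) f"
proof -
  interpret M: module R M by fact
  let ?L = "listset (map (supp R) fs)"
  let ?p = "\<lambda>fs xs. \<Otimes>i\<in>{..<length fs}. (fs ! i) (xs ! i)"
  have fin: "finite (supp R f)" "finite ?L"
    using assms(2,3) by (auto simp: free_module_carrier intro!: finite_listset)
  have nth: "fs ! i \<in> carrier (free_module R X)" if "i < length fs" for i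
    using that assms(3) by (auto simp: in_lists_conv_set)
  have L: "xs \<in> lists X \<and> length xs = length fs" if "xs \<in> ?L" for xs
    using that nth unfolding listset_closed in_lists_conv_set
    by (auto simp: in_set_conv_nth free_module_carrier subset_iff)
  have p: "?p fs xs \<in> carrier R" for xs
    using nth by (intro finprod_closed) (auto simp: free_module_carrier)
  have hc: "h (x # xs) \<in> carrier M" if "x \<in> supp R f" "xs \<in> ?L" for x xs
    using that L assms(2,4) by (auto simp: free_module_carrier)
  have fx: "f x \<in> carrier R" for x using assms(2) by (auto simp: free_module_carrier)
  have "listset (map (supp R) (f # fs)) = (\<lambda>z. fst z # snd z) ` (supp R f \<times> ?L)"
    by (auto simp: set_Cons_def image_iff)
  then have "multilin_ext R M h (f # fs) =
     (\<Oplus>\<^bsub>M\<^esub>xs\<in>(\<lambda>z. fst z # snd z) ` (supp R f \<times> ?L). ?p (f # fs) xs \<odot>\<^bsub>M\<^esub> h xs)"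
    unfolding multilin_ext_def by presburger
  also have "\<dots> = (\<Oplus>\<^bsub>M\<^esub>z\<in>supp R f \<times> ?L. ?p (f # fs) (fst z # snd z) \<odot>\<^bsub>M\<^esub> h (fst z # snd z))"
  proof (rule M.finsum_reindex)
    show "inj_on (\<lambda>z. fst z # snd z) (supp R f \<times> ?L)" by (auto simp: inj_on_def)
    have "?p (f # fs) (x # xs) \<in> carrier R" for x xs
      using nth fx by (intro finprod_closed) (auto simp: free_module_carrier nth_Cons split: nat.splits)
    then show "(\<lambda>xs. ?p (f # fs) xs \<odot>\<^bsub>M\<^esub> h xs) \<in> (\<lambda>z. fst z # snd z) ` (supp R f \<times> ?L) \<rightarrow> carrier M"
      using hc by auto
  qed
  also have "\<dots> = (\<Oplus>\<^bsub>M\<^esub>z\<in>supp R f \<times> ?L. f (fst z) \<odot>\<^bsub>M\<^esub> (?p fs (snd z) \<odot>\<^bsub>M\<^esub> h (fst z # snd z)))"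
  proof (rule M.finsum_cong')
    fix z assume z: "z \<in> supp R f \<times> ?L"
    have "?p (f # fs) (fst z # snd z) = f (fst z) \<otimes> ?p fs (snd z)"
      using nth fx by (simp add: finprod_lessThan_shift free_module_carrier nth_Cons split: nat.splits)
    then show "?p (f # fs) (fst z # snd z) \<odot>\<^bsub>M\<^esub> h (fst z # snd z) =
      f (fst z) \<odot>\<^bsub>M\<^esub> (?p fs (snd z) \<odot>\<^bsub>M\<^esub> h (fst z # snd z))"
      using p fx hc z M.smult_assoc1 by auto
  qed (use p fx hc in auto)
  also have "\<dots> = (\<Oplus>\<^bsub>M\<^esub>x\<in>supp R f. \<Oplus>\<^bsub>M\<^esub>xs\<in>?L. f x \<odot>\<^bsub>M\<^esub> (?p fs xs \<odot>\<^bsub>M\<^esub> h (x # xs)))"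
    using fin p fx hc by (intro finsum_Sigma) (auto intro: M.abelian_group_axioms)
  also have "\<dots> = (\<Oplus>\<^bsub>M\<^esub>x\<in>supp R f. f x \<odot>\<^bsub>M\<^esub> (\<Oplus>\<^bsub>M\<^esub>xs\<in>?L. ?p fs xs \<odot>\<^bsub>M\<^esub> h (x # xs)))"
    using fin p fx hc by (intro M.finsum_cong' M.finsum_smult_ldistr[symmetric]) (auto intro!: M.finsum_closed)
  finally show ?thesis by (simp add: lin_ext_def multilin_ext_def)
qed

lemma multilin_ext_closed:
  assumes "module R M" "fs \<in> lists (carrier (free_module R X))"
    "\<And>xs. xs \<in> lists X \<Longrightarrow> length xs = length fs \<Longrightarrow> h xs \<in> carrier M"
  shows "multilin_ext R M h fs \<in> carrier M"
  using assms(2,3)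
proof (induction fs arbitrary: h rule: list.induct)
  case Nil
  then show ?case by (simp add: multilin_ext_Nil[OF assms(1)])
next
  case (Cons f fs)
  have f: "f \<in> carrier (free_module R X)" "fs \<in> lists (carrier (free_module R X))" using Cons.prems(1) by auto
  have hx: "h (x # xs) \<in> carrier M" if "x \<in> X" "xs \<in> lists X" "length xs = length fs" for x xs
    using Cons.prems(2)[of "x # xs"] that by simp
  have "(\<lambda>x. multilin_ext R M (\<lambda>xs. h (x # xs)) fs) \<in> X \<rightarrow> carrier M"
    using hx f(2) by (intro funcsetI Cons.IH) simp_all
  then show ?case using Cons.prems(2) by (simp add: multilin_ext_Cons[OF assms(1) f] lin_ext_closed[OF assms(1) f(1)])
qed

lemma multilin_ext_slot:
  assumes "module R M" "fs \<in> lists (carrier (free_module R X))"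
    "\<And>xs. xs \<in> lists X \<Longrightarrow> length xs = length fs \<Longrightarrow> h xs \<in> carrier M" "i < length fs"
  shows "(\<lambda>f. multilin_ext R M h (fs[i := f])) \<in> lin_maps R (free_module R X) M"
  using assms(2-4)
proof (induction fs arbitrary: h i rule: list.induct)
  case (Cons f fs)
  have f: "f \<in> carrier (free_module R X)" "fs \<in> lists (carrier (free_module R X))" using Cons.prems(1) by auto
  have hx: "h (x # xs) \<in> carrier M" if "x \<in> X" "xs \<in> lists X" "length xs = length fs" for x xs
    using Cons.prems(2)[of "x # xs"] that by simp
  show ?case
  proof (cases i)
    case 0
    have "(\<lambda>x. multilin_ext R M (\<lambda>xs. h (x # xs)) fs) \<in> X \<rightarrow> carrier M"
      using hx f by (intro funcsetI multilin_ext_closed[OF assms(1) f(2)]) simp_all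
    then have "lin_ext R M (\<lambda>x. multilin_ext R M (\<lambda>xs. h (x # xs)) fs) \<in> lin_maps R (free_module R X) M"
      by (rule lin_ext_linear[OF assms(1)])
    moreover have "multilin_ext R M h ((f # fs)[i := g]) = lin_ext R M (\<lambda>x. multilin_ext R M (\<lambda>xs. h (x # xs)) fs) g"
      if "g \<in> carrier (free_module R X)" for g
      using 0 Cons.prems(2) by (simp add: multilin_ext_Cons[OF assms(1) that f(2)])
    ultimately show ?thesis by (rule lin_maps_cong[OF module_free_module])
  next
    case (Suc j)
    have j: "j < length fs" using Cons.prems Suc by simp
    interpret M: module R M by fact
    have IH: "(\<lambda>g. multilin_ext R M (\<lambda>xs. h (x # xs)) (fs[j := g])) \<in> lin_maps R (free_module R X) M" if "x \<in> X" for x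
      using hx that f(2) j by (intro Cons.IH) simp_all
    have supp: "x \<in> X" "f x \<in> carrier R" if "x \<in> supp R f" for x using f that by (auto simp: free_module_carrier)
    have "(\<lambda>g. lin_ext R M (\<lambda>x. multilin_ext R M (\<lambda>xs. h (x # xs)) (fs[j := g])) f) \<in> lin_maps R (free_module R X) M"
      unfolding lin_ext_def using supp IH by (intro lin_maps_finsum[OF assms(1)] lin_maps_scale[OF assms(1)]) auto
    moreover have "multilin_ext R M h ((f # fs)[i := g]) =
        lin_ext R M (\<lambda>x. multilin_ext R M (\<lambda>xs. h (x # xs)) (fs[j := g])) f" if "g \<in> carrier (free_module R X)" for g
    proof -
      have "fs[j := g] \<in> lists (carrier (free_module R X))"
        using that f(2) set_update_subset_insert[of fs j g] by (auto simp: in_lists_conv_set)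
      then show ?thesis using Suc Cons.prems(2) multilin_ext_Cons[OF assms(1) f(1)] by simp
    qed
    ultimately show ?thesis by (rule lin_maps_cong[OF module_free_module])
  qed
qed simp

lemma multilin_ext_basis:
  assumes "module R M" "xs \<in> lists X"
    "\<And>xs'. xs' \<in> lists X \<Longrightarrow> length xs' = length xs \<Longrightarrow> h xs' \<in> carrier M"
  shows "multilin_ext R M h (map (basis R) xs) = h xs"
  using assms(2,3)
proof (induction xs arbitrary: h rule: list.induct)
  case Nil
  then show ?case by (simp add: multilin_ext_Nil[OF assms(1)])
next
  case (Cons x xs)
  have x: "x \<in> X" "xs \<in> lists X" using Cons.prems(1) by auto
  have hx: "h (y # ys) \<in> carrier M" if "y \<in> X" "ys \<in> lists X" "length ys = length xs" for y ys
    using Cons.prems(2)[of "y # ys"] that by simp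
  have b: "map (basis R) xs \<in> lists (carrier (free_module R X))" using x(2) by (auto intro!: basis_closed)
  have "multilin_ext R M h (map (basis R) (x # xs)) = lin_ext R M (\<lambda>x. multilin_ext R M (\<lambda>xs. h (x # xs)) (map (basis R) xs)) (basis R x)"
    using multilin_ext_Cons[OF assms(1) basis_closed[OF x(1)] b, of h] Cons.prems(2) by simp
  also have "\<dots> = multilin_ext R M (\<lambda>xs. h (x # xs)) (map (basis R) xs)"
    using hx by (intro lin_ext_basis[OF assms(1) _ x(1)] funcsetI multilin_ext_closed[OF assms(1) b]) simp_all
  also have "\<dots> = h (x # xs)" using hx x by (intro Cons.IH) simp_all
  finally show ?case .
qed

end

text \<open>The slots of a list are released one after the other: the induction is on the number \<open>j\<close> of initial slots
  that need not contain generators. Keeping the property \<open>Q\<close> abstract covers equations as well as membership in a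
  kernel.\<close>
lemma multi_induct:
  assumes slot: "\<And>xs i. xs \<in> lists C \<Longrightarrow> length xs = k \<Longrightarrow> i < k \<Longrightarrow> (\<And>s. s \<in> S \<Longrightarrow> Q (xs[i := s])) \<Longrightarrow>
      (\<And>x. x \<in> C \<Longrightarrow> Q (xs[i := x]))"
    and gen: "\<And>ss. ss \<in> lists S \<Longrightarrow> length ss = k \<Longrightarrow> Q ss" and sub: "S \<subseteq> C"
    and xs: "xs \<in> lists C" "length xs = k"
  shows "Q xs"
proof -
  have "\<forall>xs\<in>lists C. length xs = k \<longrightarrow> (\<forall>i<k. j \<le> i \<longrightarrow> xs ! i \<in> S) \<longrightarrow> Q xs" if "j \<le> k" for j
    using that
  proof (induction j)
    case 0
    then show ?case using gen by (metis in_listsI in_set_conv_nth zero_le)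
  next
    case (Suc j)
    show ?case
    proof (intro ballI impI)
      fix xs assume xs: "xs \<in> lists C" "length xs = k" "\<forall>i<k. Suc j \<le> i \<longrightarrow> xs ! i \<in> S"
      have "Q (xs[j := s])" if s: "s \<in> S" for s
      proof -
        have "xs[j := s] \<in> lists C" using xs s sub set_update_subset_insert[of xs j s] by (auto simp: in_lists_conv_set)
        moreover have "\<forall>i<k. j \<le> i \<longrightarrow> xs[j := s] ! i \<in> S" using xs s Suc.prems
          by (metis Suc_leI le_neq_implies_less nth_list_update_eq nth_list_update_neq)
        ultimately show ?thesis using Suc xs(2) by simp
      qed
      then have "Q (xs[j := xs ! j])" using slot[OF xs(1,2), of j "xs ! j"] Suc.prems xs by (auto simp: in_lists_conv_set)
      then show "Q xs" by simp
    qed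
  qed
  from this[of k] xs show ?thesis by auto
qed

text \<open>Multilinear maps are handled as functions on lists that are linear in each slot \<open>xs[i := x]\<close>; two of them
  agree if they do so on lists of generators.\<close>
lemma multilin_eqI:
  assumes "module R M" "module R N" "carrier M = mspan R M S" "S \<subseteq> carrier M"
    "\<And>xs i. xs \<in> lists (carrier M) \<Longrightarrow> length xs = k \<Longrightarrow> i < k \<Longrightarrow> (\<lambda>x. T (xs[i := x])) \<in> lin_maps R M N"
    "\<And>xs i. xs \<in> lists (carrier M) \<Longrightarrow> length xs = k \<Longrightarrow> i < k \<Longrightarrow> (\<lambda>x. T' (xs[i := x])) \<in> lin_maps R M N"
    "\<And>ss. ss \<in> lists S \<Longrightarrow> length ss = k \<Longrightarrow> T ss = T' ss"
    "xs \<in> lists (carrier M)" "length xs = k"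
  shows "T xs = T' xs"
proof (rule multi_induct[where C = "carrier M" and S = S and k = k])
  fix xs i x
  assume xs: "xs \<in> lists (carrier M)" "length xs = k" "i < k" and *: "\<And>s. s \<in> S \<Longrightarrow> T (xs[i := s]) = T' (xs[i := s])"
    and x: "x \<in> carrier M"
  show "T (xs[i := x]) = T' (xs[i := x])"
    by (rule lin_maps_mspan_eq[OF assms(1,2) assms(5)[OF xs] assms(6)[OF xs] assms(4)]) (use * x assms(3) in auto)
qed (use assms in auto)

section \<open>Permutations of concatenated lists\<close>

lemma lists_update: "xs \<in> lists S \<Longrightarrow> x \<in> S \<Longrightarrow> xs[i := x] \<in> lists S"
  using set_update_subset_insert[of xs i x] by (auto simp: in_lists_conv_set)

lemma lists_nth: "xs \<in> lists S \<Longrightarrow> i < length xs \<Longrightarrow> xs ! i \<in> S"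
  by (auto simp: in_lists_conv_set)

lemma lists_map: "(\<And>x. x \<in> S \<Longrightarrow> f x \<in> T) \<Longrightarrow> xs \<in> lists S \<Longrightarrow> map f xs \<in> lists T"
  by (auto simp: in_lists_conv_set)

lemma perm_of_permutes:
  assumes "mset l = mset [0..<n]"
  shows "perm_of l permutes {..<n}"
proof -
  have l: "length l = n" "set l = {..<n}" "distinct l"
    using mset_eq_length[OF assms] mset_eq_setD[OF assms] mset_eq_imp_distinct_iff[OF assms]
    by (simp_all add: atLeast0LessThan)
  have "bij_betw ((!) l) {..<n} {..<n}" using l by (intro bij_betw_nth) auto
  moreover have "bij_betw (perm_of l) {..<n} {..<n} \<longleftrightarrow> bij_betw ((!) l) {..<n} {..<n}"
    using l(1) by (intro bij_betw_cong) (auto simp: perm_of_def)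
  ultimately have "bij_betw (perm_of l) {..<n} {..<n}" by simp
  then show ?thesis using l(1) by (intro bij_imp_permutes) (auto simp: perm_of_def)
qed

lemma permute_list_perm_of: "length l = length L \<Longrightarrow> permute_list (perm_of l) L = map ((!) L) l"
  by (auto simp: permute_list_def perm_of_def intro!: nth_equalityI)

lemma length_blocks [simp]: "length (blocks a ns) = length ns"
  by (induction a ns rule: blocks.induct) auto

lemma concat_blocks: "concat (blocks a ns) = [a..<a + sum_list ns]"
proof (induction a ns rule: blocks.induct)
  case (2 a n ns)
  have "[a..<a + n + sum_list ns] = [a..<a + n] @ [a + n..<a + n + sum_list ns]" by (rule upt_add_eq_append) simp
  then show ?case using 2 by (simp add: add.assoc)
qed simp

lemma length_nth_blocks: "i < length ns \<Longrightarrow> length (blocks a ns ! i) = ns ! i"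
  by (induction a ns arbitrary: i rule: blocks.induct) (auto simp: nth_Cons split: nat.splits)

lemma map_nth_blocks: "map (map ((!) (ps @ concat xss))) (blocks (length ps) (map length xss)) = xss"
proof (induction xss arbitrary: ps)
  case (Cons xs xss)
  have "map ((!) (ps @ concat (xs # xss))) [length ps..<length ps + length xs] = xs"
    by (auto intro!: nth_equalityI simp: nth_append)
  moreover have "map (map ((!) ((ps @ xs) @ concat xss))) (blocks (length (ps @ xs)) (map length xss)) = xss"
    by (rule Cons)
  ultimately show ?case by simp
qed simp

lemma mset_concat_permute:
  assumes "\<sigma> permutes {..<length xss}"
  shows "mset (concat (permute_list \<sigma> xss)) = mset (concat xss)"
proof -
  have "mset (map mset (permute_list \<sigma> xss)) = mset (map mset xss)"
    using mset_permute_list[OF assms] by simp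
  then have "sum_list (map mset (permute_list \<sigma> xss)) = sum_list (map mset xss)"
    by (metis sum_mset_sum_list)
  then show ?thesis by (simp add: mset_concat)
qed

text \<open>The two permutations in the equivariance axioms of an operad are characterised by what they do to the
  concatenated argument lists. Both facts follow from one observation: the list of indices in \<^const>\<open>perm_of\<close> is the
  same rearrangement of \<open>[0..<n]\<close>, cut into blocks, so indexing the concatenation along it rearranges the
  arguments.\<close>
lemma concat_permute_list:
  assumes "\<sigma> permutes {..<length xss}"
  defines "\<tau> \<equiv> perm_of (concat (permute_list \<sigma> (blocks 0 (map length xss))))"
  shows "concat (permute_list \<sigma> xss) = permute_list \<tau> (concat xss)"
    and "\<tau> permutes {..<length (concat xss)}"
proof -
  let ?B = "blocks 0 (map length xss)"
  have p: "\<sigma> permutes {..<length ?B}" using assms(1) by simp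
  have m: "mset (concat (permute_list \<sigma> ?B)) = mset [0..<length (concat xss)]"
    using mset_concat_permute[OF p] by (simp add: concat_blocks length_concat)
  have "permute_list \<tau> (concat xss) = map ((!) (concat xss)) (concat (permute_list \<sigma> ?B))"
    unfolding \<tau>_def using mset_eq_length[OF m] by (intro permute_list_perm_of) simp
  also have "\<dots> = concat (permute_list \<sigma> (map (map ((!) (concat xss))) ?B))"
    using p by (simp add: map_concat permute_list_map)
  also have "\<dots> = concat (permute_list \<sigma> xss)" by (simp add: map_nth_blocks[of "[]", simplified])
  finally show "concat (permute_list \<sigma> xss) = permute_list \<tau> (concat xss)" by simp
  show "\<tau> permutes {..<length (concat xss)}" unfolding \<tau>_def using m by (rule perm_of_permutes)
qed

lemma mset_concat_map2_permute:
  assumes "length \<sigma>s = length xss" "\<And>i. i < length xss \<Longrightarrow> \<sigma>s ! i permutes {..<length (xss ! i)}"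
  shows "mset (concat (map2 permute_list \<sigma>s xss)) = mset (concat xss)"
  using assms
proof (induction \<sigma>s xss rule: list_induct2)
  case (Cons \<sigma> \<sigma>s xs xss)
  have "\<sigma> permutes {..<length xs}" using Cons.prems[of 0] by simp
  moreover have "\<And>i. i < length xss \<Longrightarrow> \<sigma>s ! i permutes {..<length (xss ! i)}" using Cons.prems[of "Suc i" for i] by simp
  ultimately show ?case using Cons.IH by simp
qed simp

lemma concat_map2_permute_list:
  assumes "length \<sigma>s = length xss" "\<And>i. i < length xss \<Longrightarrow> \<sigma>s ! i permutes {..<length (xss ! i)}"
  defines "\<tau> \<equiv> perm_of (concat (map2 permute_list \<sigma>s (blocks 0 (map length xss))))"
  shows "concat (map2 permute_list \<sigma>s xss) = permute_list \<tau> (concat xss)"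
    and "\<tau> permutes {..<length (concat xss)}"
proof -
  let ?B = "blocks 0 (map length xss)"
  have m: "mset (concat (map2 permute_list \<sigma>s ?B)) = mset [0..<length (concat xss)]"
    using assms by (subst mset_concat_map2_permute) (auto simp: concat_blocks length_concat length_nth_blocks)
  have "permute_list \<tau> (concat xss) = map ((!) (concat xss)) (concat (map2 permute_list \<sigma>s ?B))"
    unfolding \<tau>_def using mset_eq_length[OF m] by (intro permute_list_perm_of) simp
  also have "\<dots> = concat (map2 permute_list \<sigma>s (map (map ((!) (concat xss))) ?B))"
    unfolding map_concat
    using assms by (intro arg_cong[where f = concat] nth_equalityI) (auto simp: permute_list_map length_nth_blocks)
  also have "\<dots> = concat (map2 permute_list \<sigma>s xss)" by (simp add: map_nth_blocks[of "[]", simplified])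
  finally show "concat (map2 permute_list \<sigma>s xss) = permute_list \<tau> (concat xss)" by simp
  show "\<tau> permutes {..<length (concat xss)}" unfolding \<tau>_def using m by (rule perm_of_permutes)
qed

lemma permute_list_update:
  assumes "\<sigma> permutes {..<length xs}" "i < length xs"
  shows "permute_list \<sigma> (xs[i := x]) = (permute_list \<sigma> xs)[inv_into UNIV \<sigma> i := x]"
proof (rule nth_equalityI)
  fix j assume "j < length (permute_list \<sigma> (xs[i := x]))"
  then have j: "j < length xs" by simp
  have "\<sigma> j < length xs" using permutes_in_image[OF assms(1), of j] j by simp
  moreover have "\<sigma> j = i \<longleftrightarrow> j = inv_into UNIV \<sigma> i" using permutes_inverses[OF assms(1)] by metis
  ultimately show "permute_list \<sigma> (xs[i := x]) ! j = (permute_list \<sigma> xs)[inv_into UNIV \<sigma> i := x] ! j"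
    using j assms by (auto simp: permute_list_nth nth_list_update permutes_in_image)
qed simp

lemma concat_update:
  assumes "i < length xss" "j < length xs"
  shows "concat (xss[i := xs[j := x]]) = (concat (xss[i := xs]))[length (concat (take i xss)) + j := x]"
  using assms
proof (induction xss arbitrary: i)
  case (Cons ys xss)
  then show ?case by (cases i) (auto simp: list_update_append)
qed simp

lemma concat_position:
  assumes "i < length xss" "j < length (xss ! i)"
  shows "length (concat (take i xss)) + j < length (concat xss)"
    and "concat xss ! (length (concat (take i xss)) + j) = xss ! i ! j"
proof -
  have "concat xss = concat (take i xss) @ xss ! i @ concat (drop (Suc i) xss)"
    using assms(1) by (metis concat.simps(2) concat_append id_take_nth_drop)
  then show "length (concat (take i xss)) + j < length (concat xss)"
    "concat xss ! (length (concat (take i xss)) + j) = xss ! i ! j"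
    using assms(2) by (auto simp: nth_append)
qed

lemma (in abelian_monoid) finsum_lessThan_add:
  fixes n k :: nat
  assumes "\<And>i. i < n + k \<Longrightarrow> F i \<in> carrier G"
  shows "(\<Oplus>i\<in>{..<n + k}. F i) = (\<Oplus>i\<in>{..<n}. F i) \<oplus> (\<Oplus>i\<in>{..<k}. F (n + i))"
  using assms
proof (induction k)
  case 0
  then show ?case by simp
next
  case (Suc k)
  have c: "F (n + k) \<in> carrier G" "(\<Oplus>i\<in>{..<n}. F i) \<in> carrier G" "(\<Oplus>i\<in>{..<k}. F (n + i)) \<in> carrier G"
    using Suc.prems by (auto intro!: finsum_closed)
  have "(\<Oplus>i\<in>{..<n + Suc k}. F i) = F (n + k) \<oplus> (\<Oplus>i\<in>{..<n + k}. F i)"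
    unfolding add_Suc_right lessThan_Suc using Suc.prems by (intro finsum_insert) auto
  moreover have "(\<Oplus>i\<in>{..<Suc k}. F (n + i)) = F (n + k) \<oplus> (\<Oplus>i\<in>{..<k}. F (n + i))"
    unfolding lessThan_Suc using Suc.prems by (intro finsum_insert) auto
  ultimately show ?case using Suc c by (simp add: a_ac)
qed

text \<open>A sum over the leaves of a composite is a double sum, over the composed terms and over the leaves of each
  of them.\<close>
lemma finsum_concat:
  assumes "abelian_monoid M" "\<And>J. J < length (concat xss) \<Longrightarrow> F J \<in> carrier M"
  shows "(\<Oplus>\<^bsub>M\<^esub>J\<in>{..<length (concat xss)}. F J) =
    (\<Oplus>\<^bsub>M\<^esub>i\<in>{..<length xss}. \<Oplus>\<^bsub>M\<^esub>j\<in>{..<length (xss ! i)}. F (length (concat (take i xss)) + j))"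
  using assms(2)
proof (induction xss rule: rev_induct)
  interpret M: abelian_monoid M by fact
  {
    case Nil
    then show ?case by simp
  next
    case (snoc xs xss)
    let ?L = "length (concat xss)"
    have F: "F J \<in> carrier M" if "J < ?L + length xs" for J using snoc.prems that by simp
    let ?G = "\<lambda>xss i. \<Oplus>\<^bsub>M\<^esub>j\<in>{..<length (xss ! i)}. F (length (concat (take i xss)) + j)"
    define H where "H i = ?G (xss @ [xs]) i" for i
    have Gc: "?G xss i \<in> carrier M" if "i < length xss" for i
      using concat_position(1)[OF that] by (intro M.finsum_closed) (auto intro!: F trans_less_add1)
    have GH: "?G xss i = H i" if "i < length xss" for i using that by (simp add: H_def nth_append)
    have Hc: "H i \<in> carrier M" if "i < length xss" for i using GH[OF that] Gc[OF that] by simp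
    have Hl: "H (length xss) \<in> carrier M" using F by (auto simp: H_def intro!: M.finsum_closed)
    have "(\<Oplus>\<^bsub>M\<^esub>J\<in>{..<length (concat (xss @ [xs]))}. F J) = (\<Oplus>\<^bsub>M\<^esub>J\<in>{..<?L}. F J) \<oplus>\<^bsub>M\<^esub> H (length xss)"
      using M.finsum_lessThan_add[of ?L "length xs" F] F by (simp add: H_def)
    also have "(\<Oplus>\<^bsub>M\<^esub>J\<in>{..<?L}. F J) = (\<Oplus>\<^bsub>M\<^esub>i\<in>{..<length xss}. ?G xss i)"
      using F by (intro snoc.IH) simp
    also have "\<dots> = (\<Oplus>\<^bsub>M\<^esub>i\<in>{..<length xss}. H i)"
      using Hc GH by (intro M.finsum_cong'[OF refl]) (auto simp del: M.finsum_cong')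
    also have "\<dots> \<oplus>\<^bsub>M\<^esub> H (length xss) = H (length xss) \<oplus>\<^bsub>M\<^esub> (\<Oplus>\<^bsub>M\<^esub>i\<in>{..<length xss}. H i)"
      using Hc Hl by (intro M.a_comm M.finsum_closed) auto
    also have "\<dots> = (\<Oplus>\<^bsub>M\<^esub>i\<in>insert (length xss) {..<length xss}. H i)"
      using Hc Hl by (intro M.finsum_insert[symmetric]) auto
    also have "insert (length xss) {..<length xss} = {..<length (xss @ [xs])}" by auto
    finally show ?case unfolding H_def .
  }
qed

section \<open>Free algebras\<close>

sublocale operad \<subseteq> ground_ring R
  by unfold_locales

context operad
begin

abbreviation "FM V \<equiv> free_module R (fa_gens P V)"
abbreviation "Al V \<equiv> free_alg R P V"
abbreviation "Nul V \<equiv> fa_null R P V"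
abbreviation "tm V g \<equiv> fa_term R P V (fst g) (snd g)"
abbreviation "var V v \<equiv> fa_var R P V v"
abbreviation "fop V x Xs \<equiv> fa_op R P V x Xs"

lemma fa_gens_iff: "(x, vs) \<in> fa_gens P V \<longleftrightarrow> snd x \<in> carrier (Op P (fst x)) \<and> vs \<in> lists (carrier V) \<and> length vs = fst x"
  by (auto simp: fa_gens_def ops_def)

lemma fa_gensE:
  assumes "g \<in> fa_gens P V"
  shows "fst g \<in> ops P" "snd (fst g) \<in> carrier (Op P (fst (fst g)))" "snd g \<in> lists (carrier V)" "length (snd g) = fst (fst g)"
  using assms by (auto simp: fa_gens_def ops_def)

text \<open>Families of values on the generators \<open>\<mu> \<otimes> v\<^sub>1 \<otimes> \<dots> \<otimes> v\<^sub>n\<close> that factor through the relations, i.e. that are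
  linear in each tensor factor and invariant under the symmetric groups.\<close>
definition fa_compat :: "('r, 'v) module \<Rightarrow> ('r, 'm) module \<Rightarrow> (('o, 'v) fa_gen \<Rightarrow> 'm) \<Rightarrow> bool" where
  "fa_compat V M h \<longleftrightarrow>
    (\<forall>n vs. vs \<in> lists (carrier V) \<longrightarrow> length vs = n \<longrightarrow> (\<lambda>\<mu>. h ((n, \<mu>), vs)) \<in> lin_maps R (Op P n) M) \<and>
    (\<forall>x vs i. (x, vs) \<in> fa_gens P V \<longrightarrow> i < length vs \<longrightarrow> (\<lambda>v. h (x, vs[i := v])) \<in> lin_maps R V M) \<and>
    (\<forall>n \<sigma> \<mu> vs. ((n, \<mu>), vs) \<in> fa_gens P V \<longrightarrow> \<sigma> permutes {..<n} \<longrightarrow>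
       h ((n, act P n \<sigma> \<mu>), permute_list \<sigma> vs) = h ((n, \<mu>), vs))"

lemma fa_compatD:
  assumes "fa_compat V M h"
  shows "\<And>n vs. vs \<in> lists (carrier V) \<Longrightarrow> length vs = n \<Longrightarrow> (\<lambda>\<mu>. h ((n, \<mu>), vs)) \<in> lin_maps R (Op P n) M"
    and "\<And>x vs i. (x, vs) \<in> fa_gens P V \<Longrightarrow> i < length vs \<Longrightarrow> (\<lambda>v. h (x, vs[i := v])) \<in> lin_maps R V M"
    and "\<And>n \<sigma> \<mu> vs. ((n, \<mu>), vs) \<in> fa_gens P V \<Longrightarrow> \<sigma> permutes {..<n} \<Longrightarrow>
       h ((n, act P n \<sigma> \<mu>), permute_list \<sigma> vs) = h ((n, \<mu>), vs)"
    and "\<And>g. g \<in> fa_gens P V \<Longrightarrow> h g \<in> carrier M"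
proof -
  show 1: "\<And>n vs. vs \<in> lists (carrier V) \<Longrightarrow> length vs = n \<Longrightarrow> (\<lambda>\<mu>. h ((n, \<mu>), vs)) \<in> lin_maps R (Op P n) M"
    and "\<And>x vs i. (x, vs) \<in> fa_gens P V \<Longrightarrow> i < length vs \<Longrightarrow> (\<lambda>v. h (x, vs[i := v])) \<in> lin_maps R V M"
    and "\<And>n \<sigma> \<mu> vs. ((n, \<mu>), vs) \<in> fa_gens P V \<Longrightarrow> \<sigma> permutes {..<n} \<Longrightarrow>
       h ((n, act P n \<sigma> \<mu>), permute_list \<sigma> vs) = h ((n, \<mu>), vs)"
    using assms unfolding fa_compat_def by blast+
  fix g assume g: "g \<in> fa_gens P V"
  note f = fa_gensE[OF g]
  show "h g \<in> carrier M"
    using lin_maps_closed[OF 1[OF f(3,4)] f(2)] by simp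
qed

lemma act_closed: "\<mu> \<in> carrier (Op P n) \<Longrightarrow> \<sigma> permutes {..<n} \<Longrightarrow> act P n \<sigma> \<mu> \<in> carrier (Op P n)"
  using act_linear by (rule lin_maps_closed)

lemma permute_list_lists: "\<sigma> permutes {..<length vs} \<Longrightarrow> vs \<in> lists S \<Longrightarrow> permute_list \<sigma> vs \<in> lists S"
  by (simp add: in_lists_conv_set)

lemma fa_gens_closed:
  assumes "module R V"
  shows "((n, \<mu>), vs) \<in> fa_gens P V \<Longrightarrow> ((n, \<mu>'), vs) \<in> fa_gens P V \<Longrightarrow> ((n, \<mu> \<oplus>\<^bsub>Op P n\<^esub> \<mu>'), vs) \<in> fa_gens P V"
    "a \<in> carrier R \<Longrightarrow> ((n, \<mu>), vs) \<in> fa_gens P V \<Longrightarrow> ((n, a \<odot>\<^bsub>Op P n\<^esub> \<mu>), vs) \<in> fa_gens P V"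
    "(x, vs) \<in> fa_gens P V \<Longrightarrow> v \<in> carrier V \<Longrightarrow> (x, vs[i := v]) \<in> fa_gens P V"
    "((n, \<mu>), vs) \<in> fa_gens P V \<Longrightarrow> \<sigma> permutes {..<n} \<Longrightarrow> ((n, act P n \<sigma> \<mu>), permute_list \<sigma> vs) \<in> fa_gens P V"
  using mod_add[OF module_Op] mod_smult[OF module_Op]
  by (auto simp del: in_lists_conv_set simp: fa_gens_iff lists_update act_closed permute_list_lists)

lemma fa_rels_cases:
  assumes "r \<in> fa_rels R P V"
    and "\<And>n \<mu> \<mu>' vs. ((n, \<mu>), vs) \<in> fa_gens P V \<Longrightarrow> ((n, \<mu>'), vs) \<in> fa_gens P V \<Longrightarrow>
      Q (basis R ((n, \<mu> \<oplus>\<^bsub>Op P n\<^esub> \<mu>'), vs) \<ominus>\<^bsub>FM V\<^esub> (basis R ((n, \<mu>), vs) \<oplus>\<^bsub>FM V\<^esub> basis R ((n, \<mu>'), vs)))"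
    and "\<And>a n \<mu> vs. a \<in> carrier R \<Longrightarrow> ((n, \<mu>), vs) \<in> fa_gens P V \<Longrightarrow>
      Q (basis R ((n, a \<odot>\<^bsub>Op P n\<^esub> \<mu>), vs) \<ominus>\<^bsub>FM V\<^esub> a \<odot>\<^bsub>FM V\<^esub> basis R ((n, \<mu>), vs))"
    and "\<And>x vs i v w. (x, vs) \<in> fa_gens P V \<Longrightarrow> i < length vs \<Longrightarrow> v \<in> carrier V \<Longrightarrow> w \<in> carrier V \<Longrightarrow>
      Q (basis R (x, vs[i := v \<oplus>\<^bsub>V\<^esub> w]) \<ominus>\<^bsub>FM V\<^esub> (basis R (x, vs[i := v]) \<oplus>\<^bsub>FM V\<^esub> basis R (x, vs[i := w])))"
    and "\<And>a x vs i v. a \<in> carrier R \<Longrightarrow> (x, vs) \<in> fa_gens P V \<Longrightarrow> i < length vs \<Longrightarrow> v \<in> carrier V \<Longrightarrow>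
      Q (basis R (x, vs[i := a \<odot>\<^bsub>V\<^esub> v]) \<ominus>\<^bsub>FM V\<^esub> a \<odot>\<^bsub>FM V\<^esub> basis R (x, vs[i := v]))"
    and "\<And>n \<sigma> \<mu> vs. ((n, \<mu>), vs) \<in> fa_gens P V \<Longrightarrow> \<sigma> permutes {..<n} \<Longrightarrow>
      Q (basis R ((n, act P n \<sigma> \<mu>), permute_list \<sigma> vs) \<ominus>\<^bsub>FM V\<^esub> basis R ((n, \<mu>), vs))"
  shows "Q r"
  using assms(1) unfolding fa_rels_def Let_def by (elim UnE CollectE exE conjE) (simp_all only: assms(2-))

lemma fa_rels_sub:
  assumes "module R V"
  shows "fa_rels R P V \<subseteq> carrier (FM V)"
proof
  note F = module_free_module[of "fa_gens P V"]
  note c = mod_minus[OF F] mod_add[OF F] mod_smult[OF F] basis_closed fa_gens_closed[OF assms]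
    mod_add[OF assms] mod_smult[OF assms]
  fix r assume "r \<in> fa_rels R P V"
  then show "r \<in> carrier (FM V)"
    by (rule fa_rels_cases) (intro c; (assumption | simp add: assms mod_add mod_smult))+
qed

lemma fa_compat_rels:
  assumes "module R V" "module R M" "fa_compat V M h" "r \<in> fa_rels R P V"
  shows "lin_ext R M h r = \<zero>\<^bsub>M\<^esub>"
proof -
  interpret M: module R M by fact
  note F = module_free_module[of "fa_gens P V"]
  note D = fa_compatD[OF assms(3)]
  have hc: "h \<in> fa_gens P V \<rightarrow> carrier M" using D(4) by auto
  note L = lin_ext_linear[OF assms(2) hc]
  note B = lin_ext_basis[OF assms(2) hc]
  have bc: "basis R g \<in> carrier (FM V)" if "g \<in> fa_gens P V" for g using that by (rule basis_closed)
  note G = fa_gens_closed[OF assms(1)]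
  have self: "x \<ominus>\<^bsub>M\<^esub> x = \<zero>\<^bsub>M\<^esub>" if "x \<in> carrier M" for x using that by (simp add: a_minus_def M.r_neg)
  have mA: "lin_ext R M h (basis R g \<ominus>\<^bsub>FM V\<^esub> (basis R g1 \<oplus>\<^bsub>FM V\<^esub> basis R g2)) = \<zero>\<^bsub>M\<^esub>"
    if "g \<in> fa_gens P V" "g1 \<in> fa_gens P V" "g2 \<in> fa_gens P V" "h g = h g1 \<oplus>\<^bsub>M\<^esub> h g2" for g g1 g2
    using that D(4) bc by (simp add: lin_maps_diff[OF F assms(2) L] lin_maps_add[OF L] B mod_add[OF F] self del: free_module_simps)
  have mS: "lin_ext R M h (basis R g \<ominus>\<^bsub>FM V\<^esub> a \<odot>\<^bsub>FM V\<^esub> basis R g1) = \<zero>\<^bsub>M\<^esub>"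
    if "g \<in> fa_gens P V" "g1 \<in> fa_gens P V" "a \<in> carrier R" "h g = a \<odot>\<^bsub>M\<^esub> h g1" for g g1 a
    using that D(4) bc by (simp add: lin_maps_diff[OF F assms(2) L] lin_maps_smult[OF L] B mod_smult[OF F] self del: free_module_simps)
  have mP: "lin_ext R M h (basis R g \<ominus>\<^bsub>FM V\<^esub> basis R g1) = \<zero>\<^bsub>M\<^esub>"
    if "g \<in> fa_gens P V" "g1 \<in> fa_gens P V" "h g = h g1" for g g1
    using that D(4) bc by (simp add: lin_maps_diff[OF F assms(2) L] B self del: free_module_simps)
  show ?thesis
    using assms(4)
  proof (rule fa_rels_cases)
    fix n \<mu> \<mu>' vs assume g: "((n, \<mu>), vs) \<in> fa_gens P V" "((n, \<mu>'), vs) \<in> fa_gens P V"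
    then show "lin_ext R M h (basis R ((n, \<mu> \<oplus>\<^bsub>Op P n\<^esub> \<mu>'), vs) \<ominus>\<^bsub>FM V\<^esub> (basis R ((n, \<mu>), vs) \<oplus>\<^bsub>FM V\<^esub> basis R ((n, \<mu>'), vs))) = \<zero>\<^bsub>M\<^esub>"
      using lin_maps_add[OF D(1)] by (intro mA G) (auto simp: fa_gens_iff)
  next
    fix a n \<mu> vs assume g: "a \<in> carrier R" "((n, \<mu>), vs) \<in> fa_gens P V"
    then show "lin_ext R M h (basis R ((n, a \<odot>\<^bsub>Op P n\<^esub> \<mu>), vs) \<ominus>\<^bsub>FM V\<^esub> a \<odot>\<^bsub>FM V\<^esub> basis R ((n, \<mu>), vs)) = \<zero>\<^bsub>M\<^esub>"
      using lin_maps_smult[OF D(1)] by (intro mS G) (auto simp: fa_gens_iff)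
  next
    fix x vs i v w assume g: "(x, vs) \<in> fa_gens P V" "i < length vs" "v \<in> carrier V" "w \<in> carrier V"
    show "lin_ext R M h (basis R (x, vs[i := v \<oplus>\<^bsub>V\<^esub> w]) \<ominus>\<^bsub>FM V\<^esub> (basis R (x, vs[i := v]) \<oplus>\<^bsub>FM V\<^esub> basis R (x, vs[i := w]))) = \<zero>\<^bsub>M\<^esub>"
      using lin_maps_add[OF D(2)[OF g(1,2)] g(3,4)] g mod_add[OF assms(1)] by (intro mA G) auto
  next
    fix a x vs i v assume g: "a \<in> carrier R" "(x, vs) \<in> fa_gens P V" "i < length vs" "v \<in> carrier V"
    show "lin_ext R M h (basis R (x, vs[i := a \<odot>\<^bsub>V\<^esub> v]) \<ominus>\<^bsub>FM V\<^esub> a \<odot>\<^bsub>FM V\<^esub> basis R (x, vs[i := v])) = \<zero>\<^bsub>M\<^esub>"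
      using lin_maps_smult[OF D(2)[OF g(2,3)] g(1,4)] g mod_smult[OF assms(1)] by (intro mS G) auto
  next
    fix n \<sigma> \<mu> vs assume g: "((n, \<mu>), vs) \<in> fa_gens P V" "\<sigma> permutes {..<n}"
    then show "lin_ext R M h (basis R ((n, act P n \<sigma> \<mu>), permute_list \<sigma> vs) \<ominus>\<^bsub>FM V\<^esub> basis R ((n, \<mu>), vs)) = \<zero>\<^bsub>M\<^esub>"
      using D(3) by (intro mP G) auto
  qed
qed

end

context operad
begin

lemma fa_relsI:
  shows "((n, \<mu>), vs) \<in> fa_gens P V \<Longrightarrow> ((n, \<mu>'), vs) \<in> fa_gens P V \<Longrightarrow>
      basis R ((n, \<mu> \<oplus>\<^bsub>Op P n\<^esub> \<mu>'), vs) \<ominus>\<^bsub>FM V\<^esub> (basis R ((n, \<mu>), vs) \<oplus>\<^bsub>FM V\<^esub> basis R ((n, \<mu>'), vs)) \<in> fa_rels R P V"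
    and "a \<in> carrier R \<Longrightarrow> ((n, \<mu>), vs) \<in> fa_gens P V \<Longrightarrow>
      basis R ((n, a \<odot>\<^bsub>Op P n\<^esub> \<mu>), vs) \<ominus>\<^bsub>FM V\<^esub> a \<odot>\<^bsub>FM V\<^esub> basis R ((n, \<mu>), vs) \<in> fa_rels R P V"
    and "(x, vs) \<in> fa_gens P V \<Longrightarrow> i < length vs \<Longrightarrow> v \<in> carrier V \<Longrightarrow> w \<in> carrier V \<Longrightarrow>
      basis R (x, vs[i := v \<oplus>\<^bsub>V\<^esub> w]) \<ominus>\<^bsub>FM V\<^esub> (basis R (x, vs[i := v]) \<oplus>\<^bsub>FM V\<^esub> basis R (x, vs[i := w])) \<in> fa_rels R P V"
    and "a \<in> carrier R \<Longrightarrow> (x, vs) \<in> fa_gens P V \<Longrightarrow> i < length vs \<Longrightarrow> v \<in> carrier V \<Longrightarrow>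
      basis R (x, vs[i := a \<odot>\<^bsub>V\<^esub> v]) \<ominus>\<^bsub>FM V\<^esub> a \<odot>\<^bsub>FM V\<^esub> basis R (x, vs[i := v]) \<in> fa_rels R P V"
    and "((n, \<mu>), vs) \<in> fa_gens P V \<Longrightarrow> \<sigma> permutes {..<n} \<Longrightarrow>
      basis R ((n, act P n \<sigma> \<mu>), permute_list \<sigma> vs) \<ominus>\<^bsub>FM V\<^esub> basis R ((n, \<mu>), vs) \<in> fa_rels R P V"
  unfolding fa_rels_def Let_def
  by - ((rule UnI1, rule UnI1, rule UnI1, rule UnI1, blast), (rule UnI1, rule UnI1, rule UnI1, rule UnI2, blast),
      (rule UnI1, rule UnI1, rule UnI2, blast), (rule UnI1, rule UnI2, blast), rule UnI2, blast)

lemma submodule_null: "module R V \<Longrightarrow> submodule (Nul V) R (FM V)"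
  unfolding fa_null_def by (intro submodule_mspan module_free_module fa_rels_sub)

lemma module_alg: "module R V \<Longrightarrow> module R (Al V)"
  unfolding free_alg_def by (intro module_quot module_free_module submodule_null)

lemma tm_eq: "tm V g = Nul V +>\<^bsub>FM V\<^esub> basis R g"
  by (simp add: fa_term_def)

lemma coset_lin: "module R V \<Longrightarrow> (\<lambda>f. Nul V +>\<^bsub>FM V\<^esub> f) \<in> lin_maps R (FM V) (Al V)"
  unfolding free_alg_def by (intro lin_maps_coset module_free_module submodule_null)

lemma tm_closed: "module R V \<Longrightarrow> g \<in> fa_gens P V \<Longrightarrow> tm V g \<in> carrier (Al V)"
  unfolding tm_eq by (rule lin_maps_closed[OF coset_lin]) (auto intro: basis_closed)

lemma alg_zero: "\<zero>\<^bsub>Al V\<^esub> = Nul V"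
  by (simp add: free_alg_def)

lemma coset_rel_zero:
  assumes "module R V" "r \<in> fa_rels R P V"
  shows "Nul V +>\<^bsub>FM V\<^esub> r = \<zero>\<^bsub>Al V\<^esub>"
  using assms fa_rels_sub[OF assms(1)] unfolding alg_zero
  by (subst coset_eq_self_iff[OF module_free_module submodule_null[OF assms(1)]])
    (auto simp: fa_null_def intro: mspan_memI)

lemma tm_compat:
  assumes "module R V"
  shows "fa_compat V (Al V) (tm V)"
proof -
  let ?c = "\<lambda>f. Nul V +>\<^bsub>FM V\<^esub> f"
  note A = module_alg[OF assms] and F = module_free_module[of "fa_gens P V"]
  note L = coset_lin[OF assms]
  note G = fa_gens_closed[OF assms]
  have bc: "basis R g \<in> carrier (FM V)" if "g \<in> fa_gens P V" for g using that by (rule basis_closed)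
  have c: "?c (basis R g) \<in> carrier (Al V)" if "g \<in> fa_gens P V" for g using tm_closed[OF assms that] by (simp add: tm_eq)
  have mA: "tm V g = tm V g1 \<oplus>\<^bsub>Al V\<^esub> tm V g2"
    if "g \<in> fa_gens P V" "g1 \<in> fa_gens P V" "g2 \<in> fa_gens P V"
      "basis R g \<ominus>\<^bsub>FM V\<^esub> (basis R g1 \<oplus>\<^bsub>FM V\<^esub> basis R g2) \<in> fa_rels R P V" for g g1 g2
    using coset_rel_zero[OF assms that(4)] that(1-3) unfolding tm_eq
    by - (rule sub_zeroE[OF A], simp_all add: lin_maps_diff[OF F A L] lin_maps_add[OF L] bc mod_add[OF F] c mod_add[OF A] del: free_module_simps)
  have mS: "tm V g = a \<odot>\<^bsub>Al V\<^esub> tm V g1"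
    if "g \<in> fa_gens P V" "g1 \<in> fa_gens P V" "a \<in> carrier R"
      "basis R g \<ominus>\<^bsub>FM V\<^esub> a \<odot>\<^bsub>FM V\<^esub> basis R g1 \<in> fa_rels R P V" for g g1 a
    using coset_rel_zero[OF assms that(4)] that(1-3) unfolding tm_eq
    by - (rule sub_zeroE[OF A], simp_all add: lin_maps_diff[OF F A L] lin_maps_smult[OF L] bc mod_smult[OF F] c mod_smult[OF A] del: free_module_simps)
  have mP: "tm V g = tm V g1"
    if "g \<in> fa_gens P V" "g1 \<in> fa_gens P V" "basis R g \<ominus>\<^bsub>FM V\<^esub> basis R g1 \<in> fa_rels R P V" for g g1
    using coset_rel_zero[OF assms that(3)] that(1-2) unfolding tm_eq
    by - (rule sub_zeroE[OF A], simp_all add: lin_maps_diff[OF F A L] bc c del: free_module_simps)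
  show ?thesis
    unfolding fa_compat_def
  proof (intro conjI allI impI)
    fix n vs assume vs: "vs \<in> lists (carrier V)" "length vs = n"
    then have g: "((n, \<mu>), vs) \<in> fa_gens P V" if "\<mu> \<in> carrier (Op P n)" for \<mu> using that by (simp add: fa_gens_iff)
    show "(\<lambda>\<mu>. tm V ((n, \<mu>), vs)) \<in> lin_maps R (Op P n) (Al V)"
      by (intro lin_mapsI mA mS tm_closed[OF assms] g fa_relsI mod_add[OF module_Op] mod_smult[OF module_Op])
  next
    fix x vs i assume g: "(x, vs) \<in> fa_gens P V" "i < length vs"
    show "(\<lambda>v. tm V (x, vs[i := v])) \<in> lin_maps R V (Al V)"
      using g by (intro lin_mapsI mA mS tm_closed[OF assms] G(3) fa_relsI mod_add[OF assms] mod_smult[OF assms])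
  next
    fix n \<sigma> \<mu> vs assume "((n, \<mu>), vs) \<in> fa_gens P V" "\<sigma> permutes {..<n}"
    then show "tm V ((n, act P n \<sigma> \<mu>), permute_list \<sigma> vs) = tm V ((n, \<mu>), vs)"
      by (intro mP G(4) fa_relsI)
  qed
qed

abbreviation "Tms V \<equiv> tm V ` fa_gens P V"

lemma Tms_sub: "module R V \<Longrightarrow> Tms V \<subseteq> carrier (Al V)"
  using tm_closed by auto

lemma alg_cases:
  assumes "X \<in> carrier (Al V)"
  obtains f where "f \<in> carrier (FM V)" "X = Nul V +>\<^bsub>FM V\<^esub> f"
  using assms unfolding free_alg_def by (rule quot_cases)

text \<open>Terms are the cosets of the basis elements, which span the free module.\<close>
lemma alg_span:
  assumes "module R V"
  shows "carrier (Al V) = mspan R (Al V) (Tms V)"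
proof
  note A = module_alg[OF assms] and F = module_free_module[of "fa_gens P V"]
  show "mspan R (Al V) (Tms V) \<subseteq> carrier (Al V)"
    by (intro mspan_least submodule_carrier A Tms_sub assms)
  show "carrier (Al V) \<subseteq> mspan R (Al V) (Tms V)"
  proof
    fix X assume "X \<in> carrier (Al V)"
    then obtain f where f: "f \<in> carrier (FM V)" "X = Nul V +>\<^bsub>FM V\<^esub> f" by (rule alg_cases)
    have f': "f \<in> mspan R (FM V) (basis R ` fa_gens P V)" using f(1) free_module_mspan_basis[of "fa_gens P V"] by simp
    have b: "basis R ` fa_gens P V \<subseteq> carrier (FM V)" by (auto intro: basis_closed)
    have "Nul V +>\<^bsub>FM V\<^esub> f \<in> mspan R (Al V) (Tms V)"
    proof (rule lin_maps_mspan_into[OF F A coset_lin[OF assms] b submodule_mspan[OF A Tms_sub[OF assms]] _ f'])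
      fix s assume "s \<in> basis R ` fa_gens P V"
      then obtain g where "g \<in> fa_gens P V" "s = basis R g" by auto
      then show "Nul V +>\<^bsub>FM V\<^esub> s \<in> mspan R (Al V) (Tms V)" by (auto simp: tm_eq intro!: mspan_memI)
    qed
    then show "X \<in> mspan R (Al V) (Tms V)" using f by simp
  qed
qed

lemma alg_lin_eq:
  assumes "module R V" "module R M" "T \<in> lin_maps R (Al V) M" "T' \<in> lin_maps R (Al V) M"
    "\<And>g. g \<in> fa_gens P V \<Longrightarrow> T (tm V g) = T' (tm V g)" "X \<in> carrier (Al V)"
  shows "T X = T' X"
  by (rule lin_maps_mspan_eq[OF module_alg[OF assms(1)] assms(2-4) Tms_sub[OF assms(1)]])
    (use assms alg_span[OF assms(1)] in auto)

lemma alg_lin_into: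
  assumes "module R V" "module R M" "T \<in> lin_maps R (Al V) M" "submodule H R M"
    "\<And>g. g \<in> fa_gens P V \<Longrightarrow> T (tm V g) \<in> H" "X \<in> carrier (Al V)"
  shows "T X \<in> H"
  by (rule lin_maps_mspan_into[OF module_alg[OF assms(1)] assms(2,3) Tms_sub[OF assms(1)] assms(4)])
    (use assms alg_span[OF assms(1)] in auto)

lemma fa_rep_props:
  assumes "module R V" "f \<in> carrier (FM V)"
  shows "fa_rep (Nul V +>\<^bsub>FM V\<^esub> f) \<in> carrier (FM V)"
    and "Nul V +>\<^bsub>FM V\<^esub> fa_rep (Nul V +>\<^bsub>FM V\<^esub> f) = Nul V +>\<^bsub>FM V\<^esub> f"
proof -
  note c = coset_facts[OF module_free_module submodule_null[OF assms(1)]]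
  have "fa_rep (Nul V +>\<^bsub>FM V\<^esub> f) \<in> Nul V +>\<^bsub>FM V\<^esub> f"
    unfolding fa_rep_def using c(2)[OF assms(2)] by (rule someI[of "\<lambda>g. g \<in> Nul V +>\<^bsub>FM V\<^esub> f"])
  then show "fa_rep (Nul V +>\<^bsub>FM V\<^esub> f) \<in> carrier (FM V)"
    "Nul V +>\<^bsub>FM V\<^esub> fa_rep (Nul V +>\<^bsub>FM V\<^esub> f) = Nul V +>\<^bsub>FM V\<^esub> f"
    using c(6,7)[OF assms(2)] by auto
qed

lemma fa_rep_closed: "module R V \<Longrightarrow> X \<in> carrier (Al V) \<Longrightarrow> fa_rep X \<in> carrier (FM V)"
  and fa_rep_coset: "module R V \<Longrightarrow> X \<in> carrier (Al V) \<Longrightarrow> Nul V +>\<^bsub>FM V\<^esub> fa_rep X = X"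
  by (auto elim!: alg_cases simp: fa_rep_props)

lemma lift_kills_null:
  assumes "module R V" "module R M" "fa_compat V M h" "f \<in> Nul V"
  shows "lin_ext R M h f = \<zero>\<^bsub>M\<^esub>"
proof -
  have hc: "h \<in> fa_gens P V \<rightarrow> carrier M" using fa_compatD(4)[OF assms(3)] by auto
  have "lin_ext R M h f \<in> {\<zero>\<^bsub>M\<^esub>}"
    using lin_maps_mspan_into[OF module_free_module assms(2) lin_ext_linear[OF assms(2) hc] fa_rels_sub[OF assms(1)]
        submodule_zero[OF assms(2)] _ assms(4)[unfolded fa_null_def]] fa_compat_rels[OF assms(1-3)] by simp
  then show ?thesis by simp
qed

text \<open>This is the universal property of the module \<open>\<Oplus>\<^sub>n O(n) \<otimes>\<^sub>S\<^sub>n V\<^sup>\<otimes>\<^sup>n\<close>.\<close>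
lemma fa_lift:
  assumes "module R V" "module R M" "fa_compat V M h"
  defines "T \<equiv> \<lambda>X. lin_ext R M h (fa_rep X)"
  shows "T \<in> lin_maps R (Al V) M" and "\<And>g. g \<in> fa_gens P V \<Longrightarrow> T (tm V g) = h g"
proof -
  note A = module_alg[OF assms(1)] and F = module_free_module[of "fa_gens P V"]
  have hc: "h \<in> fa_gens P V \<rightarrow> carrier M" using fa_compatD(4)[OF assms(3)] by auto
  note L = lin_ext_linear[OF assms(2) hc]
  have T: "T (Nul V +>\<^bsub>FM V\<^esub> f) = lin_ext R M h f" if f: "f \<in> carrier (FM V)" for f
  proof -
    note r = fa_rep_props[OF assms(1) f]
    have "fa_rep (Nul V +>\<^bsub>FM V\<^esub> f) \<ominus>\<^bsub>FM V\<^esub> f \<in> Nul V"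
      using r f coset_eq_iff[OF F submodule_null[OF assms(1)]] by blast
    then have "lin_ext R M h (fa_rep (Nul V +>\<^bsub>FM V\<^esub> f)) \<ominus>\<^bsub>M\<^esub> lin_ext R M h f = \<zero>\<^bsub>M\<^esub>"
      using lift_kills_null[OF assms(1-3)] lin_maps_diff[OF F assms(2) L r(1) f] by simp
    then show ?thesis unfolding T_def using r(1) f by (metis sub_zeroE[OF assms(2)] lin_maps_closed[OF L])
  qed
  show "T \<in> lin_maps R (Al V) M"
  proof (rule lin_mapsI)
    fix X assume "X \<in> carrier (Al V)"
    then obtain f where f: "f \<in> carrier (FM V)" "X = Nul V +>\<^bsub>FM V\<^esub> f" by (rule alg_cases)
    show "T X \<in> carrier M" unfolding f(2) T[OF f(1)] using f(1) by (rule lin_maps_closed[OF L])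
    fix a assume a: "a \<in> carrier R"
    show "T (a \<odot>\<^bsub>Al V\<^esub> X) = a \<odot>\<^bsub>M\<^esub> T X"
      unfolding f(2) lin_maps_smult[OF coset_lin[OF assms(1)] a f(1), symmetric]
      by (simp add: T f mod_smult[OF F a f(1)] lin_maps_smult[OF L a f(1)] del: free_module_simps)
  next
    fix X Y assume XY: "X \<in> carrier (Al V)" "Y \<in> carrier (Al V)"
    obtain f where f: "f \<in> carrier (FM V)" "X = Nul V +>\<^bsub>FM V\<^esub> f" using XY(1) by (rule alg_cases)
    obtain g where g: "g \<in> carrier (FM V)" "Y = Nul V +>\<^bsub>FM V\<^esub> g" using XY(2) by (rule alg_cases)
    show "T (X \<oplus>\<^bsub>Al V\<^esub> Y) = T X \<oplus>\<^bsub>M\<^esub> T Y"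
      unfolding f(2) g(2) lin_maps_add[OF coset_lin[OF assms(1)] f(1) g(1), symmetric]
      by (simp add: T f g mod_add[OF F f(1) g(1)] lin_maps_add[OF L f(1) g(1)] del: free_module_simps)
  qed
  show "T (tm V g) = h g" if "g \<in> fa_gens P V" for g
    unfolding tm_eq T[OF basis_closed[OF that]] by (rule lin_ext_basis[OF assms(2) hc that])
qed

text \<open>Maps out of \<open>O(V)\<close> are defined through a chosen representative. Such a map is identified by exhibiting a
  linear map with the right values on terms: linearity then makes the choice irrelevant.\<close>
lemma lin_ext_rep:
  assumes "module R V" "module R M" "T \<in> lin_maps R (Al V) M" "X \<in> carrier (Al V)"
    "\<And>g. g \<in> fa_gens P V \<Longrightarrow> h g = T (tm V g)"
  shows "lin_ext R M h (fa_rep X) = T X"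
proof -
  note F = module_free_module[of "fa_gens P V"]
  have hc: "h \<in> fa_gens P V \<rightarrow> carrier M" using assms(5) lin_maps_closed[OF assms(3)] tm_closed[OF assms(1)] by auto
  have b: "basis R ` fa_gens P V \<subseteq> carrier (FM V)" by (auto intro: basis_closed)
  have "lin_ext R M h (fa_rep X) = T (Nul V +>\<^bsub>FM V\<^esub> fa_rep X)"
    by (rule lin_maps_mspan_eq[OF F assms(2) lin_ext_linear[OF assms(2) hc] lin_maps_comp[OF coset_lin[OF assms(1)] assms(3)] b])
      (use lin_ext_basis[OF assms(2) hc] assms(5) fa_rep_closed[OF assms(1,4)] free_module_mspan_basis[of "fa_gens P V"] in \<open>auto simp: tm_eq\<close>)
  then show ?thesis by (simp add: fa_rep_coset assms)
qed

subsection \<open>The algebra structure\<close>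

text \<open>Operadic composition on the level of generators; the structure map of \<open>O(V)\<close> is its multilinear
  extension.\<close>
abbreviation cgen :: "nat \<times> 'o \<Rightarrow> ('o, 'v) fa_gen list \<Rightarrow> ('o, 'v) fa_gen" where
  "cgen x gs \<equiv> (comp_op P x (map fst gs), concat (map snd gs))"

lemma cmp_closed:
  assumes "x \<in> ops P" "ys \<in> lists (ops P)" "length ys = fst x"
  shows "cmp P x ys \<in> carrier (Op P (total_arity ys))" and "comp_op P x ys \<in> ops P"
proof -
  show "cmp P x ys \<in> carrier (Op P (total_arity ys))"
    using lin_maps_closed[OF cmp_linear_outer[OF assms(2)], of "snd x"] assms by (simp add: ops_def)
  then show "comp_op P x ys \<in> ops P" by (simp add: ops_def comp_op_def)
qed

lemma gens_lists:
  assumes "gs \<in> lists (fa_gens P V)"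
  shows "map fst gs \<in> lists (ops P)" "concat (map snd gs) \<in> lists (carrier V)"
    "length (concat (map snd gs)) = total_arity (map fst gs)" "map length (map snd gs) = map fst (map fst gs)"
proof -
  have g: "g \<in> set gs \<Longrightarrow> g \<in> fa_gens P V" for g using assms by (auto simp: in_lists_conv_set)
  show "map fst gs \<in> lists (ops P)" using fa_gensE(1)[OF g] by (auto simp: in_lists_conv_set)
  have "v \<in> carrier V" if "g \<in> set gs" "v \<in> set (snd g)" for g v
    using fa_gensE(3)[OF g[OF that(1)]] that(2) by (simp add: in_lists_conv_set)
  then show "concat (map snd gs) \<in> lists (carrier V)" by (auto simp: in_lists_conv_set)
  show l: "map length (map snd gs) = map fst (map fst gs)"
    using fa_gensE(4)[OF g] by simp
  show "length (concat (map snd gs)) = total_arity (map fst gs)"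
    by (simp only: length_concat l total_arity_def)
qed

lemma cgen_closed:
  assumes "x \<in> ops P" "gs \<in> lists (fa_gens P V)" "length gs = fst x"
  shows "cgen x gs \<in> fa_gens P V"
  using gens_lists[OF assms(2)] cmp_closed[OF assms(1), of "map fst gs"] assms(3)
  by (auto simp: fa_gens_def comp_op_def)

text \<open>Linearity and equivariance in one of the composed terms: this uses linearity of the operadic composition
  in its inner arguments and its inner equivariance.\<close>
lemma cgen_slot_compat:
  assumes V: "module R V" and x: "x \<in> ops P" and gs: "gs \<in> lists (fa_gens P V)" "length gs = fst x" "i < length gs"
  shows "fa_compat V (Al V) (\<lambda>g. tm V (cgen x (gs[i := g])))"
  unfolding fa_compat_def
proof (intro conjI allI impI)
  note TC = fa_compatD[OF tm_compat[OF V]]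
  fix n vs assume vs: "vs \<in> lists (carrier V)" "length vs = n"
  have g: "((n, \<mu>), vs) \<in> fa_gens P V" if "\<mu> \<in> carrier (Op P n)" for \<mu> using that vs by (simp add: fa_gens_iff)
  let ?z = "\<zero>\<^bsub>Op P n\<^esub>"
  let ?gs = "gs[i := ((n, ?z), vs)]"
  let ?ys = "map fst ?gs"
  have z: "?z \<in> carrier (Op P n)" by (rule mod_zero[OF module_Op])
  have gsz: "?gs \<in> lists (fa_gens P V)" using gs(1) g[OF z] by (rule lists_update)
  have ys: "?ys \<in> lists (ops P)" "length ?ys = fst x" "i < fst x" "?ys ! i = (n, ?z)"
    using gens_lists(1)[OF gsz] gs by auto
  have lin: "(\<lambda>\<nu>. cmp P x (?ys[i := (n, \<nu>)])) \<in> lin_maps R (Op P n) (Op P (total_arity ?ys))"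
    using cmp_linear_inner[OF x ys(1,2,3)] ys(4) by simp
  have ar: "map fst (map fst (gs[i := ((n, \<mu>), vs)])) = map fst ?ys" for \<mu> using gs(3) by (simp add: map_update)
  have "tm V (cgen x (gs[i := ((n, \<mu>), vs)])) =
    tm V ((total_arity ?ys, cmp P x (?ys[i := (n, \<mu>)])), concat (map snd ?gs))" for \<mu>
    using ar[of \<mu>] by (simp add: comp_op_def total_arity_def map_update)
  moreover have "(\<lambda>\<mu>. tm V ((total_arity ?ys, cmp P x (?ys[i := (n, \<mu>)])), concat (map snd ?gs))) \<in> lin_maps R (Op P n) (Al V)"
    using gens_lists[OF gsz] by (intro lin_maps_comp[OF lin] TC(1)) auto
  ultimately show "(\<lambda>\<mu>. tm V (cgen x (gs[i := ((n, \<mu>), vs)]))) \<in> lin_maps R (Op P n) (Al V)" by presburger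
next
  note TC = fa_compatD[OF tm_compat[OF V]]
  fix y vs j assume g: "(y, vs) \<in> fa_gens P V" and j: "j < length vs"
  let ?gs = "gs[i := (y, vs)]"
  have gsz: "?gs \<in> lists (fa_gens P V)" using gs(1) g by (rule lists_update)
  let ?J = "length (concat (take i (map snd gs))) + j"
  have "cgen x (gs[i := (y, vs[j := v])]) = (comp_op P x (map fst ?gs), (concat (map snd ?gs))[?J := v])" for v
    using gs(3) j by (simp add: map_update concat_update)
  moreover have "?J < length (concat (map snd ?gs))"
    using concat_position(1)[of i "map snd ?gs" j] gs(3) j by (simp add: map_update)
  moreover have "(comp_op P x (map fst ?gs), concat (map snd ?gs)) \<in> fa_gens P V"
    using cgen_closed[OF x gsz] gs(2) by simp
  ultimately show "(\<lambda>v. tm V (cgen x (gs[i := (y, vs[j := v])]))) \<in> lin_maps R V (Al V)"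
    using TC(2) by presburger
next
  note TC = fa_compatD[OF tm_compat[OF V]]
  fix n \<sigma> \<nu> ws assume g: "((n, \<nu>), ws) \<in> fa_gens P V" and \<sigma>: "\<sigma> permutes {..<n}"
  let ?gs = "gs[i := ((n, \<nu>), ws)]"
  let ?gs' = "gs[i := ((n, act P n \<sigma> \<nu>), permute_list \<sigma> ws)]"
  let ?ys = "map fst ?gs" and ?vss = "map snd ?gs"
  let ?\<sigma>s = "(replicate (fst x) id)[i := \<sigma>]"
  have gsz: "?gs \<in> lists (fa_gens P V)" using gs(1) g by (rule lists_update)
  note gl = gens_lists[OF gsz]
  have ws: "length ws = n" using g by (simp add: fa_gens_iff)
  have perm: "\<forall>k<fst x. ?\<sigma>s ! k permutes {..<fst (?ys ! k)}"
    using gs \<sigma> by (auto simp: nth_list_update permutes_id)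
  have perm': "?\<sigma>s ! k permutes {..<length (?vss ! k)}" if "k < length ?vss" for k
  proof -
    have "length (?vss ! k) = fst (?ys ! k)" using arg_cong[OF gl(4), of "\<lambda>l. l ! k"] that by simp
    then show ?thesis using perm that gs(2) by simp
  qed
  have ysn: "snd (?ys ! k) \<in> carrier (Op P (fst (?ys ! k)))" if "k < fst x" for k
    using gl(1) that gs(2) lists_nth[of ?ys "ops P" k] by (simp add: ops_def)
  have m1: "map2 (\<lambda>\<sigma> y. (fst y, act P (fst y) \<sigma> (snd y))) ?\<sigma>s ?ys = map fst ?gs'"
  proof (rule nth_equalityI)
    fix k assume "k < length (map2 (\<lambda>\<sigma> y. (fst y, act P (fst y) \<sigma> (snd y))) ?\<sigma>s ?ys)"
    then have k: "k < fst x" using gs(2) by simp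
    show "map2 (\<lambda>\<sigma> y. (fst y, act P (fst y) \<sigma> (snd y))) ?\<sigma>s ?ys ! k = map fst ?gs' ! k"
      using k ysn[OF k] gs act_id by (cases "k = i") (auto simp: prod_eq_iff)
  qed (use gs in simp)
  have m2: "map2 permute_list ?\<sigma>s ?vss = map snd ?gs'"
    using gs by (intro nth_equalityI) (auto simp: nth_list_update)
  let ?\<tau> = "perm_of (concat (map2 permute_list ?\<sigma>s (blocks 0 (map length ?vss))))"
  have bl: "map length ?vss = map fst ?ys" using gl(4) by simp
  have c1: "concat (map snd ?gs') = permute_list ?\<tau> (concat ?vss)"
    using concat_map2_permute_list(1)[of ?\<sigma>s ?vss] perm' gs(2) m2 by simp
  have c2: "?\<tau> permutes {..<length (concat ?vss)}"
    using concat_map2_permute_list(2)[of ?\<sigma>s ?vss] perm' gs(2) by simp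
  have e: "cmp P x (map fst ?gs') = act P (total_arity ?ys) ?\<tau> (cmp P x ?ys)"
    using cmp_equivariant_inner[OF x gl(1) _ _ perm] gs(2) unfolding m1 bl by simp
  have ta: "total_arity (map fst ?gs') = total_arity ?ys" using gs(3) by (simp add: total_arity_def map_update)
  have cg: "((total_arity ?ys, cmp P x ?ys), concat ?vss) \<in> fa_gens P V"
    using cgen_closed[OF x gsz] gs(2) by (simp add: comp_op_def)
  show "tm V (cgen x ?gs') = tm V (cgen x ?gs)"
    using TC(3)[OF cg, of ?\<tau>] c2 gl(3) e ta c1 by (simp add: comp_op_def)
qed

end

lemma lists_nthI: "(\<And>k. k < length xs \<Longrightarrow> xs ! k \<in> S) \<Longrightarrow> xs \<in> lists S"
  by (metis in_listsI in_set_conv_nth)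

context operad
begin

text \<open>The structure map on representatives. It is multilinear by construction, and it descends to \<open>O(V)\<close> because
  it vanishes as soon as one argument is a relation.\<close>
definition fop_rep :: "('r, 'v) module \<Rightarrow> nat \<times> 'o \<Rightarrow> (('o, 'v) fa_gen \<Rightarrow> 'r) list \<Rightarrow> ('r, 'o, 'v) fa" where
  "fop_rep V x fs = multilin_ext R (Al V) (\<lambda>gs. tm V (cgen x gs)) fs"

lemma fop_eq: "fop V x Xs = fop_rep V x (map fa_rep Xs)"
  by (simp add: fa_op_def fop_rep_def)

lemma fop_rep_basis:
  assumes "module R V" "x \<in> ops P" "gs \<in> lists (fa_gens P V)" "length gs = fst x"
  shows "fop_rep V x (map (basis R) gs) = tm V (cgen x gs)"
  unfolding fop_rep_def
  using assms(3,4) tm_closed[OF assms(1) cgen_closed[OF assms(2)]]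
  by (intro multilin_ext_basis[OF module_alg[OF assms(1)]]) simp_all

lemma fop_rep_slot:
  assumes "module R V" "x \<in> ops P" "fs \<in> lists (carrier (FM V))" "length fs = fst x" "i < fst x"
  shows "(\<lambda>f. fop_rep V x (fs[i := f])) \<in> lin_maps R (FM V) (Al V)"
  unfolding fop_rep_def
  using assms(3-5) tm_closed[OF assms(1) cgen_closed[OF assms(2)]]
  by (intro multilin_ext_slot[OF module_alg[OF assms(1)]]) simp_all

text \<open>By induction over the other slots these may be assumed to contain generators; then composition is
  compatible with the relations in the remaining slot by \<open>cgen_slot_compat\<close>.\<close>
lemma fop_rep_null:
  assumes V: "module R V" and x: "x \<in> ops P" and fs: "fs \<in> lists (carrier (FM V))" "length fs = fst x" "i < fst x"
    and r: "r \<in> Nul V"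
  shows "fop_rep V x (fs[i := r]) = \<zero>\<^bsub>Al V\<^esub>"
proof -
  note A = module_alg[OF V] and F = module_free_module[of "fa_gens P V"]
  have rF: "r \<in> carrier (FM V)" using r submodule_facts(1)[OF F submodule_null[OF V]] by auto
  have b: "basis R ` fa_gens P V \<subseteq> carrier (FM V)" by (auto intro: basis_closed)
  have ne: "basis R ` fa_gens P V \<noteq> {}"
    using unt_closed mod_zero[OF V] by (auto simp: fa_gens_def ops_def intro!: exI[of _ 1] exI[of _ "unt P"] exI[of _ "[\<zero>\<^bsub>V\<^esub>]"])
  show ?thesis
  proof (rule multi_induct[where Q = "\<lambda>fs. fop_rep V x (fs[i := r]) = \<zero>\<^bsub>Al V\<^esub>" and S = "basis R ` fa_gens P V"
        and C = "carrier (FM V)" and k = "fst x"])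
    fix fs j f assume fs: "fs \<in> lists (carrier (FM V))" "length fs = fst x" "j < fst x"
      and *: "\<And>s. s \<in> basis R ` fa_gens P V \<Longrightarrow> fop_rep V x (fs[j := s, i := r]) = \<zero>\<^bsub>Al V\<^esub>"
      and f: "f \<in> carrier (FM V)"
    show "fop_rep V x (fs[j := f, i := r]) = \<zero>\<^bsub>Al V\<^esub>"
    proof (cases "j = i")
      case True
      then show ?thesis using * ne by fastforce
    next
      case False
      have "fs[i := r] \<in> lists (carrier (FM V))" using fs(1) rF by (rule lists_update)
      then have L: "(\<lambda>f. fop_rep V x (fs[i := r, j := f])) \<in> lin_maps R (FM V) (Al V)"
        using fs by (intro fop_rep_slot[OF V x]) auto
      have sw: "fs[j := s, i := r] = fs[i := r, j := s]" for s using False by (rule list_update_swap)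
      have "fop_rep V x (fs[i := r, j := f]) \<in> {\<zero>\<^bsub>Al V\<^esub>}"
        using * f free_module_mspan_basis[of "fa_gens P V"] unfolding sw
        by - (rule lin_maps_mspan_into[OF F A L b submodule_zero[OF A]], simp_all)
      then show ?thesis unfolding sw by simp
    qed
  next
    fix ss assume ss: "ss \<in> lists (basis R ` fa_gens P V)" "length ss = fst x"
    then obtain gs where gs: "gs \<in> lists (fa_gens P V)" "ss = map (basis R) gs"
      unfolding lists_image by auto
    have l: "length gs = fst x" using ss(2) gs(2) by simp
    have "ss \<in> lists (carrier (FM V))" using ss(1) lists_mono[OF b] by blast
    then have L: "(\<lambda>f. fop_rep V x (ss[i := f])) \<in> lin_maps R (FM V) (Al V)"
      using ss fs(3) by (intro fop_rep_slot[OF V x]) auto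
    have C: "fa_compat V (Al V) (\<lambda>g. tm V (cgen x (gs[i := g])))"
      using cgen_slot_compat[OF V x gs(1) l] fs(3) l by simp
    have hc: "(\<lambda>g. tm V (cgen x (gs[i := g]))) \<in> fa_gens P V \<rightarrow> carrier (Al V)" using fa_compatD(4)[OF C] by auto
    have "fop_rep V x (ss[i := r]) = lin_ext R (Al V) (\<lambda>g. tm V (cgen x (gs[i := g]))) r"
    proof (rule lin_maps_mspan_eq[OF F A L lin_ext_linear[OF A hc] b])
      fix s assume "s \<in> basis R ` fa_gens P V"
      then obtain g where g: "g \<in> fa_gens P V" "s = basis R g" by auto
      have "ss[i := s] = map (basis R) (gs[i := g])" using gs g by (simp add: map_update)
      then have "fop_rep V x (ss[i := s]) = tm V (cgen x (gs[i := g]))"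
        using fop_rep_basis[OF V x lists_update[OF gs(1) g(1)], of i] l by simp
      then show "fop_rep V x (ss[i := s]) = lin_ext R (Al V) (\<lambda>g. tm V (cgen x (gs[i := g]))) s"
        using lin_ext_basis[OF A hc g(1)] g(2) by simp
    next
      show "r \<in> mspan R (FM V) (basis R ` fa_gens P V)" using rF free_module_mspan_basis[of "fa_gens P V"] by simp
    qed
    also have "\<dots> = \<zero>\<^bsub>Al V\<^esub>" by (rule lift_kills_null[OF V A C r])
    finally show "fop_rep V x (ss[i := r]) = \<zero>\<^bsub>Al V\<^esub>" .
  qed (use b fs in auto)
qed

text \<open>The representatives are exchanged one slot at a time.\<close>
lemma fop_rep_cong:
  assumes V: "module R V" and x: "x \<in> ops P" and fs: "fs \<in> lists (carrier (FM V))" "length fs = fst x"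
    and fs': "fs' \<in> lists (carrier (FM V))" "length fs' = fst x"
    and eq: "\<And>i. i < fst x \<Longrightarrow> fs ! i \<ominus>\<^bsub>FM V\<^esub> fs' ! i \<in> Nul V"
  shows "fop_rep V x fs = fop_rep V x fs'"
proof -
  note A = module_alg[OF V] and F = module_free_module[of "fa_gens P V"]
  have "fop_rep V x (take j fs' @ drop j fs) = fop_rep V x fs" if "j \<le> fst x" for j
    using that
  proof (induction j)
    case (Suc j)
    let ?gs = "take j fs' @ drop j fs"
    have gs: "?gs \<in> lists (carrier (FM V))" "length ?gs = fst x"
      using fs fs' Suc.prems by (auto simp: in_lists_conv_set dest: in_set_takeD in_set_dropD)
    have u: "?gs[j := fs ! j] = ?gs" "?gs[j := fs' ! j] = take (Suc j) fs' @ drop (Suc j) fs"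
      using fs fs' Suc.prems by (auto simp: list_eq_iff_nth_eq nth_list_update nth_append less_Suc_eq min_def)
    have L: "(\<lambda>f. fop_rep V x (?gs[j := f])) \<in> lin_maps R (FM V) (Al V)"
      using gs Suc.prems by (intro fop_rep_slot[OF V x]) auto
    have c: "fs ! j \<in> carrier (FM V)" "fs' ! j \<in> carrier (FM V)"
      using fs fs' Suc.prems by (auto intro: lists_nth)
    have "fop_rep V x (?gs[j := fs ! j \<ominus>\<^bsub>FM V\<^esub> fs' ! j]) = \<zero>\<^bsub>Al V\<^esub>"
      using gs Suc.prems eq by (intro fop_rep_null[OF V x]) auto
    then have "fop_rep V x (?gs[j := fs ! j]) \<ominus>\<^bsub>Al V\<^esub> fop_rep V x (?gs[j := fs' ! j]) = \<zero>\<^bsub>Al V\<^esub>"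
      using lin_maps_diff[OF F A L c] by simp
    then have "fop_rep V x (?gs[j := fs ! j]) = fop_rep V x (?gs[j := fs' ! j])"
      using lin_maps_closed[OF L] c by (metis sub_zeroE[OF A])
    then show ?case using Suc u by simp
  qed simp
  from this[of "fst x"] show ?thesis using fs(2) fs'(2) by simp
qed

lemma map_rep_lists: "module R V \<Longrightarrow> Xs \<in> lists (carrier (Al V)) \<Longrightarrow> map fa_rep Xs \<in> lists (carrier (FM V))"
  by (auto simp: in_lists_conv_set fa_rep_closed)

lemma fop_cosets:
  assumes V: "module R V" and x: "x \<in> ops P" and fs: "fs \<in> lists (carrier (FM V))" "length fs = fst x"
  shows "fop V x (map (\<lambda>f. Nul V +>\<^bsub>FM V\<^esub> f) fs) = fop_rep V x fs"
  unfolding fop_eq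
proof (rule fop_rep_cong[OF V x _ _ fs])
  note F = module_free_module[of "fa_gens P V"]
  have f: "fs ! i \<in> carrier (FM V)" if "i < fst x" for i using fs that by (auto intro: lists_nth)
  note r = fa_rep_props[OF V]
  show "map fa_rep (map (\<lambda>f. Nul V +>\<^bsub>FM V\<^esub> f) fs) \<in> lists (carrier (FM V))"
    using fs(1) r by (auto simp: in_lists_conv_set)
  fix i assume i: "i < fst x"
  show "map fa_rep (map (\<lambda>f. Nul V +>\<^bsub>FM V\<^esub> f) fs) ! i \<ominus>\<^bsub>FM V\<^esub> fs ! i \<in> Nul V"
    using i fs(2) r[OF f[OF i]] f[OF i] coset_eq_iff[OF F submodule_null[OF V]] by simp
qed (use fs in simp)

lemma fop_closed:
  assumes "module R V" "x \<in> ops P" "Xs \<in> lists (carrier (Al V))" "length Xs = fst x"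
  shows "fop V x Xs \<in> carrier (Al V)"
  unfolding fop_eq fop_rep_def
  using assms(4) tm_closed[OF assms(1) cgen_closed[OF assms(2)]]
  by (intro multilin_ext_closed[OF module_alg[OF assms(1)] map_rep_lists[OF assms(1,3)]]) simp_all

lemma fop_slot:
  assumes V: "module R V" and x: "x \<in> ops P" and Xs: "Xs \<in> lists (carrier (Al V))" "length Xs = fst x" "i < fst x"
  shows "(\<lambda>X. fop V x (Xs[i := X])) \<in> lin_maps R (Al V) (Al V)"
proof -
  note A = module_alg[OF V] and F = module_free_module[of "fa_gens P V"]
  let ?fs = "map fa_rep Xs"
  let ?c = "\<lambda>f. Nul V +>\<^bsub>FM V\<^esub> f"
  have fs: "?fs \<in> lists (carrier (FM V))" "length ?fs = fst x" using map_rep_lists[OF V Xs(1)] Xs(2) by auto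
  have Xs': "map ?c ?fs = Xs" using Xs(1) fa_rep_coset[OF V] by (auto simp: in_lists_conv_set intro: map_idI)
  note L = fop_rep_slot[OF V x fs Xs(3)]
  have e: "fop V x (Xs[i := ?c f]) = fop_rep V x (?fs[i := f])" if f: "f \<in> carrier (FM V)" for f
    using fop_cosets[OF V x lists_update[OF fs(1) f], of i] fs(2) Xs' by (simp add: map_update)
  show ?thesis
  proof (rule lin_mapsI)
    fix X assume "X \<in> carrier (Al V)"
    then obtain f where f: "f \<in> carrier (FM V)" "X = ?c f" by (rule alg_cases)
    show "fop V x (Xs[i := X]) \<in> carrier (Al V)" using lin_maps_closed[OF L f(1)] e[OF f(1)] f(2) by simp
    fix a assume a: "a \<in> carrier R"
    have "fop V x (Xs[i := ?c (a \<odot>\<^bsub>FM V\<^esub> f)]) = a \<odot>\<^bsub>Al V\<^esub> fop V x (Xs[i := ?c f])"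
      unfolding e[OF f(1)] e[OF mod_smult[OF F a f(1)]] by (rule lin_maps_smult[OF L a f(1)])
    then show "fop V x (Xs[i := a \<odot>\<^bsub>Al V\<^esub> X]) = a \<odot>\<^bsub>Al V\<^esub> fop V x (Xs[i := X])"
      unfolding f(2) lin_maps_smult[OF coset_lin[OF V] a f(1), symmetric] .
  next
    fix X Y assume XY: "X \<in> carrier (Al V)" "Y \<in> carrier (Al V)"
    obtain f where f: "f \<in> carrier (FM V)" "X = ?c f" using XY(1) by (rule alg_cases)
    obtain g where g: "g \<in> carrier (FM V)" "Y = ?c g" using XY(2) by (rule alg_cases)
    have "fop V x (Xs[i := ?c (f \<oplus>\<^bsub>FM V\<^esub> g)]) = fop V x (Xs[i := ?c f]) \<oplus>\<^bsub>Al V\<^esub> fop V x (Xs[i := ?c g])"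
      unfolding e[OF f(1)] e[OF g(1)] e[OF mod_add[OF F f(1) g(1)]] by (rule lin_maps_add[OF L f(1) g(1)])
    then show "fop V x (Xs[i := X \<oplus>\<^bsub>Al V\<^esub> Y]) = fop V x (Xs[i := X]) \<oplus>\<^bsub>Al V\<^esub> fop V x (Xs[i := Y])"
      unfolding f(2) g(2) lin_maps_add[OF coset_lin[OF V] f(1) g(1), symmetric] .
  qed
qed

lemma fop_terms:
  assumes V: "module R V" and x: "x \<in> ops P" and gs: "gs \<in> lists (fa_gens P V)" "length gs = fst x"
  shows "fop V x (map (tm V) gs) = tm V (cgen x gs)"
proof -
  have "map (basis R) gs \<in> lists (carrier (FM V))" using gs(1) by (auto simp: in_lists_conv_set intro: basis_closed)
  then have "fop V x (map (\<lambda>f. Nul V +>\<^bsub>FM V\<^esub> f) (map (basis R) gs)) = fop_rep V x (map (basis R) gs)"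
    using gs by (intro fop_cosets[OF V x]) auto
  then show ?thesis using fop_rep_basis[OF V x gs] by (simp add: tm_eq comp_def)
qed

lemma Tms_listE:
  assumes "ss \<in> lists (Tms V)"
  obtains gs where "gs \<in> lists (fa_gens P V)" "ss = map (tm V) gs"
  using assms unfolding lists_image by auto

lemma alg_multilin_eqI:
  assumes V: "module R V" and N: "module R N"
    and "\<And>Xs i. Xs \<in> lists (carrier (Al V)) \<Longrightarrow> length Xs = k \<Longrightarrow> i < k \<Longrightarrow> (\<lambda>x. T (Xs[i := x])) \<in> lin_maps R (Al V) N"
    and "\<And>Xs i. Xs \<in> lists (carrier (Al V)) \<Longrightarrow> length Xs = k \<Longrightarrow> i < k \<Longrightarrow> (\<lambda>x. T' (Xs[i := x])) \<in> lin_maps R (Al V) N"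
    and "\<And>gs. gs \<in> lists (fa_gens P V) \<Longrightarrow> length gs = k \<Longrightarrow> T (map (tm V) gs) = T' (map (tm V) gs)"
    and "Xs \<in> lists (carrier (Al V))" "length Xs = k"
  shows "T Xs = T' Xs"
proof (rule multilin_eqI[OF module_alg[OF V] N alg_span[OF V] Tms_sub[OF V] assms(3,4) _ assms(6,7)])
  fix ss assume ss: "ss \<in> lists (Tms V)" "length ss = k"
  obtain gs where "gs \<in> lists (fa_gens P V)" "ss = map (tm V) gs" using ss(1) by (rule Tms_listE)
  then show "T ss = T' ss" using assms(5)[of gs] ss(2) by simp
qed

lemma fop_op_linear:
  assumes V: "module R V" and Xs: "Xs \<in> lists (carrier (Al V))" "length Xs = n"
  shows "(\<lambda>\<mu>. fop V (n, \<mu>) Xs) \<in> lin_maps R (Op P n) (Al V)"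
proof -
  note A = module_alg[OF V]
  note TC = fa_compatD[OF tm_compat[OF V]]
  have o: "\<mu> \<in> carrier (Op P n) \<Longrightarrow> (n, \<mu>) \<in> ops P" for \<mu> by (simp add: ops_def)
  have s: "(\<lambda>X. fop V (n, \<mu>) (Xs[i := X])) \<in> lin_maps R (Al V) (Al V)"
    if "\<mu> \<in> carrier (Op P n)" "Xs \<in> lists (carrier (Al V))" "length Xs = n" "i < n" for \<mu> Xs i
    using fop_slot[OF V o[OF that(1)] that(2)] that(3,4) by simp
  have lin: "(\<lambda>\<mu>. tm V (cgen (n, \<mu>) gs)) \<in> lin_maps R (Op P n) (Al V)" if "gs \<in> lists (fa_gens P V)" "length gs = n" for gs
  proof -
    note g = gens_lists[OF that(1)]
    have "(\<lambda>\<mu>. cmp P (length (map fst gs), \<mu>) (map fst gs)) \<in> lin_maps R (Op P (length (map fst gs))) (Op P (total_arity (map fst gs)))"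
      using g(1) by (rule cmp_linear_outer)
    then have "(\<lambda>\<mu>. cmp P (n, \<mu>) (map fst gs)) \<in> lin_maps R (Op P n) (Op P (total_arity (map fst gs)))" using that(2) by simp
    then show ?thesis unfolding comp_op_def by (rule lin_maps_comp[OF _ TC(1)[OF g(2,3)]])
  qed
  show ?thesis
  proof (rule lin_mapsI)
    fix \<mu> assume m: "\<mu> \<in> carrier (Op P n)"
    show "fop V (n, \<mu>) Xs \<in> carrier (Al V)" using fop_closed[OF V o[OF m] Xs(1)] Xs(2) by simp
    fix a assume a: "a \<in> carrier R"
    note am = mod_smult[OF module_Op a m]
    show "fop V (n, a \<odot>\<^bsub>Op P n\<^esub> \<mu>) Xs = a \<odot>\<^bsub>Al V\<^esub> fop V (n, \<mu>) Xs"
    proof (rule alg_multilin_eqI[OF V A _ _ _ Xs])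
      fix gs assume gs: "gs \<in> lists (fa_gens P V)" "length gs = n"
      then show "fop V (n, a \<odot>\<^bsub>Op P n\<^esub> \<mu>) (map (tm V) gs) = a \<odot>\<^bsub>Al V\<^esub> fop V (n, \<mu>) (map (tm V) gs)"
        using lin_maps_smult[OF lin[OF gs] a m] fop_terms[OF V o[OF m] gs(1)] fop_terms[OF V o[OF am] gs(1)] by simp
    qed (rule s[OF am] lin_maps_scale[OF A s[OF m] a]; assumption)+
  next
    fix \<mu> \<nu> assume m: "\<mu> \<in> carrier (Op P n)" and n: "\<nu> \<in> carrier (Op P n)"
    note mn = mod_add[OF module_Op m n]
    show "fop V (n, \<mu> \<oplus>\<^bsub>Op P n\<^esub> \<nu>) Xs = fop V (n, \<mu>) Xs \<oplus>\<^bsub>Al V\<^esub> fop V (n, \<nu>) Xs"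
    proof (rule alg_multilin_eqI[OF V A _ _ _ Xs])
      fix gs assume gs: "gs \<in> lists (fa_gens P V)" "length gs = n"
      then show "fop V (n, \<mu> \<oplus>\<^bsub>Op P n\<^esub> \<nu>) (map (tm V) gs) = fop V (n, \<mu>) (map (tm V) gs) \<oplus>\<^bsub>Al V\<^esub> fop V (n, \<nu>) (map (tm V) gs)"
        using lin_maps_add[OF lin[OF gs] m n] fop_terms[OF V o[OF m] gs(1)] fop_terms[OF V o[OF n] gs(1)]
          fop_terms[OF V o[OF mn] gs(1)] by simp
    qed (rule s[OF mn] lin_maps_plus[OF A s[OF m] s[OF n]]; assumption)+
  qed
qed

lemma fop_equivariant:
  assumes V: "module R V" and m: "\<mu> \<in> carrier (Op P k)" and \<sigma>: "\<sigma> permutes {..<k}"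
    and Xs: "Xs \<in> lists (carrier (Al V))" "length Xs = k"
  shows "fop V (k, act P k \<sigma> \<mu>) (permute_list \<sigma> Xs) = fop V (k, \<mu>) Xs"
proof -
  note A = module_alg[OF V]
  note TC = fa_compatD[OF tm_compat[OF V]]
  have o: "(k, \<mu>) \<in> ops P" "(k, act P k \<sigma> \<mu>) \<in> ops P" using m act_closed[OF m \<sigma>] by (auto simp: ops_def)
  have inv: "inv_into UNIV \<sigma> i < k" if "i < k" for i
    using permutes_in_image[OF permutes_inv[OF \<sigma>], of i] that by simp
  show ?thesis
  proof (rule alg_multilin_eqI[OF V A _ _ _ Xs])
    fix Xs i assume Xs: "Xs \<in> lists (carrier (Al V))" "length Xs = k" "i < k"
    have p: "permute_list \<sigma> Xs \<in> lists (carrier (Al V))" using permute_list_lists[of \<sigma> Xs] \<sigma> Xs by simp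
    have "(\<lambda>X. fop V (k, act P k \<sigma> \<mu>) ((permute_list \<sigma> Xs)[inv_into UNIV \<sigma> i := X])) \<in> lin_maps R (Al V) (Al V)"
      using Xs inv by (intro fop_slot[OF V o(2) p]) auto
    then show "(\<lambda>X. fop V (k, act P k \<sigma> \<mu>) (permute_list \<sigma> (Xs[i := X]))) \<in> lin_maps R (Al V) (Al V)"
      using permute_list_update[of \<sigma> Xs i] \<sigma> Xs by simp
  next
    fix Xs i assume "Xs \<in> lists (carrier (Al V))" "length Xs = k" "i < k"
    then show "(\<lambda>X. fop V (k, \<mu>) (Xs[i := X])) \<in> lin_maps R (Al V) (Al V)" by (intro fop_slot[OF V o(1)]) auto
  next
    fix gs assume gs: "gs \<in> lists (fa_gens P V)" "length gs = k"
    have p: "permute_list \<sigma> gs \<in> lists (fa_gens P V)" using permute_list_lists[of \<sigma> gs] \<sigma> gs by simp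
    let ?ys = "map fst gs" and ?vss = "map snd gs"
    note gl = gens_lists[OF gs(1)]
    let ?\<tau> = "perm_of (concat (permute_list \<sigma> (blocks 0 (map length ?vss))))"
    have pm: "\<sigma> permutes {..<length gs}" using \<sigma> gs by simp
    have ta: "total_arity (permute_list \<sigma> ?ys) = total_arity ?ys"
    proof -
      have pm': "\<sigma> permutes {..<length ?ys}" using pm by simp
      have "mset (map fst (permute_list \<sigma> ?ys)) = mset (map fst ?ys)" by (simp only: mset_map mset_permute_list[OF pm'])
      then show ?thesis unfolding total_arity_def by (metis sum_mset_sum_list)
    qed
    have e: "cmp P (k, act P k \<sigma> \<mu>) (permute_list \<sigma> ?ys) = act P (total_arity ?ys) ?\<tau> (cmp P (k, \<mu>) ?ys)"
      using cmp_equivariant_outer[OF o(1) gl(1) _ \<sigma>] gs(2) unfolding gl(4) by simp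
    have c: "concat (permute_list \<sigma> ?vss) = permute_list ?\<tau> (concat ?vss)" "?\<tau> permutes {..<length (concat ?vss)}"
      using concat_permute_list[of \<sigma> ?vss] pm by simp_all
    have cg: "((total_arity ?ys, cmp P (k, \<mu>) ?ys), concat ?vss) \<in> fa_gens P V"
      using cgen_closed[OF o(1) gs(1)] gs(2) by (simp add: comp_op_def)
    have "permute_list \<sigma> (map (tm V) gs) = map (tm V) (permute_list \<sigma> gs)" using pm by (simp add: permute_list_map)
    then have "fop V (k, act P k \<sigma> \<mu>) (permute_list \<sigma> (map (tm V) gs)) = tm V (cgen (k, act P k \<sigma> \<mu>) (permute_list \<sigma> gs))"
      using fop_terms[OF V o(2) p] gs(2) by simp
    also have "\<dots> = tm V ((total_arity ?ys, act P (total_arity ?ys) ?\<tau> (cmp P (k, \<mu>) ?ys)), permute_list ?\<tau> (concat ?vss))"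
      using pm e c ta by (simp add: permute_list_map[symmetric] comp_op_def)
    also have "\<dots> = tm V (cgen (k, \<mu>) gs)"
      using TC(3)[OF cg] c(2) gl(3) by (simp add: comp_op_def)
    also have "\<dots> = fop V (k, \<mu>) (map (tm V) gs)" using fop_terms[OF V o(1) gs(1)] gs(2) by simp
    finally show "fop V (k, act P k \<sigma> \<mu>) (permute_list \<sigma> (map (tm V) gs)) = fop V (k, \<mu>) (map (tm V) gs)" .
  qed
qed

lemma unt_ops: "(1, unt P) \<in> ops P" "(Suc 0, unt P) \<in> ops P"
  using unt_closed by (simp_all add: ops_def)

lemma var_tm: "var V v = tm V ((1, unt P), [v])"
  by (simp add: fa_var_def)

lemma var_gen: "v \<in> carrier V \<Longrightarrow> ((1, unt P), [v]) \<in> fa_gens P V"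
  using unt_closed by (simp add: fa_gens_iff)

lemma var_lin: "module R V \<Longrightarrow> fa_var R P V \<in> lin_maps R V (Al V)"
proof -
  assume V: "module R V"
  have "(\<lambda>v. tm V ((1, unt P), [\<zero>\<^bsub>V\<^esub>][0 := v])) \<in> lin_maps R V (Al V)"
    by (intro fa_compatD(2)[OF tm_compat[OF V]] var_gen mod_zero[OF V]) simp
  then show ?thesis by (simp add: fa_var_def[abs_def])
qed

text \<open>Terms are values of operations at variables, so the structure map and \<open>V\<close> determine everything.\<close>
lemma tm_fop:
  assumes V: "module R V" and g: "(x, vs) \<in> fa_gens P V"
  shows "tm V (x, vs) = fop V x (map (fa_var R P V) vs)"
proof -
  let ?gs = "map (\<lambda>v. ((1, unt P), [v])) vs"
  have x: "x \<in> ops P" "vs \<in> lists (carrier V)" "length vs = fst x" using fa_gensE[OF g] by auto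
  have gs: "?gs \<in> lists (fa_gens P V)" "length ?gs = fst x"
    using x unt_closed by (auto simp: in_lists_conv_set fa_gens_def ops_def)
  have r: "map fst ?gs = replicate (fst x) (1, unt P)" using x(3) by (simp add: map_replicate_const comp_def)
  have t: "total_arity (replicate (fst x) (1, unt P)) = fst x" by (simp add: total_arity_def sum_list_replicate)
  have c: "concat (map snd ?gs) = vs" by (simp add: comp_def)
  have "cgen x ?gs = (x, vs)" unfolding c r comp_op_def t cmp_unt_right[OF x(1)] by simp
  moreover have "map (tm V) ?gs = map (fa_var R P V) vs" by (simp add: fa_var_def)
  ultimately show ?thesis using fop_terms[OF V x(1) gs] by metis
qed

lemma fop_unt:
  assumes V: "module R V" and X: "X \<in> carrier (Al V)"
  shows "fop V (1, unt P) [X] = X"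
proof -
  note A = module_alg[OF V]
  have L: "(\<lambda>X. fop V (1, unt P) [X]) \<in> lin_maps R (Al V) (Al V)"
    using fop_slot[OF V unt_ops(1), of "[\<zero>\<^bsub>Al V\<^esub>]" 0] mod_zero[OF A] by simp
  show ?thesis
  proof (rule alg_lin_eq[OF V A L lin_maps_id _ X])
    fix g assume g: "g \<in> fa_gens P V"
    have "fop V (1, unt P) (map (tm V) [g]) = tm V (cgen (1, unt P) [g])" using g by (intro fop_terms[OF V unt_ops(1)]) auto
    also have "cgen (1, unt P) [g] = g"
      using cmp_unt_left[OF fa_gensE(1)[OF g]] by (simp add: comp_op_def total_arity_def prod_eq_iff)
    finally show "fop V (1, unt P) [tm V g] = tm V g" by simp
  qed
qed

text \<open>This is the associativity axiom of the operad read on terms.\<close>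
lemma fop_assoc_terms:
  assumes V: "module R V" and x: "x \<in> ops P" and ys: "ys \<in> lists (ops P)" "length ys = fst x"
    and gss: "gss \<in> lists (lists (fa_gens P V))" "map length gss = map fst ys"
  shows "fop V (comp_op P x ys) (map (tm V) (concat gss)) = fop V x (map2 (fop V) ys (map (map (tm V)) gss))"
proof -
  have l: "length gss = length ys" using arg_cong[OF gss(2), of length] by simp
  have lk: "length (gss ! k) = fst (ys ! k)" if "k < length ys" for k using arg_cong[OF gss(2), of "\<lambda>l. l ! k"] that l by simp
  have gk: "gss ! k \<in> lists (fa_gens P V)" if "k < length ys" for k using gss(1) that l by (intro lists_nth[of gss]) auto
  have yk: "ys ! k \<in> ops P" if "k < length ys" for k using ys that by (auto intro: lists_nth)
  let ?hs = "map2 cgen ys gss"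
  have hs: "?hs \<in> lists (fa_gens P V)" "length ?hs = fst x"
  proof -
    show "length ?hs = fst x" using ys l by simp
    have "?hs ! k \<in> fa_gens P V" if "k < length ?hs" for k
      using that l cgen_closed[OF yk gk lk, of k] by simp
    then show "?hs \<in> lists (fa_gens P V)" by (rule lists_nthI)
  qed
  have "map2 (fop V) ys (map (map (tm V)) gss) = map (tm V) ?hs"
  proof (rule nth_equalityI)
    fix k assume "k < length (map2 (fop V) ys (map (map (tm V)) gss))"
    then have k: "k < length ys" by simp
    show "map2 (fop V) ys (map (map (tm V)) gss) ! k = map (tm V) ?hs ! k"
      using k l fop_terms[OF V yk[OF k] gk[OF k] lk[OF k]] by simp
  qed (use l in simp)
  then have "fop V x (map2 (fop V) ys (map (map (tm V)) gss)) = tm V (cgen x ?hs)"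
    using fop_terms[OF V x hs] by simp
  also have "cgen x ?hs = cgen (comp_op P x ys) (concat gss)"
  proof -
    let ?zss = "map (map fst) gss"
    have z: "?zss \<in> lists (lists (ops P))" "map length ?zss = map fst ys"
      using gss(2) lists_map[OF gens_lists(1) gss(1)] by (simp_all add: comp_def del: in_lists_conv_set)
    have m: "map fst ?hs = map2 (comp_op P) ys ?zss" using l by (intro nth_equalityI) auto
    have a: "cmp P (comp_op P x ys) (concat ?zss) = cmp P x (map fst ?hs)"
      using cmp_assoc[OF x ys z] m by simp
    have t: "total_arity (map fst ?hs) = total_arity (concat ?zss)"
    proof -
      have a: "map fst (map2 (comp_op P) ys ?zss) = map total_arity ?zss" using l by (intro nth_equalityI) (auto simp: comp_op_def)
      have b: "sum_list (map total_arity zss) = total_arity (concat zss)" for zss :: "(nat \<times> 'o) list list"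
        by (induction zss) (auto simp: total_arity_def)
      show ?thesis unfolding m total_arity_def[of "map2 (comp_op P) ys ?zss"] a by (rule b)
    qed
    have c: "concat (map snd ?hs) = concat (map snd (concat gss))"
    proof -
      have "map snd ?hs = map (\<lambda>gs. concat (map snd gs)) gss" using l by (intro nth_equalityI) auto
      moreover have "concat (map (\<lambda>gs. concat (map snd gs)) gss) = concat (map snd (concat gss))" by (induction gss) auto
      ultimately show ?thesis by simp
    qed
    have "comp_op P x (map fst ?hs) = (total_arity (map fst ?hs), cmp P x (map fst ?hs))"
      "comp_op P (comp_op P x ys) (map fst (concat gss)) = (total_arity (concat ?zss), cmp P (comp_op P x ys) (concat ?zss))"
      by (simp_all only: comp_op_def map_concat)
    then show ?thesis by (simp only: a t c)
  qed
  also have "tm V (cgen (comp_op P x ys) (concat gss)) = fop V (comp_op P x ys) (map (tm V) (concat gss))"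
  proof -
    have "concat gss \<in> lists (fa_gens P V)" using gss(1) by (auto simp: in_lists_conv_set)
    moreover have "length (concat gss) = fst (comp_op P x ys)" using gss(2) by (simp add: length_concat comp_op_def total_arity_def)
    ultimately show ?thesis using fop_terms[OF V cmp_closed(2)[OF x ys]] by simp
  qed
  finally show ?thesis by simp
qed

end

lemma lin_maps_list: "h \<in> lin_maps R M N \<Longrightarrow> xs \<in> lists (carrier M) \<Longrightarrow> map h xs \<in> lists (carrier N)"
  by (auto simp: in_lists_conv_set lin_maps_def)

context operad
begin

lemma tm_list: "module R V \<Longrightarrow> gs \<in> lists (fa_gens P V) \<Longrightarrow> map (tm V) gs \<in> lists (carrier (Al V))"
  using tm_closed[of V] by (auto simp: in_lists_conv_set)

text \<open>Inserting a linear combination \<open>H\<close> at one leaf of a composite is the same as inserting it into the factor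
  that contains the leaf. Both sides are linear in \<open>H\<close>, and for a term \<open>H\<close> this is associativity with units at all
  other leaves.\<close>
lemma fop_assoc_one:
  assumes V: "module R V" and x: "x \<in> ops P" and gs: "gs \<in> lists (fa_gens P V)" "length gs = fst x"
    and i: "i < length gs" and j: "j < length (snd (gs ! i))" and H: "H \<in> carrier (Al V)"
  shows "fop V (comp_op P x (map fst gs)) ((map (fa_var R P V) (concat (map snd gs)))[length (concat (take i (map snd gs))) + j := H]) =
    fop V x ((map (tm V) gs)[i := fop V (fst (gs ! i)) ((map (fa_var R P V) (snd (gs ! i)))[j := H])])"
proof -
  note A = module_alg[OF V]
  let ?ys = "map fst gs" and ?wss = "map snd gs"
  let ?J = "length (concat (take i ?wss)) + j"
  let ?u = "\<lambda>v. ((1::nat, unt P), [v])"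
  note gl = gens_lists[OF gs(1)]
  have gk: "gs ! k \<in> fa_gens P V" if "k < length gs" for k using gs(1) that by (rule lists_nth)
  have wk: "snd (gs ! k) \<in> lists (carrier V)" "fst (gs ! k) \<in> ops P" "length (snd (gs ! k)) = fst (fst (gs ! k))" if "k < length gs" for k
    using fa_gensE[OF gk[OF that]] by auto
  have vl: "map (fa_var R P V) ws \<in> lists (carrier (Al V))" if "ws \<in> lists (carrier V)" for ws
    using that by (rule lin_maps_list[OF var_lin[OF V]])
  have J: "?J < length (concat ?wss)" using concat_position(1)[of i ?wss j] i j by simp
  have L1: "(\<lambda>H. fop V (comp_op P x ?ys) ((map (fa_var R P V) (concat ?wss))[?J := H])) \<in> lin_maps R (Al V) (Al V)"
    using fop_slot[OF V cmp_closed(2)[OF x gl(1)] vl[OF gl(2)], of ?J] gl(3) gs(2) J by (simp add: comp_op_def)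
  have tl: "map (tm V) gs \<in> lists (carrier (Al V))" using gs(1) by (rule tm_list[OF V])
  have L2: "(\<lambda>H. fop V x ((map (tm V) gs)[i := fop V (fst (gs ! i)) ((map (fa_var R P V) (snd (gs ! i)))[j := H])])) \<in> lin_maps R (Al V) (Al V)"
    by (rule lin_maps_comp[OF fop_slot[OF V wk(2)[OF i] vl[OF wk(1)[OF i]]] fop_slot[OF V x tl]]) (use i j wk(3)[OF i] gs(2) in simp_all)
  show ?thesis
  proof (rule alg_lin_eq[OF V A L1 L2 _ H])
    fix g assume g: "g \<in> fa_gens P V"
    let ?gss = "(map (map ?u) ?wss)[i := (map ?u (snd (gs ! i)))[j := g]]"
    have ul: "map ?u ws \<in> lists (fa_gens P V)" if "ws \<in> lists (carrier V)" for ws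
      using that unt_closed by (auto simp: in_lists_conv_set fa_gens_def ops_def)
    have "map (map ?u) ?wss \<in> lists (lists (fa_gens P V))"
      using ul[OF wk(1)] by - (rule lists_nthI, simp only: nth_map length_map)
    then have gss: "?gss \<in> lists (lists (fa_gens P V))" by (rule lists_update) (intro lists_update ul wk i g)
    have ml: "map length ?gss = map fst ?ys"
      using wk(3) i by (intro nth_equalityI) (auto simp: nth_list_update)
    have c: "concat ?gss = (map ?u (concat ?wss))[?J := g]"
    proof -
      have "map (map ?u) ?wss ! i = map ?u (snd (gs ! i))" using i by simp
      then have e: "(map (map ?u) ?wss)[i := map ?u (snd (gs ! i))] = map (map ?u) ?wss" by (metis list_update_id)
      have "concat ?gss = (concat ((map (map ?u) ?wss)[i := map ?u (snd (gs ! i))]))[length (concat (take i (map (map ?u) ?wss))) + j := g]"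
        using i j by (intro concat_update) auto
      also have "length (concat (take i (map (map ?u) ?wss))) = length (concat (take i ?wss))"
        by (simp add: length_concat take_map comp_def)
      finally show ?thesis unfolding e by (simp add: map_concat)
    qed
    have l: "map (tm V) (concat ?gss) = (map (fa_var R P V) (concat ?wss))[?J := tm V g]"
      unfolding c by (simp add: map_update comp_def fa_var_def[abs_def])
    have r: "map2 (fop V) ?ys (map (map (tm V)) ?gss) =
      (map (tm V) gs)[i := fop V (fst (gs ! i)) ((map (fa_var R P V) (snd (gs ! i)))[j := tm V g])]"
    proof (rule nth_equalityI)
      fix k assume "k < length (map2 (fop V) ?ys (map (map (tm V)) ?gss))"
      then have k: "k < length gs" by simp
      have t: "fop V (fst (gs ! k)) (map (fa_var R P V) (snd (gs ! k))) = tm V (gs ! k)"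
        using tm_fop[OF V, of "fst (gs ! k)" "snd (gs ! k)"] gk[OF k] by simp
      show "map2 (fop V) ?ys (map (map (tm V)) ?gss) ! k =
        (map (tm V) gs)[i := fop V (fst (gs ! i)) ((map (fa_var R P V) (snd (gs ! i)))[j := tm V g])] ! k"
        using k i t by (cases "k = i") (simp_all add: map_update comp_def fa_var_def[abs_def])
    qed (use i in simp)
    show "fop V (comp_op P x ?ys) ((map (fa_var R P V) (concat ?wss))[?J := tm V g]) =
      fop V x ((map (tm V) gs)[i := fop V (fst (gs ! i)) ((map (fa_var R P V) (snd (gs ! i)))[j := tm V g])])"
      using fop_assoc_terms[OF V x gl(1) _ gss ml] gs(2) unfolding l r by simp
  qed
qed

subsection \<open>Extension of linear maps to derivations\<close>

text \<open>The value on \<open>\<mu>(v\<^sub>1, \<dots>, v\<^sub>n)\<close> of the derivation that extends \<open>h\<close>.\<close>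
definition dform :: "('r, 'v) module \<Rightarrow> ('v \<Rightarrow> ('r, 'o, 'v) fa) \<Rightarrow> ('o, 'v) fa_gen \<Rightarrow> ('r, 'o, 'v) fa" where
  "dform V h g = (\<Oplus>\<^bsub>Al V\<^esub>i\<in>{..<length (snd g)}. fop V (fst g) ((map (fa_var R P V) (snd g))[i := h (snd g ! i)]))"

lemma var_closed: "module R V \<Longrightarrow> v \<in> carrier V \<Longrightarrow> var V v \<in> carrier (Al V)"
  by (rule lin_maps_closed[OF var_lin])

lemma var_list: "module R V \<Longrightarrow> vs \<in> lists (carrier V) \<Longrightarrow> map (fa_var R P V) vs \<in> lists (carrier (Al V))"
  by (rule lin_maps_list[OF var_lin])

lemma dform_compat:
  assumes V: "module R V" and h: "h \<in> lin_maps R V (Al V)"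
  shows "fa_compat V (Al V) (dform V h)"
  unfolding fa_compat_def
proof (intro conjI allI impI)
  note A = module_alg[OF V]
  fix n vs assume vs: "vs \<in> lists (carrier V)" "length vs = n"
  have "(\<lambda>\<mu>. fop V (n, \<mu>) ((map (fa_var R P V) vs)[i := h (vs ! i)])) \<in> lin_maps R (Op P n) (Al V)" if "i \<in> {..<n}" for i
    using that vs lists_nth[OF vs(1)] lin_maps_closed[OF h]
    by (intro fop_op_linear[OF V] lists_update var_list[OF V]) simp_all
  then have "(\<lambda>\<mu>. \<Oplus>\<^bsub>Al V\<^esub>i\<in>{..<n}. fop V (n, \<mu>) ((map (fa_var R P V) vs)[i := h (vs ! i)])) \<in> lin_maps R (Op P n) (Al V)"
    by (rule lin_maps_finsum[OF A])
  then show "(\<lambda>\<mu>. dform V h ((n, \<mu>), vs)) \<in> lin_maps R (Op P n) (Al V)" using vs(2) by (simp add: dform_def)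
next
  note A = module_alg[OF V]
  fix x vs j assume g: "(x, vs) \<in> fa_gens P V" and j: "j < length vs"
  note f = fa_gensE[OF g, simplified]
  have vl: "map (fa_var R P V) vs \<in> lists (carrier (Al V))" using f(3) by (rule var_list[OF V])
  have "(\<lambda>v. fop V x ((map (fa_var R P V) (vs[j := v]))[i := h (vs[j := v] ! i)])) \<in> lin_maps R V (Al V)" if i: "i \<in> {..<length vs}" for i
  proof (cases "i = j")
    case True
    have "(\<lambda>v. fop V x ((map (fa_var R P V) vs)[j := h v])) \<in> lin_maps R V (Al V)"
      by (rule lin_maps_comp[OF h fop_slot[OF V f(1) vl]]) (use f j in simp_all)
    then show ?thesis using True j by (simp add: map_update)
  next
    case False
    have "h (vs ! i) \<in> carrier (Al V)" using i f(3) by (intro lin_maps_closed[OF h] lists_nth) simp_all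
    then have l: "(map (fa_var R P V) vs)[i := h (vs ! i)] \<in> lists (carrier (Al V))" by (rule lists_update[OF vl])
    have "(\<lambda>v. fop V x ((map (fa_var R P V) vs)[i := h (vs ! i), j := var V v])) \<in> lin_maps R V (Al V)"
      by (rule lin_maps_comp[OF var_lin[OF V] fop_slot[OF V f(1) l]]) (use f j in simp_all)
    moreover have "(map (fa_var R P V) (vs[j := v]))[i := h (vs[j := v] ! i)] = (map (fa_var R P V) vs)[i := h (vs ! i), j := var V v]" for v
      using False by (simp add: map_update list_update_swap[OF False])
    ultimately show ?thesis by presburger
  qed
  then have "(\<lambda>v. \<Oplus>\<^bsub>Al V\<^esub>i\<in>{..<length vs}. fop V x ((map (fa_var R P V) (vs[j := v]))[i := h (vs[j := v] ! i)])) \<in> lin_maps R V (Al V)"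
    by (rule lin_maps_finsum[OF A])
  then show "(\<lambda>v. dform V h (x, vs[j := v])) \<in> lin_maps R V (Al V)" by (simp add: dform_def)
next
  note A = module_alg[OF V]
  fix n \<sigma> \<mu> vs assume g: "((n, \<mu>), vs) \<in> fa_gens P V" and \<sigma>: "\<sigma> permutes {..<n}"
  note f = fa_gensE[OF g, simplified]
  interpret A: module R "Al V" by (rule A)
  have pv: "\<sigma> permutes {..<length vs}" using \<sigma> f(4) by simp
  have hi: "h (vs ! i) \<in> carrier (Al V)" if "i < n" for i using that f by (intro lin_maps_closed[OF h] lists_nth) simp_all
  let ?F = "\<lambda>i. fop V (n, \<mu>) ((map (fa_var R P V) vs)[i := h (vs ! i)])"
  have Fc: "?F i \<in> carrier (Al V)" if "i < n" for i
    using f hi[OF that] by (intro fop_closed[OF V] lists_update var_list[OF V]) simp_all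
  have im: "\<sigma> ` {..<n} = {..<n}" using \<sigma> by (rule permutes_image)
  have s: "\<sigma> i < n" if "i < n" for i using permutes_in_image[OF \<sigma>, of i] that by simp
  have "fop V (n, act P n \<sigma> \<mu>) ((map (fa_var R P V) (permute_list \<sigma> vs))[i := h (permute_list \<sigma> vs ! i)]) = ?F (\<sigma> i)" if i: "i < n" for i
  proof -
    have "permute_list \<sigma> ((map (fa_var R P V) vs)[\<sigma> i := h (vs ! \<sigma> i)]) = (permute_list \<sigma> (map (fa_var R P V) vs))[i := h (vs ! \<sigma> i)]"
      using permute_list_update[of \<sigma> "map (fa_var R P V) vs" "\<sigma> i"] pv s[OF i] f(4) permutes_inverses(2)[OF \<sigma>] by simp
    also have "\<dots> = (map (fa_var R P V) (permute_list \<sigma> vs))[i := h (permute_list \<sigma> vs ! i)]"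
      using pv i f(4) by (simp add: permute_list_map permute_list_nth)
    finally have e: "(map (fa_var R P V) (permute_list \<sigma> vs))[i := h (permute_list \<sigma> vs ! i)] =
      permute_list \<sigma> ((map (fa_var R P V) vs)[\<sigma> i := h (vs ! \<sigma> i)])" by simp
    show ?thesis unfolding e
      using f hi[OF s[OF i]] by (intro fop_equivariant[OF V _ \<sigma>] lists_update var_list[OF V]) simp_all
  qed
  then have "(\<Oplus>\<^bsub>Al V\<^esub>i\<in>{..<n}. fop V (n, act P n \<sigma> \<mu>) ((map (fa_var R P V) (permute_list \<sigma> vs))[i := h (permute_list \<sigma> vs ! i)])) =
      (\<Oplus>\<^bsub>Al V\<^esub>i\<in>{..<n}. ?F (\<sigma> i))"
    using Fc s by (intro A.finsum_cong'[OF refl]) (simp_all add: Pi_iff)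
  then have "dform V h ((n, act P n \<sigma> \<mu>), permute_list \<sigma> vs) = (\<Oplus>\<^bsub>Al V\<^esub>i\<in>{..<n}. ?F (\<sigma> i))"
    using f(4) by (simp add: dform_def)
  also have "\<dots> = (\<Oplus>\<^bsub>Al V\<^esub>i\<in>\<sigma> ` {..<n}. ?F i)"
    using Fc s inj_on_subset[OF permutes_inj[OF \<sigma>]] by (intro A.finsum_reindex[symmetric]) auto
  finally show "dform V h ((n, act P n \<sigma> \<mu>), permute_list \<sigma> vs) = dform V h ((n, \<mu>), vs)"
    unfolding im using f(4) by (simp add: dform_def)
qed

lemma Der_carrier:
  "d \<in> carrier (Der R P V) \<longleftrightarrow> d \<in> lin_maps R (Al V) (Al V) \<and> d \<in> extensional (carrier (Al V)) \<and>
    (\<forall>x\<in>ops P. \<forall>Xs\<in>lists (carrier (Al V)). length Xs = fst x \<longrightarrow>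
          d (fop V x Xs) = (\<Oplus>\<^bsub>Al V\<^esub>i\<in>{..<length Xs}. fop V x (Xs[i := d (Xs ! i)])))"
  by (auto simp: Der_def Let_def)

lemma Der_simps:
  "\<zero>\<^bsub>Der R P V\<^esub> = (\<lambda>X\<in>carrier (Al V). \<zero>\<^bsub>Al V\<^esub>)" "d \<oplus>\<^bsub>Der R P V\<^esub> e = (\<lambda>X\<in>carrier (Al V). d X \<oplus>\<^bsub>Al V\<^esub> e X)"
  "a \<odot>\<^bsub>Der R P V\<^esub> d = (\<lambda>X\<in>carrier (Al V). a \<odot>\<^bsub>Al V\<^esub> d X)"
  by (simp_all add: Der_def Let_def)

lemma leibniz_slot:
  assumes V: "module R V" and x: "x \<in> ops P" and D: "D \<in> lin_maps R (Al V) (Al V)"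
    and Xs: "Xs \<in> lists (carrier (Al V))" "length Xs = fst x" "j < fst x"
  shows "(\<lambda>X. \<Oplus>\<^bsub>Al V\<^esub>i\<in>{..<fst x}. fop V x (Xs[j := X, i := D (Xs[j := X] ! i)])) \<in> lin_maps R (Al V) (Al V)"
proof (rule lin_maps_finsum[OF module_alg[OF V]])
  fix i assume i: "i \<in> {..<fst x}"
  show "(\<lambda>X. fop V x (Xs[j := X, i := D (Xs[j := X] ! i)])) \<in> lin_maps R (Al V) (Al V)"
  proof (cases "i = j")
    case True
    have "(\<lambda>X. fop V x (Xs[j := D X])) \<in> lin_maps R (Al V) (Al V)"
      by (rule lin_maps_comp[OF D fop_slot[OF V x Xs]])
    then show ?thesis using True Xs by simp
  next
    case False
    have "D (Xs ! i) \<in> carrier (Al V)" using i Xs by (intro lin_maps_closed[OF D] lists_nth) simp_all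
    then have "(\<lambda>X. fop V x (Xs[i := D (Xs ! i), j := X])) \<in> lin_maps R (Al V) (Al V)"
      using Xs by (intro fop_slot[OF V x] lists_update) simp_all
    moreover have "Xs[j := X, i := D (Xs[j := X] ! i)] = Xs[i := D (Xs ! i), j := X]" for X
      using False by (simp add: list_update_swap[OF False])
    ultimately show ?thesis by presburger
  qed
qed

text \<open>On terms the extension is forced to be \<open>\<mu>(v\<^sub>1, \<dots>, v\<^sub>n) \<mapsto> \<Sum>\<^sub>i \<mu>(v\<^sub>1, \<dots>, h(v\<^sub>i), \<dots>, v\<^sub>n)\<close>, which respects
  the relations; the Leibniz rule for a composite of terms reorganises the sum over all leaves into a sum over the
  composed terms.\<close>
lemma derivation_exists:
  assumes V: "module R V" and h: "h \<in> lin_maps R V (Al V)"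
  shows "\<exists>d\<in>carrier (Der R P V). \<forall>v\<in>carrier V. d (var V v) = h v"
proof -
  note A = module_alg[OF V]
  interpret A: module R "Al V" by (rule A)
  note C = dform_compat[OF V h]
  define D where "D = (\<lambda>X. lin_ext R (Al V) (dform V h) (fa_rep X))"
  have D: "D \<in> lin_maps R (Al V) (Al V)" and Dt: "\<And>g. g \<in> fa_gens P V \<Longrightarrow> D (tm V g) = dform V h g"
    unfolding D_def using fa_lift[OF V A C] by auto
  have Dc: "X \<in> carrier (Al V) \<Longrightarrow> D X \<in> carrier (Al V)" for X using D by (rule lin_maps_closed)
  have leib: "D (fop V x Xs) = (\<Oplus>\<^bsub>Al V\<^esub>i\<in>{..<fst x}. fop V x (Xs[i := D (Xs ! i)]))"
    if x: "x \<in> ops P" and Xs: "Xs \<in> lists (carrier (Al V))" "length Xs = fst x" for x Xs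
  proof (rule alg_multilin_eqI[OF V A _ _ _ Xs])
    fix Xs j assume Xs: "Xs \<in> lists (carrier (Al V))" "length Xs = fst x" "j < fst x"
    show "(\<lambda>X. D (fop V x (Xs[j := X]))) \<in> lin_maps R (Al V) (Al V)"
      by (rule lin_maps_comp[OF fop_slot[OF V x Xs] D])
    show "(\<lambda>X. \<Oplus>\<^bsub>Al V\<^esub>i\<in>{..<fst x}. fop V x (Xs[j := X, i := D (Xs[j := X] ! i)])) \<in> lin_maps R (Al V) (Al V)"
      by (rule leibniz_slot[OF V x D Xs])
  next
    fix gs assume gs: "gs \<in> lists (fa_gens P V)" "length gs = fst x"
    let ?wss = "map snd gs"
    note gl = gens_lists[OF gs(1)]
    have gk: "gs ! k \<in> fa_gens P V" if "k < length gs" for k using gs(1) that by (rule lists_nth)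
    have tl: "map (tm V) gs \<in> lists (carrier (Al V))" using gs(1) by (rule tm_list[OF V])
    have cg: "cgen x gs \<in> fa_gens P V" by (rule cgen_closed[OF x gs])
    let ?F = "\<lambda>J. fop V (comp_op P x (map fst gs)) ((map (fa_var R P V) (concat ?wss))[J := h (concat ?wss ! J)])"
    have Fc: "?F J \<in> carrier (Al V)" if "J < length (concat ?wss)" for J
      using that fa_gensE[OF cg] lists_nth[OF gl(2) that]
      by (intro fop_closed[OF V] lists_update var_list[OF V] lin_maps_closed[OF h]) simp_all
    have wk: "snd (gs ! k) \<in> lists (carrier V)" "fst (gs ! k) \<in> ops P" "length (snd (gs ! k)) = fst (fst (gs ! k))" if "k < length gs" for k
      using fa_gensE[OF gk[OF that]] by auto
    have "D (fop V x (map (tm V) gs)) = dform V h (cgen x gs)" using fop_terms[OF V x gs] Dt[OF cg] by simp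
    also have "\<dots> = (\<Oplus>\<^bsub>Al V\<^esub>J\<in>{..<length (concat ?wss)}. ?F J)" by (simp add: dform_def)
    also have "\<dots> = (\<Oplus>\<^bsub>Al V\<^esub>i\<in>{..<length ?wss}. \<Oplus>\<^bsub>Al V\<^esub>j\<in>{..<length (?wss ! i)}. ?F (length (concat (take i ?wss)) + j))"
      using Fc by (intro finsum_concat) (unfold_locales, blast)
    also have "\<dots> = (\<Oplus>\<^bsub>Al V\<^esub>i\<in>{..<fst x}. fop V x ((map (tm V) gs)[i := D (map (tm V) gs ! i)]))"
    proof (rule A.finsum_cong')
      show "{..<length ?wss} = {..<fst x}" using gs by simp
      have Di: "D (map (tm V) gs ! i) \<in> carrier (Al V)" if "i < fst x" for i
        using that gs by (intro Dc lists_nth[OF tl]) simp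
      show "(\<lambda>i. fop V x ((map (tm V) gs)[i := D (map (tm V) gs ! i)])) \<in> {..<fst x} \<rightarrow> carrier (Al V)"
        using gs(2) Di by (intro funcsetI fop_closed[OF V x] lists_update tl) simp_all
      fix i assume "i \<in> {..<fst x}"
      then have i: "i < length gs" "i < fst x" using gs by simp_all
      note L = fop_slot[OF V x tl _ i(2)]
      let ?G = "\<lambda>j. fop V (fst (gs ! i)) ((map (fa_var R P V) (snd (gs ! i)))[j := h (snd (gs ! i) ! j)])"
      have hj: "h (snd (gs ! i) ! j) \<in> carrier (Al V)" if "j < length (snd (gs ! i))" for j
        using lists_nth[OF wk(1)[OF i(1)] that] by (rule lin_maps_closed[OF h])
      have Gc: "?G j \<in> carrier (Al V)" if "j < length (snd (gs ! i))" for j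
        using that wk[OF i(1)] hj[OF that] by (intro fop_closed[OF V] lists_update var_list[OF V]) simp_all
      have Fj: "?F (length (concat (take i ?wss)) + j) = fop V x ((map (tm V) gs)[i := ?G j])" if "j < length (snd (gs ! i))" for j
        using fop_assoc_one[OF V x gs i(1) that hj[OF that]] concat_position(2)[of i ?wss j] i that by simp
      have Gl: "fop V x ((map (tm V) gs)[i := X]) \<in> carrier (Al V)" if "X \<in> carrier (Al V)" for X
        using gs(2) that by (intro fop_closed[OF V x] lists_update tl) simp_all
      have "(\<Oplus>\<^bsub>Al V\<^esub>j\<in>{..<length (?wss ! i)}. ?F (length (concat (take i ?wss)) + j)) =
          (\<Oplus>\<^bsub>Al V\<^esub>j\<in>{..<length (snd (gs ! i))}. fop V x ((map (tm V) gs)[i := ?G j]))"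
        using i Fj Gl[OF Gc] by (intro A.finsum_cong') (simp_all add: Pi_iff)
      also have "\<dots> = fop V x ((map (tm V) gs)[i := \<Oplus>\<^bsub>Al V\<^esub>j\<in>{..<length (snd (gs ! i))}. ?G j])"
        using gs(2) Gc by (intro lin_maps_finsum_apply[OF A A L, symmetric]) simp_all
      also have "(\<Oplus>\<^bsub>Al V\<^esub>j\<in>{..<length (snd (gs ! i))}. ?G j) = D (map (tm V) gs ! i)"
        using i Dt[OF gk[OF i(1)]] by (simp add: dform_def)
      finally show "(\<Oplus>\<^bsub>Al V\<^esub>j\<in>{..<length (?wss ! i)}. ?F (length (concat (take i ?wss)) + j)) =
        fop V x ((map (tm V) gs)[i := D (map (tm V) gs ! i)])" .
    qed
    finally show "D (fop V x (map (tm V) gs)) = (\<Oplus>\<^bsub>Al V\<^esub>i\<in>{..<fst x}. fop V x ((map (tm V) gs)[i := D (map (tm V) gs ! i)]))" .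
  qed
  let ?d = "restrict D (carrier (Al V))"
  have "?d \<in> carrier (Der R P V)"
    unfolding Der_carrier
  proof (intro conjI ballI impI)
    show "?d \<in> lin_maps R (Al V) (Al V)" using A D by (rule lin_maps_cong) simp
    show "?d \<in> extensional (carrier (Al V))" by simp
    fix x Xs assume x: "x \<in> ops P" and Xs: "Xs \<in> lists (carrier (Al V))" "length Xs = fst x"
    have n: "Xs ! i \<in> carrier (Al V)" if "i < fst x" for i using lists_nth[OF Xs(1)] Xs(2) that by simp
    have "fop V x (Xs[i := D (Xs ! i)]) \<in> carrier (Al V)" if "i < fst x" for i
      using Xs(2) by (intro fop_closed[OF V x] lists_update Xs(1) Dc n that) simp
    then have "(\<Oplus>\<^bsub>Al V\<^esub>i\<in>{..<length Xs}. fop V x (Xs[i := ?d (Xs ! i)])) = (\<Oplus>\<^bsub>Al V\<^esub>i\<in>{..<fst x}. fop V x (Xs[i := D (Xs ! i)]))"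
      using Xs(2) n by (intro A.finsum_cong') (simp_all add: Pi_iff)
    then show "?d (fop V x Xs) = (\<Oplus>\<^bsub>Al V\<^esub>i\<in>{..<length Xs}. fop V x (Xs[i := ?d (Xs ! i)]))"
      using leib[OF x Xs] fop_closed[OF V x Xs] by simp
  qed
  moreover have "?d (var V v) = h v" if v: "v \<in> carrier V" for v
  proof -
    have hv: "h v \<in> carrier (Al V)" using v by (rule lin_maps_closed[OF h])
    have "D (var V v) = dform V h ((1, unt P), [v])" unfolding var_tm by (rule Dt[OF var_gen[OF v]])
    also have "\<dots> = fop V (1, unt P) [h v]"
      using hv fop_unt[OF V hv] by (simp add: dform_def lessThan_Suc)
    finally show ?thesis using fop_unt[OF V hv] var_closed[OF V v] by simp
  qed
  ultimately show ?thesis by blast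
qed

subsection \<open>Functoriality\<close>

lemma fa_map_facts:
  assumes V: "module R V" and W: "module R W" and h: "h \<in> lin_maps R V W"
  shows fa_map_lin: "fa_map R P W h \<in> lin_maps R (Al V) (Al W)"
    and fa_map_tm: "\<And>g. g \<in> fa_gens P V \<Longrightarrow> fa_map R P W h (tm V g) = tm W (fst g, map h (snd g))"
proof -
  note A = module_alg[OF W]
  note TC = fa_compatD[OF tm_compat[OF W]]
  have ml: "map h vs \<in> lists (carrier W)" if "vs \<in> lists (carrier V)" for vs
    using that by (rule lin_maps_list[OF h])
  have mg: "(x, map h vs) \<in> fa_gens P W" if "(x, vs) \<in> fa_gens P V" for x vs
    using that ml[of vs] by (auto simp: fa_gens_def)
  have C: "fa_compat V (Al W) (\<lambda>g. tm W (fst g, map h (snd g)))"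
    unfolding fa_compat_def
  proof (intro conjI allI impI)
    fix n vs assume "vs \<in> lists (carrier V)" "length vs = n"
    then show "(\<lambda>\<mu>. tm W (fst ((n, \<mu>), vs), map h (snd ((n, \<mu>), vs)))) \<in> lin_maps R (Op P n) (Al W)"
      using TC(1)[OF ml, of vs n] by simp
  next
    fix x vs i assume g: "(x, vs) \<in> fa_gens P V" "i < length vs"
    then show "(\<lambda>v. tm W (fst (x, vs[i := v]), map h (snd (x, vs[i := v])))) \<in> lin_maps R V (Al W)"
      using lin_maps_comp[OF h TC(2)[OF mg[OF g(1)], of i]] by (simp add: map_update)
  next
    fix n \<sigma> \<mu> vs assume g: "((n, \<mu>), vs) \<in> fa_gens P V" "\<sigma> permutes {..<n}"
    then have "\<sigma> permutes {..<length vs}" by (simp add: fa_gens_iff)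
    then show "tm W (fst ((n, act P n \<sigma> \<mu>), permute_list \<sigma> vs), map h (snd ((n, act P n \<sigma> \<mu>), permute_list \<sigma> vs))) =
      tm W (fst ((n, \<mu>), vs), map h (snd ((n, \<mu>), vs)))"
      using TC(3)[OF mg[OF g(1)] g(2)] by (simp add: permute_list_map)
  qed
  have e: "fa_map R P W h = (\<lambda>X. lin_ext R (Al W) (\<lambda>g. tm W (fst g, map h (snd g))) (fa_rep X))"
    by (simp add: fa_map_def[abs_def] case_prod_beta')
  show "fa_map R P W h \<in> lin_maps R (Al V) (Al W)" unfolding e by (rule fa_lift(1)[OF V A C])
  show "\<And>g. g \<in> fa_gens P V \<Longrightarrow> fa_map R P W h (tm V g) = tm W (fst g, map h (snd g))"
    unfolding e by (rule fa_lift(2)[OF V A C])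
qed

lemma fa_map_var:
  assumes "module R V" "module R W" "h \<in> lin_maps R V W" "v \<in> carrier V"
  shows "fa_map R P W h (var V v) = var W (h v)"
  unfolding var_tm using fa_map_tm[OF assms(1-3) var_gen[OF assms(4)]] by simp

lemma fa_map_fop:
  assumes V: "module R V" and W: "module R W" and h: "h \<in> lin_maps R V W" and x: "x \<in> ops P"
    and Xs: "Xs \<in> lists (carrier (Al V))" "length Xs = fst x"
  shows "fa_map R P W h (fop V x Xs) = fop W x (map (fa_map R P W h) Xs)"
proof (rule alg_multilin_eqI[OF V module_alg[OF W] _ _ _ Xs])
  note f = fa_map_lin[OF V W h]
  fix Xs i assume Xs: "Xs \<in> lists (carrier (Al V))" "length Xs = fst x" "i < fst x"
  show "(\<lambda>X. fa_map R P W h (fop V x (Xs[i := X]))) \<in> lin_maps R (Al V) (Al W)"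
    by (rule lin_maps_comp[OF fop_slot[OF V x Xs] f])
  have "map (fa_map R P W h) Xs \<in> lists (carrier (Al W))" using Xs(1) by (rule lin_maps_list[OF f])
  then have "(\<lambda>X. fop W x ((map (fa_map R P W h) Xs)[i := fa_map R P W h X])) \<in> lin_maps R (Al V) (Al W)"
    using Xs by (intro lin_maps_comp[OF f] fop_slot[OF W x]) simp_all
  then show "(\<lambda>X. fop W x (map (fa_map R P W h) (Xs[i := X]))) \<in> lin_maps R (Al V) (Al W)" by (simp add: map_update)
next
  fix gs assume gs: "gs \<in> lists (fa_gens P V)" "length gs = fst x"
  let ?hs = "map (\<lambda>g. (fst g, map h (snd g))) gs"
  have ml: "map h vs \<in> lists (carrier W)" if "vs \<in> lists (carrier V)" for vs
    using that by (rule lin_maps_list[OF h])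
  have g: "(fst g, map h (snd g)) \<in> fa_gens P W" if "g \<in> fa_gens P V" for g
    using fa_gensE[OF that] ml[of "snd g"] by (simp add: fa_gens_def)
  have hs: "?hs \<in> lists (fa_gens P W)" using g gs(1) by (auto simp: in_lists_conv_set)
  have m: "map (fa_map R P W h) (map (tm V) gs) = map (tm W) ?hs"
    using gs(1) fa_map_tm[OF V W h] by (auto simp: in_lists_conv_set)
  have c: "(fst (cgen x gs), map h (snd (cgen x gs))) = cgen x ?hs" by (simp add: map_concat comp_def)
  have "fa_map R P W h (fop V x (map (tm V) gs)) = tm W (cgen x ?hs)"
    unfolding fop_terms[OF V x gs] fa_map_tm[OF V W h cgen_closed[OF x gs]] c ..
  also have "\<dots> = fop W x (map (tm W) ?hs)" using gs(2) by (intro fop_terms[OF W x hs, symmetric]) simp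
  finally show "fa_map R P W h (fop V x (map (tm V) gs)) = fop W x (map (fa_map R P W h) (map (tm V) gs))"
    unfolding m .
qed

end

section \<open>Binary operads: structural induction on free algebras\<close>

subsection \<open>Planar trees\<close>

text \<open>Planar trees number their leaves from left to right. The offset \<open>a\<close> makes the subtrees of a planar tree
  planar as well.\<close>
fun planar :: "nat \<Rightarrow> 'b btree \<Rightarrow> 'b btree" where
  "planar a (Leaf i) = Leaf a"
| "planar a (Node b l r) = Node b (planar a l) (planar (a + length (leaves l)) r)"

lemma relabel_simps [simp]:
  "relabel f (Leaf i) = Leaf (f i)" "relabel f (Node b l r) = Node b (relabel f l) (relabel f r)"
  by (simp_all add: relabel_def)

lemma leaves_planar [simp]: "leaves (planar a t) = [a..<a + length (leaves t)]"
proof (induction t arbitrary: a)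
  case (Node b l r)
  have "[a..<a + length (leaves l) + length (leaves r)] =
    [a..<a + length (leaves l)] @ [a + length (leaves l)..<a + length (leaves l) + length (leaves r)]"
    by (rule upt_add_eq_append) simp
  then show ?case using Node by (simp add: add.assoc)
qed simp

lemma set_btree_planar [simp]: "set_btree (planar a t) = set_btree t"
  by (induction t arbitrary: a) auto

lemma relabel_shift_planar: "relabel (\<lambda>j. c + j) (planar a t) = planar (c + a) t"
  by (induction t arbitrary: a) (auto simp: add.assoc)

lemma relabel_add_zero: "relabel ((+) 0) t = t"
  by (induction t) auto

lemma relabel_planar: "(\<And>i. i < length (leaves t) \<Longrightarrow> f (a + i) = leaves t ! i) \<Longrightarrow> relabel f (planar a t) = t"
proof (induction t arbitrary: a)
  case (Node b l r)
  have "f (a + i) = leaves l ! i" if "i < length (leaves l)" for i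
    using Node.prems[of i] that by (simp add: nth_append)
  moreover have "f (a + length (leaves l) + i) = leaves r ! i" if "i < length (leaves r)" for i
    using Node.prems[of "length (leaves l) + i"] that by (simp add: add.assoc)
  ultimately show ?case using Node.IH by simp
qed auto

lemma relabel_inj: "inj f \<Longrightarrow> relabel f s = relabel f t \<Longrightarrow> s = t"
proof (induction s arbitrary: t)
  case (Leaf i)
  then show ?case by (cases t) (auto dest: injD)
next
  case (Node b l r)
  then show ?case by (cases t) auto
qed

lemma (in ground_ring) multilin_ext_basis_single:
  assumes "module R M" "h xs \<in> carrier M"
  shows "multilin_ext R M h (map (basis R) xs) = h xs"
proof -
  interpret M: module R M by fact
  let ?fs = "map (basis R) xs"
  let ?p = "\<lambda>ys. \<Otimes>i\<in>{..<length ?fs}. (?fs ! i) (ys ! i)"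
  have p: "?p ys \<in> carrier R" for ys
    by (intro finprod_closed) (auto simp: basis_def)
  have eq: "ys = xs" if "ys \<in> listset (map (supp R) ?fs)" for ys
    using that unfolding listset_closed by (auto intro!: nth_equalityI dest!: subsetD[OF supp_basis])
  have "multilin_ext R M h ?fs = multilin_ext R M (\<lambda>_. h xs) ?fs"
    unfolding multilin_ext_def using eq p assms(2)
    by (intro M.finsum_cong') auto
  also have "\<dots> = h xs"
    using multilin_ext_basis[OF assms(1), of xs UNIV "\<lambda>_. h xs"] assms(2) by auto
  finally show ?thesis .
qed

locale bin_operad = operad R P for R :: "'r ring" (structure) and P :: "('r, 'o) operad" +
  assumes binary: "binary_operad R P"

subsection \<open>The binary operations\<close>

context operad
begin

definition bop :: "('r, 'v) module \<Rightarrow> 'o \<Rightarrow> ('r, 'o, 'v) fa \<Rightarrow> ('r, 'o, 'v) fa \<Rightarrow> ('r, 'o, 'v) fa" where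
  "bop V b X Y = fop V (2, b) [X, Y]"

lemma op2: "b \<in> carrier (Op P 2) \<Longrightarrow> (2, b) \<in> ops P"
  by (simp add: ops_def)

lemma bop_closed: "module R V \<Longrightarrow> b \<in> carrier (Op P 2) \<Longrightarrow> X \<in> carrier (Al V) \<Longrightarrow> Y \<in> carrier (Al V) \<Longrightarrow> bop V b X Y \<in> carrier (Al V)"
  unfolding bop_def by (intro fop_closed) (auto simp: op2)

lemma bop_left: "module R V \<Longrightarrow> b \<in> carrier (Op P 2) \<Longrightarrow> Y \<in> carrier (Al V) \<Longrightarrow> (\<lambda>X. bop V b X Y) \<in> lin_maps R (Al V) (Al V)"
  unfolding bop_def using fop_slot[of V "(2, b)" "[Y, Y]" 0] by (simp add: op2)

lemma bop_right: "module R V \<Longrightarrow> b \<in> carrier (Op P 2) \<Longrightarrow> X \<in> carrier (Al V) \<Longrightarrow> (\<lambda>Y. bop V b X Y) \<in> lin_maps R (Al V) (Al V)"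
  unfolding bop_def using fop_slot[of V "(2, b)" "[X, X]" 1] by (simp add: op2)

lemma bop_tm:
  assumes "module R V" "b \<in> carrier (Op P 2)" "g \<in> fa_gens P V" "g' \<in> fa_gens P V"
  shows "bop V b (tm V g) (tm V g') = tm V ((fst (fst g) + fst (fst g'), cmp P (2, b) [fst g, fst g']), snd g @ snd g')"
  using fop_terms[OF assms(1) op2[OF assms(2)], of "[g, g']"] assms(3,4)
  by (simp add: bop_def comp_op_def total_arity_def)

lemma bop_gen:
  assumes "b \<in> carrier (Op P 2)" "g \<in> fa_gens P V" "g' \<in> fa_gens P V"
  shows "((fst (fst g) + fst (fst g'), cmp P (2, b) [fst g, fst g']), snd g @ snd g') \<in> fa_gens P V"
  using cgen_closed[OF op2[OF assms(1)], of "[g, g']" V] assms(2,3)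
  by (simp add: comp_op_def total_arity_def)

lemma fa_map_bop:
  assumes "module R V" "module R W" "h \<in> lin_maps R V W" "b \<in> carrier (Op P 2)" "X \<in> carrier (Al V)" "Y \<in> carrier (Al V)"
  shows "fa_map R P W h (bop V b X Y) = bop W b (fa_map R P W h X) (fa_map R P W h Y)"
  using fa_map_fop[OF assms(1-3) op2[OF assms(4)], of "[X, Y]"] assms(5,6) by (simp add: bop_def)

lemma Der_lin: "d \<in> carrier (Der R P V) \<Longrightarrow> d \<in> lin_maps R (Al V) (Al V)"
  by (simp add: Der_carrier)

lemma Der_closed: "d \<in> carrier (Der R P V) \<Longrightarrow> X \<in> carrier (Al V) \<Longrightarrow> d X \<in> carrier (Al V)"
  by (rule lin_maps_closed[OF Der_lin])

lemma Der_ext: "d \<in> carrier (Der R P V) \<Longrightarrow> d \<in> extensional (carrier (Al V))"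
  by (simp add: Der_carrier)

lemma Der_bop:
  assumes V: "module R V" and d: "d \<in> carrier (Der R P V)" and b: "b \<in> carrier (Op P 2)"
    and X: "X \<in> carrier (Al V)" and Y: "Y \<in> carrier (Al V)"
  shows "d (bop V b X Y) = bop V b (d X) Y \<oplus>\<^bsub>Al V\<^esub> bop V b X (d Y)"
proof -
  interpret A: module R "Al V" by (rule module_alg[OF V])
  have "\<And>x Xs. x \<in> ops P \<Longrightarrow> Xs \<in> lists (carrier (Al V)) \<Longrightarrow> length Xs = fst x \<Longrightarrow>
    d (fop V x Xs) = (\<Oplus>\<^bsub>Al V\<^esub>i\<in>{..<length Xs}. fop V x (Xs[i := d (Xs ! i)]))"
    using d unfolding Der_carrier by blast
  from this[OF op2[OF b], of "[X, Y]"]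
  have e: "d (bop V b X Y) = (\<Oplus>\<^bsub>Al V\<^esub>i\<in>{..<2}. fop V (2, b) ([X, Y][i := d ([X, Y] ! i)]))"
    using X Y by (simp add: bop_def numeral_2_eq_2)
  have s: "{..<2::nat} = insert 0 {1}" by auto
  have "bop V b (d X) Y \<in> carrier (Al V)" "bop V b X (d Y) \<in> carrier (Al V)"
    using X Y Der_closed[OF d] by (auto intro: bop_closed[OF V b])
  then show ?thesis unfolding e s by (subst A.finsum_insert) (auto simp: bop_def)
qed

end

context bin_operad
begin

text \<open>Since \<open>O\<close> is a quotient of a free operad on binary generators, an operation is a sum of operations given
  by labelled trees, up to permutation by planar ones, and these are iterated binary operations. The family \<open>S\<close>
  keeps track of the variables occurring in a term.\<close>
lemma term_induct:
  assumes V: "module R V"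
    and sub: "\<And>vs. vs \<in> lists (carrier V) \<Longrightarrow> submodule (S vs) R (Al V)"
    and leaf: "\<And>v. v \<in> carrier V \<Longrightarrow> var V v \<in> S [v]"
    and node: "\<And>b us vs X Y. b \<in> carrier (Op P 2) \<Longrightarrow> us \<in> lists (carrier V) \<Longrightarrow> vs \<in> lists (carrier V) \<Longrightarrow>
      us \<noteq> [] \<Longrightarrow> vs \<noteq> [] \<Longrightarrow> X \<in> S us \<Longrightarrow> Y \<in> S vs \<Longrightarrow> bop V b X Y \<in> S (us @ vs)"
    and perm: "\<And>\<sigma> vs. vs \<in> lists (carrier V) \<Longrightarrow> \<sigma> permutes {..<length vs} \<Longrightarrow> S (permute_list \<sigma> vs) \<subseteq> S vs"
    and g: "g \<in> fa_gens P V"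
  shows "tm V g \<in> S (snd g)"
proof -
  obtain B :: "'o set" and \<phi> where hom: "operad_hom R (free_binary_operad R B) P \<phi>"
    and surj: "\<And>n. \<phi> n ` carrier (Op (free_binary_operad R B) n) = carrier (Op P n)"
    using binary unfolding binary_operad_def by blast
  let ?Q = "free_binary_operad R B"
  have Op: "Op ?Q n = free_module R (btrees B n)" for n by (simp add: free_binary_operad_def)
  have lin: "\<phi> n \<in> lin_maps R (free_module R (btrees B n)) (Op P n)" for n
    using hom unfolding operad_hom_def by (simp add: Op)
  have act: "\<phi> n (act ?Q n \<sigma> \<mu>) = act P n \<sigma> (\<phi> n \<mu>)"
    if "\<sigma> permutes {..<n}" "\<mu> \<in> carrier (Op ?Q n)" for n \<sigma> \<mu>
    using hom that unfolding operad_hom_def by blast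
  have unt: "\<phi> 1 (unt ?Q) = unt P" using hom unfolding operad_hom_def by blast
  have cmp: "\<phi> (total_arity ys) (cmp ?Q x ys) = cmp P (fst x, \<phi> (fst x) (snd x)) (map (\<lambda>y. (fst y, \<phi> (fst y) (snd y))) ys)"
    if "x \<in> ops ?Q" "ys \<in> lists (ops ?Q)" "length ys = fst x" for x ys
    using hom that unfolding operad_hom_def by blast
  have bc: "basis R t \<in> carrier (free_module R (btrees B n))" if "t \<in> btrees B n" for t n
    using that by (rule basis_closed)
  have \<phi>c: "\<phi> n (basis R t) \<in> carrier (Op P n)" if "t \<in> btrees B n" for t n
    using lin_maps_closed[OF lin bc[OF that]] .
  have pl: "planar 0 t \<in> btrees B (length (leaves t))" if "set_btree t \<subseteq> B" for t
    using that by (auto simp: btrees_def atLeast0LessThan)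
  \<comment> \<open>On planar trees, grafting \<open>l\<close> and \<open>r\<close> on a corolla concatenates the lists of variables.\<close>
  have planar: "tm V ((length (leaves t), \<phi> (length (leaves t)) (basis R (planar 0 t))), vs) \<in> S vs"
    if "set_btree t \<subseteq> B" "vs \<in> lists (carrier V)" "length vs = length (leaves t)" for t vs
    using that
  proof (induction t arbitrary: vs)
    case (Leaf i)
    then obtain v where v: "vs = [v]" "v \<in> carrier V" by (cases vs) auto
    have "\<phi> 1 (basis R (Leaf 0)) = unt P" using unt by (simp add: free_binary_operad_def)
    then show ?case using leaf[OF v(2)] v(1) by (simp add: var_tm)
  next
    case (Node b l r)
    let ?p = "length (leaves l)" and ?q = "length (leaves r)"
    let ?us = "take ?p vs" and ?ws = "drop ?p vs"
    have sB: "set_btree l \<subseteq> B" "set_btree r \<subseteq> B" "b \<in> B" using Node.prems(1) by auto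
    have ne: "leaves t \<noteq> []" for t :: "'o btree" by (induction t) auto
    have uw: "?us \<in> lists (carrier V)" "?ws \<in> lists (carrier V)" "length ?us = ?p" "length ?ws = ?q" "?us @ ?ws = vs"
      using Node.prems by (auto simp: in_lists_conv_set dest: in_set_takeD in_set_dropD)
    have unE: "?us \<noteq> []" "?ws \<noteq> []" using uw ne[of l] ne[of r] by (metis length_0_conv)+
    let ?N = "Node b (Leaf 0) (Leaf 1)"
    let ?x = "(2, basis R ?N)"
    let ?ys = "[(?p, basis R (planar 0 l)), (?q, basis R (planar 0 r))]"
    have N: "?N \<in> btrees B 2" using sB by (auto simp: btrees_def)
    have x: "?x \<in> ops ?Q" using bc[OF N] by (simp add: ops_def Op)
    have ys: "?ys \<in> lists (ops ?Q)" using bc[OF pl[OF sB(1)]] bc[OF pl[OF sB(2)]] by (simp add: ops_def Op)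
    have ta: "total_arity ?ys = ?p + ?q" by (simp add: total_arity_def)
    have gr: "graft (map fst ?ys) ?N [planar 0 l, planar 0 r] = planar 0 (Node b l r)"
      using relabel_shift_planar[of ?p 0 r] by (simp add: graft_def relabel_add_zero)
    have pb: "planar 0 (Node b l r) \<in> btrees B (?p + ?q)" using pl[OF Node.prems(1)] by simp
    have "cmp ?Q ?x ?ys = multilin_ext R (free_module R (btrees B (?p + ?q)))
        (\<lambda>ts. basis R (graft (map fst ?ys) (hd ts) (tl ts))) (map (basis R) [?N, planar 0 l, planar 0 r])"
      by (simp add: free_binary_operad_def total_arity_def)
    also have "\<dots> = basis R (graft (map fst ?ys) ?N [planar 0 l, planar 0 r])"
      using multilin_ext_basis_single[OF module_free_module[of "btrees B (?p + ?q)"],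
          of "\<lambda>ts. basis R (graft (map fst ?ys) (hd ts) (tl ts))" "[?N, planar 0 l, planar 0 r]"] bc[OF pb] gr
      by simp
    finally have c: "cmp ?Q ?x ?ys = basis R (planar 0 (Node b l r))" unfolding gr .
    let ?\<beta> = "\<phi> 2 (basis R ?N)"
    let ?gl = "((?p, \<phi> ?p (basis R (planar 0 l))), ?us)" and ?gr = "((?q, \<phi> ?q (basis R (planar 0 r))), ?ws)"
    have \<beta>: "?\<beta> \<in> carrier (Op P 2)" by (rule \<phi>c[OF N])
    have e: "\<phi> (?p + ?q) (basis R (planar 0 (Node b l r))) = cmp P (2, ?\<beta>) [fst ?gl, fst ?gr]"
      using cmp[OF x ys] unfolding c ta by simp
    have gg: "?gl \<in> fa_gens P V" "?gr \<in> fa_gens P V"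
      using uw \<phi>c[OF pl[OF sB(1)]] \<phi>c[OF pl[OF sB(2)]] by (simp_all add: fa_gens_iff del: in_lists_conv_set)
    have "bop V ?\<beta> (tm V ?gl) (tm V ?gr) \<in> S (?us @ ?ws)"
      using Node.IH(1)[OF sB(1) uw(1,3)] Node.IH(2)[OF sB(2) uw(2,4)] by (intro node[OF \<beta> uw(1,2) unE])
    then show ?case using bop_tm[OF V \<beta> gg] e uw(5) by simp
  qed
  \<comment> \<open>The labels of the leaves of \<open>t\<close> form a permutation that turns \<open>t\<close> into a planar tree.\<close>
  have tree: "tm V ((n, \<phi> n (basis R t)), vs) \<in> S vs"
    if t: "t \<in> btrees B n" and vs: "vs \<in> lists (carrier V)" "length vs = n" for t n vs
  proof -
    have lt: "set_btree t \<subseteq> B" "distinct (leaves t)" "set (leaves t) = {..<n}" using t by (auto simp: btrees_def)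
    have n: "length (leaves t) = n" using distinct_card[OF lt(2)] lt(3) by simp
    let ?\<sigma> = "perm_of (leaves t)"
    have "mset (leaves t) = mset [0..<n]" using lt by (intro set_eq_iff_mset_eq_distinct[THEN iffD1]) (auto simp: atLeast0LessThan)
    then have \<sigma>: "?\<sigma> permutes {..<n}" by (rule perm_of_permutes)
    have rl: "relabel ?\<sigma> (planar 0 t) = t" by (rule relabel_planar) (simp add: perm_of_def)
    have "relabel ?\<sigma> s = t \<longleftrightarrow> s = planar 0 t" for s
      using relabel_inj[OF permutes_inj[OF \<sigma>], of s "planar 0 t"] rl by auto
    then have "act ?Q n ?\<sigma> (basis R t) = basis R (planar 0 t)"
      by (auto simp: free_binary_operad_def basis_def fun_eq_iff)
    then have a: "act P n ?\<sigma> (\<phi> n (basis R t)) = \<phi> n (basis R (planar 0 t))"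
      using act[OF \<sigma>, of "basis R t"] bc[OF t] by (simp add: Op)
    have gt: "((n, \<phi> n (basis R t)), vs) \<in> fa_gens P V" using vs \<phi>c[OF t] by (simp add: fa_gens_iff del: in_lists_conv_set)
    have pv: "?\<sigma> permutes {..<length vs}" using \<sigma> vs(2) by simp
    have "tm V ((n, \<phi> n (basis R t)), vs) = tm V ((n, \<phi> n (basis R (planar 0 t))), permute_list ?\<sigma> vs)"
      using fa_compatD(3)[OF tm_compat[OF V] gt \<sigma>] a by simp
    also have "\<dots> \<in> S (permute_list ?\<sigma> vs)"
      using planar[OF lt(1) permute_list_lists[OF pv vs(1)]] n vs(2) by simp
    finally show ?thesis using perm[OF vs(1) pv] by auto
  qed
  obtain n \<mu> vs where gd: "g = ((n, \<mu>), vs)" by (metis prod.exhaust)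
  have \<mu>: "\<mu> \<in> carrier (Op P n)" and vs: "vs \<in> lists (carrier V)" "length vs = n" using fa_gensE[OF g] gd by auto
  obtain f where f: "f \<in> carrier (free_module R (btrees B n))" "\<mu> = \<phi> n f" using surj[of n] \<mu> by (auto simp: Op)
  have "tm V ((n, \<phi> n f), vs) \<in> S vs"
  proof (rule lin_maps_mspan_into[OF module_free_module module_alg[OF V] lin_maps_comp[OF lin fa_compatD(1)[OF tm_compat[OF V] vs]] _ sub[OF vs(1)]])
    show "basis R ` btrees B n \<subseteq> carrier (free_module R (btrees B n))" using bc by auto
    show "f \<in> mspan R (free_module R (btrees B n)) (basis R ` btrees B n)" using f(1) free_module_mspan_basis by metis
    fix s assume "s \<in> basis R ` btrees B n"
    then show "tm V ((n, \<phi> n s), vs) \<in> S vs" using tree vs by auto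
  qed
  then show ?thesis using gd f(2) by simp
qed

text \<open>This is \<open>term_induct\<close> for a family that ignores the variables. It puts linear combinations and products on
  the same footing, so that no terms appear in arguments by induction on elements of \<open>O(V)\<close>.\<close>
lemma alg_induct [consumes 2, case_names var add smult bop]:
  assumes V: "module R V" and X: "X \<in> carrier (Al V)"
    and "\<And>v. v \<in> carrier V \<Longrightarrow> Q (var V v)"
    and "\<And>X Y. X \<in> carrier (Al V) \<Longrightarrow> Y \<in> carrier (Al V) \<Longrightarrow> Q X \<Longrightarrow> Q Y \<Longrightarrow> Q (X \<oplus>\<^bsub>Al V\<^esub> Y)"
    and "\<And>a X. a \<in> carrier R \<Longrightarrow> X \<in> carrier (Al V) \<Longrightarrow> Q X \<Longrightarrow> Q (a \<odot>\<^bsub>Al V\<^esub> X)"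
    and "\<And>b X Y. b \<in> carrier (Op P 2) \<Longrightarrow> X \<in> carrier (Al V) \<Longrightarrow> Y \<in> carrier (Al V) \<Longrightarrow> Q X \<Longrightarrow> Q Y \<Longrightarrow> Q (bop V b X Y)"
  shows "Q X"
proof -
  note A = module_alg[OF V]
  let ?H = "{X \<in> carrier (Al V). Q X}"
  have z: "\<zero>\<^bsub>Al V\<^esub> \<in> ?H" using assms(3)[OF mod_zero[OF V]] lin_maps_zero[OF V A var_lin[OF V]] mod_zero[OF A] by simp
  have H: "submodule ?H R (Al V)"
    using assms(4,5) z mod_add[OF A] mod_smult[OF A] by (intro submoduleI'[OF A]) auto
  have "(\<lambda>X. X) X \<in> ?H"
  proof (rule alg_lin_into[OF V A lin_maps_id H _ X])
    fix g assume "g \<in> fa_gens P V"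
    then show "tm V g \<in> ?H"
    proof (rule term_induct[OF V, where S = "\<lambda>_. ?H", rotated -1])
      fix v assume "v \<in> carrier V"
      then show "var V v \<in> ?H" using assms(3) var_closed[OF V] by simp
    next
      fix b X Y assume "b \<in> carrier (Op P 2)" "X \<in> ?H" "Y \<in> ?H"
      then show "bop V b X Y \<in> ?H" using assms(6) bop_closed[OF V] by simp
    qed (rule H, rule subset_refl)
  qed
  then show ?thesis by simp
qed

text \<open>Trees have at least one leaf, so \<open>O(0) = 0\<close>. In terms of \<open>term_induct\<close>: only the empty list of variables
  gets the zero module, and it is never of the form \<open>us @ vs\<close> with nonempty parts.\<close>
lemma tm_nullary:
  assumes V: "module R V" and g: "g \<in> fa_gens P V" "snd g = []"
  shows "tm V g = \<zero>\<^bsub>Al V\<^esub>"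
proof -
  note A = module_alg[OF V]
  have "tm V g \<in> (if snd g = [] then {\<zero>\<^bsub>Al V\<^esub>} else carrier (Al V))"
  proof (rule term_induct[OF V, where S = "\<lambda>vs. if vs = [] then {\<zero>\<^bsub>Al V\<^esub>} else carrier (Al V)", OF _ _ _ _ g(1)])
    show "submodule (if vs = [] then {\<zero>\<^bsub>Al V\<^esub>} else carrier (Al V)) R (Al V)" for vs
      using submodule_zero[OF A] submodule_carrier[OF A] by simp
    show "(if permute_list \<sigma> vs = [] then {\<zero>\<^bsub>Al V\<^esub>} else carrier (Al V)) \<subseteq> (if vs = [] then {\<zero>\<^bsub>Al V\<^esub>} else carrier (Al V))"
      for \<sigma> and vs :: "'b list"
    proof -
      have "permute_list \<sigma> vs = [] \<longleftrightarrow> vs = []" by (metis length_0_conv length_permute_list)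
      then show ?thesis by simp
    qed
  qed (use var_closed[OF V] bop_closed[OF V] in auto)
  then show ?thesis using g(2) by simp
qed

subsection \<open>Decomposable elements\<close>

text \<open>The decomposable elements. They form the part of \<open>O(V)\<close> of arity at least two, described without the
  grading.\<close>
definition dec :: "('r, 'v) module \<Rightarrow> ('r, 'o, 'v) fa set" where
  "dec V = mspan R (Al V) {bop V b X Y | b X Y. b \<in> carrier (Op P 2) \<and> X \<in> carrier (Al V) \<and> Y \<in> carrier (Al V)}"

lemma bops_sub: "module R V \<Longrightarrow> {bop V b X Y | b X Y. b \<in> carrier (Op P 2) \<and> X \<in> carrier (Al V) \<and> Y \<in> carrier (Al V)} \<subseteq> carrier (Al V)"
  using bop_closed[of V] by auto

lemma submodule_dec: "module R V \<Longrightarrow> submodule (dec V) R (Al V)"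
  unfolding dec_def by (intro submodule_mspan module_alg bops_sub)

lemma dec_sub: "module R V \<Longrightarrow> X \<in> dec V \<Longrightarrow> X \<in> carrier (Al V)"
  using submodule_facts(1)[OF module_alg submodule_dec] by blast

lemma bop_dec: "b \<in> carrier (Op P 2) \<Longrightarrow> X \<in> carrier (Al V) \<Longrightarrow> Y \<in> carrier (Al V) \<Longrightarrow> bop V b X Y \<in> dec V"
  unfolding dec_def by (rule mspan_memI) auto

lemma dec_into:
  assumes "module R V" "module R M" "T \<in> lin_maps R (Al V) M" "submodule H R M"
    "\<And>b X Y. b \<in> carrier (Op P 2) \<Longrightarrow> X \<in> carrier (Al V) \<Longrightarrow> Y \<in> carrier (Al V) \<Longrightarrow> T (bop V b X Y) \<in> H"
    "X \<in> dec V"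
  shows "T X \<in> H"
  by (rule lin_maps_mspan_into[OF module_alg[OF assms(1)] assms(2,3) bops_sub[OF assms(1)] assms(4) _ assms(6)[unfolded dec_def]])
    (use assms(5) in auto)

lemma fa_deg_gens_sub: "module R V \<Longrightarrow> {fa_term R P V x vs | x vs. (x, vs) \<in> fa_gens P V \<and> fst x = n} \<subseteq> carrier (Al V)"
  using tm_closed[of V] by force

lemma submodule_fa_deg: "module R V \<Longrightarrow> submodule (fa_deg R P V n) R (Al V)"
  unfolding fa_deg_def by (intro submodule_mspan module_alg fa_deg_gens_sub)

lemma tm_deg: "g \<in> fa_gens P V \<Longrightarrow> tm V g \<in> fa_deg R P V (fst (fst g))"
  unfolding fa_deg_def by (rule mspan_memI) (metis (mono_tags, lifting) mem_Collect_eq prod.collapse)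

lemma fa_deg_into:
  assumes "module R V" "module R M" "T \<in> lin_maps R (Al V) M" "submodule H R M"
    "\<And>g. g \<in> fa_gens P V \<Longrightarrow> fst (fst g) = n \<Longrightarrow> T (tm V g) \<in> H" "X \<in> fa_deg R P V n"
  shows "T X \<in> H"
  by (rule lin_maps_mspan_into[OF module_alg[OF assms(1)] assms(2,3) fa_deg_gens_sub[OF assms(1)] assms(4) _ assms(6)[unfolded fa_deg_def]])
    (use assms(5) in fastforce)

lemma fa_deg_dec:
  assumes V: "module R V" and k: "2 \<le> k"
  shows "fa_deg R P V k \<subseteq> dec V"
proof
  note A = module_alg[OF V]
  fix X assume "X \<in> fa_deg R P V k"
  then show "X \<in> dec V"
  proof (rule fa_deg_into[OF V A lin_maps_id submodule_dec[OF V], rotated])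
    fix g assume g: "g \<in> fa_gens P V" "fst (fst g) = k"
    let ?S = "\<lambda>vs. if length vs \<ge> 2 then dec V else carrier (Al V)"
    have "tm V g \<in> ?S (snd g)"
    proof (rule term_induct[OF V, where S = ?S, OF _ _ _ _ g(1)])
      show "submodule (?S vs) R (Al V)" for vs using submodule_dec[OF V] submodule_carrier[OF A] by simp
      fix b and us vs :: "'b list" and X Y assume b: "b \<in> carrier (Op P 2)" "us \<noteq> []" "vs \<noteq> []" "X \<in> ?S us" "Y \<in> ?S vs"
      have "X \<in> carrier (Al V)" "Y \<in> carrier (Al V)" using b dec_sub[OF V] by (auto split: if_splits)
      then show "bop V b X Y \<in> ?S (us @ vs)" using b bop_dec bop_closed[OF V] by auto
    qed (use var_closed[OF V] in auto)
    then show "tm V g \<in> dec V" using fa_gensE(4)[OF g(1)] g(2) k by simp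
  qed
qed

text \<open>A product of two terms has arity at least two, since terms of arity zero vanish. With \<open>fa_deg_dec\<close> this
  says that the decomposables are spanned by the homogeneous elements of arity at least two.\<close>
lemma dec_deg:
  assumes V: "module R V" and H: "module R M" "T \<in> lin_maps R (Al V) M" "submodule H R M"
    and deg: "\<And>k X. 2 \<le> k \<Longrightarrow> X \<in> fa_deg R P V k \<Longrightarrow> T X \<in> H" and X: "X \<in> dec V"
  shows "T X \<in> H"
proof (rule dec_into[OF V H _ X])
  note A = module_alg[OF V]
  fix b X Y assume b: "b \<in> carrier (Op P 2)" and X: "X \<in> carrier (Al V)" and Y: "Y \<in> carrier (Al V)"
  have t: "T (bop V b (tm V g) (tm V g')) \<in> H" if g: "g \<in> fa_gens P V" "g' \<in> fa_gens P V" for g g'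
  proof (cases "snd g = [] \<or> snd g' = []")
    case True
    have "bop V b (tm V g) (tm V g') = \<zero>\<^bsub>Al V\<^esub>"
      using True
    proof
      assume "snd g = []"
      then show ?thesis using tm_nullary[OF V g(1)] lin_maps_zero[OF A A bop_left[OF V b tm_closed[OF V g(2)]]] by simp
    next
      assume "snd g' = []"
      then show ?thesis using tm_nullary[OF V g(2)] lin_maps_zero[OF A A bop_right[OF V b tm_closed[OF V g(1)]]] by simp
    qed
    then show ?thesis using lin_maps_zero[OF A H(1,2)] submodule_facts(2)[OF H(1,3)] by simp
  next
    case False
    let ?h = "((fst (fst g) + fst (fst g'), cmp P (2, b) [fst g, fst g']), snd g @ snd g')"
    have "fst (fst g) \<noteq> 0" "fst (fst g') \<noteq> 0" using False fa_gensE(4)[OF g(1)] fa_gensE(4)[OF g(2)] by (metis length_0_conv)+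
    then have "T (tm V ?h) \<in> H" using tm_deg[OF bop_gen[OF b g]] by (intro deg[of "fst (fst g) + fst (fst g')"]) auto
    then show ?thesis using bop_tm[OF V b g] by simp
  qed
  have "T (bop V b (tm V g) Y) \<in> H" if g: "g \<in> fa_gens P V" for g
    using t[OF g] by (rule alg_lin_into[OF V H(1) lin_maps_comp[OF bop_right[OF V b tm_closed[OF V g]] H(2)] H(3) _ Y])
  then show "T (bop V b X Y) \<in> H"
    by (rule alg_lin_into[OF V H(1) lin_maps_comp[OF bop_left[OF V b Y] H(2)] H(3) _ X])
qed

end

section \<open>Linear functionals and dual bases\<close>

lemma dsum_simps [simp]:
  "carrier (dsum M N) = carrier M \<times> carrier N" "\<zero>\<^bsub>dsum M N\<^esub> = (\<zero>\<^bsub>M\<^esub>, \<zero>\<^bsub>N\<^esub>)"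
  "x \<oplus>\<^bsub>dsum M N\<^esub> y = (fst x \<oplus>\<^bsub>M\<^esub> fst y, snd x \<oplus>\<^bsub>N\<^esub> snd y)" "a \<odot>\<^bsub>dsum M N\<^esub> x = (a \<odot>\<^bsub>M\<^esub> fst x, a \<odot>\<^bsub>N\<^esub> snd x)"
  by (simp_all add: dsum_def)

lemma power_module_simps [simp]:
  "carrier (power_module R n) = {..<n} \<rightarrow>\<^sub>E carrier R" "\<zero>\<^bsub>power_module R n\<^esub> = (\<lambda>i\<in>{..<n}. \<zero>\<^bsub>R\<^esub>)"
  "x \<oplus>\<^bsub>power_module R n\<^esub> y = (\<lambda>i\<in>{..<n}. x i \<oplus>\<^bsub>R\<^esub> y i)" "a \<odot>\<^bsub>power_module R n\<^esub> x = (\<lambda>i\<in>{..<n}. a \<otimes>\<^bsub>R\<^esub> x i)"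
  by (simp_all add: power_module_def)

lemma module_dsum:
  fixes M :: "('r, 'a) module" and N :: "('r, 'b) module"
  assumes "module R M" "module R N"
  shows "module R (dsum M N)"
proof -
  interpret M: module R M by fact
  interpret N: module R N by fact
  show ?thesis
  proof (rule moduleI)
    show "cring R" by unfold_locales
    show "abelian_group (dsum M N)"
    proof (rule abelian_groupI)
      fix x assume "x \<in> carrier (dsum M N)"
      then show "\<exists>y\<in>carrier (dsum M N). y \<oplus>\<^bsub>dsum M N\<^esub> x = \<zero>\<^bsub>dsum M N\<^esub>"
        by (intro bexI[of _ "(\<ominus>\<^bsub>M\<^esub> fst x, \<ominus>\<^bsub>N\<^esub> snd x)"]) (auto simp: M.l_neg N.l_neg)
    qed (auto simp: M.a_ac N.a_ac)
  qed (auto simp: M.smult_l_distr N.smult_l_distr M.smult_r_distr N.smult_r_distr M.smult_assoc1 N.smult_assoc1)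
qed

context ground_ring
begin

lemma module_power: "module R (power_module R n)"
proof (rule module_separated[where I = "{..<n}" and N = "\<lambda>_. self_module R" and h = "\<lambda>i x. x i"])
  show "cring R" by unfold_locales
  show "(\<lambda>x. x i) \<in> lin_maps R (power_module R n) (self_module R)" if "i \<in> {..<n}" for i
    using that by (intro lin_mapsI) (auto simp: PiE_mem)
  show "x = y" if "x \<in> carrier (power_module R n)" "y \<in> carrier (power_module R n)" "\<And>i. i \<in> {..<n} \<Longrightarrow> x i = y i" for x y
    using that by (auto intro: PiE_ext)
qed (auto simp: module_self PiE_mem)

abbreviation "functionals V \<equiv> lin_maps R V (self_module R)"

lemma functional_closed: "f \<in> functionals V \<Longrightarrow> v \<in> carrier V \<Longrightarrow> f v \<in> carrier R"
  using lin_maps_closed[of f R V "self_module R" v] by simp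

text \<open>Finitely many elements with coordinate functionals, as in the dual basis lemma for finitely generated
  projective modules. Modules that are free of finite rank have this property, and direct sums inherit it.\<close>
definition dual_basis :: "('r, 'v) module \<Rightarrow> bool" where
  "dual_basis V \<longleftrightarrow> (\<exists>n e \<phi>. (\<forall>i<n. e i \<in> carrier V \<and> \<phi> i \<in> functionals V) \<and>
     (\<forall>v\<in>carrier V. v = (\<Oplus>\<^bsub>V\<^esub>i\<in>{..<n::nat}. \<phi> i v \<odot>\<^bsub>V\<^esub> e i)))"

lemma dual_basisE:
  assumes "dual_basis V"
  obtains n e \<phi> where "\<And>i. i < n \<Longrightarrow> e i \<in> carrier V" "\<And>i. i < n \<Longrightarrow> \<phi> i \<in> functionals V"
    "\<And>v. v \<in> carrier V \<Longrightarrow> (\<Oplus>\<^bsub>V\<^esub>i\<in>{..<n::nat}. \<phi> i v \<odot>\<^bsub>V\<^esub> e i) = v"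
proof -
  from assms obtain n e \<phi> where "\<forall>i<n. e i \<in> carrier V \<and> \<phi> i \<in> functionals V"
    and "\<forall>v\<in>carrier V. v = (\<Oplus>\<^bsub>V\<^esub>i\<in>{..<n::nat}. \<phi> i v \<odot>\<^bsub>V\<^esub> e i)"
    unfolding dual_basis_def by blast
  then show thesis by (intro that[of n e \<phi>]) auto
qed

lemma lin_maps_inv_into:
  assumes M: "module R M" and h: "h \<in> lin_maps R M N" "bij_betw h (carrier M) (carrier N)"
  shows "inv_into (carrier M) h \<in> lin_maps R N M"
proof -
  note inj = bij_betw_imp_inj_on[OF h(2)] and im = bij_betw_imp_surj_on[OF h(2)]
  let ?g = "inv_into (carrier M) h"
  have g: "?g y \<in> carrier M" "h (?g y) = y" if "y \<in> carrier N" for y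
    using that im by (auto intro: inv_into_into f_inv_into_f)
  have u: "?g y = x" if "x \<in> carrier M" "h x = y" for x y using that inv_into_f_f[OF inj] by auto
  show ?thesis
  proof (rule lin_mapsI)
    fix x y assume "x \<in> carrier N" "y \<in> carrier N"
    then show "?g (x \<oplus>\<^bsub>N\<^esub> y) = ?g x \<oplus>\<^bsub>M\<^esub> ?g y"
      using g by (intro u mod_add[OF M]) (simp_all add: lin_maps_add[OF h(1)])
  next
    fix a y assume "a \<in> carrier R" "y \<in> carrier N"
    then show "?g (a \<odot>\<^bsub>N\<^esub> y) = a \<odot>\<^bsub>M\<^esub> ?g y"
      using g by (intro u mod_smult[OF M]) (simp_all add: lin_maps_smult[OF h(1)])
  qed (rule g)
qed

lemma dual_basis_power: "dual_basis (power_module R n)"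
proof -
  interpret Pm: module R "power_module R n" by (rule module_power)
  let ?M = "power_module R n"
  define \<epsilon> where "\<epsilon> i = (\<lambda>j\<in>{..<n}. if j = i then \<one> else \<zero>)" for i
  have \<epsilon>: "\<epsilon> i \<in> carrier ?M" for i by (auto simp: \<epsilon>_def)
  have pr: "(\<lambda>x. x i) \<in> functionals ?M" if "i < n" for i
    using that by (intro lin_mapsI) (auto simp: PiE_mem)
  have dec: "(\<Oplus>\<^bsub>?M\<^esub>i\<in>{..<n}. x i \<odot>\<^bsub>?M\<^esub> \<epsilon> i) = x" if x: "x \<in> carrier ?M" for x
  proof -
    have xi: "x i \<in> carrier R" if "i < n" for i using x that by (auto simp: PiE_mem)
    have c: "x i \<odot>\<^bsub>?M\<^esub> \<epsilon> i \<in> carrier ?M" if "i \<in> {..<n}" for i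
      using xi that \<epsilon> by (intro mod_smult[OF module_power]) auto
    have s: "(\<Oplus>\<^bsub>?M\<^esub>i\<in>{..<n}. x i \<odot>\<^bsub>?M\<^esub> \<epsilon> i) \<in> carrier ?M" using c by (intro Pm.finsum_closed) blast
    have "(\<Oplus>\<^bsub>?M\<^esub>i\<in>{..<n}. x i \<odot>\<^bsub>?M\<^esub> \<epsilon> i) j = x j" if j: "j < n" for j
    proof -
      have "(\<Oplus>\<^bsub>?M\<^esub>i\<in>{..<n}. x i \<odot>\<^bsub>?M\<^esub> \<epsilon> i) j = (\<Oplus>\<^bsub>self_module R\<^esub>i\<in>{..<n}. (x i \<odot>\<^bsub>?M\<^esub> \<epsilon> i) j)"
        by (rule lin_maps_finsum_apply[OF module_power module_self pr[OF j]]) (use c in auto)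
      also have "\<dots> = (\<Oplus>i\<in>{..<n}. (x i \<odot>\<^bsub>?M\<^esub> \<epsilon> i) j)"
        by (simp add: finsum_def finprod_def self_module_def)
      also have "\<dots> = (\<Oplus>i\<in>{..<n}. if j = i then x i else \<zero>)"
        using xi j by (intro finsum_cong') (auto simp: \<epsilon>_def)
      also have "\<dots> = x j" using xi j by (intro add.finprod_singleton) auto
      finally show ?thesis .
    qed
    then show ?thesis using s x by (intro PiE_ext[of _ "{..<n}" "\<lambda>_. carrier R" x]) auto
  qed
  show ?thesis
    unfolding dual_basis_def
    by (rule exI[of _ n], rule exI[of _ \<epsilon>], rule exI[of _ "\<lambda>i x. x i"]) (use \<epsilon> pr dec in force)
qed

lemma free_fin_rank_dual_basis:
  assumes "free_fin_rank R V"
  shows "module R V" "dual_basis V"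
proof -
  show V: "module R V" using assms by (simp add: free_fin_rank_def)
  obtain n h where h: "h \<in> lin_maps R (power_module R n) V" "bij_betw h (carrier (power_module R n)) (carrier V)"
    using assms unfolding free_fin_rank_def mod_iso_def by blast
  interpret V: module R V by (rule V)
  let ?M = "power_module R n"
  let ?g = "inv_into (carrier ?M) h"
  have g: "?g \<in> lin_maps R V ?M" using module_power h by (rule lin_maps_inv_into)
  obtain m e \<phi> where e: "\<And>i. i < m \<Longrightarrow> e i \<in> carrier ?M" and \<phi>: "\<And>i. i < m \<Longrightarrow> \<phi> i \<in> functionals ?M"
    and dec: "\<And>x. x \<in> carrier ?M \<Longrightarrow> (\<Oplus>\<^bsub>?M\<^esub>i\<in>{..<m::nat}. \<phi> i x \<odot>\<^bsub>?M\<^esub> e i) = x"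
    using dual_basis_power by (rule dual_basisE) blast
  show "dual_basis V"
    unfolding dual_basis_def
  proof (rule exI[of _ m], rule exI[of _ "\<lambda>i. h (e i)"], rule exI[of _ "\<lambda>i v. \<phi> i (?g v)"], intro conjI allI impI ballI)
    fix i assume "i < m"
    then show "h (e i) \<in> carrier V" "(\<lambda>v. \<phi> i (?g v)) \<in> functionals V"
      using lin_maps_closed[OF h(1) e] lin_maps_comp[OF g \<phi>] by auto
  next
    fix v assume v: "v \<in> carrier V"
    have gv: "?g v \<in> carrier ?M" using lin_maps_closed[OF g v] .
    have c: "\<phi> i (?g v) \<in> carrier R" if "i < m" for i using functional_closed[OF \<phi>[OF that] gv] .
    have "v = h (\<Oplus>\<^bsub>?M\<^esub>i\<in>{..<m}. \<phi> i (?g v) \<odot>\<^bsub>?M\<^esub> e i)"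
      using dec[OF gv] v h(2) by (simp add: bij_betw_def f_inv_into_f)
    also have "\<dots> = (\<Oplus>\<^bsub>V\<^esub>i\<in>{..<m}. h (\<phi> i (?g v) \<odot>\<^bsub>?M\<^esub> e i))"
      using c e by (intro lin_maps_finsum_apply[OF module_power V h(1)] mod_smult[OF module_power]) auto
    also have "\<dots> = (\<Oplus>\<^bsub>V\<^esub>i\<in>{..<m}. \<phi> i (?g v) \<odot>\<^bsub>V\<^esub> h (e i))"
      using c e lin_maps_smult[OF h(1)] lin_maps_closed[OF h(1)]
      by (intro V.finsum_cong') (auto simp del: power_module_simps)
    finally show "v = (\<Oplus>\<^bsub>V\<^esub>i\<in>{..<m}. \<phi> i (?g v) \<odot>\<^bsub>V\<^esub> h (e i))" .
  qed
qed

lemma lin_fst: "fst \<in> lin_maps R (dsum M N) M" and lin_snd: "snd \<in> lin_maps R (dsum M N) N"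
  by (auto simp: lin_maps_def)

lemma lin_pair: "f \<in> lin_maps R K M \<Longrightarrow> g \<in> lin_maps R K N \<Longrightarrow> (\<lambda>x. (f x, g x)) \<in> lin_maps R K (dsum M N)"
  by (auto simp: lin_maps_def)

lemma lin_inl: "module R N \<Longrightarrow> (\<lambda>x. (x, \<zero>\<^bsub>N\<^esub>)) \<in> lin_maps R M (dsum M N)"
  and lin_inr: "module R M \<Longrightarrow> (\<lambda>x. (\<zero>\<^bsub>M\<^esub>, x)) \<in> lin_maps R N (dsum M N)"
  by (auto intro!: lin_pair lin_maps_id lin_maps_const_zero)

lemma dual_basis_dsum:
  assumes V: "module R V" and W: "module R W" and dV: "dual_basis V" and dW: "dual_basis W"
  shows "dual_basis (dsum V W)"
proof -
  let ?U = "dsum V W"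
  note U = module_dsum[OF V W]
  interpret U: module R ?U by (rule U)
  interpret V: module R V by (rule V)
  interpret W: module R W by (rule W)
  obtain n e \<phi> where e: "\<And>i. i < n \<Longrightarrow> e i \<in> carrier V" and \<phi>: "\<And>i. i < n \<Longrightarrow> \<phi> i \<in> functionals V"
    and dec: "\<And>v. v \<in> carrier V \<Longrightarrow> (\<Oplus>\<^bsub>V\<^esub>i\<in>{..<n::nat}. \<phi> i v \<odot>\<^bsub>V\<^esub> e i) = v"
    using dV by (rule dual_basisE) blast
  obtain m e' \<psi> where e': "\<And>i. i < m \<Longrightarrow> e' i \<in> carrier W" and \<psi>: "\<And>i. i < m \<Longrightarrow> \<psi> i \<in> functionals W"
    and dec': "\<And>w. w \<in> carrier W \<Longrightarrow> (\<Oplus>\<^bsub>W\<^esub>i\<in>{..<m::nat}. \<psi> i w \<odot>\<^bsub>W\<^esub> e' i) = w"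
    using dW by (rule dual_basisE) blast
  let ?e = "\<lambda>i. if i < n then (e i, \<zero>\<^bsub>W\<^esub>) else (\<zero>\<^bsub>V\<^esub>, e' (i - n))"
  let ?\<phi> = "\<lambda>i. if i < n then (\<lambda>u. \<phi> i (fst u)) else (\<lambda>u. \<psi> (i - n) (snd u))"
  have ec: "?e i \<in> carrier ?U" if "i < n + m" for i using that e e' by auto
  have \<phi>c: "?\<phi> i \<in> functionals ?U" if "i < n + m" for i
    using that lin_maps_comp[OF lin_fst[of V W] \<phi>] lin_maps_comp[OF lin_snd[of V W] \<psi>] by auto
  show ?thesis
    unfolding dual_basis_def
  proof (rule exI[of _ "n + m"], rule exI[of _ ?e], rule exI[of _ ?\<phi>], intro conjI allI impI ballI)
    fix u assume u: "u \<in> carrier ?U"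
    have su: "fst u \<in> carrier V" "snd u \<in> carrier W" using u by auto
    have c: "\<phi> i (fst u) \<in> carrier R" if "i < n" for i using functional_closed[OF \<phi>[OF that] su(1)] .
    have c': "\<psi> i (snd u) \<in> carrier R" if "i < m" for i using functional_closed[OF \<psi>[OF that] su(2)] .
    have t: "?\<phi> i u \<odot>\<^bsub>?U\<^esub> ?e i \<in> carrier ?U" if "i < n + m" for i
      by (rule mod_smult[OF U functional_closed[OF \<phi>c[OF that] u] ec[OF that]])
    have 1: "(\<Oplus>\<^bsub>?U\<^esub>i\<in>{..<n}. ?\<phi> i u \<odot>\<^bsub>?U\<^esub> ?e i) = (fst u, \<zero>\<^bsub>W\<^esub>)"
    proof -
      have "(\<Oplus>\<^bsub>?U\<^esub>i\<in>{..<n}. ?\<phi> i u \<odot>\<^bsub>?U\<^esub> ?e i) = (\<Oplus>\<^bsub>?U\<^esub>i\<in>{..<n}. (\<phi> i (fst u) \<odot>\<^bsub>V\<^esub> e i, \<zero>\<^bsub>W\<^esub>))"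
        using e c by (intro U.finsum_cong') auto
      also have "\<dots> = (\<Oplus>\<^bsub>V\<^esub>i\<in>{..<n}. \<phi> i (fst u) \<odot>\<^bsub>V\<^esub> e i, \<zero>\<^bsub>W\<^esub>)"
        by (rule lin_maps_finsum_apply[OF V U lin_inl[OF W], symmetric]) (use e c in auto)
      finally show ?thesis using dec[OF su(1)] by simp
    qed
    have 2: "(\<Oplus>\<^bsub>?U\<^esub>i\<in>{..<m}. ?\<phi> (n + i) u \<odot>\<^bsub>?U\<^esub> ?e (n + i)) = (\<zero>\<^bsub>V\<^esub>, snd u)"
    proof -
      have "(\<Oplus>\<^bsub>?U\<^esub>i\<in>{..<m}. ?\<phi> (n + i) u \<odot>\<^bsub>?U\<^esub> ?e (n + i)) = (\<Oplus>\<^bsub>?U\<^esub>i\<in>{..<m}. (\<zero>\<^bsub>V\<^esub>, \<psi> i (snd u) \<odot>\<^bsub>W\<^esub> e' i))"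
        using e' c' by (intro U.finsum_cong') auto
      also have "\<dots> = (\<zero>\<^bsub>V\<^esub>, \<Oplus>\<^bsub>W\<^esub>i\<in>{..<m}. \<psi> i (snd u) \<odot>\<^bsub>W\<^esub> e' i)"
        by (rule lin_maps_finsum_apply[OF W U lin_inr[OF V], symmetric]) (use e' c' in auto)
      finally show ?thesis using dec'[OF su(2)] by simp
    qed
    have 3: "(\<Oplus>\<^bsub>?U\<^esub>i\<in>{..<n + m}. ?\<phi> i u \<odot>\<^bsub>?U\<^esub> ?e i) = (\<Oplus>\<^bsub>?U\<^esub>i\<in>{..<n}. ?\<phi> i u \<odot>\<^bsub>?U\<^esub> ?e i) \<oplus>\<^bsub>?U\<^esub>
        (\<Oplus>\<^bsub>?U\<^esub>i\<in>{..<m}. ?\<phi> (n + i) u \<odot>\<^bsub>?U\<^esub> ?e (n + i))"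
      by (rule U.finsum_lessThan_add) (rule t)
    also have "\<dots> = u" unfolding 1 2 using su by (cases u) simp
    finally show "u = (\<Oplus>\<^bsub>?U\<^esub>i\<in>{..<n + m}. ?\<phi> i u \<odot>\<^bsub>?U\<^esub> ?e i)" by (rule sym)
  qed (use ec \<phi>c in blast)+
qed

lemma dual_basis_pt:
  assumes V: "module R V" and d: "dual_basis V"
  shows "dual_basis (dsum (self_module R) V)"
proof (rule dual_basis_dsum[OF module_self V _ d])
  interpret S: module R "self_module R" by (rule module_self)
  have "(\<Oplus>\<^bsub>self_module R\<^esub>i\<in>{..<1::nat}. v \<odot>\<^bsub>self_module R\<^esub> \<one>) = v" if "v \<in> carrier R" for v
    using that by (simp add: lessThan_Suc S.finsum_insert)
  then show "dual_basis (self_module R)"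
    unfolding dual_basis_def
    by (intro exI[of _ "1::nat"] exI[of _ "\<lambda>_. \<one>"] exI[of _ "\<lambda>_ v. v"]) (simp add: lin_maps_id)
qed

end

section \<open>Derivations\<close>

lemma (in abelian_group) diff_add_cancel:
  assumes "a \<in> carrier G" "b \<in> carrier G" "t \<in> carrier G"
  shows "(a \<oplus> t) \<ominus> (b \<oplus> t) = a \<ominus> b"
proof -
  have "(a \<oplus> t) \<oplus> (\<ominus> b \<oplus> \<ominus> t) = (a \<oplus> \<ominus> b) \<oplus> (t \<oplus> \<ominus> t)" using assms by (simp add: a_ac)
  then show ?thesis using assms by (simp add: a_minus_def minus_add r_neg)
qed

lemma (in abelian_group) commutator_leibniz:
  assumes "p \<in> carrier G" "q \<in> carrier G" "r \<in> carrier G" "s \<in> carrier G" "p' \<in> carrier G" "s' \<in> carrier G"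
  shows "((p \<oplus> q) \<oplus> (r \<oplus> s)) \<ominus> ((p' \<oplus> r) \<oplus> (q \<oplus> s')) = (p \<ominus> p') \<oplus> (s \<ominus> s')"
proof -
  have "(p \<oplus> q) \<oplus> (r \<oplus> s) = (p \<oplus> s) \<oplus> (q \<oplus> r)" "(p' \<oplus> r) \<oplus> (q \<oplus> s') = (p' \<oplus> s') \<oplus> (q \<oplus> r)"
    using assms by (simp_all add: a_ac)
  then show ?thesis using assms diff_add_cancel[of "p \<oplus> s" "p' \<oplus> s'" "q \<oplus> r"] by (simp add: a_minus_def minus_add a_ac)
qed

context bin_operad
begin

lemma Der_eqI:
  assumes V: "module R V" and d: "d \<in> carrier (Der R P V)" and e: "e \<in> carrier (Der R P V)"
    and eq: "\<And>v. v \<in> carrier V \<Longrightarrow> d (var V v) = e (var V v)"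
  shows "d = e"
proof (rule extensionalityI[OF Der_ext[OF d] Der_ext[OF e]])
  fix X assume "X \<in> carrier (Al V)"
  with V show "d X = e X"
  proof (induction rule: alg_induct)
    case (var v)
    then show ?case by (rule eq)
  next
    case (add X Y)
    then show ?case by (simp add: lin_maps_add[OF Der_lin[OF d]] lin_maps_add[OF Der_lin[OF e]])
  next
    case (smult a X)
    then show ?case by (simp add: lin_maps_smult[OF Der_lin[OF d]] lin_maps_smult[OF Der_lin[OF e]])
  next
    case (bop b X Y)
    then show ?case by (simp add: Der_bop[OF V d] Der_bop[OF V e])
  qed
qed

lemma der_ext_facts:
  assumes V: "module R V" and h: "h \<in> lin_maps R V (Al V)"
  shows der_ext_Der: "der_ext R P V h \<in> carrier (Der R P V)"
    and der_ext_var: "\<And>v. v \<in> carrier V \<Longrightarrow> der_ext R P V h (var V v) = h v"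
proof -
  have "\<exists>!d. d \<in> carrier (Der R P V) \<and> (\<forall>v\<in>carrier V. d (var V v) = h v)"
    using derivation_exists[OF V h] Der_eqI[OF V] by metis
  from theI'[OF this] show "der_ext R P V h \<in> carrier (Der R P V)"
    "\<And>v. v \<in> carrier V \<Longrightarrow> der_ext R P V h (var V v) = h v"
    unfolding der_ext_def by auto
qed

text \<open>Since \<open>O(V)\<close> is generated by \<open>V\<close> under the binary operations, the Leibniz rule for these suffices.\<close>
lemma binary_derivation:
  assumes V: "module R V" and D: "D \<in> lin_maps R (Al V) (Al V)"
    and leib: "\<And>b X Y. b \<in> carrier (Op P 2) \<Longrightarrow> X \<in> carrier (Al V) \<Longrightarrow> Y \<in> carrier (Al V) \<Longrightarrow>
      D (bop V b X Y) = bop V b (D X) Y \<oplus>\<^bsub>Al V\<^esub> bop V b X (D Y)"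
  shows "restrict D (carrier (Al V)) \<in> carrier (Der R P V)"
proof -
  have h: "(\<lambda>v. D (var V v)) \<in> lin_maps R V (Al V)" by (rule lin_maps_comp[OF var_lin[OF V] D])
  let ?d = "der_ext R P V (\<lambda>v. D (var V v))"
  note d = der_ext_Der[OF V h]
  have "restrict D (carrier (Al V)) = ?d"
  proof (rule extensionalityI[OF restrict_extensional Der_ext[OF d]])
    fix X assume X: "X \<in> carrier (Al V)"
    with V have "D X = ?d X"
    proof (induction rule: alg_induct)
      case (var v)
      then show ?case by (simp add: der_ext_var[OF V h])
    next
      case (add X Y)
      then show ?case by (simp add: lin_maps_add[OF D] lin_maps_add[OF Der_lin[OF d]])
    next
      case (smult a X)
      then show ?case by (simp add: lin_maps_smult[OF D] lin_maps_smult[OF Der_lin[OF d]])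
    next
      case (bop b X Y)
      then show ?case by (simp add: Der_bop[OF V d] leib)
    qed
    then show "restrict D (carrier (Al V)) X = ?d X" using X by simp
  qed
  then show ?thesis using d by simp
qed

lemma Der_add_closed:
  assumes V: "module R V" and d: "d \<in> carrier (Der R P V)" and e: "e \<in> carrier (Der R P V)"
  shows "d \<oplus>\<^bsub>Der R P V\<^esub> e \<in> carrier (Der R P V)"
proof -
  note A = module_alg[OF V]
  interpret A: module R "Al V" by (rule A)
  show ?thesis unfolding Der_simps
  proof (rule binary_derivation[OF V lin_maps_plus[OF A Der_lin[OF d] Der_lin[OF e]]])
    fix b X Y assume b: "b \<in> carrier (Op P 2)" "X \<in> carrier (Al V)" "Y \<in> carrier (Al V)"
    then show "d (bop V b X Y) \<oplus>\<^bsub>Al V\<^esub> e (bop V b X Y) =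
        bop V b (d X \<oplus>\<^bsub>Al V\<^esub> e X) Y \<oplus>\<^bsub>Al V\<^esub> bop V b X (d Y \<oplus>\<^bsub>Al V\<^esub> e Y)"
      by (simp add: Der_bop[OF V d] Der_bop[OF V e] lin_maps_add[OF bop_left[OF V]] lin_maps_add[OF bop_right[OF V]]
          Der_closed[OF d] Der_closed[OF e] bop_closed[OF V] A.a_ac)
  qed
qed

lemma Der_smult_closed:
  assumes V: "module R V" and d: "d \<in> carrier (Der R P V)" and a: "a \<in> carrier R"
  shows "a \<odot>\<^bsub>Der R P V\<^esub> d \<in> carrier (Der R P V)"
proof -
  note A = module_alg[OF V]
  interpret A: module R "Al V" by (rule A)
  show ?thesis unfolding Der_simps
  proof (rule binary_derivation[OF V lin_maps_scale[OF A Der_lin[OF d] a]])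
    fix b X Y assume b: "b \<in> carrier (Op P 2)" "X \<in> carrier (Al V)" "Y \<in> carrier (Al V)"
    then show "a \<odot>\<^bsub>Al V\<^esub> d (bop V b X Y) = bop V b (a \<odot>\<^bsub>Al V\<^esub> d X) Y \<oplus>\<^bsub>Al V\<^esub> bop V b X (a \<odot>\<^bsub>Al V\<^esub> d Y)"
      by (simp add: Der_bop[OF V d] lin_maps_smult[OF bop_left[OF V] a] lin_maps_smult[OF bop_right[OF V] a]
          Der_closed[OF d] bop_closed[OF V] A.smult_r_distr a)
  qed
qed

lemma Der_zero_closed:
  assumes V: "module R V"
  shows "\<zero>\<^bsub>Der R P V\<^esub> \<in> carrier (Der R P V)"
proof -
  note A = module_alg[OF V]
  interpret A: module R "Al V" by (rule A)
  show ?thesis unfolding Der_simps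
  proof (rule binary_derivation[OF V lin_maps_const_zero[OF A]])
    fix b X Y assume b: "b \<in> carrier (Op P 2)" "X \<in> carrier (Al V)" "Y \<in> carrier (Al V)"
    then show "\<zero>\<^bsub>Al V\<^esub> = bop V b \<zero>\<^bsub>Al V\<^esub> Y \<oplus>\<^bsub>Al V\<^esub> bop V b X \<zero>\<^bsub>Al V\<^esub>"
      by (simp add: lin_maps_zero[OF A A bop_left[OF V]] lin_maps_zero[OF A A bop_right[OF V]])
  qed
qed

lemma Der_apply:
  assumes "X \<in> carrier (Al V)"
  shows "(d \<oplus>\<^bsub>Der R P V\<^esub> e) X = d X \<oplus>\<^bsub>Al V\<^esub> e X" "(a \<odot>\<^bsub>Der R P V\<^esub> d) X = a \<odot>\<^bsub>Al V\<^esub> d X" "\<zero>\<^bsub>Der R P V\<^esub> X = \<zero>\<^bsub>Al V\<^esub>"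
  using assms by (simp_all add: Der_simps)

lemma module_Der:
  assumes V: "module R V"
  shows "module R (Der R P V)"
proof (rule module_separated[where I = "carrier (Al V)" and N = "\<lambda>_. Al V" and h = "\<lambda>X d. d X"])
  show "cring R" by unfold_locales
  show "(\<lambda>d. d X) \<in> lin_maps R (Der R P V) (Al V)" if "X \<in> carrier (Al V)" for X
    using that by (intro lin_mapsI) (auto simp: Der_apply Der_closed)
  show "d = e" if "d \<in> carrier (Der R P V)" "e \<in> carrier (Der R P V)" "\<And>X. X \<in> carrier (Al V) \<Longrightarrow> d X = e X" for d e
    using that by (intro extensionalityI[OF Der_ext Der_ext])
qed (auto simp: module_alg[OF V] Der_apply intro: Der_add_closed[OF V] Der_smult_closed[OF V] Der_zero_closed[OF V])

lemma Der_eval: "X \<in> carrier (Al V) \<Longrightarrow> (\<lambda>d. d X) \<in> lin_maps R (Der R P V) (Al V)"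
  by (rule lin_mapsI) (simp_all add: Der_apply Der_closed)

lemma Der_diff_apply:
  assumes "module R V" "d \<in> carrier (Der R P V)" "e \<in> carrier (Der R P V)" "X \<in> carrier (Al V)"
  shows "(d \<ominus>\<^bsub>Der R P V\<^esub> e) X = d X \<ominus>\<^bsub>Al V\<^esub> e X"
  by (rule lin_maps_diff[OF module_Der[OF assms(1)] module_alg[OF assms(1)] Der_eval[OF assms(4)] assms(2,3)])

lemma Der_kills_smult_zero: "module R V \<Longrightarrow> d \<in> carrier (Der R P V) \<Longrightarrow> d \<zero>\<^bsub>Al V\<^esub> = \<zero>\<^bsub>Al V\<^esub>"
  by (rule lin_maps_zero[OF module_alg module_alg Der_lin])

text \<open>By the Leibniz rule, the derivative of a product is a sum of two products.\<close>
lemma Der_dec: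
  assumes V: "module R V" and d: "d \<in> carrier (Der R P V)" and X: "X \<in> dec V"
  shows "d X \<in> dec V"
proof (rule dec_into[OF V module_alg[OF V] Der_lin[OF d] submodule_dec[OF V] _ X])
  fix b X Y assume "b \<in> carrier (Op P 2)" "X \<in> carrier (Al V)" "Y \<in> carrier (Al V)"
  then show "d (bop V b X Y) \<in> dec V"
    unfolding Der_bop[OF V d \<open>b \<in> _\<close> \<open>X \<in> _\<close> \<open>Y \<in> _\<close>]
    by (intro submodule_facts(3)[OF module_alg[OF V] submodule_dec[OF V]] bop_dec Der_closed[OF d])
qed

subsection \<open>The bracket as a commutator\<close>

lemma prelie_facts:
  assumes V: "module R V" and d: "d \<in> carrier (Der R P V)" and e: "e \<in> carrier (Der R P V)"
  shows prelie_Der: "prelie R P V d e \<in> carrier (Der R P V)"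
    and prelie_var: "\<And>v. v \<in> carrier V \<Longrightarrow> prelie R P V d e (var V v) = e (d (var V v))"
proof -
  have h: "(\<lambda>v. e (d (var V v))) \<in> lin_maps R V (Al V)"
    by (rule lin_maps_comp[OF lin_maps_comp[OF var_lin[OF V] Der_lin[OF d]] Der_lin[OF e]])
  show "prelie R P V d e \<in> carrier (Der R P V)"
    "\<And>v. v \<in> carrier V \<Longrightarrow> prelie R P V d e (var V v) = e (d (var V v))"
    unfolding prelie_def using der_ext_facts[OF V h] by auto
qed

text \<open>The bracket, defined by extending values on \<open>V\<close>, is the commutator \<open>e \<circ> d - d \<circ> e\<close> on all of \<open>O(V)\<close>,
  because commutators of derivations are derivations.\<close>
lemma bracket_facts:
  assumes V: "module R V" and d: "d \<in> carrier (Der R P V)" and e: "e \<in> carrier (Der R P V)"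
  shows bracket_Der: "bracket R P V d e \<in> carrier (Der R P V)"
    and bracket_apply: "\<And>X. X \<in> carrier (Al V) \<Longrightarrow> bracket R P V d e X = e (d X) \<ominus>\<^bsub>Al V\<^esub> d (e X)"
proof -
  note A = module_alg[OF V]
  interpret A: module R "Al V" by (rule A)
  note pd = prelie_Der[OF V d e] prelie_Der[OF V e d]
  show B: "bracket R P V d e \<in> carrier (Der R P V)"
    unfolding bracket_def by (intro mod_minus[OF module_Der[OF V]] pd)
  let ?D = "\<lambda>X. e (d X) \<ominus>\<^bsub>Al V\<^esub> d (e X)"
  have L: "?D \<in> lin_maps R (Al V) (Al V)"
    by (intro lin_maps_minus[OF A] lin_maps_comp[OF Der_lin[OF d] Der_lin[OF e]] lin_maps_comp[OF Der_lin[OF e] Der_lin[OF d]])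
  have D: "restrict ?D (carrier (Al V)) \<in> carrier (Der R P V)"
  proof (rule binary_derivation[OF V L])
    fix b X Y assume b: "b \<in> carrier (Op P 2)" and X: "X \<in> carrier (Al V)" and Y: "Y \<in> carrier (Al V)"
    note c = Der_closed[OF d] Der_closed[OF e] X Y bop_closed[OF V b]
    let ?b = "bop V b"
    have m: "?b (x \<ominus>\<^bsub>Al V\<^esub> y) z = ?b x z \<ominus>\<^bsub>Al V\<^esub> ?b y z" "?b z (x \<ominus>\<^bsub>Al V\<^esub> y) = ?b z x \<ominus>\<^bsub>Al V\<^esub> ?b z y"
      if "x \<in> carrier (Al V)" "y \<in> carrier (Al V)" "z \<in> carrier (Al V)" for x y z
      using lin_maps_diff[OF A A bop_left[OF V b that(3)] that(1,2)] lin_maps_diff[OF A A bop_right[OF V b that(3)] that(1,2)] by auto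
    have "e (d (?b X Y)) = (?b (e (d X)) Y \<oplus>\<^bsub>Al V\<^esub> ?b (d X) (e Y)) \<oplus>\<^bsub>Al V\<^esub> (?b (e X) (d Y) \<oplus>\<^bsub>Al V\<^esub> ?b X (e (d Y)))"
      by (simp add: c Der_bop[OF V d b] Der_bop[OF V e b] lin_maps_add[OF Der_lin[OF e]])
    moreover have "d (e (?b X Y)) = (?b (d (e X)) Y \<oplus>\<^bsub>Al V\<^esub> ?b (e X) (d Y)) \<oplus>\<^bsub>Al V\<^esub> (?b (d X) (e Y) \<oplus>\<^bsub>Al V\<^esub> ?b X (d (e Y)))"
      by (simp add: c Der_bop[OF V d b] Der_bop[OF V e b] lin_maps_add[OF Der_lin[OF d]])
    ultimately show "?D (?b X Y) = ?b (?D X) Y \<oplus>\<^bsub>Al V\<^esub> ?b X (?D Y)"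
      by (simp add: c m A.M.commutator_leibniz)
  qed
  have "bracket R P V d e = restrict ?D (carrier (Al V))"
  proof (rule Der_eqI[OF V B D])
    fix v assume v: "v \<in> carrier V"
    then show "bracket R P V d e (var V v) = restrict ?D (carrier (Al V)) (var V v)"
      unfolding bracket_def
      by (simp add: Der_diff_apply[OF V pd] var_closed[OF V] prelie_var[OF V d e] prelie_var[OF V e d])
  qed
  then show "bracket R P V d e X = e (d X) \<ominus>\<^bsub>Al V\<^esub> d (e X)" if "X \<in> carrier (Al V)" for X
    using that by simp
qed

subsection \<open>Elementary derivations\<close>

abbreviation "ten V x f \<equiv> der_tensor R P V x f"

lemma ten_facts:
  assumes V: "module R V" and x: "x \<in> carrier (Al V)" and f: "f \<in> functionals V"
  shows ten_Der: "ten V x f \<in> carrier (Der R P V)"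
    and ten_var: "\<And>v. v \<in> carrier V \<Longrightarrow> ten V x f (var V v) = f v \<odot>\<^bsub>Al V\<^esub> x"
proof -
  note A = module_alg[OF V]
  interpret A: module R "Al V" by (rule A)
  have h: "(\<lambda>v. f v \<odot>\<^bsub>Al V\<^esub> x) \<in> lin_maps R V (Al V)"
    using f x functional_closed[OF f] lin_maps_add[OF f] lin_maps_smult[OF f]
    by (intro lin_mapsI) (auto simp: A.smult_l_distr A.smult_assoc1)
  show "ten V x f \<in> carrier (Der R P V)" "\<And>v. v \<in> carrier V \<Longrightarrow> ten V x f (var V v) = f v \<odot>\<^bsub>Al V\<^esub> x"
    unfolding der_tensor_def using der_ext_facts[OF V h] by auto
qed

lemma ten_linear:
  assumes V: "module R V" and f: "f \<in> functionals V"
  shows "(\<lambda>x. ten V x f) \<in> lin_maps R (Al V) (Der R P V)"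
proof -
  note A = module_alg[OF V] and D = module_Der[OF V]
  interpret A: module R "Al V" by (rule A)
  note T = ten_Der[OF V _ f] and v = ten_var[OF V _ f]
  show ?thesis
  proof (rule lin_mapsI)
    fix x y assume x: "x \<in> carrier (Al V)" and y: "y \<in> carrier (Al V)"
    show "ten V (x \<oplus>\<^bsub>Al V\<^esub> y) f = ten V x f \<oplus>\<^bsub>Der R P V\<^esub> ten V y f"
      by (rule Der_eqI[OF V T[OF mod_add[OF A x y]] mod_add[OF D T[OF x] T[OF y]]])
        (simp add: v x y Der_apply var_closed[OF V] A.smult_r_distr functional_closed[OF f])
  next
    fix a x assume a: "a \<in> carrier R" and x: "x \<in> carrier (Al V)"
    show "ten V (a \<odot>\<^bsub>Al V\<^esub> x) f = a \<odot>\<^bsub>Der R P V\<^esub> ten V x f"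
      by (rule Der_eqI[OF V T[OF mod_smult[OF A a x]] mod_smult[OF D a T[OF x]]])
        (simp add: v x a Der_apply var_closed[OF V] A.smult_assoc1[symmetric] m_comm functional_closed[OF f])
  qed (rule T)
qed

text \<open>Each term substitutes one of the elements into the other: the derivation \<open>y \<otimes> g\<close> replaces a leaf \<open>v\<close> of
  \<open>x\<close> by \<open>g(v) y\<close>.\<close>
lemma bracket_ten:
  assumes V: "module R V" and x: "x \<in> carrier (Al V)" and y: "y \<in> carrier (Al V)"
    and f: "f \<in> functionals V" and g: "g \<in> functionals V"
  shows "bracket R P V (ten V x f) (ten V y g) = ten V (ten V y g x) f \<ominus>\<^bsub>Der R P V\<^esub> ten V (ten V x f y) g"
proof -
  note tx = ten_Der[OF V x f] and ty = ten_Der[OF V y g]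
  note cx = Der_closed[OF ty x] and cy = Der_closed[OF tx y]
  note t1 = ten_Der[OF V cx f] and t2 = ten_Der[OF V cy g]
  show ?thesis
    by (rule Der_eqI[OF V bracket_Der[OF V tx ty] mod_minus[OF module_Der[OF V] t1 t2]])
      (simp add: bracket_apply[OF V tx ty] Der_diff_apply[OF V t1 t2] var_closed[OF V] ten_var[OF V x f] ten_var[OF V y g]
        ten_var[OF V cx f] ten_var[OF V cy g] lin_maps_smult[OF Der_lin[OF tx]] lin_maps_smult[OF Der_lin[OF ty]]
        functional_closed[OF f] functional_closed[OF g] x y)
qed

text \<open>For a dual basis \<open>(e\<^sub>i, \<phi>\<^sub>i)\<close> one has \<open>d = \<Sum>\<^sub>i d(e\<^sub>i) \<otimes> \<phi>\<^sub>i\<close>; linear statements about derivations may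
  therefore be checked on elementary ones, whose first factor is moreover a value of \<open>d\<close>.\<close>
lemma Der_in_submodule:
  assumes V: "module R V" and db: "dual_basis V" and H: "submodule H R (Der R P V)" and d: "d \<in> carrier (Der R P V)"
    and t: "\<And>v f. v \<in> carrier V \<Longrightarrow> f \<in> functionals V \<Longrightarrow> ten V (d (var V v)) f \<in> H"
  shows "d \<in> H"
proof -
  note A = module_alg[OF V] and D = module_Der[OF V]
  interpret A: module R "Al V" by (rule A)
  interpret D: module R "Der R P V" by (rule D)
  obtain n e \<phi> where e: "\<And>i. i < n \<Longrightarrow> e i \<in> carrier V" and \<phi>: "\<And>i. i < n \<Longrightarrow> \<phi> i \<in> functionals V"
    and dec: "\<And>v. v \<in> carrier V \<Longrightarrow> (\<Oplus>\<^bsub>V\<^esub>i\<in>{..<n::nat}. \<phi> i v \<odot>\<^bsub>V\<^esub> e i) = v"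
    using db by (rule dual_basisE) blast
  let ?t = "\<lambda>i. ten V (d (var V (e i))) (\<phi> i)"
  have de: "d (var V (e i)) \<in> carrier (Al V)" if "i < n" for i using e[OF that] by (intro Der_closed[OF d] var_closed[OF V])
  have tc: "?t i \<in> carrier (Der R P V)" if "i < n" for i using that by (intro ten_Der[OF V] de \<phi>)
  have s: "(\<Oplus>\<^bsub>Der R P V\<^esub>i\<in>{..<n}. ?t i) \<in> carrier (Der R P V)" using tc by (intro D.finsum_closed) auto
  have L: "(\<lambda>v. d (var V v)) \<in> lin_maps R V (Al V)" by (rule lin_maps_comp[OF var_lin[OF V] Der_lin[OF d]])
  have d_eq: "d = (\<Oplus>\<^bsub>Der R P V\<^esub>i\<in>{..<n}. ?t i)"
  proof (rule Der_eqI[OF V d s])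
    fix v assume v: "v \<in> carrier V"
    have \<phi>v: "\<phi> i v \<in> carrier R" if "i < n" for i using functional_closed[OF \<phi>[OF that] v] .
    have "d (var V v) = d (var V (\<Oplus>\<^bsub>V\<^esub>i\<in>{..<n}. \<phi> i v \<odot>\<^bsub>V\<^esub> e i))" using dec[OF v] by simp
    also have "\<dots> = (\<Oplus>\<^bsub>Al V\<^esub>i\<in>{..<n}. d (var V (\<phi> i v \<odot>\<^bsub>V\<^esub> e i)))"
      using e \<phi>v by (intro lin_maps_finsum_apply[OF V A L] mod_smult[OF V]) auto
    also have "\<dots> = (\<Oplus>\<^bsub>Al V\<^esub>i\<in>{..<n}. ?t i (var V v))"
      using e \<phi>v v \<phi> de by (intro A.finsum_cong') (auto simp: lin_maps_smult[OF L] ten_var[OF V])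
    also have "\<dots> = (\<Oplus>\<^bsub>Der R P V\<^esub>i\<in>{..<n}. ?t i) (var V v)"
      using tc v by (intro lin_maps_finsum_apply[OF D A Der_eval, symmetric] var_closed[OF V]) auto
    finally show "d (var V v) = (\<Oplus>\<^bsub>Der R P V\<^esub>i\<in>{..<n}. ?t i) (var V v)" .
  qed
  have sum_in: "(\<Oplus>\<^bsub>Der R P V\<^esub>i\<in>I. ?t i) \<in> H" if "finite I" "I \<subseteq> {..<n}" for I
    using that
  proof (induction I rule: finite_induct)
    case empty
    then show ?case using submodule_facts(2)[OF D H] by simp
  next
    case (insert i I)
    then have "(\<Oplus>\<^bsub>Der R P V\<^esub>i\<in>insert i I. ?t i) = ?t i \<oplus>\<^bsub>Der R P V\<^esub> (\<Oplus>\<^bsub>Der R P V\<^esub>i\<in>I. ?t i)"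
      using tc by (intro D.finsum_insert) auto
    then show ?case using insert t e \<phi> submodule_facts(3)[OF D H] by auto
  qed
  show ?thesis by (rule ssubst[where P = "\<lambda>d. d \<in> H", OF d_eq sum_in]) simp_all
qed

end

section \<open>Functoriality of derivations\<close>

context bin_operad
begin

lemma fa_map_comp:
  assumes V: "module R V" and W: "module R W" and K: "module R K"
    and f: "f \<in> lin_maps R V W" and g: "g \<in> lin_maps R W K" and h: "h \<in> lin_maps R V K"
    and eq: "\<And>v. v \<in> carrier V \<Longrightarrow> g (f v) = h v" and X: "X \<in> carrier (Al V)"
  shows "fa_map R P K g (fa_map R P W f X) = fa_map R P K h X"
proof (rule alg_lin_eq[OF V module_alg[OF K] lin_maps_comp[OF fa_map_lin[OF V W f] fa_map_lin[OF W K g]] fa_map_lin[OF V K h] _ X])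
  fix a assume a: "a \<in> fa_gens P V"
  note fa = fa_gensE[OF a]
  have "map f (snd a) \<in> lists (carrier W)" using fa(3) by (rule lin_maps_list[OF f])
  then have b: "(fst a, map f (snd a)) \<in> fa_gens P W" using fa by (simp add: fa_gens_def)
  have "map g (map f (snd a)) = map h (snd a)" using fa(3) eq by (auto simp: in_lists_conv_set)
  then show "fa_map R P K g (fa_map R P W f (tm V a)) = fa_map R P K h (tm V a)"
    using fa_map_tm[OF W K g b] by (simp add: fa_map_tm[OF V W f a] fa_map_tm[OF V K h a] del: map_map)
qed

lemma fa_map_ident:
  assumes V: "module R V" and h: "h \<in> lin_maps R V V" and eq: "\<And>v. v \<in> carrier V \<Longrightarrow> h v = v" and X: "X \<in> carrier (Al V)"
  shows "fa_map R P V h X = X"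
proof (rule alg_lin_eq[OF V module_alg[OF V] fa_map_lin[OF V V h] lin_maps_id _ X])
  fix a assume a: "a \<in> fa_gens P V"
  have "map h (snd a) = snd a" using fa_gensE(3)[OF a] eq by (auto simp: in_lists_conv_set intro: map_idI)
  then show "fa_map R P V h (tm V a) = tm V a" by (simp add: fa_map_tm[OF V V h a])
qed

lemma fa_map_closed: "module R V \<Longrightarrow> module R W \<Longrightarrow> h \<in> lin_maps R V W \<Longrightarrow> X \<in> carrier (Al V) \<Longrightarrow> fa_map R P W h X \<in> carrier (Al W)"
  by (rule lin_maps_closed[OF fa_map_lin])

lemma fa_map_dec:
  assumes V: "module R V" and W: "module R W" and h: "h \<in> lin_maps R V W" and X: "X \<in> dec V"
  shows "fa_map R P W h X \<in> dec W"
proof (rule dec_into[OF V module_alg[OF W] fa_map_lin[OF V W h] submodule_dec[OF W] _ X])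
  fix b X Y assume "b \<in> carrier (Op P 2)" "X \<in> carrier (Al V)" "Y \<in> carrier (Al V)"
  then show "fa_map R P W h (bop V b X Y) \<in> dec W"
    by (simp add: fa_map_bop[OF V W h] bop_dec fa_map_closed[OF V W h])
qed

lemma fa_map_deg:
  assumes V: "module R V" and W: "module R W" and h: "h \<in> lin_maps R V W" and X: "X \<in> fa_deg R P V n"
  shows "fa_map R P W h X \<in> fa_deg R P W n"
proof (rule fa_deg_into[OF V module_alg[OF W] fa_map_lin[OF V W h] submodule_fa_deg[OF W] _ X])
  fix g assume g: "g \<in> fa_gens P V" "fst (fst g) = n"
  have "map h (snd g) \<in> lists (carrier W)" using fa_gensE(3)[OF g(1)] by (rule lin_maps_list[OF h])
  then have "(fst g, map h (snd g)) \<in> fa_gens P W" using fa_gensE[OF g(1)] by (simp add: fa_gens_def)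
  from tm_deg[OF this] show "fa_map R P W h (tm V g) \<in> fa_deg R P W n"
    unfolding fa_map_tm[OF V W h g(1)] using g(2) by simp
qed

lemma SR_homD:
  assumes "f \<in> SR_hom R V W"
  shows "fst f \<in> lin_maps R V W" "snd f \<in> lin_maps R W V" "\<And>v. v \<in> carrier V \<Longrightarrow> snd f (fst f v) = v"
  using assms by (auto simp: SR_hom_def)

lemma Der_map_facts:
  assumes V: "module R V" and W: "module R W" and f: "f \<in> SR_hom R V W" and d: "d \<in> carrier (Der R P V)"
  shows Der_map_Der: "Der_map R P V W f d \<in> carrier (Der R P W)"
    and Der_map_var: "\<And>w. w \<in> carrier W \<Longrightarrow> Der_map R P V W f d (var W w) = fa_map R P W (fst f) (d (var V (snd f w)))"
proof -
  note F = SR_homD[OF f]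
  have h: "(\<lambda>w. fa_map R P W (fst f) (d (var V (snd f w)))) \<in> lin_maps R W (Al W)"
    by (rule lin_maps_comp[OF lin_maps_comp[OF lin_maps_comp[OF F(2) var_lin[OF V]] Der_lin[OF d]] fa_map_lin[OF V W F(1)]])
  show "Der_map R P V W f d \<in> carrier (Der R P W)"
    "\<And>w. w \<in> carrier W \<Longrightarrow> Der_map R P V W f d (var W w) = fa_map R P W (fst f) (d (var V (snd f w)))"
    unfolding Der_map_def using der_ext_facts[OF W h] by auto
qed

text \<open>Both sides satisfy the same Leibniz rule along \<open>O(i)\<close>, and on \<open>V\<close> they agree because \<open>r \<circ> i = id\<close>.
  Compatibility with composition and with brackets are consequences.\<close>
lemma Der_map_intertwines:
  assumes V: "module R V" and W: "module R W" and f: "f \<in> SR_hom R V W" and d: "d \<in> carrier (Der R P V)" and X: "X \<in> carrier (Al V)"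
  shows "Der_map R P V W f d (fa_map R P W (fst f) X) = fa_map R P W (fst f) (d X)"
  using V X
proof (induction rule: alg_induct)
  note F = SR_homD[OF f] and DD = Der_map_Der[OF V W f d] and m = fa_map_lin[OF V W SR_homD(1)[OF f]]
  note mc = lin_maps_closed[OF m] and dc = Der_closed[OF d]
  {
    case (var v)
    then show ?case using lin_maps_closed[OF F(1)] F(3) by (simp add: fa_map_var[OF V W F(1)] Der_map_var[OF V W f d])
  next
    case (add X Y)
    then show ?case by (simp add: lin_maps_add[OF m] mc dc lin_maps_add[OF Der_lin[OF DD]] lin_maps_add[OF Der_lin[OF d]])
  next
    case (smult a X)
    then show ?case by (simp add: lin_maps_smult[OF m] mc dc lin_maps_smult[OF Der_lin[OF DD]] lin_maps_smult[OF Der_lin[OF d]])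
  next
    case (bop b X Y)
    then show ?case
      by (simp add: fa_map_bop[OF V W F(1)] Der_bop[OF W DD] Der_bop[OF V d] mc dc lin_maps_add[OF m] bop_closed[OF V])
  }
qed

lemma Der_map_lin:
  assumes V: "module R V" and W: "module R W" and f: "f \<in> SR_hom R V W"
  shows "Der_map R P V W f \<in> lin_maps R (Der R P V) (Der R P W)"
proof -
  note F = SR_homD[OF f] and m = fa_map_lin[OF V W SR_homD(1)[OF f]]
  note c = Der_map_Der[OF V W f] and v = Der_map_var[OF V W f]
  have vc: "var V (snd f w) \<in> carrier (Al V)" if "w \<in> carrier W" for w
    using that by (intro var_closed[OF V] lin_maps_closed[OF F(2)])
  show ?thesis
  proof (rule lin_mapsI)
    fix d e assume d: "d \<in> carrier (Der R P V)" and e: "e \<in> carrier (Der R P V)"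
    note de = mod_add[OF module_Der[OF V] d e]
    show "Der_map R P V W f (d \<oplus>\<^bsub>Der R P V\<^esub> e) = Der_map R P V W f d \<oplus>\<^bsub>Der R P W\<^esub> Der_map R P V W f e"
      by (rule Der_eqI[OF W c[OF de] mod_add[OF module_Der[OF W] c[OF d] c[OF e]]])
        (simp add: v d e de Der_apply var_closed[OF W] vc lin_maps_add[OF m] Der_closed[OF d] Der_closed[OF e])
  next
    fix a d assume a: "a \<in> carrier R" and d: "d \<in> carrier (Der R P V)"
    note ad = mod_smult[OF module_Der[OF V] a d]
    show "Der_map R P V W f (a \<odot>\<^bsub>Der R P V\<^esub> d) = a \<odot>\<^bsub>Der R P W\<^esub> Der_map R P V W f d"
      by (rule Der_eqI[OF W c[OF ad] mod_smult[OF module_Der[OF W] a c[OF d]]])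
        (simp add: v a d ad Der_apply var_closed[OF W] vc lin_maps_smult[OF m] Der_closed[OF d])
  qed (rule c)
qed

lemma Der_map_ident:
  assumes V: "module R V" and d: "d \<in> carrier (Der R P V)"
  shows "Der_map R P V V (id, id) d = d"
proof -
  have f: "(id, id) \<in> SR_hom R V V" by (auto simp: SR_hom_def lin_maps_def)
  show ?thesis
    by (rule Der_eqI[OF V Der_map_Der[OF V V f d] d])
      (simp add: Der_map_var[OF V V f d] fa_map_ident[OF V SR_homD(1)[OF f, simplified]] Der_closed[OF d] var_closed[OF V])
qed

lemma SR_comp_hom:
  assumes "f \<in> SR_hom R U V" "g \<in> SR_hom R V W"
  shows "SR_comp g f \<in> SR_hom R U W"
  using SR_homD[OF assms(1)] SR_homD[OF assms(2)]
  by (auto simp: SR_hom_def SR_comp_def comp_def lin_maps_comp[of "fst f"] lin_maps_comp[of "snd g"] lin_maps_closed)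

lemma Der_map_SR_comp:
  assumes U: "module R U" and V: "module R V" and W: "module R W"
    and f: "f \<in> SR_hom R U V" and g: "g \<in> SR_hom R V W" and d: "d \<in> carrier (Der R P U)"
  shows "Der_map R P U W (SR_comp g f) d = Der_map R P V W g (Der_map R P U V f d)"
proof -
  note F = SR_homD[OF f] and G = SR_homD[OF g] and h = SR_comp_hom[OF f g]
  note d' = Der_map_Der[OF U V f d]
  show ?thesis
  proof (rule Der_eqI[OF W Der_map_Der[OF U W h d] Der_map_Der[OF V W g d']])
    fix w assume w: "w \<in> carrier W"
    have gw: "snd g w \<in> carrier V" using w by (rule lin_maps_closed[OF G(2)])
    have X: "d (var U (snd f (snd g w))) \<in> carrier (Al U)"
      by (intro Der_closed[OF d] var_closed[OF U] lin_maps_closed[OF F(2)] gw)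
    show "Der_map R P U W (SR_comp g f) d (var W w) = Der_map R P V W g (Der_map R P U V f d) (var W w)"
      unfolding Der_map_var[OF U W h d w] Der_map_var[OF V W g d' w] Der_map_var[OF U V f d gw]
      using fa_map_comp[OF U V W F(1) G(1) SR_homD(1)[OF h] _ X] by (simp add: SR_comp_def)
  qed
qed

lemma Der_map_bracket:
  assumes V: "module R V" and W: "module R W" and f: "f \<in> SR_hom R V W"
    and d: "d \<in> carrier (Der R P V)" and e: "e \<in> carrier (Der R P V)"
  shows "Der_map R P V W f (bracket R P V d e) = bracket R P W (Der_map R P V W f d) (Der_map R P V W f e)"
proof -
  note F = SR_homD[OF f] and d' = Der_map_Der[OF V W f d] and e' = Der_map_Der[OF V W f e]
  note B = bracket_Der[OF V d e]
  show ?thesis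
  proof (rule Der_eqI[OF W Der_map_Der[OF V W f B] bracket_Der[OF W d' e']])
    fix w assume w: "w \<in> carrier W"
    let ?x = "var V (snd f w)"
    have x: "?x \<in> carrier (Al V)" using w by (intro var_closed[OF V] lin_maps_closed[OF F(2)])
    show "Der_map R P V W f (bracket R P V d e) (var W w) = bracket R P W (Der_map R P V W f d) (Der_map R P V W f e) (var W w)"
      using x
      by (simp add: Der_map_var[OF V W f B w] bracket_apply[OF V d e] bracket_apply[OF W d' e'] var_closed[OF W w]
        Der_map_var[OF V W f d w] Der_map_var[OF V W f e w] Der_map_intertwines[OF V W f] d e Der_closed[OF d] Der_closed[OF e]
        lin_maps_diff[OF module_alg[OF V] module_alg[OF W] fa_map_lin[OF V W F(1)]])
  qed
qed

lemma Der_map_ten: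
  assumes V: "module R V" and W: "module R W" and f: "f \<in> SR_hom R V W"
    and x: "x \<in> carrier (Al V)" and \<phi>: "\<phi> \<in> functionals V"
  shows "Der_map R P V W f (ten V x \<phi>) = ten W (fa_map R P W (fst f) x) (\<lambda>w. \<phi> (snd f w))"
proof -
  note F = SR_homD[OF f] and m = fa_map_lin[OF V W SR_homD(1)[OF f]]
  have \<phi>': "(\<lambda>w. \<phi> (snd f w)) \<in> functionals W" by (rule lin_maps_comp[OF F(2) \<phi>])
  note t = ten_Der[OF V x \<phi>] and mx = lin_maps_closed[OF m x]
  show ?thesis
    by (rule Der_eqI[OF W Der_map_Der[OF V W f t] ten_Der[OF W mx \<phi>']])
      (simp add: Der_map_var[OF V W f t] ten_var[OF V x \<phi>] ten_var[OF W mx \<phi>'] lin_maps_closed[OF F(2)]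
        lin_maps_smult[OF m] functional_closed[OF \<phi>] x)
qed

section \<open>Positive degree and the Lie algebra generated in degree one\<close>

lemma Der_deg_iff: "d \<in> Der_deg R P V k \<longleftrightarrow> d \<in> carrier (Der R P V) \<and> (\<forall>v\<in>carrier V. d (var V v) \<in> fa_deg R P V (k + 1))"
  by (simp add: Der_deg_def)

lemma submodule_Der_values:
  assumes V: "module R V" and H: "submodule H R (Al V)"
  shows "submodule {d \<in> carrier (Der R P V). \<forall>v\<in>carrier V. d (var V v) \<in> H} R (Der R P V)"
  using submodule_facts[OF module_alg[OF V] H] module_facts[OF module_Der[OF V]]
  by (intro submoduleI'[OF module_Der[OF V]]) (auto simp: Der_apply var_closed[OF V])

lemma Der_pos_sub: "(\<Union>k\<in>{1..}. Der_deg R P V k) \<subseteq> carrier (Der R P V)"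
  by (auto simp: Der_deg_iff)

lemma Der_plus_carrier_mspan: "carrier (Der_plus R P V) = mspan R (Der R P V) (\<Union>k\<in>{1..}. Der_deg R P V k)"
  by (simp add: Der_plus_def)

lemma submodule_Der_plus: "module R V \<Longrightarrow> submodule (carrier (Der_plus R P V)) R (Der R P V)"
  unfolding Der_plus_carrier_mspan by (intro submodule_mspan module_Der Der_pos_sub)

text \<open>The decomposables are the sum of the parts of arity at least two, and a dual basis splits \<open>d\<close> into
  homogeneous pieces. This replaces the grading by a single condition on values.\<close>
lemma Der_plus_iff:
  assumes V: "module R V" and db: "dual_basis V"
  shows "d \<in> carrier (Der_plus R P V) \<longleftrightarrow> d \<in> carrier (Der R P V) \<and> (\<forall>v\<in>carrier V. d (var V v) \<in> dec V)"
proof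
  let ?H = "{d \<in> carrier (Der R P V). \<forall>v\<in>carrier V. d (var V v) \<in> dec V}"
  have "(\<Union>k\<in>{1..}. Der_deg R P V k) \<subseteq> ?H"
  proof (intro UN_least subsetI)
    fix k d assume "k \<in> {1::nat..}" "d \<in> Der_deg R P V k"
    then show "d \<in> ?H" using fa_deg_dec[OF V, of "k + 1"] unfolding Der_deg_iff by auto
  qed
  then have "mspan R (Der R P V) (\<Union>k\<in>{1..}. Der_deg R P V k) \<subseteq> ?H"
    by (intro mspan_least submodule_Der_values submodule_dec V)
  then show "d \<in> carrier (Der_plus R P V) \<Longrightarrow> d \<in> carrier (Der R P V) \<and> (\<forall>v\<in>carrier V. d (var V v) \<in> dec V)"
    unfolding Der_plus_carrier_mspan by blast
next
  assume d: "d \<in> carrier (Der R P V) \<and> (\<forall>v\<in>carrier V. d (var V v) \<in> dec V)"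
  show "d \<in> carrier (Der_plus R P V)"
  proof (rule Der_in_submodule[OF V db submodule_Der_plus[OF V]])
    fix v f assume v: "v \<in> carrier V" and f: "f \<in> functionals V"
    show "ten V (d (var V v)) f \<in> carrier (Der_plus R P V)"
    proof (rule dec_deg[OF V module_Der[OF V] ten_linear[OF V f] submodule_Der_plus[OF V]])
      fix k X assume k: "2 \<le> k" and X: "X \<in> fa_deg R P V k"
      note fd = submodule_facts[OF module_alg[OF V] submodule_fa_deg[OF V]]
      have XA: "X \<in> carrier (Al V)" using X fd(1) by blast
      have "ten V X f \<in> Der_deg R P V (k - 1)"
        unfolding Der_deg_iff using k X fd(4) ten_Der[OF V XA f] functional_closed[OF f] by (simp add: ten_var[OF V XA f])
      then show "ten V X f \<in> carrier (Der_plus R P V)"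
        using k unfolding Der_plus_carrier_mspan by (intro mspan_memI) auto
    qed (use d v in auto)
  qed (use d in auto)
qed

lemma Der_plus_sub: "module R V \<Longrightarrow> d \<in> carrier (Der_plus R P V) \<Longrightarrow> d \<in> carrier (Der R P V)"
  using submodule_facts(1)[OF module_Der submodule_Der_plus] by blast

lemma Der_plus_bracket:
  assumes V: "module R V" and db: "dual_basis V" and d: "d \<in> carrier (Der_plus R P V)" and e: "e \<in> carrier (Der_plus R P V)"
  shows "bracket R P V d e \<in> carrier (Der_plus R P V)"
proof -
  note D = Der_plus_sub[OF V d] Der_plus_sub[OF V e]
  have "d (var V v) \<in> dec V" "e (var V v) \<in> dec V" if "v \<in> carrier V" for v
    using d e that unfolding Der_plus_iff[OF V db] by auto
  then show ?thesis
    unfolding Der_plus_iff[OF V db]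
    using bracket_Der[OF V D] Der_dec[OF V D(1)] Der_dec[OF V D(2)] submodule_facts(5)[OF module_alg[OF V] submodule_dec[OF V]]
    by (simp add: bracket_apply[OF V D] var_closed[OF V])
qed

lemma Der_map_deg:
  assumes V: "module R V" and W: "module R W" and f: "f \<in> SR_hom R V W" and d: "d \<in> Der_deg R P V k"
  shows "Der_map R P V W f d \<in> Der_deg R P W k"
proof -
  have D: "d \<in> carrier (Der R P V)" using d by (simp add: Der_deg_iff)
  show ?thesis unfolding Der_deg_iff
  proof (intro conjI ballI)
    fix w assume w: "w \<in> carrier W"
    have "d (var V (snd f w)) \<in> fa_deg R P V (k + 1)"
      using d lin_maps_closed[OF SR_homD(2)[OF f] w] unfolding Der_deg_iff by blast
    then show "Der_map R P V W f d (var W w) \<in> fa_deg R P W (k + 1)"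
      unfolding Der_map_var[OF V W f D w] by (rule fa_map_deg[OF V W SR_homD(1)[OF f]])
  qed (rule Der_map_Der[OF V W f D])
qed

lemma Der_map_plus:
  assumes V: "module R V" and W: "module R W" and f: "f \<in> SR_hom R V W" and d: "d \<in> carrier (Der_plus R P V)"
  shows "Der_map R P V W f d \<in> carrier (Der_plus R P W)"
proof (rule lin_maps_mspan_into[OF module_Der[OF V] module_Der[OF W] Der_map_lin[OF V W f] Der_pos_sub submodule_Der_plus[OF W]])
  show "d \<in> mspan R (Der R P V) (\<Union>k\<in>{1..}. Der_deg R P V k)" using d unfolding Der_plus_carrier_mspan .
  fix s assume "s \<in> (\<Union>k\<in>{1..}. Der_deg R P V k)"
  then show "Der_map R P V W f s \<in> carrier (Der_plus R P W)"
    unfolding Der_plus_carrier_mspan using Der_map_deg[OF V W f] by (intro mspan_memI) auto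
qed

abbreviation "Lie V \<equiv> carrier (Der_Lie R P V)"

lemma Lie_facts:
  assumes V: "module R V"
  shows submodule_Lie: "submodule (Lie V) R (Der R P V)"
    and Lie_bracket: "\<And>d e. d \<in> Lie V \<Longrightarrow> e \<in> Lie V \<Longrightarrow> bracket R P V d e \<in> Lie V"
    and Lie_deg1: "\<And>d. d \<in> Der_deg R P V 1 \<Longrightarrow> d \<in> Lie V"
proof -
  have c: "Lie V = \<Inter>{L. submodule L R (Der R P V) \<and> (\<forall>d\<in>L. \<forall>e\<in>L. bracket R P V d e \<in> L) \<and> Der_deg R P V 1 \<subseteq> L}"
    by (simp add: Der_Lie_def)
  show "submodule (Lie V) R (Der R P V)"
    unfolding c
  proof (rule submodule_Inter[OF module_Der[OF V]])
    have "carrier (Der R P V) \<in> {L. submodule L R (Der R P V) \<and> (\<forall>d\<in>L. \<forall>e\<in>L. bracket R P V d e \<in> L) \<and> Der_deg R P V 1 \<subseteq> L}"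
      using submodule_carrier[OF module_Der[OF V]] bracket_Der[OF V] by (auto simp: Der_deg_iff)
    then show "{L. submodule L R (Der R P V) \<and> (\<forall>d\<in>L. \<forall>e\<in>L. bracket R P V d e \<in> L) \<and> Der_deg R P V 1 \<subseteq> L} \<noteq> {}" by blast
  qed blast
  show "\<And>d e. d \<in> Lie V \<Longrightarrow> e \<in> Lie V \<Longrightarrow> bracket R P V d e \<in> Lie V" unfolding c by blast
  show "\<And>d. d \<in> Der_deg R P V 1 \<Longrightarrow> d \<in> Lie V" unfolding c by blast
qed

lemma Lie_least:
  assumes "submodule L R (Der R P V)" "\<And>d e. d \<in> L \<Longrightarrow> e \<in> L \<Longrightarrow> bracket R P V d e \<in> L" "Der_deg R P V 1 \<subseteq> L"
  shows "Lie V \<subseteq> L"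
  using assms by (auto simp: Der_Lie_def)

lemma Lie_sub: "module R V \<Longrightarrow> d \<in> Lie V \<Longrightarrow> d \<in> carrier (Der R P V)"
  using submodule_facts(1)[OF module_Der submodule_Lie] by blast

lemma Lie_plus:
  assumes V: "module R V" and db: "dual_basis V"
  shows "Lie V \<subseteq> carrier (Der_plus R P V)"
  by (rule Lie_least[OF submodule_Der_plus[OF V] Der_plus_bracket[OF V db]])
    (auto simp: Der_plus_carrier_mspan intro!: mspan_memI bexI[of _ 1])

text \<open>The preimage of the Lie algebra of \<open>W\<close> is a Lie algebra containing the derivations of degree one.\<close>
lemma Der_map_Lie:
  assumes V: "module R V" and W: "module R W" and f: "f \<in> SR_hom R V W" and d: "d \<in> Lie V"
  shows "Der_map R P V W f d \<in> Lie W"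
proof -
  let ?L = "{d \<in> carrier (Der R P V). Der_map R P V W f d \<in> Lie W}"
  have "Lie V \<subseteq> ?L"
  proof (rule Lie_least)
    show "submodule ?L R (Der R P V)"
      by (rule submodule_preimage[OF module_Der[OF V] module_Der[OF W] Der_map_lin[OF V W f] submodule_Lie[OF W]])
    show "bracket R P V d e \<in> ?L" if "d \<in> ?L" "e \<in> ?L" for d e
      using that bracket_Der[OF V] Lie_bracket[OF W] by (simp add: Der_map_bracket[OF V W f])
    show "Der_deg R P V 1 \<subseteq> ?L"
      using Lie_deg1[OF W Der_map_deg[OF V W f]] by (auto simp: Der_deg_iff[of _ V])
  qed
  then show ?thesis using d by blast
qed

end

section \<open>Pointed derivations and the divergence\<close>

context bin_operad
begin

lemma module_pt: "module R V \<Longrightarrow> module R (pt R V)"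
  by (rule module_dsum[OF module_self])

lemma lin_zero_pair: "module R V \<Longrightarrow> Pair \<zero> \<in> lin_maps R V (pt R V)"
  using lin_inr[OF module_self, of V] by simp

text \<open>The inclusion \<open>O(V) \<subseteq> O(R \<oplus> V)\<close>, the base point, and the terms linear in it.\<close>
abbreviation "lft V \<equiv> fa_map R P (pt R V) (Pair \<zero>)"
abbreviation "base V \<equiv> var (pt R V) (\<one>, \<zero>\<^bsub>V\<^esub>)"
abbreviation "Lin V \<equiv> fa_lin R P V (self_module R)"

lemma lft_lin: "module R V \<Longrightarrow> lft V \<in> lin_maps R (Al V) (Al (pt R V))"
  by (intro fa_map_lin module_pt lin_zero_pair)

lemma lft_closed: "module R V \<Longrightarrow> X \<in> carrier (Al V) \<Longrightarrow> lft V X \<in> carrier (Al (pt R V))"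
  by (rule lin_maps_closed[OF lft_lin])

lemma lft_var: "module R V \<Longrightarrow> v \<in> carrier V \<Longrightarrow> lft V (var V v) = var (pt R V) (\<zero>, v)"
  by (rule fa_map_var[OF _ module_pt lin_zero_pair])

lemma lft_bop: "module R V \<Longrightarrow> b \<in> carrier (Op P 2) \<Longrightarrow> X \<in> carrier (Al V) \<Longrightarrow> Y \<in> carrier (Al V) \<Longrightarrow>
    lft V (bop V b X Y) = bop (pt R V) b (lft V X) (lft V Y)"
  by (rule fa_map_bop[OF _ module_pt lin_zero_pair])

lemma base_closed: "module R V \<Longrightarrow> base V \<in> carrier (Al (pt R V))"
  by (rule var_closed[OF module_pt]) (auto simp: mod_zero)

lemma var_point:
  assumes V: "module R V" and a: "a \<in> carrier R"
  shows "var (pt R V) (a, \<zero>\<^bsub>V\<^esub>) = a \<odot>\<^bsub>Al (pt R V)\<^esub> base V"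
proof -
  interpret V: module R V by (rule V)
  show ?thesis
    using lin_maps_smult[OF var_lin[OF module_pt[OF V]] a, of "(\<one>, \<zero>\<^bsub>V\<^esub>)"] a by simp
qed

lemma var_pt:
  assumes V: "module R V" and u: "u \<in> carrier (pt R V)"
  shows "var (pt R V) u = fst u \<odot>\<^bsub>Al (pt R V)\<^esub> base V \<oplus>\<^bsub>Al (pt R V)\<^esub> var (pt R V) (\<zero>, snd u)"
proof -
  interpret V: module R V by (rule V)
  have "var (pt R V) ((fst u, \<zero>\<^bsub>V\<^esub>) \<oplus>\<^bsub>pt R V\<^esub> (\<zero>, snd u)) = var (pt R V) (fst u, \<zero>\<^bsub>V\<^esub>) \<oplus>\<^bsub>Al (pt R V)\<^esub> var (pt R V) (\<zero>, snd u)"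
    using u by (intro lin_maps_add[OF var_lin[OF module_pt[OF V]]]) auto
  moreover have "(fst u, \<zero>\<^bsub>V\<^esub>) \<oplus>\<^bsub>pt R V\<^esub> (\<zero>, snd u) = u" using u by (cases u) simp
  moreover have "fst u \<in> carrier R" using u by auto
  ultimately show ?thesis using var_point[OF V, of "fst u"] by simp
qed

subsection \<open>Terms linear in the base point\<close>

text \<open>Lists of variables from \<open>V\<close>, and lists with exactly one variable from the base point: the two kinds of
  leaf labels that occur when a term linear in the base point is taken apart.\<close>
definition base_list :: "('r, 'v) module \<Rightarrow> ('r \<times> 'v) list \<Rightarrow> bool" where
  "base_list V us \<longleftrightarrow> (\<exists>vs\<in>lists (carrier V). us = map (Pair \<zero>) vs)"

definition lin_list :: "('r, 'v) module \<Rightarrow> ('r \<times> 'v) list \<Rightarrow> bool" where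
  "lin_list V us \<longleftrightarrow> (\<exists>vs\<in>lists (carrier V). \<exists>i<length vs. \<exists>a\<in>carrier R. us = (map (Pair \<zero>) vs)[i := (a, \<zero>\<^bsub>V\<^esub>)])"

lemma base_listI: "vs \<in> lists (carrier V) \<Longrightarrow> base_list V (map (Pair \<zero>) vs)"
  unfolding base_list_def by blast

lemma lin_listI: "vs \<in> lists (carrier V) \<Longrightarrow> i < length vs \<Longrightarrow> a \<in> carrier R \<Longrightarrow> lin_list V ((map (Pair \<zero>) vs)[i := (a, \<zero>\<^bsub>V\<^esub>)])"
  unfolding lin_list_def by blast

lemma base_list_append:
  assumes "base_list V (us @ ws)"
  shows "base_list V us" "base_list V ws"
proof -
  obtain vs where vs: "vs \<in> lists (carrier V)" "us @ ws = map (Pair \<zero>) vs" using assms by (auto simp: base_list_def)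
  then obtain vs1 vs2 where "vs = vs1 @ vs2" "us = map (Pair \<zero>) vs1" "ws = map (Pair \<zero>) vs2"
    by (auto simp: append_eq_map_conv)
  then show "base_list V us" "base_list V ws" using vs(1) by (auto simp: base_list_def)
qed

lemma lin_list_append:
  assumes "lin_list V (us @ ws)"
  shows "lin_list V us \<and> base_list V ws \<or> base_list V us \<and> lin_list V ws"
proof -
  obtain vs i a where vs: "vs \<in> lists (carrier V)" "i < length vs" "a \<in> carrier R"
    and e: "us @ ws = (map (Pair \<zero>) vs)[i := (a, \<zero>\<^bsub>V\<^esub>)]" using assms by (auto simp: lin_list_def)
  let ?n = "length us"
  have tl: "take ?n vs \<in> lists (carrier V)" "drop ?n vs \<in> lists (carrier V)"
    using vs(1) by (auto simp: in_lists_conv_set dest: in_set_takeD in_set_dropD)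
  have us: "us = take ?n ((map (Pair \<zero>) vs)[i := (a, \<zero>\<^bsub>V\<^esub>)])" and ws: "ws = drop ?n ((map (Pair \<zero>) vs)[i := (a, \<zero>\<^bsub>V\<^esub>)])"
    using e by (metis append_eq_conv_conj)+
  have len: "length vs = ?n + length ws" using arg_cong[OF e, of length] by simp
  show ?thesis
  proof (cases "i < ?n")
    case True
    have "us = (map (Pair \<zero>) (take ?n vs))[i := (a, \<zero>\<^bsub>V\<^esub>)]" using us by (simp add: take_update_swap take_map)
    then have "lin_list V us" using lin_listI[OF tl(1) _ vs(3), of i] True len by simp
    moreover have "ws = map (Pair \<zero>) (drop ?n vs)" using ws True by (simp add: drop_map)
    then have "base_list V ws" using base_listI[OF tl(2)] by simp
    ultimately show ?thesis by blast
  next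
    case False
    have "us = map (Pair \<zero>) (take ?n vs)" using us False by (simp add: take_map)
    then have "base_list V us" using base_listI[OF tl(1)] by simp
    moreover have w: "ws = (map (Pair \<zero>) (drop ?n vs))[i - ?n := (a, \<zero>\<^bsub>V\<^esub>)]" using ws False by (simp add: drop_update_swap drop_map)
    have "i - ?n < length (drop ?n vs)" using False vs(2) by simp
    then have "lin_list V ((map (Pair \<zero>) (drop ?n vs))[i - ?n := (a, \<zero>\<^bsub>V\<^esub>)])" by (rule lin_listI[OF tl(2) _ vs(3)])
    then have "lin_list V ws" using w by (rule ssubst[rotated, where P = "lin_list V"])
    ultimately show ?thesis by blast
  qed
qed

lemma base_list_permute:
  assumes "base_list V us" "\<sigma> permutes {..<length us}"
  shows "base_list V (permute_list \<sigma> us)"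
proof -
  obtain vs where vs: "vs \<in> lists (carrier V)" "us = map (Pair \<zero>) vs" using assms(1) unfolding base_list_def by blast
  have \<sigma>: "\<sigma> permutes {..<length vs}" using assms(2) vs(2) by simp
  have "permute_list \<sigma> us = map (Pair \<zero>) (permute_list \<sigma> vs)" unfolding vs(2) using \<sigma> by (rule permute_list_map)
  then show ?thesis using base_listI[OF permute_list_lists[OF \<sigma> vs(1)]] by simp
qed

lemma lin_list_permute:
  assumes "lin_list V us" "\<sigma> permutes {..<length us}"
  shows "lin_list V (permute_list \<sigma> us)"
proof -
  obtain vs i a where vs: "vs \<in> lists (carrier V)" "i < length vs" "a \<in> carrier R"
    and e: "us = (map (Pair \<zero>) vs)[i := (a, \<zero>\<^bsub>V\<^esub>)]" using assms(1) unfolding lin_list_def by blast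
  have \<sigma>: "\<sigma> permutes {..<length vs}" using assms(2) e by simp
  have "permute_list \<sigma> us = (map (Pair \<zero>) (permute_list \<sigma> vs))[inv_into UNIV \<sigma> i := (a, \<zero>\<^bsub>V\<^esub>)]"
    unfolding e using permute_list_update[of \<sigma> "map (Pair \<zero>) vs" i] \<sigma> vs(2) by (simp add: permute_list_map)
  moreover have "inv_into UNIV \<sigma> i < length (permute_list \<sigma> vs)"
    using permutes_in_image[OF permutes_inv[OF \<sigma>], of i] vs(2) by simp
  ultimately show ?thesis using permute_list_lists[OF \<sigma> vs(1)] vs(3) unfolding lin_list_def by blast
qed

abbreviation "Lin_gens V \<equiv> {tm (pt R V) g | g. g \<in> fa_gens P (pt R V) \<and> lin_list V (snd g)}"

lemma Lin_mspan:
  assumes V: "module R V"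
  shows "Lin V = mspan R (Al (pt R V)) (Lin_gens V)"
proof -
  have "{fa_term R P (pt R V) x ((map (\<lambda>v. (\<zero>\<^bsub>self_module R\<^esub>, v)) vs)[i := (w, \<zero>\<^bsub>V\<^esub>)]) | x vs i w.
        (x, vs) \<in> fa_gens P V \<and> i < length vs \<and> w \<in> carrier (self_module R)} = Lin_gens V" (is "?L = ?R")
  proof
    show "?L \<subseteq> ?R"
    proof
      fix t assume "t \<in> ?L"
      then obtain x vs i a where t: "t = fa_term R P (pt R V) x ((map (Pair \<zero>) vs)[i := (a, \<zero>\<^bsub>V\<^esub>)])"
        and g: "(x, vs) \<in> fa_gens P V" "i < length vs" "a \<in> carrier R" by auto
      note f = fa_gensE[OF g(1), simplified]
      have "(map (Pair \<zero>) vs)[i := (a, \<zero>\<^bsub>V\<^esub>)] \<in> lists (carrier (pt R V))"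
        using lin_maps_list[OF lin_zero_pair[OF V] f(3)] g(3) mod_zero[OF V] by (intro lists_update) auto
      then have "(x, (map (Pair \<zero>) vs)[i := (a, \<zero>\<^bsub>V\<^esub>)]) \<in> fa_gens P (pt R V)" using f by (simp add: fa_gens_iff)
      moreover have "lin_list V ((map (Pair \<zero>) vs)[i := (a, \<zero>\<^bsub>V\<^esub>)])" unfolding lin_list_def using f(3) g(2,3) by blast
      moreover have "t = tm (pt R V) (x, (map (Pair \<zero>) vs)[i := (a, \<zero>\<^bsub>V\<^esub>)])" by (simp add: t)
      ultimately show "t \<in> ?R" by (intro CollectI exI[of _ "(x, (map (Pair \<zero>) vs)[i := (a, \<zero>\<^bsub>V\<^esub>)])"]) simp
    qed
    show "?R \<subseteq> ?L"
    proof
      fix t assume "t \<in> ?R"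
      then obtain x us where t: "t = fa_term R P (pt R V) x us" and g: "(x, us) \<in> fa_gens P (pt R V)" "lin_list V us" by auto
      obtain vs i a where vs: "vs \<in> lists (carrier V)" "i < length vs" "a \<in> carrier R"
        and e: "us = (map (Pair \<zero>) vs)[i := (a, \<zero>\<^bsub>V\<^esub>)]" using g(2) by (auto simp: lin_list_def)
      have "(x, vs) \<in> fa_gens P V" using g(1) vs(1) e by (simp add: fa_gens_iff)
      then show "t \<in> ?L" using t vs e by (intro CollectI exI[of _ x] exI[of _ vs] exI[of _ i] exI[of _ a]) simp
    qed
  qed
  then show ?thesis by (simp add: fa_lin_def)
qed

lemma Lin_gens_sub: "module R V \<Longrightarrow> Lin_gens V \<subseteq> carrier (Al (pt R V))"
  using tm_closed[OF module_pt] by auto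

lemma submodule_Lin: "module R V \<Longrightarrow> submodule (Lin V) R (Al (pt R V))"
proof -
  assume V: "module R V"
  show ?thesis unfolding Lin_mspan[OF V] by (rule submodule_mspan[OF module_alg[OF module_pt[OF V]] Lin_gens_sub[OF V]])
qed

lemma Lin_sub: "module R V \<Longrightarrow> m \<in> Lin V \<Longrightarrow> m \<in> carrier (Al (pt R V))"
  using submodule_facts(1)[OF module_alg[OF module_pt] submodule_Lin] by blast

lemma Lin_into:
  assumes V: "module R V" and "module R M" "T \<in> lin_maps R (Al (pt R V)) M" "submodule H R M"
    "\<And>g. g \<in> fa_gens P (pt R V) \<Longrightarrow> lin_list V (snd g) \<Longrightarrow> T (tm (pt R V) g) \<in> H" "X \<in> Lin V"
  shows "T X \<in> H"
  by (rule lin_maps_mspan_into[OF module_alg[OF module_pt[OF V]] assms(2,3) Lin_gens_sub[OF V] assms(4) _ assms(6)[unfolded Lin_mspan[OF V]]])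
    (use assms(5) in auto)

lemma Lin_base: "module R V \<Longrightarrow> base V \<in> Lin V"
proof -
  assume V: "module R V"
  have c: "(\<one>, \<zero>\<^bsub>V\<^esub>) \<in> carrier (pt R V)" using mod_zero[OF V] by simp
  have "\<exists>vs\<in>lists (carrier V). \<exists>i<length vs. \<exists>a\<in>carrier R. [(\<one>, \<zero>\<^bsub>V\<^esub>)] = (map (Pair \<zero>) vs)[i := (a, \<zero>\<^bsub>V\<^esub>)]"
    using mod_zero[OF V] by (intro bexI[of _ "[\<zero>\<^bsub>V\<^esub>]"] exI[of _ 0] conjI bexI[of _ \<one>]) auto
  then have "lin_list V [(\<one>, \<zero>\<^bsub>V\<^esub>)]" by (simp add: lin_list_def)
  then show ?thesis unfolding Lin_mspan[OF V] var_tm using var_gen[OF c] by (intro mspan_memI) fastforce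
qed

lemma lin_list_append1: "lin_list V us \<Longrightarrow> vs \<in> lists (carrier V) \<Longrightarrow> lin_list V (us @ map (Pair \<zero>) vs)"
  unfolding lin_list_def
proof (elim bexE exE conjE)
  fix ws i a assume "ws \<in> lists (carrier V)" "i < length ws" "a \<in> carrier R" "us = (map (Pair \<zero>) ws)[i := (a, \<zero>\<^bsub>V\<^esub>)]" "vs \<in> lists (carrier V)"
  then show "\<exists>vs'\<in>lists (carrier V). \<exists>i<length vs'. \<exists>a\<in>carrier R. us @ map (Pair \<zero>) vs = (map (Pair \<zero>) vs')[i := (a, \<zero>\<^bsub>V\<^esub>)]"
    by (intro bexI[of _ "ws @ vs"] exI[of _ i] conjI bexI[of _ a]) (auto simp: list_update_append)
qed

lemma lin_list_append2: "lin_list V us \<Longrightarrow> vs \<in> lists (carrier V) \<Longrightarrow> lin_list V (map (Pair \<zero>) vs @ us)"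
  unfolding lin_list_def
proof (elim bexE exE conjE)
  fix ws i a assume "ws \<in> lists (carrier V)" "i < length ws" "a \<in> carrier R" "us = (map (Pair \<zero>) ws)[i := (a, \<zero>\<^bsub>V\<^esub>)]" "vs \<in> lists (carrier V)"
  then show "\<exists>vs'\<in>lists (carrier V). \<exists>i<length vs'. \<exists>a\<in>carrier R. map (Pair \<zero>) vs @ us = (map (Pair \<zero>) vs')[i := (a, \<zero>\<^bsub>V\<^esub>)]"
    by (intro bexI[of _ "vs @ ws"] exI[of _ "length vs + i"] conjI bexI[of _ a]) (auto simp: list_update_append)
qed

lemma Lin_bop:
  assumes V: "module R V" and b: "b \<in> carrier (Op P 2)" and m: "m \<in> Lin V" and X: "X \<in> carrier (Al V)"
  shows "bop (pt R V) b m (lft V X) \<in> Lin V" and "bop (pt R V) b (lft V X) m \<in> Lin V"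
proof -
  note W = module_pt[OF V] and AW = module_alg[OF module_pt[OF V]]
  have lt: "lft V (tm V h) = tm (pt R V) (fst h, map (Pair \<zero>) (snd h))" "(fst h, map (Pair \<zero>) (snd h)) \<in> fa_gens P (pt R V)"
    if h: "h \<in> fa_gens P V" for h
    using fa_map_tm[OF V W lin_zero_pair[OF V] h] fa_gensE[OF h] lin_maps_list[OF lin_zero_pair[OF V]] by (auto simp: fa_gens_def)
  have g1: "bop (pt R V) b (tm (pt R V) g) (lft V X) \<in> Lin V" "bop (pt R V) b (lft V X) (tm (pt R V) g) \<in> Lin V"
    if g: "g \<in> fa_gens P (pt R V)" "lin_list V (snd g)" for g
  proof -
    have tc: "tm (pt R V) g \<in> carrier (Al (pt R V))" by (rule tm_closed[OF W g(1)])
    have "bop (pt R V) b (tm (pt R V) g) (lft V (tm V h)) \<in> Lin V \<and> bop (pt R V) b (lft V (tm V h)) (tm (pt R V) g) \<in> Lin V"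
      if h: "h \<in> fa_gens P V" for h
    proof
      note l = lin_list_append1[OF g(2) fa_gensE(3)[OF h]] lin_list_append2[OF g(2) fa_gensE(3)[OF h]]
      show "bop (pt R V) b (tm (pt R V) g) (lft V (tm V h)) \<in> Lin V"
        unfolding lt(1)[OF h] bop_tm[OF W b g(1) lt(2)[OF h]] Lin_mspan[OF V]
        using bop_gen[OF b g(1) lt(2)[OF h]] l(1) by (intro mspan_memI) force
      show "bop (pt R V) b (lft V (tm V h)) (tm (pt R V) g) \<in> Lin V"
        unfolding lt(1)[OF h] bop_tm[OF W b lt(2)[OF h] g(1)] Lin_mspan[OF V]
        using bop_gen[OF b lt(2)[OF h] g(1)] l(2) by (intro mspan_memI) force
    qed
    then show "bop (pt R V) b (tm (pt R V) g) (lft V X) \<in> Lin V" "bop (pt R V) b (lft V X) (tm (pt R V) g) \<in> Lin V"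
      using alg_lin_into[OF V AW lin_maps_comp[OF lft_lin[OF V] bop_right[OF W b tc]] submodule_Lin[OF V] _ X]
        alg_lin_into[OF V AW lin_maps_comp[OF lft_lin[OF V] bop_left[OF W b tc]] submodule_Lin[OF V] _ X] by blast+
  qed
  show "bop (pt R V) b m (lft V X) \<in> Lin V"
    using g1(1) by (rule Lin_into[OF V AW bop_left[OF W b lft_closed[OF V X]] submodule_Lin[OF V] _ m])
  show "bop (pt R V) b (lft V X) m \<in> Lin V"
    using g1(2) by (rule Lin_into[OF V AW bop_right[OF W b lft_closed[OF V X]] submodule_Lin[OF V] _ m])
qed

text \<open>The terms linear in the base point are built from the base point by multiplying with elements of \<open>O(V)\<close>:
  these are the branches off the path from the root of a tree to its marked leaf. The induction over terms follows
  both kinds of lists at once: subtrees off the path have leaves in \<open>V\<close> and represent elements of \<open>O(V)\<close>.\<close>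
lemma Lin_induct [consumes 2, case_names base add smult left right]:
  assumes V: "module R V" and m: "m \<in> Lin V"
    and base: "Q (base V)"
    and add: "\<And>x y. x \<in> Lin V \<Longrightarrow> y \<in> Lin V \<Longrightarrow> Q x \<Longrightarrow> Q y \<Longrightarrow> Q (x \<oplus>\<^bsub>Al (pt R V)\<^esub> y)"
    and smult: "\<And>a x. a \<in> carrier R \<Longrightarrow> x \<in> Lin V \<Longrightarrow> Q x \<Longrightarrow> Q (a \<odot>\<^bsub>Al (pt R V)\<^esub> x)"
    and left: "\<And>b x X. b \<in> carrier (Op P 2) \<Longrightarrow> x \<in> Lin V \<Longrightarrow> X \<in> carrier (Al V) \<Longrightarrow> Q x \<Longrightarrow> Q (bop (pt R V) b x (lft V X))"
    and right: "\<And>b x X. b \<in> carrier (Op P 2) \<Longrightarrow> x \<in> Lin V \<Longrightarrow> X \<in> carrier (Al V) \<Longrightarrow> Q x \<Longrightarrow> Q (bop (pt R V) b (lft V X) x)"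
  shows "Q m"
proof -
  note W = module_pt[OF V] and A = module_alg[OF V] and AW = module_alg[OF module_pt[OF V]]
  note sl = submodule_facts[OF AW submodule_Lin[OF V]]
  interpret AW: module R "Al (pt R V)" by (rule AW)
  let ?H = "{x \<in> Lin V. Q x}"
  have "Q (\<zero> \<odot>\<^bsub>Al (pt R V)\<^esub> base V)" by (intro smult base Lin_base V) simp
  then have z: "Q \<zero>\<^bsub>Al (pt R V)\<^esub>" using base_closed[OF V] by simp
  have H: "submodule ?H R (Al (pt R V))" using sl add smult z by (intro submoduleI'[OF AW]) auto
  let ?I = "lft V ` carrier (Al V)"
  have I: "submodule ?I R (Al (pt R V))" by (rule submodule_image[OF A AW lft_lin[OF V] submodule_carrier[OF A]])
  let ?S = "\<lambda>us. (if base_list V us then ?I else carrier (Al (pt R V))) \<inter> (if lin_list V us then ?H else carrier (Al (pt R V)))"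
  have Sc: "X \<in> carrier (Al (pt R V))" if "X \<in> ?S us" for X us
    using that submodule_facts(1)[OF AW I] sl(1) by (auto split: if_splits)
  have "(\<lambda>x. x) m \<in> ?H"
  proof (rule Lin_into[OF V AW lin_maps_id H _ m])
    fix g assume g: "g \<in> fa_gens P (pt R V)" "lin_list V (snd g)"
    have "tm (pt R V) g \<in> ?S (snd g)"
    proof (rule term_induct[OF W, where S = ?S, OF _ _ _ _ g(1)])
      show "submodule (?S us) R (Al (pt R V))" for us
        by (intro submodule_Int[OF AW]) (simp_all add: I H submodule_carrier[OF AW])
    next
      fix u assume u: "u \<in> carrier (pt R V)"
      have "var (pt R V) u \<in> ?I" if l: "base_list V [u]"
      proof -
        obtain v where "v \<in> carrier V" "u = (\<zero>, v)" using l by (auto simp: base_list_def)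
        then show ?thesis using lft_var[OF V, of v] var_closed[OF V, of v] by (metis imageI)
      qed
      moreover have "var (pt R V) u \<in> ?H" if l: "lin_list V [u]"
      proof -
        obtain vs i a where "vs \<in> lists (carrier V)" "i < length vs" and a: "a \<in> carrier R"
          and "[u] = (map (Pair \<zero>) vs)[i := (a, \<zero>\<^bsub>V\<^esub>)]" using l by (auto simp: lin_list_def)
        then have "u = (a, \<zero>\<^bsub>V\<^esub>)"
          by (metis One_nat_def length_Cons length_list_update length_map less_one list.size(3) nth_Cons_0 nth_list_update_eq)
        then show ?thesis using var_point[OF V a] submodule_facts(4)[OF AW H a] base Lin_base[OF V] by simp
      qed
      ultimately show "var (pt R V) u \<in> ?S [u]" using var_closed[OF W u] by simp
    next
      fix b us ws X Y assume b: "b \<in> carrier (Op P 2)" and X: "X \<in> ?S us" and Y: "Y \<in> ?S ws"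
      have "bop (pt R V) b X Y \<in> ?I" if l: "base_list V (us @ ws)"
      proof -
        obtain X' Y' where "X' \<in> carrier (Al V)" "Y' \<in> carrier (Al V)" "X = lft V X'" "Y = lft V Y'"
          using X Y base_list_append[OF l] by auto
        then show ?thesis using lft_bop[OF V b, of X' Y'] bop_closed[OF V b, of X' Y'] by (metis imageI)
      qed
      moreover have "bop (pt R V) b X Y \<in> ?H" if l: "lin_list V (us @ ws)"
        using lin_list_append[OF l]
      proof
        assume "lin_list V us \<and> base_list V ws"
        then obtain Y' where "X \<in> ?H" "Y' \<in> carrier (Al V)" "Y = lft V Y'" using X Y by auto
        then show ?thesis using left[OF b] Lin_bop(1)[OF V b] by simp
      next
        assume "base_list V us \<and> lin_list V ws"
        then obtain X' where "Y \<in> ?H" "X' \<in> carrier (Al V)" "X = lft V X'" using X Y by auto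
        then show ?thesis using right[OF b] Lin_bop(2)[OF V b] by simp
      qed
      ultimately show "bop (pt R V) b X Y \<in> ?S (us @ ws)"
        using bop_closed[OF W b Sc[OF X] Sc[OF Y]] by simp
    next
      fix \<sigma> us assume "us \<in> lists (carrier (pt R V))" "\<sigma> permutes {..<length us}"
      then show "?S (permute_list \<sigma> us) \<subseteq> ?S us"
        using base_list_permute[of V us \<sigma>] lin_list_permute[of V us \<sigma>] submodule_facts(1)[OF AW I] sl(1) by auto
    qed
    then show "tm (pt R V) g \<in> ?H" using g(2) by simp
  qed
  then show ?thesis by simp
qed

subsection \<open>Pointed derivations\<close>

lemma fst_functional: "fst \<in> functionals (pt R V)"
  by (rule lin_fst)

lemma der_point_ten: "der_point R P V y = ten (pt R V) y fst"
  by (simp add: der_point_def der_tensor_def)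

lemma Der_pt_iff: "p \<in> carrier (Der_pt R P V) \<longleftrightarrow> p \<in> carrier (Der R P (pt R V)) \<and>
    (\<forall>v\<in>carrier V. p (var (pt R V) (\<zero>, v)) = \<zero>\<^bsub>Al (pt R V)\<^esub>) \<and> (\<forall>a\<in>carrier R. p (var (pt R V) (a, \<zero>\<^bsub>V\<^esub>)) \<in> Lin V)"
  by (auto simp: Der_pt_def)

lemma Der_ptD:
  assumes V: "module R V" and p: "p \<in> carrier (Der_pt R P V)"
  shows "p \<in> carrier (Der R P (pt R V))" "\<And>v. v \<in> carrier V \<Longrightarrow> p (var (pt R V) (\<zero>, v)) = \<zero>\<^bsub>Al (pt R V)\<^esub>" "p (base V) \<in> Lin V"
  using p by (auto simp: Der_pt_iff)

lemma Der_ptI: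
  assumes V: "module R V" and p: "p \<in> carrier (Der R P (pt R V))"
    and "\<And>v. v \<in> carrier V \<Longrightarrow> p (var (pt R V) (\<zero>, v)) = \<zero>\<^bsub>Al (pt R V)\<^esub>" and b: "p (base V) \<in> Lin V"
  shows "p \<in> carrier (Der_pt R P V)"
  unfolding Der_pt_iff
proof (intro conjI ballI)
  fix a assume a: "a \<in> carrier R"
  show "p (var (pt R V) (a, \<zero>\<^bsub>V\<^esub>)) \<in> Lin V"
    unfolding var_point[OF V a] lin_maps_smult[OF Der_lin[OF p] a base_closed[OF V]]
    by (rule submodule_facts(4)[OF module_alg[OF module_pt[OF V]] submodule_Lin[OF V] a b])
qed (use assms in auto)

lemma submodule_Der_pt: "module R V \<Longrightarrow> submodule (carrier (Der_pt R P V)) R (Der R P (pt R V))"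
proof -
  assume V: "module R V"
  note W = module_pt[OF V]
  interpret AW: module R "Al (pt R V)" by (rule module_alg[OF W])
  note D = module_Der[OF W] and sl = submodule_facts[OF module_alg[OF W] submodule_Lin[OF V]]
  have vc: "var (pt R V) (\<zero>, v) \<in> carrier (Al (pt R V))" if "v \<in> carrier V" for v using that by (intro var_closed[OF W]) simp
  note bc = base_closed[OF V]
  show ?thesis
  proof (rule submoduleI'[OF D])
    show "carrier (Der_pt R P V) \<subseteq> carrier (Der R P (pt R V))" using Der_ptD(1)[OF V] by blast
    show "\<zero>\<^bsub>Der R P (pt R V)\<^esub> \<in> carrier (Der_pt R P V)"
      by (rule Der_ptI[OF V mod_zero[OF D]]) (simp_all add: Der_apply vc bc sl(2))
    fix p q assume p: "p \<in> carrier (Der_pt R P V)" and q: "q \<in> carrier (Der_pt R P V)"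
    show "p \<oplus>\<^bsub>Der R P (pt R V)\<^esub> q \<in> carrier (Der_pt R P V)"
      by (rule Der_ptI[OF V mod_add[OF D Der_ptD(1)[OF V p] Der_ptD(1)[OF V q]]])
        (simp_all add: Der_apply vc bc sl(3) Der_ptD[OF V p] Der_ptD[OF V q])
  next
    fix a p assume a: "a \<in> carrier R" and p: "p \<in> carrier (Der_pt R P V)"
    show "a \<odot>\<^bsub>Der R P (pt R V)\<^esub> p \<in> carrier (Der_pt R P V)"
      by (rule Der_ptI[OF V mod_smult[OF D a Der_ptD(1)[OF V p]]])
        (simp_all add: Der_apply vc bc sl(4) a Der_ptD[OF V p])
  qed
qed

lemma Der_pt_ten:
  assumes V: "module R V" and y: "y \<in> Lin V"
  shows "ten (pt R V) y fst \<in> carrier (Der_pt R P V)" and "ten (pt R V) y fst (base V) = y"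
proof -
  note W = module_pt[OF V]
  interpret AW: module R "Al (pt R V)" by (rule module_alg[OF W])
  note yc = Lin_sub[OF V y]
  note v = ten_var[OF W yc fst_functional]
  show b: "ten (pt R V) y fst (base V) = y" using v[of "(\<one>, \<zero>\<^bsub>V\<^esub>)"] mod_zero[OF V] yc by simp
  show "ten (pt R V) y fst \<in> carrier (Der_pt R P V)"
    by (rule Der_ptI[OF V ten_Der[OF W yc fst_functional]]) (simp_all add: v b yc y)
qed

lemma Der_pt_eq:
  assumes V: "module R V" and p: "p \<in> carrier (Der_pt R P V)"
  shows "p = ten (pt R V) (p (base V)) fst"
proof -
  note W = module_pt[OF V] and D = Der_ptD[OF V p]
  interpret AW: module R "Al (pt R V)" by (rule module_alg[OF W])
  note yc = Lin_sub[OF V D(3)]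
  show ?thesis
  proof (rule Der_eqI[OF W D(1) ten_Der[OF W yc fst_functional]])
    fix u assume u: "u \<in> carrier (pt R V)"
    have u': "fst u \<in> carrier R" "snd u \<in> carrier V" using u by auto
    have vc: "var (pt R V) (\<zero>, snd u) \<in> carrier (Al (pt R V))" using u' by (intro var_closed[OF W]) simp
    show "p (var (pt R V) u) = ten (pt R V) (p (base V)) fst (var (pt R V) u)"
      unfolding ten_var[OF W yc fst_functional u] unfolding var_pt[OF V u]
      using u' vc base_closed[OF V] D(2) yc by (simp add: lin_maps_add[OF Der_lin[OF D(1)]] lin_maps_smult[OF Der_lin[OF D(1)]])
  qed
qed

lemma Der_pt_lft:
  assumes V: "module R V" and p: "p \<in> carrier (Der_pt R P V)" and X: "X \<in> carrier (Al V)"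
  shows "p (lft V X) = \<zero>\<^bsub>Al (pt R V)\<^esub>"
  using V X
proof (induction rule: alg_induct)
  note W = module_pt[OF V] and D = Der_ptD[OF V p] and A = module_alg[OF module_pt[OF V]]
  interpret AW: module R "Al (pt R V)" by (rule module_alg[OF module_pt[OF V]])
  {
    case (var v)
    then show ?case by (simp add: lft_var[OF V] D(2))
  next
    case (add X Y)
    then show ?case by (simp add: lin_maps_add[OF lft_lin[OF V]] lin_maps_add[OF Der_lin[OF D(1)]] lft_closed[OF V])
  next
    case (smult a X)
    then show ?case by (simp add: lin_maps_smult[OF lft_lin[OF V]] lin_maps_smult[OF Der_lin[OF D(1)]] lft_closed[OF V])
  next
    case (bop b X Y)
    then show ?case
      by (simp add: lft_bop[OF V] Der_bop[OF W D(1)] lft_closed[OF V] lin_maps_zero[OF A A bop_left[OF W]] lin_maps_zero[OF A A bop_right[OF W]])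
  }
qed

text \<open>Pointed derivations kill \<open>O(V)\<close>, so they are linear for multiplication by it and act at the marked leaf
  only.\<close>
lemma Der_pt_left_right:
  assumes V: "module R V" and p: "p \<in> carrier (Der_pt R P V)" and b: "b \<in> carrier (Op P 2)"
    and m: "m \<in> carrier (Al (pt R V))" and X: "X \<in> carrier (Al V)"
  shows "p (bop (pt R V) b m (lft V X)) = bop (pt R V) b (p m) (lft V X)"
    "p (bop (pt R V) b (lft V X) m) = bop (pt R V) b (lft V X) (p m)"
proof -
  note W = module_pt[OF V] and D = Der_ptD[OF V p] and A = module_alg[OF module_pt[OF V]]
  interpret AW: module R "Al (pt R V)" by (rule A)
  note c = lft_closed[OF V X] Der_closed[OF D(1) m] m
  show "p (bop (pt R V) b m (lft V X)) = bop (pt R V) b (p m) (lft V X)"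
    "p (bop (pt R V) b (lft V X) m) = bop (pt R V) b (lft V X) (p m)"
    using c by (simp_all add: Der_bop[OF W D(1) b] Der_pt_lft[OF V p X] lin_maps_zero[OF A A bop_left[OF W b]]
      lin_maps_zero[OF A A bop_right[OF W b]] bop_closed[OF W b])
qed

lemma Der_pt_Lin:
  assumes V: "module R V" and p: "p \<in> carrier (Der_pt R P V)" and m: "m \<in> Lin V"
  shows "p m \<in> Lin V"
  using V m
proof (induction rule: Lin_induct)
  note W = module_pt[OF V] and D = Der_ptD[OF V p]
  note sl = submodule_facts[OF module_alg[OF module_pt[OF V]] submodule_Lin[OF V]] and s = Lin_sub[OF V]
  {
    case base
    then show ?case by (rule D(3))
  next
    case (add x y)
    then show ?case by (simp add: lin_maps_add[OF Der_lin[OF D(1)]] s sl(3))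
  next
    case (smult a x)
    then show ?case by (simp add: lin_maps_smult[OF Der_lin[OF D(1)]] s sl(4))
  next
    case (left b x X)
    then show ?case by (simp add: Der_pt_left_right[OF V p] s Lin_bop(1)[OF V])
  next
    case (right b x X)
    then show ?case by (simp add: Der_pt_left_right[OF V p] s Lin_bop(2)[OF V])
  }
qed

lemma Der_pt_bracket:
  assumes V: "module R V" and p: "p \<in> carrier (Der_pt R P V)" and q: "q \<in> carrier (Der_pt R P V)"
  shows "bracket R P (pt R V) p q \<in> carrier (Der_pt R P V)"
proof -
  note W = module_pt[OF V] and P = Der_ptD[OF V p] and Q = Der_ptD[OF V q]
  interpret AW: module R "Al (pt R V)" by (rule module_alg[OF W])
  note sl = submodule_facts[OF module_alg[OF W] submodule_Lin[OF V]]
  have vc: "var (pt R V) (\<zero>, v) \<in> carrier (Al (pt R V))" if "v \<in> carrier V" for v using that by (intro var_closed[OF W]) simp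
  show ?thesis
  proof (rule Der_ptI[OF V bracket_Der[OF W P(1) Q(1)]])
    fix v assume v: "v \<in> carrier V"
    show "bracket R P (pt R V) p q (var (pt R V) (\<zero>, v)) = \<zero>\<^bsub>Al (pt R V)\<^esub>"
      using v by (simp add: bracket_apply[OF W P(1) Q(1) vc] P(2) Q(2) Der_kills_smult_zero[OF W P(1)] Der_kills_smult_zero[OF W Q(1)]
        a_minus_def AW.r_neg)
  next
    show "bracket R P (pt R V) p q (base V) \<in> Lin V"
      unfolding bracket_apply[OF W P(1) Q(1) base_closed[OF V]]
      by (intro sl(5) Der_pt_Lin[OF V p] Der_pt_Lin[OF V q] Lin_base V)
  qed
qed

end

context bin_operad
begin

subsection \<open>Contraction\<close>

text \<open>This is the map \<open>x \<mapsto> O(V; f)(\<delta>(x))\<close> by \<open>delta_contr\<close> below. As the restriction to \<open>O(V)\<close> of a derivation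
  of \<open>O(R \<oplus> V)\<close> it comes with a Leibniz rule.\<close>
definition contr :: "('r, 'v) module \<Rightarrow> ('v \<Rightarrow> 'r) \<Rightarrow> ('r, 'o, 'v) fa \<Rightarrow> ('r, 'o, 'r \<times> 'v) fa" where
  "contr V f X = ten (pt R V) (base V) (\<lambda>u. f (snd u)) (lft V X)"

lemma snd_functional: "f \<in> functionals V \<Longrightarrow> (\<lambda>u. f (snd u)) \<in> functionals (pt R V)"
  by (rule lin_maps_comp[OF lin_snd])

lemma contr_facts:
  assumes V: "module R V" and f: "f \<in> functionals V"
  shows contr_lin: "contr V f \<in> lin_maps R (Al V) (Al (pt R V))"
    and contr_var: "\<And>v. v \<in> carrier V \<Longrightarrow> contr V f (var V v) = f v \<odot>\<^bsub>Al (pt R V)\<^esub> base V"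
    and contr_bop: "\<And>b X Y. b \<in> carrier (Op P 2) \<Longrightarrow> X \<in> carrier (Al V) \<Longrightarrow> Y \<in> carrier (Al V) \<Longrightarrow>
      contr V f (bop V b X Y) = bop (pt R V) b (contr V f X) (lft V Y) \<oplus>\<^bsub>Al (pt R V)\<^esub> bop (pt R V) b (lft V X) (contr V f Y)"
proof -
  note W = module_pt[OF V] and b = base_closed[OF V] and f' = snd_functional[OF f]
  note t = ten_Der[OF W b f']
  show "contr V f \<in> lin_maps R (Al V) (Al (pt R V))"
    unfolding contr_def[abs_def] by (rule lin_maps_comp[OF lft_lin[OF V] Der_lin[OF t]])
  show "\<And>v. v \<in> carrier V \<Longrightarrow> contr V f (var V v) = f v \<odot>\<^bsub>Al (pt R V)\<^esub> base V"
    unfolding contr_def by (simp add: lft_var[OF V] ten_var[OF W b f'])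
  show "\<And>b X Y. b \<in> carrier (Op P 2) \<Longrightarrow> X \<in> carrier (Al V) \<Longrightarrow> Y \<in> carrier (Al V) \<Longrightarrow>
      contr V f (bop V b X Y) = bop (pt R V) b (contr V f X) (lft V Y) \<oplus>\<^bsub>Al (pt R V)\<^esub> bop (pt R V) b (lft V X) (contr V f Y)"
    unfolding contr_def by (simp add: lft_bop[OF V] Der_bop[OF W t] lft_closed[OF V])
qed

lemma contr_closed: "module R V \<Longrightarrow> f \<in> functionals V \<Longrightarrow> X \<in> carrier (Al V) \<Longrightarrow> contr V f X \<in> carrier (Al (pt R V))"
  by (rule lin_maps_closed[OF contr_lin])

lemma contr_Lin:
  assumes V: "module R V" and f: "f \<in> functionals V" and X: "X \<in> carrier (Al V)"
  shows "contr V f X \<in> Lin V"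
  using V X
proof (induction rule: alg_induct)
  note sl = submodule_facts[OF module_alg[OF module_pt[OF V]] submodule_Lin[OF V]] and L = contr_lin[OF V f]
  {
    case (var v)
    then show ?case by (simp add: contr_var[OF V f] sl(4) functional_closed[OF f] Lin_base[OF V])
  next
    case (add X Y)
    then show ?case by (simp add: lin_maps_add[OF L] sl(3))
  next
    case (smult a X)
    then show ?case by (simp add: lin_maps_smult[OF L] sl(4))
  next
    case (bop b X Y)
    then show ?case by (simp add: contr_bop[OF V f] sl(3) Lin_bop[OF V])
  }
qed

lemma contr_dec:
  assumes V: "module R V" and f: "f \<in> functionals V" and X: "X \<in> dec V"
  shows "contr V f X \<in> dec (pt R V)"
  unfolding contr_def
  by (intro Der_dec[OF module_pt[OF V] ten_Der[OF module_pt[OF V] base_closed[OF V] snd_functional[OF f]]]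
      fa_map_dec[OF V module_pt[OF V] lin_zero_pair[OF V]] X)

text \<open>Marking each leaf in turn is a derivation as well, namely the one of \<open>O(V \<oplus> V)\<close> that sends \<open>(0, v)\<close> to
  \<open>(v, 0)\<close>.\<close>
lemma delta_eq:
  assumes V: "module R V" and X: "X \<in> carrier (Al V)"
  defines "U \<equiv> dsum V V"
  defines "E \<equiv> der_ext R P U (\<lambda>u. var U (snd u, \<zero>\<^bsub>V\<^esub>))"
  shows "fa_delta R P V X = E (fa_map R P U (Pair \<zero>\<^bsub>V\<^esub>) X)"
    and "E \<in> carrier (Der R P U)" and "\<And>v. v \<in> carrier V \<Longrightarrow> E (var U (\<zero>\<^bsub>V\<^esub>, v)) = var U (v, \<zero>\<^bsub>V\<^esub>)"
proof -
  have U: "module R U" unfolding U_def by (rule module_dsum[OF V V])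
  note A = module_alg[OF U]
  interpret A: module R "Al U" by (rule A)
  have j: "Pair \<zero>\<^bsub>V\<^esub> \<in> lin_maps R V U" unfolding U_def by (rule lin_inr[OF V])
  have k: "(\<lambda>v. (v, \<zero>\<^bsub>V\<^esub>)) \<in> lin_maps R V U" unfolding U_def by (rule lin_inl[OF V])
  have s: "snd \<in> lin_maps R U V" unfolding U_def by (rule lin_snd)
  have h: "(\<lambda>u. var U (snd u, \<zero>\<^bsub>V\<^esub>)) \<in> lin_maps R U (Al U)"
    by (rule lin_maps_comp[OF lin_maps_comp[OF s k] var_lin[OF U]])
  show ED: "E \<in> carrier (Der R P U)" unfolding E_def by (rule der_ext_Der[OF U h])
  have jc: "v \<in> carrier V \<Longrightarrow> (\<zero>\<^bsub>V\<^esub>, v) \<in> carrier U" for v using lin_maps_closed[OF j] by blast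
  show Ev: "E (var U (\<zero>\<^bsub>V\<^esub>, v)) = var U (v, \<zero>\<^bsub>V\<^esub>)" if "v \<in> carrier V" for v
    unfolding E_def using der_ext_var[OF U h jc[OF that]] by simp
  show "fa_delta R P V X = E (fa_map R P U (Pair \<zero>\<^bsub>V\<^esub>) X)"
    unfolding fa_delta_def U_def[symmetric]
  proof (rule lin_ext_rep[OF V A lin_maps_comp[OF fa_map_lin[OF V U j] Der_lin[OF ED]] X])
    fix g assume g: "g \<in> fa_gens P V"
    obtain x vs where gd: "g = (x, vs)" by (cases g)
    note f = fa_gensE[OF g, unfolded gd, simplified]
    have jl: "map (Pair \<zero>\<^bsub>V\<^esub>) vs \<in> lists (carrier U)" by (rule lin_maps_list[OF j f(3)])
    have jg: "(x, map (Pair \<zero>\<^bsub>V\<^esub>) vs) \<in> fa_gens P U" using f jl by (simp add: fa_gens_def)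
    let ?us = "\<lambda>i. (map (Pair \<zero>\<^bsub>V\<^esub>) vs)[i := (vs ! i, \<zero>\<^bsub>V\<^esub>)]"
    have ug: "(x, ?us i) \<in> fa_gens P U" if "i < length vs" for i
      using f jl lin_maps_closed[OF k lists_nth[OF f(3) that]] by (simp add: fa_gens_def lists_update del: in_lists_conv_set)
    have vl: "map (fa_var R P U) (map (Pair \<zero>\<^bsub>V\<^esub>) vs) \<in> lists (carrier (Al U))" by (rule var_list[OF U jl])
    have leib: "E (fop U x Xs) = (\<Oplus>\<^bsub>Al U\<^esub>i\<in>{..<length Xs}. fop U x (Xs[i := E (Xs ! i)]))"
      if "Xs \<in> lists (carrier (Al U))" "length Xs = fst x" for Xs
      using ED f(1) that unfolding Der_carrier by blast
    have "E (fa_map R P U (Pair \<zero>\<^bsub>V\<^esub>) (tm V g)) = E (fop U x (map (fa_var R P U) (map (Pair \<zero>\<^bsub>V\<^esub>) vs)))"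
      using fa_map_tm[OF V U j g] tm_fop[OF U jg] gd by simp
    also have "\<dots> = (\<Oplus>\<^bsub>Al U\<^esub>i\<in>{..<length vs}. fop U x ((map (fa_var R P U) (map (Pair \<zero>\<^bsub>V\<^esub>) vs))[i := E (map (fa_var R P U) (map (Pair \<zero>\<^bsub>V\<^esub>) vs) ! i)]))"
      using leib[OF vl] f(4) by simp
    also have "\<dots> = (\<Oplus>\<^bsub>Al U\<^esub>i\<in>{..<length vs}. tm U (x, ?us i))"
    proof (rule A.finsum_cong')
      fix i assume "i \<in> {..<length vs}"
      then have i: "i < length vs" by simp
      have "(map (fa_var R P U) (map (Pair \<zero>\<^bsub>V\<^esub>) vs))[i := E (map (fa_var R P U) (map (Pair \<zero>\<^bsub>V\<^esub>) vs) ! i)] = map (fa_var R P U) (?us i)"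
        using i Ev[OF lists_nth[OF f(3) i]] by (simp add: map_update)
      then show "fop U x ((map (fa_var R P U) (map (Pair \<zero>\<^bsub>V\<^esub>) vs))[i := E (map (fa_var R P U) (map (Pair \<zero>\<^bsub>V\<^esub>) vs) ! i)]) = tm U (x, ?us i)"
        using tm_fop[OF U ug[OF i]] by simp
    qed (use tm_closed[OF U ug] in auto)
    finally show "(case g of (x, vs) \<Rightarrow> \<Oplus>\<^bsub>Al U\<^esub>i\<in>{..<length vs}. fa_term R P U x ((map (Pair \<zero>\<^bsub>V\<^esub>) vs)[i := (vs ! i, \<zero>\<^bsub>V\<^esub>)])) =
      E (fa_map R P U (Pair \<zero>\<^bsub>V\<^esub>) (tm V g))" using gd by simp
  qed
qed

lemma delta_contr:
  assumes V: "module R V" and f: "f \<in> functionals V" and X: "X \<in> carrier (Al V)"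
  shows "fa_map R P (pt R V) (\<lambda>(v, w). (f v, w)) (fa_delta R P V X) = contr V f X"
proof -
  note W = module_pt[OF V]
  let ?U = "dsum V V"
  note U = module_dsum[OF V V]
  have F: "(\<lambda>(v, w). (f v, w)) \<in> lin_maps R ?U (pt R V)"
    using lin_pair[OF lin_maps_comp[OF lin_fst f] lin_snd] by (simp add: case_prod_beta')
  let ?F = "fa_map R P (pt R V) (\<lambda>(v, w). (f v, w))"
  let ?j = "fa_map R P ?U (Pair \<zero>\<^bsub>V\<^esub>)"
  have j: "Pair \<zero>\<^bsub>V\<^esub> \<in> lin_maps R V ?U" by (rule lin_inr[OF V])
  note jl = fa_map_lin[OF V U j] and Fl = fa_map_lin[OF U W F]
  obtain E where E: "E \<in> carrier (Der R P ?U)" "\<And>v. v \<in> carrier V \<Longrightarrow> E (var ?U (\<zero>\<^bsub>V\<^esub>, v)) = var ?U (v, \<zero>\<^bsub>V\<^esub>)"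
    and d: "\<And>X. X \<in> carrier (Al V) \<Longrightarrow> fa_delta R P V X = E (?j X)"
    by (rule that[OF delta_eq(2)[OF V X] delta_eq(3)[OF V X] delta_eq(1)[OF V]]) auto
  have f0: "f \<zero>\<^bsub>V\<^esub> = \<zero>" using lin_maps_zero[OF V module_self f] by simp
  have Fj: "?F (?j X) = lft V X" if "X \<in> carrier (Al V)" for X
    by (rule fa_map_comp[OF V U W j F lin_zero_pair[OF V] _ that]) (simp add: f0)
  note jc = lin_maps_closed[OF jl] and Ec = Der_closed[OF E(1)] and EL = Der_lin[OF E(1)] and C = contr_lin[OF V f]
  have "?F (E (?j X)) = contr V f X"
    using V X
  proof (induction rule: alg_induct)
    case (var v)
    have "(v, \<zero>\<^bsub>V\<^esub>) \<in> carrier ?U" using var mod_zero[OF V] by simp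
    then show ?case
      using var functional_closed[OF f var]
      by (simp add: fa_map_var[OF V U j] E(2) fa_map_var[OF U W F] contr_var[OF V f] var_point[OF V functional_closed[OF f var], symmetric])
  next
    case (add X Y)
    then show ?case by (simp add: lin_maps_add[OF jl] jc lin_maps_add[OF EL] Ec lin_maps_add[OF Fl] lin_maps_add[OF C])
  next
    case (smult a X)
    then show ?case by (simp add: lin_maps_smult[OF jl] jc lin_maps_smult[OF EL] Ec lin_maps_smult[OF Fl] lin_maps_smult[OF C])
  next
    case (bop b X Y)
    then show ?case
      by (simp add: fa_map_bop[OF V U j] Der_bop[OF U E(1)] jc Ec bop_closed[OF U] lin_maps_add[OF Fl] fa_map_bop[OF U W F]
        Fj contr_bop[OF V f])
  qed
  then show ?thesis by (simp add: d[OF X])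
qed

text \<open>The contraction is linear in \<open>f\<close>, and \<open>f = \<Sum>\<^sub>i f(e\<^sub>i) \<phi>\<^sub>i\<close>.\<close>
lemma contr_decompose:
  assumes V: "module R V" and f: "f \<in> functionals V"
    and e: "\<And>i. i < n \<Longrightarrow> e i \<in> carrier V" and \<phi>: "\<And>i. i < n \<Longrightarrow> \<phi> i \<in> functionals V"
    and dec: "\<And>v. v \<in> carrier V \<Longrightarrow> (\<Oplus>\<^bsub>V\<^esub>i\<in>{..<n::nat}. \<phi> i v \<odot>\<^bsub>V\<^esub> e i) = v" and X: "X \<in> carrier (Al V)"
  shows "contr V f X = (\<Oplus>\<^bsub>Al (pt R V)\<^esub>i\<in>{..<n}. f (e i) \<odot>\<^bsub>Al (pt R V)\<^esub> contr V (\<phi> i) X)"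
proof -
  note W = module_pt[OF V] and b = base_closed[OF V]
  note AW = module_alg[OF W] and D = module_Der[OF W]
  interpret AW: module R "Al (pt R V)" by (rule AW)
  interpret D: module R "Der R P (pt R V)" by (rule D)
  have fe: "f (e i) \<in> carrier R" if "i < n" for i using functional_closed[OF f e[OF that]] .
  let ?t = "\<lambda>i. f (e i) \<odot>\<^bsub>Der R P (pt R V)\<^esub> ten (pt R V) (base V) (\<lambda>u. \<phi> i (snd u))"
  have tt: "ten (pt R V) (base V) (\<lambda>u. \<phi> i (snd u)) \<in> carrier (Der R P (pt R V))" if "i < n" for i
    using that by (intro ten_Der[OF W b] snd_functional \<phi>)
  have tc: "?t i \<in> carrier (Der R P (pt R V))" if "i < n" for i
    using that by (intro mod_smult[OF D] fe tt)
  have sc: "(\<Oplus>\<^bsub>Der R P (pt R V)\<^esub>i\<in>{..<n}. ?t i) \<in> carrier (Der R P (pt R V))" using tc by (intro D.finsum_closed) auto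
  note f' = snd_functional[OF f]
  have L: "(\<lambda>v. f v \<odot>\<^bsub>Al (pt R V)\<^esub> base V) \<in> lin_maps R V (Al (pt R V))"
    using b functional_closed[OF f] lin_maps_add[OF f] lin_maps_smult[OF f]
    by (intro lin_mapsI) (auto simp: AW.smult_l_distr AW.smult_assoc1)
  have "ten (pt R V) (base V) (\<lambda>u. f (snd u)) = (\<Oplus>\<^bsub>Der R P (pt R V)\<^esub>i\<in>{..<n}. ?t i)"
  proof (rule Der_eqI[OF W ten_Der[OF W b f'] sc])
    fix u assume u: "u \<in> carrier (pt R V)"
    then have su: "snd u \<in> carrier V" by auto
    have \<phi>u: "\<phi> i (snd u) \<in> carrier R" if "i < n" for i using functional_closed[OF \<phi>[OF that] su] .
    have "ten (pt R V) (base V) (\<lambda>u. f (snd u)) (var (pt R V) u) = f (\<Oplus>\<^bsub>V\<^esub>i\<in>{..<n}. \<phi> i (snd u) \<odot>\<^bsub>V\<^esub> e i) \<odot>\<^bsub>Al (pt R V)\<^esub> base V"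
      unfolding ten_var[OF W b f' u] dec[OF su] ..
    also have "\<dots> = (\<Oplus>\<^bsub>Al (pt R V)\<^esub>i\<in>{..<n}. f (\<phi> i (snd u) \<odot>\<^bsub>V\<^esub> e i) \<odot>\<^bsub>Al (pt R V)\<^esub> base V)"
      using \<phi>u e by (intro lin_maps_finsum_apply[OF V AW L] mod_smult[OF V]) auto
    also have "\<dots> = (\<Oplus>\<^bsub>Al (pt R V)\<^esub>i\<in>{..<n}. ?t i (var (pt R V) u))"
    proof (rule AW.finsum_cong'[OF refl])
      have vu: "var (pt R V) u \<in> carrier (Al (pt R V))" using u by (rule var_closed[OF W])
      show "(\<lambda>i. ?t i (var (pt R V) u)) \<in> {..<n} \<rightarrow> carrier (Al (pt R V))" using Der_closed[OF tc vu] by auto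
      fix i assume "i \<in> {..<n}"
      then have i: "i < n" by simp
      have p: "f (\<phi> i (snd u) \<odot>\<^bsub>V\<^esub> e i) = f (e i) \<otimes> \<phi> i (snd u)"
        using lin_maps_smult[OF f \<phi>u[OF i] e[OF i]] \<phi>u[OF i] fe[OF i] by (simp add: m_comm)
      show "f (\<phi> i (snd u) \<odot>\<^bsub>V\<^esub> e i) \<odot>\<^bsub>Al (pt R V)\<^esub> base V = ?t i (var (pt R V) u)"
        unfolding p Der_apply(2)[OF vu] ten_var[OF W b snd_functional[OF \<phi>[OF i]] u]
        by (rule AW.smult_assoc1[OF fe[OF i] \<phi>u[OF i] b])
    qed
    also have "\<dots> = (\<Oplus>\<^bsub>Der R P (pt R V)\<^esub>i\<in>{..<n}. ?t i) (var (pt R V) u)"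
      using tc u by (intro lin_maps_finsum_apply[OF D AW Der_eval, symmetric] var_closed[OF W]) auto
    finally show "ten (pt R V) (base V) (\<lambda>u. f (snd u)) (var (pt R V) u) = (\<Oplus>\<^bsub>Der R P (pt R V)\<^esub>i\<in>{..<n}. ?t i) (var (pt R V) u)" .
  qed
  then have "contr V f X = (\<Oplus>\<^bsub>Der R P (pt R V)\<^esub>i\<in>{..<n}. ?t i) (lft V X)" by (simp add: contr_def)
  also have "\<dots> = (\<Oplus>\<^bsub>Al (pt R V)\<^esub>i\<in>{..<n}. ?t i (lft V X))"
    using tc X by (intro lin_maps_finsum_apply[OF D AW Der_eval] lft_closed[OF V]) auto
  also have "\<dots> = (\<Oplus>\<^bsub>Al (pt R V)\<^esub>i\<in>{..<n}. f (e i) \<odot>\<^bsub>Al (pt R V)\<^esub> contr V (\<phi> i) X)"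
    using X fe contr_closed[OF V \<phi>] by (intro AW.finsum_cong') (auto simp: Der_apply lft_closed[OF V] contr_def)
  finally show ?thesis .
qed

subsection \<open>The divergence\<close>

lemma ten_fst_Lin:
  assumes V: "module R V"
  shows "(\<lambda>y. ten (pt R V) y fst) \<in> lin_maps R (Al (pt R V)) (Der R P (pt R V))"
  by (rule ten_linear[OF module_pt[OF V] fst_functional])

text \<open>The conditions on elementary derivations determine \<open>\<Phi>\<close>, as these span. For existence, with a dual basis
  \<open>(e\<^sub>i, \<phi>\<^sub>i)\<close> it sends \<open>d\<close> to the sum of the contractions of \<open>d(e\<^sub>i)\<close> along \<open>\<phi>\<^sub>i\<close>.\<close>
lemma Phi_facts:
  assumes V: "module R V" and db: "dual_basis V"
  shows Phi_lin: "Phi R P V \<in> lin_maps R (Der R P V) (Der R P (pt R V))"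
    and Phi_pt: "\<And>d. d \<in> carrier (Der R P V) \<Longrightarrow> Phi R P V d \<in> carrier (Der_pt R P V)"
    and Phi_ten: "\<And>x f. x \<in> carrier (Al V) \<Longrightarrow> f \<in> functionals V \<Longrightarrow> Phi R P V (ten V x f) = ten (pt R V) (contr V f x) fst"
proof -
  note W = module_pt[OF V]
  note A = module_alg[OF V] and AW = module_alg[OF W] and D = module_Der[OF V] and DW = module_Der[OF W]
  interpret AW: module R "Al (pt R V)" by (rule AW)
  obtain n e \<phi> where e: "\<And>i. i < n \<Longrightarrow> e i \<in> carrier V" and \<phi>: "\<And>i. i < n \<Longrightarrow> \<phi> i \<in> functionals V"
    and dec: "\<And>v. v \<in> carrier V \<Longrightarrow> (\<Oplus>\<^bsub>V\<^esub>i\<in>{..<n::nat}. \<phi> i v \<odot>\<^bsub>V\<^esub> e i) = v"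
    using db by (rule dual_basisE) blast
  let ?C = "\<lambda>d. \<Oplus>\<^bsub>Al (pt R V)\<^esub>i\<in>{..<n}. contr V (\<phi> i) (d (var V (e i)))"
  have CL: "?C \<in> lin_maps R (Der R P V) (Al (pt R V))"
    using e \<phi> by (intro lin_maps_finsum[OF AW] lin_maps_comp[OF Der_eval contr_lin[OF V]] var_closed[OF V]) auto
  have Ct: "?C (ten V x f) = contr V f x" if x: "x \<in> carrier (Al V)" and f: "f \<in> functionals V" for x f
  proof -
    have "?C (ten V x f) = (\<Oplus>\<^bsub>Al (pt R V)\<^esub>i\<in>{..<n}. f (e i) \<odot>\<^bsub>Al (pt R V)\<^esub> contr V (\<phi> i) x)"
    proof (rule AW.finsum_cong'[OF refl])
      show "(\<lambda>i. f (e i) \<odot>\<^bsub>Al (pt R V)\<^esub> contr V (\<phi> i) x) \<in> {..<n} \<rightarrow> carrier (Al (pt R V))"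
        using functional_closed[OF f e] contr_closed[OF V \<phi> x] by auto
      fix i assume "i \<in> {..<n}"
      then have i: "i < n" by simp
      show "contr V (\<phi> i) (ten V x f (var V (e i))) = f (e i) \<odot>\<^bsub>Al (pt R V)\<^esub> contr V (\<phi> i) x"
        unfolding ten_var[OF V x f e[OF i]] by (rule lin_maps_smult[OF contr_lin[OF V \<phi>[OF i]] functional_closed[OF f e[OF i]] x])
    qed
    then show ?thesis using contr_decompose[OF V f e \<phi> dec x] by simp
  qed
  have CLin: "?C d \<in> Lin V" if d: "d \<in> carrier (Der R P V)" for d
  proof -
    have "d \<in> {d \<in> carrier (Der R P V). ?C d \<in> Lin V}"
    proof (rule Der_in_submodule[OF V db submodule_preimage[OF D AW CL submodule_Lin[OF V]] d])
      fix v f assume v: "v \<in> carrier V" and f: "f \<in> functionals V"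
      have x: "d (var V v) \<in> carrier (Al V)" using v by (intro Der_closed[OF d] var_closed[OF V])
      show "ten V (d (var V v)) f \<in> {d \<in> carrier (Der R P V). ?C d \<in> Lin V}"
        using ten_Der[OF V x f] Ct[OF x f] contr_Lin[OF V f x] by simp
    qed
    then show ?thesis by blast
  qed
  have dpt: "lin_maps R (Der R P V) (Der_pt R P V) = {h \<in> lin_maps R (Der R P V) (Der R P (pt R V)). h ` carrier (Der R P V) \<subseteq> carrier (Der_pt R P V)}"
    using Der_ptD(1)[OF V] by (auto simp: lin_maps_def Der_pt_def)
  let ?Q = "\<lambda>\<Phi>. \<Phi> \<in> lin_maps R (Der R P V) (Der_pt R P V) \<inter> extensional (carrier (Der R P V)) \<and>
     (\<forall>x\<in>carrier (Al V). \<forall>f\<in>functionals V. \<Phi> (ten V x f) =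
        der_point R P V (fa_map R P (pt R V) (\<lambda>(v, w). (f v, w)) (fa_delta R P V x)))"
  let ?F = "restrict (\<lambda>d. ten (pt R V) (?C d) fst) (carrier (Der R P V))"
  have FL: "?F \<in> lin_maps R (Der R P V) (Der R P (pt R V))"
    by (rule lin_maps_cong[OF D lin_maps_comp[OF CL ten_fst_Lin[OF V]]]) simp
  have Fp: "?F ` carrier (Der R P V) \<subseteq> carrier (Der_pt R P V)"
    using Der_pt_ten(1)[OF V CLin] by auto
  have Ft: "?F (ten V x f) = ten (pt R V) (contr V f x) fst" if "x \<in> carrier (Al V)" "f \<in> functionals V" for x f
    using that Ct ten_Der[OF V that] by simp
  have Q: "?Q ?F" using FL Fp Ft unfolding dpt der_point_ten by (auto simp: delta_contr[OF V])
  have "Phi R P V = ?F"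
    unfolding Phi_def
  proof (rule the_equality[where P = ?Q, OF Q])
    fix \<Phi> assume q: "?Q \<Phi>"
    have \<Phi>: "\<Phi> \<in> lin_maps R (Der R P V) (Der R P (pt R V))" using q unfolding dpt by blast
    have "\<Phi> d = ?F d" if d: "d \<in> carrier (Der R P V)" for d
    proof -
      have "d \<in> {d \<in> carrier (Der R P V). \<Phi> d \<ominus>\<^bsub>Der R P (pt R V)\<^esub> ?F d \<in> {\<zero>\<^bsub>Der R P (pt R V)\<^esub>}}"
      proof (rule Der_in_submodule[OF V db submodule_preimage[OF D DW lin_maps_minus[OF DW \<Phi> FL] submodule_zero[OF DW]] d])
        interpret DW: module R "Der R P (pt R V)" by (rule DW)
        fix v f assume v: "v \<in> carrier V" and f: "f \<in> functionals V"
        have x: "d (var V v) \<in> carrier (Al V)" using v by (intro Der_closed[OF d] var_closed[OF V])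
        have "\<Phi> (ten V (d (var V v)) f) = ?F (ten V (d (var V v)) f)"
          using q x f Ft[OF x f] by (simp add: delta_contr[OF V] der_point_ten)
        moreover have "?F (ten V (d (var V v)) f) \<in> carrier (Der R P (pt R V))" by (rule lin_maps_closed[OF FL ten_Der[OF V x f]])
        ultimately show "ten V (d (var V v)) f \<in> {d \<in> carrier (Der R P V). \<Phi> d \<ominus>\<^bsub>Der R P (pt R V)\<^esub> ?F d \<in> {\<zero>\<^bsub>Der R P (pt R V)\<^esub>}}"
          using ten_Der[OF V x f] by (simp add: a_minus_def DW.r_neg)
      qed
      then show ?thesis using sub_zeroE[OF DW lin_maps_closed[OF \<Phi> d] lin_maps_closed[OF FL d]] by blast
    qed
    then show "\<Phi> = ?F" using q by (intro extensionalityI[of _ "carrier (Der R P V)"]) auto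
  qed
  then show "Phi R P V \<in> lin_maps R (Der R P V) (Der R P (pt R V))"
    "\<And>d. d \<in> carrier (Der R P V) \<Longrightarrow> Phi R P V d \<in> carrier (Der_pt R P V)"
    "\<And>x f. x \<in> carrier (Al V) \<Longrightarrow> f \<in> functionals V \<Longrightarrow> Phi R P V (ten V x f) = ten (pt R V) (contr V f x) fst"
    using FL Fp Ft by auto
qed

lemma Phi_plus:
  assumes V: "module R V" and db: "dual_basis V" and d: "d \<in> carrier (Der_plus R P V)"
  shows "Phi R P V d \<in> carrier (Der_plus R P (pt R V))"
proof -
  note W = module_pt[OF V] and dW = dual_basis_pt[OF V db]
  note D = Der_plus_sub[OF V d]
  have "d \<in> {d \<in> carrier (Der R P V). Phi R P V d \<in> carrier (Der_plus R P (pt R V))}"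
  proof (rule Der_in_submodule[OF V db submodule_preimage[OF module_Der[OF V] module_Der[OF W] Phi_lin[OF V db] submodule_Der_plus[OF W]] D])
    fix v f assume v: "v \<in> carrier V" and f: "f \<in> functionals V"
    have x: "d (var V v) \<in> dec V" using d v unfolding Der_plus_iff[OF V db] by blast
    note xc = dec_sub[OF V x]
    note y = contr_dec[OF V f x] and yc = contr_closed[OF V f xc]
    have "ten (pt R V) (contr V f (d (var V v))) fst \<in> carrier (Der_plus R P (pt R V))"
      unfolding Der_plus_iff[OF W dW]
      using ten_Der[OF W yc fst_functional] submodule_facts(4)[OF module_alg[OF W] submodule_dec[OF W] _ y]
      by (auto simp: ten_var[OF W yc fst_functional])
    then show "ten V (d (var V v)) f \<in> {d \<in> carrier (Der R P V). Phi R P V d \<in> carrier (Der_plus R P (pt R V))}"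
      using ten_Der[OF V xc f] by (simp add: Phi_ten[OF V db xc f])
  qed
  then show ?thesis by blast
qed

subsection \<open>Naturality of the divergence\<close>

abbreviation "ptm f \<equiv> (map_prod id (fst f), map_prod id (snd f))"

lemma ptm_hom:
  assumes f: "f \<in> SR_hom R V W"
  shows "ptm f \<in> SR_hom R (pt R V) (pt R W)"
  using SR_homD[OF f] by (auto simp: SR_hom_def lin_maps_def Pi_iff)

lemma ptm_lft:
  assumes V: "module R V" and W: "module R W" and f: "f \<in> SR_hom R V W" and X: "X \<in> carrier (Al V)"
  shows "fa_map R P (pt R W) (map_prod id (fst f)) (lft V X) = lft W (fa_map R P W (fst f) X)"
proof -
  note F = SR_homD[OF f] and PF = SR_homD(1)[OF ptm_hom[OF f], unfolded fst_conv]
  have h: "(\<lambda>v. (\<zero>, fst f v)) \<in> lin_maps R V (pt R W)" using lin_maps_comp[OF F(1) lin_zero_pair[OF W]] .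
  show ?thesis
    using fa_map_comp[OF V module_pt[OF V] module_pt[OF W] lin_zero_pair[OF V] PF h _ X]
      fa_map_comp[OF V W module_pt[OF W] F(1) lin_zero_pair[OF W] h _ X] by simp
qed

lemma ptm_base:
  assumes V: "module R V" and W: "module R W" and f: "f \<in> SR_hom R V W"
  shows "fa_map R P (pt R W) (map_prod id (fst f)) (base V) = base W"
  using fa_map_var[OF module_pt[OF V] module_pt[OF W] SR_homD(1)[OF ptm_hom[OF f]], of "(\<one>, \<zero>\<^bsub>V\<^esub>)"]
    lin_maps_zero[OF V W SR_homD(1)[OF f]] mod_zero[OF V] by simp

lemma ptm_Lin:
  assumes V: "module R V" and W: "module R W" and f: "f \<in> SR_hom R V W" and m: "m \<in> Lin V"
  shows "fa_map R P (pt R W) (map_prod id (fst f)) m \<in> Lin W"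
proof -
  define h where "h = map_prod (id :: 'r \<Rightarrow> 'r) (fst f)"
  show ?thesis
    unfolding h_def[symmetric] using V m
proof (induction rule: Lin_induct)
  note F = SR_homD[OF f] and PF = SR_homD(1)[OF ptm_hom[OF f], unfolded fst_conv, folded h_def]
  note L = fa_map_lin[OF module_pt[OF V] module_pt[OF W] PF]
  note s = Lin_sub[OF V] and sl = submodule_facts[OF module_alg[OF module_pt[OF W]] submodule_Lin[OF W]]
  note B = fa_map_bop[OF module_pt[OF V] module_pt[OF W] PF]
  {
    case base
    show ?case unfolding ptm_base[OF V W f, folded h_def] by (rule Lin_base[OF W])
  next
    case (add x y)
    then show ?case by (simp add: lin_maps_add[OF L] s sl(3))
  next
    case (smult a x)
    then show ?case by (simp add: lin_maps_smult[OF L] s sl(4))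
  next
    case (left b x X)
    then show ?case by (simp add: B s lft_closed[OF V] ptm_lft[OF V W f, folded h_def] Lin_bop(1)[OF W] fa_map_closed[OF V W F(1)])
  next
    case (right b x X)
    then show ?case by (simp add: B s lft_closed[OF V] ptm_lft[OF V W f, folded h_def] Lin_bop(2)[OF W] fa_map_closed[OF V W F(1)])
  }
qed
qed

lemma Der_map_pt:
  assumes V: "module R V" and W: "module R W" and f: "f \<in> SR_hom R V W" and p: "p \<in> carrier (Der_pt R P V)"
  shows "Der_map R P (pt R V) (pt R W) (ptm f) p \<in> carrier (Der_pt R P W)"
proof -
  note D = Der_ptD[OF V p] and PH = ptm_hom[OF f] and F = SR_homD[OF f]
  note pV = module_pt[OF V] and pW = module_pt[OF W]
  note L = fa_map_lin[OF pV pW SR_homD(1)[OF PH, unfolded fst_conv]]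
  show ?thesis
  proof (rule Der_ptI[OF W Der_map_Der[OF pV pW PH D(1)]])
    fix w assume w: "w \<in> carrier W"
    then show "Der_map R P (pt R V) (pt R W) (ptm f) p (var (pt R W) (\<zero>, w)) = \<zero>\<^bsub>Al (pt R W)\<^esub>"
      using D(2)[OF lin_maps_closed[OF F(2) w]] lin_maps_zero[OF module_alg[OF pV] module_alg[OF pW] L]
      by (simp add: Der_map_var[OF pV pW PH D(1)])
  next
    have "(\<one>, \<zero>\<^bsub>W\<^esub>) \<in> carrier (pt R W)" using mod_zero[OF W] by simp
    then show "Der_map R P (pt R V) (pt R W) (ptm f) p (base W) \<in> Lin W"
      using ptm_Lin[OF V W f D(3)] lin_maps_zero[OF W V F(2)] by (simp add: Der_map_var[OF pV pW PH D(1)])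
  qed
qed

text \<open>Over \<open>W\<close> a leaf \<open>i(v)\<close> gets the coefficient \<open>\<phi>(r(i(v)))\<close>, which is \<open>\<phi>(v)\<close>.\<close>
lemma contr_natural:
  assumes V: "module R V" and W: "module R W" and f: "f \<in> SR_hom R V W" and \<phi>: "\<phi> \<in> functionals V" and X: "X \<in> carrier (Al V)"
  shows "contr W (\<lambda>w. \<phi> (snd f w)) (fa_map R P W (fst f) X) = fa_map R P (pt R W) (map_prod id (fst f)) (contr V \<phi> X)"
proof -
  define h where "h = map_prod (id :: 'r \<Rightarrow> 'r) (fst f)"
  show ?thesis
    unfolding h_def[symmetric] using V X
proof (induction rule: alg_induct)
  note F = SR_homD[OF f] and PH = ptm_hom[OF f]
  have \<phi>': "(\<lambda>w. \<phi> (snd f w)) \<in> functionals W" by (rule lin_maps_comp[OF F(2) \<phi>])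
  note pV = module_pt[OF V] and pW = module_pt[OF W]
  note PF = SR_homD(1)[OF PH, unfolded fst_conv, folded h_def]
  note L = fa_map_lin[OF pV pW PF] and B = fa_map_bop[OF pV pW PF] and m = fa_map_lin[OF V W F(1)]
  note mc = lin_maps_closed[OF m]
  note C = contr_lin[OF V \<phi>] and C' = contr_lin[OF W \<phi>'] and cc = contr_closed[OF V \<phi>]
  {
    case (var v)
    have fv: "fst f v \<in> carrier W" using lin_maps_closed[OF F(1) var] .
    show ?case
      using F(3)[OF var] lin_maps_smult[OF L functional_closed[OF \<phi> var] base_closed[OF V]]
      by (simp add: fa_map_var[OF V W F(1) var] contr_var[OF W \<phi>' fv] contr_var[OF V \<phi> var] ptm_base[OF V W f, folded h_def])
  next
    case (add X Y)
    then show ?case by (simp add: lin_maps_add[OF m] mc lin_maps_add[OF C] lin_maps_add[OF C'] lin_maps_add[OF L] cc)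
  next
    case (smult a X)
    then show ?case by (simp add: lin_maps_smult[OF m] mc lin_maps_smult[OF C] lin_maps_smult[OF C'] lin_maps_smult[OF L] cc)
  next
    case (bop b X Y)
    then show ?case
      by (simp add: fa_map_bop[OF V W F(1)] contr_bop[OF V \<phi>] contr_bop[OF W \<phi>'] mc cc lft_closed[OF V] bop_closed[OF pV]
        lin_maps_add[OF L] B ptm_lft[OF V W f, folded h_def])
  }
qed
qed

lemma Phi_natural:
  assumes V: "module R V" and W: "module R W" and dV: "dual_basis V" and dW: "dual_basis W"
    and f: "f \<in> SR_hom R V W" and d: "d \<in> carrier (Der R P V)"
  shows "Phi R P W (Der_map R P V W f d) = Der_map R P (pt R V) (pt R W) (ptm f) (Phi R P V d)"
proof -
  note F = SR_homD[OF f] and PH = ptm_hom[OF f]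
  note pV = module_pt[OF V] and pW = module_pt[OF W] and D = module_Der[OF V] and DW = module_Der[OF module_pt[OF W]]
  interpret DW: module R "Der R P (pt R W)" by (rule DW)
  note L1 = lin_maps_comp[OF Der_map_lin[OF V W f] Phi_lin[OF W dW]]
  note L2 = lin_maps_comp[OF Phi_lin[OF V dV] Der_map_lin[OF pV pW PH]]
  let ?G = "\<lambda>d. Phi R P W (Der_map R P V W f d) \<ominus>\<^bsub>Der R P (pt R W)\<^esub> Der_map R P (pt R V) (pt R W) (ptm f) (Phi R P V d)"
  have "d \<in> {d \<in> carrier (Der R P V). ?G d \<in> {\<zero>\<^bsub>Der R P (pt R W)\<^esub>}}"
  proof (rule Der_in_submodule[OF V dV submodule_preimage[OF D DW lin_maps_minus[OF DW L1 L2] submodule_zero[OF DW]] d])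
    fix v \<phi> assume v: "v \<in> carrier V" and \<phi>: "\<phi> \<in> functionals V"
    have x: "d (var V v) \<in> carrier (Al V)" using v by (intro Der_closed[OF d] var_closed[OF V])
    have \<phi>': "(\<lambda>w. \<phi> (snd f w)) \<in> functionals W" by (rule lin_maps_comp[OF F(2) \<phi>])
    have "(\<lambda>u. fst (snd (ptm f) u)) = (fst :: 'r \<times> 'b \<Rightarrow> 'r)" by (auto simp: fun_eq_iff)
    then have "Phi R P W (Der_map R P V W f (ten V (d (var V v)) \<phi>)) = Der_map R P (pt R V) (pt R W) (ptm f) (Phi R P V (ten V (d (var V v)) \<phi>))"
      using contr_natural[OF V W f \<phi> x]
      by (simp add: Der_map_ten[OF V W f x \<phi>] Phi_ten[OF V dV x \<phi>] Phi_ten[OF W dW fa_map_closed[OF V W F(1) x] \<phi>']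
        Der_map_ten[OF pV pW PH contr_closed[OF V \<phi> x] fst_functional])
    then show "ten V (d (var V v)) \<phi> \<in> {d \<in> carrier (Der R P V). ?G d \<in> {\<zero>\<^bsub>Der R P (pt R W)\<^esub>}}"
      using ten_Der[OF V x \<phi>] lin_maps_closed[OF L2 ten_Der[OF V x \<phi>]] by (simp add: a_minus_def DW.r_neg)
  qed
  then show ?thesis using sub_zeroE[OF DW lin_maps_closed[OF L1 d] lin_maps_closed[OF L2 d]] by blast
qed

end

section \<open>The Lie algebra generated in degree one\<close>

lemma (in abelian_group) jacobi_identity:
  assumes "a \<in> carrier G" "b \<in> carrier G" "k \<in> carrier G" "l \<in> carrier G" "p \<in> carrier G" "q \<in> carrier G"
  shows "a \<ominus> b \<ominus> (k \<ominus> l) = (a \<ominus> p \<ominus> (q \<ominus> l)) \<oplus> (p \<ominus> k \<ominus> (b \<ominus> q))"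
proof -
  have "(a \<ominus> p \<ominus> (q \<ominus> l)) \<oplus> (p \<ominus> k \<ominus> (b \<ominus> q)) = (a \<ominus> b \<ominus> (k \<ominus> l)) \<oplus> ((p \<oplus> \<ominus> p) \<oplus> (q \<oplus> \<ominus> q))"
    using assms by (simp add: a_minus_def minus_add a_ac)
  then show ?thesis using assms by (simp add: r_neg)
qed

lemma (in abelian_group) diff_cancel_two:
  assumes "u \<in> carrier G" "s \<in> carrier G" "t \<in> carrier G" "c \<in> carrier G" "d \<in> carrier G"
  shows "(u \<ominus> t \<ominus> s) \<oplus> ((s \<ominus> c) \<oplus> (t \<ominus> d)) = u \<ominus> (c \<oplus> d)"
proof -
  have "(u \<ominus> t \<ominus> s) \<oplus> ((s \<ominus> c) \<oplus> (t \<ominus> d)) = (u \<ominus> (c \<oplus> d)) \<oplus> ((s \<oplus> \<ominus> s) \<oplus> (t \<oplus> \<ominus> t))"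
    using assms by (simp add: a_minus_def minus_add a_ac)
  then show ?thesis using assms by (simp add: r_neg)
qed

context bin_operad
begin

lemma bracket_right_lin:
  assumes V: "module R V" and d: "d \<in> carrier (Der R P V)"
  shows "(\<lambda>e. bracket R P V d e) \<in> lin_maps R (Der R P V) (Der R P V)"
proof -
  interpret A: module R "Al V" by (rule module_alg[OF V])
  note D = module_Der[OF V] and c = Der_closed[OF d]
  show ?thesis
  proof (rule lin_mapsI)
    fix e e' assume e: "e \<in> carrier (Der R P V)" and e': "e' \<in> carrier (Der R P V)"
    note s = mod_add[OF D e e']
    show "bracket R P V d (e \<oplus>\<^bsub>Der R P V\<^esub> e') = bracket R P V d e \<oplus>\<^bsub>Der R P V\<^esub> bracket R P V d e'"
      by (rule extensionalityI[OF Der_ext[OF bracket_Der[OF V d s]] Der_ext[OF mod_add[OF D bracket_Der[OF V d e] bracket_Der[OF V d e']]]])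
        (simp add: bracket_apply[OF V d s] bracket_apply[OF V d e] bracket_apply[OF V d e'] Der_apply c Der_closed[OF e] Der_closed[OF e']
          lin_maps_add[OF Der_lin[OF d]] a_minus_def A.minus_add A.a_ac)
  next
    fix a e assume a: "a \<in> carrier R" and e: "e \<in> carrier (Der R P V)"
    note s = mod_smult[OF D a e]
    show "bracket R P V d (a \<odot>\<^bsub>Der R P V\<^esub> e) = a \<odot>\<^bsub>Der R P V\<^esub> bracket R P V d e"
      by (rule extensionalityI[OF Der_ext[OF bracket_Der[OF V d s]] Der_ext[OF mod_smult[OF D a bracket_Der[OF V d e]]]])
        (simp add: bracket_apply[OF V d s] bracket_apply[OF V d e] Der_apply c Der_closed[OF e] a
          lin_maps_smult[OF Der_lin[OF d]] a_minus_def A.smult_r_minus A.smult_r_distr)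
  qed (rule bracket_Der[OF V d])
qed

lemma bracket_antisym:
  assumes V: "module R V" and d: "d \<in> carrier (Der R P V)" and e: "e \<in> carrier (Der R P V)"
  shows "bracket R P V e d = \<ominus>\<^bsub>Der R P V\<^esub> bracket R P V d e"
proof -
  interpret D: module R "Der R P V" by (rule module_Der[OF V])
  have p: "prelie R P V d e \<in> carrier (Der R P V)" "prelie R P V e d \<in> carrier (Der R P V)"
    using prelie_Der[OF V d e] prelie_Der[OF V e d] by auto
  then show ?thesis unfolding bracket_def by (simp add: a_minus_def D.minus_add D.a_ac)
qed

lemma jacobi:
  assumes V: "module R V" and x: "x \<in> carrier (Der R P V)" and y: "y \<in> carrier (Der R P V)" and e: "e \<in> carrier (Der R P V)"
  shows "bracket R P V (bracket R P V x y) e =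
    bracket R P V x (bracket R P V y e) \<oplus>\<^bsub>Der R P V\<^esub> bracket R P V (bracket R P V x e) y"
proof -
  note A = module_alg[OF V] and D = module_Der[OF V]
  interpret A: module R "Al V" by (rule A)
  note xy = bracket_Der[OF V x y] and ye = bracket_Der[OF V y e] and xe = bracket_Der[OF V x e]
  note c = Der_closed[OF x] Der_closed[OF y] Der_closed[OF e]
  show ?thesis
  proof (rule extensionalityI[OF Der_ext[OF bracket_Der[OF V xy e]] Der_ext[OF mod_add[OF D bracket_Der[OF V x ye] bracket_Der[OF V xe y]]]])
    fix X assume X: "X \<in> carrier (Al V)"
    show "bracket R P V (bracket R P V x y) e X =
      (bracket R P V x (bracket R P V y e) \<oplus>\<^bsub>Der R P V\<^esub> bracket R P V (bracket R P V x e) y) X"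
      using A.M.jacobi_identity[of "e (y (x X))" "e (x (y X))" "y (x (e X))" "x (y (e X))" "y (e (x X))" "x (e (y X))"] X
      by (simp add: bracket_apply[OF V xy e] bracket_apply[OF V x ye] bracket_apply[OF V xe y] bracket_apply[OF V x y]
        bracket_apply[OF V y e] bracket_apply[OF V x e] Der_apply c
        lin_maps_diff[OF A A Der_lin[OF x]] lin_maps_diff[OF A A Der_lin[OF y]] lin_maps_diff[OF A A Der_lin[OF e]])
  qed
qed

text \<open>The derivations that bracket the Lie algebra into itself. Besides the Lie algebra itself they contain the
  derivations of degree zero.\<close>
definition Nrm :: "('r, 'v) module \<Rightarrow> (('r, 'o, 'v) fa \<Rightarrow> ('r, 'o, 'v) fa) set" where
  "Nrm V = {e \<in> carrier (Der R P V). \<forall>x\<in>Lie V. bracket R P V x e \<in> Lie V}"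

lemma Nrm_sub: "e \<in> Nrm V \<Longrightarrow> e \<in> carrier (Der R P V)"
  by (simp add: Nrm_def)

lemma Nrm_right: "x \<in> Lie V \<Longrightarrow> e \<in> Nrm V \<Longrightarrow> bracket R P V x e \<in> Lie V"
  by (simp add: Nrm_def)

lemma Nrm_left: "module R V \<Longrightarrow> e \<in> Nrm V \<Longrightarrow> x \<in> Lie V \<Longrightarrow> bracket R P V e x \<in> Lie V"
  using bracket_antisym[of V x e] Nrm_right[of x V e] submodule_facts(6)[OF module_Der submodule_Lie, of V]
  by (simp add: Nrm_sub Lie_sub)

lemma Lie_Nrm: "module R V \<Longrightarrow> Lie V \<subseteq> Nrm V"
  using Lie_bracket Lie_sub by (auto simp: Nrm_def)

lemma submodule_Nrm:
  assumes V: "module R V"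
  shows "submodule (Nrm V) R (Der R P V)"
proof -
  note D = module_Der[OF V]
  note l = submodule_facts[OF D submodule_Lie[OF V]]
  have L: "(\<lambda>e. bracket R P V x e) \<in> lin_maps R (Der R P V) (Der R P V)" if "x \<in> Lie V" for x
    using bracket_right_lin[OF V Lie_sub[OF V that]] .
  show ?thesis
    using l module_facts[OF D]
    by (intro submoduleI'[OF D]) (auto simp: Nrm_def lin_maps_add[OF L] lin_maps_smult[OF L] lin_maps_zero[OF D D L])
qed

lemma arity2_bop:
  assumes V: "module R V" and g: "g \<in> fa_gens P V" "fst (fst g) = 2"
  obtains b v w where "b \<in> carrier (Op P 2)" "v \<in> carrier V" "w \<in> carrier V" "tm V g = bop V b (var V v) (var V w)"
proof -
  obtain b vs where gd: "g = ((2, b), vs)" using g(2) by (cases g) (auto intro: prod.expand)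
  note f = fa_gensE[OF g(1)]
  obtain v w where vs: "vs = [v, w]" using f(4) gd by (cases vs; cases "tl vs") auto
  have "tm V g = fop V (2, b) (map (fa_var R P V) vs)" using tm_fop[OF V, of "(2, b)" vs] g(1) gd by simp
  then show thesis using that[of b v w] f gd vs by (simp add: bop_def)
qed

lemma bop_var_deg:
  assumes V: "module R V" and b: "b \<in> carrier (Op P 2)" and v: "v \<in> carrier V" and w: "w \<in> carrier V"
  shows "bop V b (var V v) (var V w) \<in> fa_deg R P V 2"
proof -
  have g: "((2, b), [v, w]) \<in> fa_gens P V" using b v w by (simp add: fa_gens_iff)
  have "bop V b (var V v) (var V w) = tm V ((2, b), [v, w])" using tm_fop[OF V g] by (simp add: bop_def)
  then show ?thesis using tm_deg[OF g] by simp
qed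

text \<open>Bracketing with a derivation of degree zero preserves degree one, and by the Jacobi identity the elements
  of the Lie algebra whose bracket with \<open>e\<close> stays inside form a Lie algebra.\<close>
lemma degree_zero_Nrm:
  assumes V: "module R V" and e: "e \<in> carrier (Der R P V)"
    and z: "\<And>v. v \<in> carrier V \<Longrightarrow> \<exists>w\<in>carrier V. e (var V v) = var V w"
  shows "e \<in> Nrm V"
proof -
  note A = module_alg[OF V] and D = module_Der[OF V]
  note l = submodule_facts[OF D submodule_Lie[OF V]]
  note fd = submodule_facts[OF A submodule_fa_deg[OF V]]
  have e2: "e X \<in> fa_deg R P V 2" if X: "X \<in> fa_deg R P V 2" for X
  proof (rule fa_deg_into[OF V A Der_lin[OF e] submodule_fa_deg[OF V] _ X])
    fix g assume g: "g \<in> fa_gens P V" "fst (fst g) = 2"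
    obtain b v w where b: "b \<in> carrier (Op P 2)" "v \<in> carrier V" "w \<in> carrier V" "tm V g = bop V b (var V v) (var V w)"
      using arity2_bop[OF V g] .
    obtain v' w' where v': "v' \<in> carrier V" "e (var V v) = var V v'" and w': "w' \<in> carrier V" "e (var V w) = var V w'"
      using z b by metis
    show "e (tm V g) \<in> fa_deg R P V 2"
      unfolding b(4) Der_bop[OF V e b(1) var_closed[OF V b(2)] var_closed[OF V b(3)]] v'(2) w'(2)
      by (intro fd(3) bop_var_deg[OF V] b v' w')
  qed
  let ?L = "{x \<in> Lie V. bracket R P V x e \<in> Lie V}"
  have "Lie V \<subseteq> ?L"
  proof (rule Lie_least)
    have "(\<lambda>x. \<ominus>\<^bsub>Der R P V\<^esub> bracket R P V e x) \<in> lin_maps R (Der R P V) (Der R P V)"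
    proof (rule lin_maps_cong[OF D lin_maps_scale[OF D bracket_right_lin[OF V e]]])
      show "\<ominus> \<one> \<in> carrier R" by simp
      show "\<And>x. x \<in> carrier (Der R P V) \<Longrightarrow> \<ominus>\<^bsub>Der R P V\<^esub> bracket R P V e x = \<ominus> \<one> \<odot>\<^bsub>Der R P V\<^esub> bracket R P V e x"
        by (rule minus_eq_smult[OF D bracket_Der[OF V e]])
    qed
    then have "(\<lambda>x. bracket R P V x e) \<in> lin_maps R (Der R P V) (Der R P V)"
      by (rule lin_maps_cong[OF D]) (rule bracket_antisym[OF V e])
    from submodule_Int[OF D submodule_Lie[OF V] submodule_preimage[OF D D this submodule_Lie[OF V]]]
    show "submodule ?L R (Der R P V)"
      by (rule back_subst[of "\<lambda>L. submodule L R (Der R P V)"]) (use l(1) in auto)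
  next
    fix x y assume xy: "x \<in> ?L" "y \<in> ?L"
    then have c: "x \<in> carrier (Der R P V)" "y \<in> carrier (Der R P V)" using l(1) by auto
    show "bracket R P V x y \<in> ?L"
      using xy l(3) Lie_bracket[OF V] by (simp add: jacobi[OF V c e])
  next
    show "Der_deg R P V 1 \<subseteq> ?L"
    proof
      fix d assume d: "d \<in> Der_deg R P V 1"
      then have dc: "d \<in> carrier (Der R P V)" and dv: "\<And>v. v \<in> carrier V \<Longrightarrow> d (var V v) \<in> fa_deg R P V 2"
        by (auto simp: Der_deg_iff numeral_2_eq_2)
      have "bracket R P V d e \<in> Der_deg R P V 1"
        unfolding Der_deg_iff
      proof (intro conjI ballI bracket_Der[OF V dc e])
        fix v assume v: "v \<in> carrier V"
        obtain w where w: "w \<in> carrier V" "e (var V v) = var V w" using z[OF v] by auto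
        have "bracket R P V d e (var V v) \<in> fa_deg R P V 2"
          unfolding bracket_apply[OF V dc e var_closed[OF V v]] w(2) by (intro fd(5) e2 dv v w)
        then show "bracket R P V d e (var V v) \<in> fa_deg R P V (1 + 1)" by (simp add: numeral_2_eq_2)
      qed
      then show "d \<in> ?L" using Lie_deg1[OF V] d by simp
    qed
  qed
  then show ?thesis using e unfolding Nrm_def by blast
qed

lemma ten_var_Nrm:
  assumes V: "module R V" and v: "v \<in> carrier V" and f: "f \<in> functionals V"
  shows "ten V (var V v) f \<in> Nrm V"
proof (rule degree_zero_Nrm[OF V ten_Der[OF V var_closed[OF V v] f]])
  fix w assume w: "w \<in> carrier V"
  have "ten V (var V v) f (var V w) = var V (f w \<odot>\<^bsub>V\<^esub> v)"
    unfolding ten_var[OF V var_closed[OF V v] f w] by (rule lin_maps_smult[OF var_lin[OF V] functional_closed[OF f w] v, symmetric])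
  then show "\<exists>u\<in>carrier V. ten V (var V v) f (var V w) = var V u"
    using mod_smult[OF V functional_closed[OF f w] v] by blast
qed

lemma ten_bop_var_Lie:
  assumes V: "module R V" and b: "b \<in> carrier (Op P 2)" and v: "v \<in> carrier V" and w: "w \<in> carrier V" and f: "f \<in> functionals V"
  shows "ten V (bop V b (var V v) (var V w)) f \<in> Lie V"
proof (rule Lie_deg1[OF V])
  have x: "bop V b (var V v) (var V w) \<in> carrier (Al V)" by (intro bop_closed[OF V b] var_closed[OF V] v w)
  show "ten V (bop V b (var V v) (var V w)) f \<in> Der_deg R P V 1"
    using ten_Der[OF V x f] submodule_facts(4)[OF module_alg[OF V] submodule_fa_deg[OF V]] bop_var_deg[OF V b v w] functional_closed[OF f]
    by (simp add: Der_deg_iff ten_var[OF V x f] numeral_2_eq_2)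
qed

subsection \<open>Subalgebras generated by sets of variables\<close>

text \<open>The part of \<open>O(V)\<close> that involves only variables in \<open>S\<close>. Letters that are independent of \<open>S\<close> cannot occur
  in it, so derivations along their dual functionals kill it.\<close>
inductive_set gen :: "('r, 'v) module \<Rightarrow> 'v set \<Rightarrow> ('r, 'o, 'v) fa set" for V :: "('r, 'v) module" and S :: "'v set" where
  gen_var: "s \<in> S \<Longrightarrow> var V s \<in> gen V S"
| gen_add: "X \<in> gen V S \<Longrightarrow> Y \<in> gen V S \<Longrightarrow> X \<oplus>\<^bsub>Al V\<^esub> Y \<in> gen V S"
| gen_smult: "a \<in> carrier R \<Longrightarrow> X \<in> gen V S \<Longrightarrow> a \<odot>\<^bsub>Al V\<^esub> X \<in> gen V S"
| gen_bop: "b \<in> carrier (Op P 2) \<Longrightarrow> X \<in> gen V S \<Longrightarrow> Y \<in> gen V S \<Longrightarrow> bop V b X Y \<in> gen V S"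

lemma gen_closed: "X \<in> gen V S \<Longrightarrow> module R V \<Longrightarrow> S \<subseteq> carrier V \<Longrightarrow> X \<in> carrier (Al V)"
  by (induction rule: gen.induct) (auto intro: var_closed bop_closed mod_add[OF module_alg] mod_smult[OF module_alg])

lemma gen_mono: "X \<in> gen V S \<Longrightarrow> S \<subseteq> T \<Longrightarrow> X \<in> gen V T"
  by (induction rule: gen.induct) (auto intro: gen.intros)

lemma gen_kill:
  assumes "X \<in> gen V S" and V: "module R V" "S \<subseteq> carrier V" and e: "e \<in> carrier (Der R P V)"
    and k: "\<And>s. s \<in> S \<Longrightarrow> e (var V s) = \<zero>\<^bsub>Al V\<^esub>"
  shows "e X = \<zero>\<^bsub>Al V\<^esub>"
proof -
  note A = module_alg[OF V(1)] and c = gen_closed[OF _ V]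
  interpret A: module R "Al V" by (rule A)
  show ?thesis using assms(1)
  proof (induction rule: gen.induct)
    case (gen_add X Y)
    then show ?case by (simp add: lin_maps_add[OF Der_lin[OF e]] c)
  next
    case (gen_smult a X)
    then show ?case by (simp add: lin_maps_smult[OF Der_lin[OF e]] c)
  next
    case (gen_bop b X Y)
    then show ?case
      by (simp add: Der_bop[OF V(1) e] c lin_maps_zero[OF A A bop_left[OF V(1)]] lin_maps_zero[OF A A bop_right[OF V(1)]])
  qed (rule k)
qed

text \<open>In \<open>(x \<otimes> f)(X)\<close> the only part that \<open>e\<close> does not kill is the inserted element \<open>x\<close>.\<close>
lemma gen_insert:
  assumes "X \<in> gen V S" and V: "module R V" "S \<subseteq> carrier V" and e: "e \<in> carrier (Der R P V)"
    and k: "\<And>s. s \<in> S \<Longrightarrow> e (var V s) = \<zero>\<^bsub>Al V\<^esub>" and x: "x \<in> carrier (Al V)" and f: "f \<in> functionals V"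
  shows "e (ten V x f X) = ten V (e x) f X"
proof -
  note A = module_alg[OF V(1)] and c = gen_closed[OF _ V]
  interpret A: module R "Al V" by (rule A)
  note ex = Der_closed[OF e x]
  note t = ten_Der[OF V(1) x f] and t' = ten_Der[OF V(1) ex f]
  note tc = Der_closed[OF t] and tc' = Der_closed[OF t'] and L = Der_lin[OF t] and L' = Der_lin[OF t']
  show ?thesis using assms(1)
  proof (induction rule: gen.induct)
    case (gen_var s)
    then have s: "s \<in> carrier V" using V(2) by auto
    show ?case
      unfolding ten_var[OF V(1) x f s] ten_var[OF V(1) ex f s] by (rule lin_maps_smult[OF Der_lin[OF e] functional_closed[OF f s] x])
  next
    case (gen_add X Y)
    then show ?case by (simp add: lin_maps_add[OF L] lin_maps_add[OF L'] c tc lin_maps_add[OF Der_lin[OF e]])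
  next
    case (gen_smult a X)
    then show ?case by (simp add: lin_maps_smult[OF L] lin_maps_smult[OF L'] c tc lin_maps_smult[OF Der_lin[OF e]])
  next
    case (gen_bop b X Y)
    have "e X = \<zero>\<^bsub>Al V\<^esub>" "e Y = \<zero>\<^bsub>Al V\<^esub>" using gen_kill[OF _ V e k] gen_bop by auto
    then show ?case
      using gen_bop c[of X] c[of Y]
      by (simp add: Der_bop[OF V(1) t] Der_bop[OF V(1) t'] Der_bop[OF V(1) e] tc tc' bop_closed[OF V(1)]
        lin_maps_add[OF Der_lin[OF e]] lin_maps_zero[OF A A bop_left[OF V(1)]] lin_maps_zero[OF A A bop_right[OF V(1)]])
  qed
qed

lemma ten_gen:
  assumes "X \<in> gen V S" and V: "module R V" "S \<subseteq> carrier V" and y: "y \<in> carrier V" and f: "f \<in> functionals V"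
  shows "ten V (var V y) f X \<in> gen V (insert y S)"
proof -
  note c = gen_closed[OF _ V] and x = var_closed[OF V(1) y]
  note t = ten_Der[OF V(1) x f]
  have m: "X \<in> gen V S \<Longrightarrow> X \<in> gen V (insert y S)" for X by (rule gen_mono) auto
  show ?thesis using assms(1)
  proof (induction rule: gen.induct)
    case (gen_var s)
    then have s: "s \<in> carrier V" using V(2) by auto
    show ?case unfolding ten_var[OF V(1) x f s] by (intro gen.gen_smult gen.gen_var functional_closed[OF f s]) simp
  next
    case (gen_add X Y)
    then show ?case by (simp add: lin_maps_add[OF Der_lin[OF t]] c gen.gen_add)
  next
    case (gen_smult a X)
    then show ?case by (simp add: lin_maps_smult[OF Der_lin[OF t]] c gen.gen_smult)
  next
    case (gen_bop b X Y)
    then show ?case by (simp add: Der_bop[OF V(1) t] c gen.gen_add gen.gen_bop m)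
  qed
qed

lemma fa_map_gen:
  assumes V: "module R V" and W: "module R W" and h: "h \<in> lin_maps R V W"
    and S: "\<And>v. v \<in> carrier V \<Longrightarrow> var W (h v) \<in> gen W S" and X: "X \<in> carrier (Al V)"
  shows "fa_map R P W h X \<in> gen W S"
  using V X
proof (induction rule: alg_induct)
  case (var v)
  then show ?case using S by (simp add: fa_map_var[OF V W h])
next
  case (add X Y)
  then show ?case by (simp add: lin_maps_add[OF fa_map_lin[OF V W h]] gen_add)
next
  case (smult a X)
  then show ?case by (simp add: lin_maps_smult[OF fa_map_lin[OF V W h]] gen_smult)
next
  case (bop b X Y)
  then show ?case by (simp add: fa_map_bop[OF V W h] gen_bop)
qed

subsection \<open>Auxiliary letters\<close>

text \<open>Variables \<open>y\<^sub>i\<close> with dual functionals \<open>g\<^sub>i\<close> that are independent of the variables in \<open>S\<close>.\<close>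
definition letters :: "('r, 'v) module \<Rightarrow> 'v set \<Rightarrow> (nat \<Rightarrow> 'v) \<Rightarrow> (nat \<Rightarrow> 'v \<Rightarrow> 'r) \<Rightarrow> nat set \<Rightarrow> bool" where
  "letters V S y g I \<longleftrightarrow> module R V \<and> S \<subseteq> carrier V \<and>
     (\<forall>i\<in>I. y i \<in> carrier V \<and> g i \<in> functionals V \<and> g i (y i) = \<one> \<and> (\<forall>s\<in>S. g i s = \<zero>) \<and>
       (\<forall>j\<in>I. i \<noteq> j \<longrightarrow> g i (y j) = \<zero>))"

lemma lettersD:
  assumes "letters V S y g I"
  shows "module R V" "S \<subseteq> carrier V" "\<And>i. i \<in> I \<Longrightarrow> y i \<in> carrier V" "\<And>i. i \<in> I \<Longrightarrow> g i \<in> functionals V"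
    "\<And>i. i \<in> I \<Longrightarrow> g i (y i) = \<one>" "\<And>i s. i \<in> I \<Longrightarrow> s \<in> S \<Longrightarrow> g i s = \<zero>"
    "\<And>i j. i \<in> I \<Longrightarrow> j \<in> I \<Longrightarrow> i \<noteq> j \<Longrightarrow> g i (y j) = \<zero>"
  using assms unfolding letters_def by blast+

lemma letters_insert: "letters V S y g I \<Longrightarrow> i \<in> I \<Longrightarrow> letters V (insert (y i) S) y g (I - {i})"
  unfolding letters_def by auto

lemma ten_letter:
  assumes l: "letters V S y g I" and i: "i \<in> I" and x: "x \<in> carrier (Al V)"
  shows "ten V x (g i) (var V (y i)) = x" "\<And>j. j \<in> I \<Longrightarrow> i \<noteq> j \<Longrightarrow> ten V x (g i) (var V (y j)) = \<zero>\<^bsub>Al V\<^esub>"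
    "\<And>s. s \<in> S \<Longrightarrow> ten V x (g i) (var V s) = \<zero>\<^bsub>Al V\<^esub>" "\<And>X. X \<in> gen V S \<Longrightarrow> ten V x (g i) X = \<zero>\<^bsub>Al V\<^esub>"
proof -
  note L = lettersD[OF l]
  interpret A: module R "Al V" by (rule module_alg[OF L(1)])
  note v = ten_var[OF L(1) x L(4)[OF i]]
  show "ten V x (g i) (var V (y i)) = x" "\<And>j. j \<in> I \<Longrightarrow> i \<noteq> j \<Longrightarrow> ten V x (g i) (var V (y j)) = \<zero>\<^bsub>Al V\<^esub>"
    using i x L by (simp_all add: v)
  show s: "\<And>s. s \<in> S \<Longrightarrow> ten V x (g i) (var V s) = \<zero>\<^bsub>Al V\<^esub>"
    using i x L(2,6) by (simp add: v subset_iff)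
  show "\<And>X. X \<in> gen V S \<Longrightarrow> ten V x (g i) X = \<zero>\<^bsub>Al V\<^esub>"
    by (rule gen_kill[OF _ L(1,2) ten_Der[OF L(1) x L(4)[OF i]] s])
qed

lemma ten_zero: "module R V \<Longrightarrow> f \<in> functionals V \<Longrightarrow> ten V \<zero>\<^bsub>Al V\<^esub> f = \<zero>\<^bsub>Der R P V\<^esub>"
  by (rule lin_maps_zero[OF module_alg module_Der ten_linear])

lemma bracket_ten_simple:
  assumes V: "module R V" and x: "x \<in> carrier (Al V)" and y: "y \<in> carrier (Al V)"
    and f: "f \<in> functionals V" and g: "g \<in> functionals V" and z: "ten V x f y = \<zero>\<^bsub>Al V\<^esub>"
  shows "bracket R P V (ten V x f) (ten V y g) = ten V (ten V y g x) f"
proof -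
  interpret D: module R "Der R P V" by (rule module_Der[OF V])
  have "ten V (ten V y g x) f \<in> carrier (Der R P V)" by (intro ten_Der[OF V] Der_closed[OF ten_Der[OF V y g]] x f)
  then show ?thesis
    unfolding bracket_ten[OF V x y f g] z ten_zero[OF V g] by (simp add: a_minus_def)
qed

lemma bop_zero:
  assumes "module R V" "b \<in> carrier (Op P 2)" "X \<in> carrier (Al V)"
  shows "bop V b \<zero>\<^bsub>Al V\<^esub> X = \<zero>\<^bsub>Al V\<^esub>" "bop V b X \<zero>\<^bsub>Al V\<^esub> = \<zero>\<^bsub>Al V\<^esub>"
  using lin_maps_zero[OF module_alg[OF assms(1)] module_alg[OF assms(1)] bop_left[OF assms]]
    lin_maps_zero[OF module_alg[OF assms(1)] module_alg[OF assms(1)] bop_right[OF assms]] by auto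

text \<open>A product \<open>l r \<otimes> g\<^sub>i\<close> whose factors do not involve the letters is an iterated bracket \<open>[[y\<^sub>j y\<^sub>k \<otimes> g\<^sub>i, l
  \<otimes> g\<^sub>j], r \<otimes> g\<^sub>k]\<close>, each bracket substituting a factor for a letter.\<close>
lemma product_Lie_step:
  assumes l: "letters V S y g I" and i: "i \<in> I" "j \<in> I" "k \<in> I" "i \<noteq> j" "i \<noteq> k" "j \<noteq> k"
    and b: "b \<in> carrier (Op P 2)" and X: "X \<in> gen V S" "ten V X (g j) \<in> Nrm V" and Y: "Y \<in> gen V S" "ten V Y (g k) \<in> Nrm V"
  shows "ten V (bop V b X Y) (g i) \<in> Lie V"
proof -
  note L = lettersD[OF l] and c = gen_closed[OF _ lettersD(1,2)[OF l]]
  note V = L(1)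
  interpret A: module R "Al V" by (rule module_alg[OF V])
  have Xc: "X \<in> carrier (Al V)" and Yc: "Y \<in> carrier (Al V)" using c X Y by auto
  have yc: "var V (y j) \<in> carrier (Al V)" "var V (y k) \<in> carrier (Al V)" using L(3) i by (auto intro: var_closed[OF V])
  have b0: "bop V b (var V (y j)) (var V (y k)) \<in> carrier (Al V)" "bop V b X (var V (y k)) \<in> carrier (Al V)"
    using yc Xc by (auto intro: bop_closed[OF V b])
  have x1: "ten V (bop V b (var V (y j)) (var V (y k))) (g i) \<in> Lie V" using i L by (intro ten_bop_var_Lie[OF V b]) auto
  have "ten V X (g j) (bop V b (var V (y j)) (var V (y k))) = bop V b X (var V (y k))"
    using ten_letter(1)[OF l i(2) Xc] ten_letter(2)[OF l i(2) Xc i(3)] i yc Xc b0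
    by (simp add: Der_bop[OF V ten_Der[OF V Xc L(4)[OF i(2)]] b] bop_zero[OF V b])
  then have "bracket R P V (ten V (bop V b (var V (y j)) (var V (y k))) (g i)) (ten V X (g j)) = ten V (bop V b X (var V (y k))) (g i)"
    using bracket_ten_simple[OF V b0(1) Xc L(4)[OF i(1)] L(4)[OF i(2)] ten_letter(4)[OF l i(1) b0(1) X(1)]] by simp
  then have x2: "ten V (bop V b X (var V (y k))) (g i) \<in> Lie V" using Nrm_right[OF x1 X(2)] by simp
  have "ten V Y (g k) (bop V b X (var V (y k))) = bop V b X Y"
    using ten_letter(1)[OF l i(3) Yc] ten_letter(4)[OF l i(3) Yc X(1)] i yc Xc Yc bop_closed[OF V b]
    by (simp add: Der_bop[OF V ten_Der[OF V Yc L(4)[OF i(3)]] b] bop_zero[OF V b])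
  then have "bracket R P V (ten V (bop V b X (var V (y k))) (g i)) (ten V Y (g k)) = ten V (bop V b X Y) (g i)"
    using bracket_ten_simple[OF V b0(2) Yc L(4)[OF i(1)] L(4)[OF i(3)] ten_letter(4)[OF l i(1) b0(2) Y(1)]] by simp
  then show ?thesis using Nrm_right[OF x2 Y(2)] by simp
qed

text \<open>The induction in \<open>gen_Nrm\<close> needs two letters besides the given one at every step; the same letters can be
  used again at each stage, as the factors never involve them.\<close>
definition three :: "nat set \<Rightarrow> bool" where
  "three I \<longleftrightarrow> (\<forall>i\<in>I. \<exists>j\<in>I. \<exists>k\<in>I. i \<noteq> j \<and> i \<noteq> k \<and> j \<noteq> k)"

lemma three_distinct:
  assumes "i \<noteq> j" "i \<noteq> k" "j \<noteq> k"
  shows "three {i, j, k}"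
  using assms unfolding three_def by auto

text \<open>For variables the derivation has degree zero; products even belong to the Lie algebra.\<close>
lemma gen_Nrm:
  assumes l: "letters V S y g I" and t: "three I" and X: "X \<in> gen V S" and i: "i \<in> I"
  shows "ten V X (g i) \<in> Nrm V"
  using X i
proof (induction arbitrary: i rule: gen.induct)
  note L = lettersD[OF l] and c = gen_closed[OF _ lettersD(1,2)[OF l]]
  note n = submodule_facts[OF module_Der[OF lettersD(1)[OF l]] submodule_Nrm[OF lettersD(1)[OF l]]]
  {
    case (gen_var s)
    then show ?case using L(2) by (intro ten_var_Nrm[OF L(1)] L(4)) auto
  next
    case (gen_add X Y)
    then show ?case using n(3) by (simp add: lin_maps_add[OF ten_linear[OF L(1) L(4)]] c)
  next
    case (gen_smult a X)
    then show ?case using n(4) by (simp add: lin_maps_smult[OF ten_linear[OF L(1) L(4)]] c)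
  next
    case (gen_bop b X Y)
    obtain j k where jk: "j \<in> I" "k \<in> I" "i \<noteq> j" "i \<noteq> k" "j \<noteq> k" using t gen_bop.prems unfolding three_def by blast
    have "ten V (bop V b X Y) (g i) \<in> Lie V"
      using gen_bop jk by (intro product_Lie_step[OF l gen_bop.prems jk]) auto
    then show ?case using Lie_Nrm[OF L(1)] by blast
  }
qed

lemma product_Lie:
  assumes l: "letters V S y g I" and t: "three I" and i: "i \<in> I" and b: "b \<in> carrier (Op P 2)"
    and X: "X \<in> gen V S" and Y: "Y \<in> gen V S"
  shows "ten V (bop V b X Y) (g i) \<in> Lie V"
proof -
  obtain j k where jk: "j \<in> I" "k \<in> I" "i \<noteq> j" "i \<noteq> k" "j \<noteq> k" using t i unfolding three_def by blast
  show ?thesis by (rule product_Lie_step[OF l i jk b X gen_Nrm[OF l t X jk(1)] Y gen_Nrm[OF l t Y jk(2)]])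
qed

text \<open>The element \<open>(y\<^sub>0 \<otimes> f)(l r)\<close> arises by replacing in turn each leaf \<open>v\<close> of \<open>l r\<close> by \<open>f(v) y\<^sub>0\<close>; it is the
  divergence of \<open>l r \<otimes> f\<close>. Bracketing as in \<open>product_Lie\<close> produces, besides \<open>l r \<otimes> f\<close>, the terms \<open>T\<^sub>1\<close> and \<open>T\<^sub>2\<close>
  in which a leaf of \<open>l\<close> or \<open>r\<close> is replaced by a product of the other factor with a letter, and a further bracket
  rotates these cyclically: the leaf that carries the product becomes the leaf \<open>y\<^sub>0\<close> of an element whose root is
  this product.\<close>
lemma product_congruent:
  assumes l: "letters V S y g {0, 1, 2, 3}" and b: "b \<in> carrier (Op P 2)"
    and X: "X \<in> gen V S" and Y: "Y \<in> gen V S" and f: "f \<in> functionals V" and fy: "\<And>i. i \<in> {0, 1, 2, 3} \<Longrightarrow> f (y i) = \<zero>"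
  shows "ten V (bop V b X Y) f \<ominus>\<^bsub>Der R P V\<^esub> ten V (ten V (var V (y 0)) f (bop V b X Y)) (g 0) \<in> Lie V"
proof -
  let ?I = "{0, 1, 2, 3::nat}"
  note L = lettersD[OF l] and c = gen_closed[OF _ lettersD(1,2)[OF l]]
  note V = L(1)
  note A = module_alg[OF V] and D = module_Der[OF V]
  interpret A: module R "Al V" by (rule A)
  interpret D: module R "Der R P V" by (rule D)
  note li = submodule_facts[OF D submodule_Lie[OF V]]
  have t: "three ?I" "three (?I - {0})" "three (?I - {1})" "three (?I - {2})" unfolding three_def by (simp_all add: insert_Diff_if)
  have I: "0 \<in> ?I" "1 \<in> ?I" "2 \<in> ?I" by auto
  have Xc: "X \<in> carrier (Al V)" and Yc: "Y \<in> carrier (Al V)" using c X Y by auto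
  let ?y = "\<lambda>i. var V (y i)"
  have yc: "?y i \<in> carrier (Al V)" if "i \<in> ?I" for i using L(3)[OF that] by (rule var_closed[OF V])
  have y0: "?y 0 \<in> carrier (Al V)" "?y 1 \<in> carrier (Al V)" "?y 2 \<in> carrier (Al V)" by (simp_all add: yc)
  have g: "g 0 \<in> functionals V" "g 1 \<in> functionals V" "g 2 \<in> functionals V" by (simp_all add: L(4))
  let ?b = "bop V b"
  note bc = bop_closed[OF V b]
  have tD: "ten V x h \<in> carrier (Der R P V)" if "x \<in> carrier (Al V)" "h \<in> functionals V" for x h using ten_Der[OF V that] .
  have tc: "ten V x h z \<in> carrier (Al V)" if "x \<in> carrier (Al V)" "h \<in> functionals V" "z \<in> carrier (Al V)" for x h z
    using Der_closed[OF tD[OF that(1,2)] that(3)] .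
  have fz: "ten V x f (?y i) = \<zero>\<^bsub>Al V\<^esub>" if "x \<in> carrier (Al V)" "i \<in> ?I" for x i
    using that fy[OF that(2)] by (simp add: ten_var[OF V that(1) f L(3)])
  define T1 where "T1 = ten V (?b (?y 1) Y) f X"
  define T2 where "T2 = ten V (?b X (?y 2)) f Y"
  define C1 where "C1 = ?b (ten V (?y 0) f X) Y"
  define C2 where "C2 = ?b X (ten V (?y 0) f Y)"
  have Tc: "T1 \<in> carrier (Al V)" "T2 \<in> carrier (Al V)" "C1 \<in> carrier (Al V)" "C2 \<in> carrier (Al V)"
    unfolding T1_def T2_def C1_def C2_def using Xc Yc y0 f by (simp_all add: tc bc)
  \<comment> \<open>Substitute \<open>X\<close> and \<open>Y\<close> for the letters of \<open>y\<^sub>1 y\<^sub>2 \<otimes> f\<close>. The leaves of \<open>X\<close> and \<open>Y\<close> are not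
    killed by \<open>f\<close>, so the opposite substitutions contribute the two other terms.\<close>
  have E1: "ten V (?b X Y) f \<ominus>\<^bsub>Der R P V\<^esub> ten V T2 (g 2) \<ominus>\<^bsub>Der R P V\<^esub> ten V T1 (g 1) \<in> Lie V"
  proof -
    let ?p = "?b (?y 1) (?y 2)"
    have pc: "?p \<in> carrier (Al V)" using y0 by (simp add: bc)
    have x1: "ten V ?p f \<in> Lie V" using L(3) f by (intro ten_bop_var_Lie[OF V b]) auto
    have "ten V X (g 1) ?p = ?b X (?y 2)"
      unfolding Der_bop[OF V tD[OF Xc g(2)] b y0(2,3)]
      using ten_letter(1)[OF l I(2) Xc] ten_letter(2)[OF l I(2) Xc I(3)] y0 Xc bc
      by (simp add: bop_zero[OF V b])
    then have e1: "bracket R P V (ten V ?p f) (ten V X (g 1)) = ten V (?b X (?y 2)) f \<ominus>\<^bsub>Der R P V\<^esub> ten V (ten V ?p f X) (g 1)"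
      using bracket_ten[OF V pc Xc f g(2)] by simp
    let ?d = "ten V (?b X (?y 2)) f" and ?e = "ten V (ten V ?p f X) (g 1)" and ?n = "ten V Y (g 2)"
    have q: "?b X (?y 2) \<in> carrier (Al V)" "ten V ?p f X \<in> carrier (Al V)" using Xc y0 pc f by (simp_all add: bc tc)
    have B: "?d \<ominus>\<^bsub>Der R P V\<^esub> ?e \<in> Lie V" using Nrm_right[OF x1 gen_Nrm[OF l t(1) X I(2)]] e1 by simp
    have "bracket R P V (?d \<ominus>\<^bsub>Der R P V\<^esub> ?e) ?n = bracket R P V ?d ?n \<ominus>\<^bsub>Der R P V\<^esub> bracket R P V ?e ?n"
    proof -
      note dD = tD[OF q(1) f] and eD = tD[OF q(2) g(2)] and nD = tD[OF Yc g(3)]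
      note deD = mod_minus[OF D dD eD]
      have "bracket R P V ?n (?d \<ominus>\<^bsub>Der R P V\<^esub> ?e) = bracket R P V ?n ?d \<ominus>\<^bsub>Der R P V\<^esub> bracket R P V ?n ?e"
        by (rule lin_maps_diff[OF D D bracket_right_lin[OF V nD] dD eD])
      then show ?thesis
        unfolding bracket_antisym[OF V nD deD] bracket_antisym[OF V nD dD] bracket_antisym[OF V nD eD]
        using bracket_Der[OF V nD dD] bracket_Der[OF V nD eD] by (simp add: a_minus_def D.minus_add)
    qed
    also have "bracket R P V ?d ?n = ten V (?b X Y) f \<ominus>\<^bsub>Der R P V\<^esub> ten V T2 (g 2)"
    proof -
      have "ten V Y (g 2) (?b X (?y 2)) = ?b X Y"
        using ten_letter(1)[OF l I(3) Yc] ten_letter(4)[OF l I(3) Yc X] y0 Xc Yc bc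
        by (simp add: Der_bop[OF V tD[OF Yc g(3)] b] bop_zero[OF V b])
      then show ?thesis using bracket_ten[OF V q(1) Yc f g(3)] by (simp add: T2_def)
    qed
    also have "bracket R P V ?e ?n = ten V T1 (g 1)"
    proof -
      have "ten V Y (g 2) ?p = ?b (?y 1) Y"
        using ten_letter(1)[OF l I(3) Yc] ten_letter(2)[OF l I(3) Yc I(2)] y0 Yc bc
        by (simp add: Der_bop[OF V tD[OF Yc g(3)] b] bop_zero[OF V b])
      then have "ten V Y (g 2) (ten V ?p f X) = T1"
        using gen_insert[OF X V L(2) tD[OF Yc g(3)] ten_letter(3)[OF l I(3) Yc] pc f] by (simp add: T1_def)
      then show ?thesis
        using bracket_ten_simple[OF V q(2) Yc g(2) g(3) ten_letter(4)[OF l I(2) q(2) Y]] by simp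
    qed
    finally show ?thesis using Nrm_right[OF B gen_Nrm[OF l t(1) Y I(3)]] by simp
  qed
  have ins: "letters V (insert (y i) S) y g (?I - {i})" if "i \<in> ?I" for i using letters_insert[OF l that] .
  have sub: "S \<subseteq> insert (y i) S" for i by auto
  \<comment> \<open>Rotate \<open>T\<^sub>1\<close> and \<open>T\<^sub>2\<close>. The letter \<open>y\<^sub>0\<close> marks the leaf, and \<open>y\<^sub>1\<close>, respectively \<open>y\<^sub>2\<close>, the place of \<open>X\<close>,
    respectively \<open>Y\<close>, in the product. Each of the two bracketed derivations involves one letter as a variable, which leaves
    three letters for \<open>gen_Nrm\<close> and \<open>product_Lie\<close>.\<close>
  have R1: "ten V T1 (g 1) \<ominus>\<^bsub>Der R P V\<^esub> ten V C1 (g 0) \<in> Lie V"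
  proof -
    let ?u = "ten V (?y 0) f X" and ?w = "?b (?y 1) Y"
    have uc: "?u \<in> carrier (Al V)" "?w \<in> carrier (Al V)" using y0 f Xc Yc by (simp_all add: tc bc)
    have "?u \<in> gen V (insert (y 0) S)" using L(3) by (intro ten_gen[OF X V L(2) _ f]) simp
    then have p: "ten V ?u (g 1) \<in> Nrm V" by (intro gen_Nrm[OF ins[OF I(1)] t(2)]) auto
    have q: "ten V ?w (g 0) \<in> Lie V"
      by (rule product_Lie[OF ins[OF I(2)] t(3) _ b]) (auto intro: gen.gen_var gen_mono[OF Y])
    have "ten V ?w (g 0) ?u = T1"
      using gen_insert[OF X V L(2) tD[OF uc(2) g(1)] ten_letter(3)[OF l I(1) uc(2)] y0(1) f] ten_letter(1)[OF l I(1) uc(2)]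
      by (simp add: T1_def)
    moreover have "ten V ?u (g 1) ?w = C1"
      unfolding Der_bop[OF V tD[OF uc(1) g(2)] b y0(2) Yc]
      using ten_letter(1)[OF l I(2) uc(1)] ten_letter(4)[OF l I(2) uc(1) Y] y0 Yc uc bc
      by (simp add: bop_zero[OF V b] C1_def)
    ultimately show ?thesis using Nrm_left[OF V p q] bracket_ten[OF V uc g(2) g(1)] by simp
  qed
  have R2: "ten V T2 (g 2) \<ominus>\<^bsub>Der R P V\<^esub> ten V C2 (g 0) \<in> Lie V"
  proof -
    let ?u = "ten V (?y 0) f Y" and ?w = "?b X (?y 2)"
    have uc: "?u \<in> carrier (Al V)" "?w \<in> carrier (Al V)" using y0 f Xc Yc by (simp_all add: tc bc)
    have "?u \<in> gen V (insert (y 0) S)" using L(3) by (intro ten_gen[OF Y V L(2) _ f]) simp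
    then have p: "ten V ?u (g 2) \<in> Nrm V" by (intro gen_Nrm[OF ins[OF I(1)] t(2)]) auto
    have q: "ten V ?w (g 0) \<in> Lie V"
      by (rule product_Lie[OF ins[OF I(3)] t(4) _ b]) (auto intro: gen.gen_var gen_mono[OF X])
    have "ten V ?w (g 0) ?u = T2"
      using gen_insert[OF Y V L(2) tD[OF uc(2) g(1)] ten_letter(3)[OF l I(1) uc(2)] y0(1) f] ten_letter(1)[OF l I(1) uc(2)]
      by (simp add: T2_def)
    moreover have "ten V ?u (g 2) ?w = C2"
      using ten_letter(1)[OF l I(3) uc(1)] ten_letter(4)[OF l I(3) uc(1) X] y0 Xc uc bc
      by (simp add: Der_bop[OF V tD[OF uc(1) g(3)] b] bop_zero[OF V b] C2_def)
    ultimately show ?thesis using Nrm_left[OF V p q] bracket_ten[OF V uc g(3) g(1)] by simp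
  qed
  have "ten V (?y 0) f (?b X Y) = C1 \<oplus>\<^bsub>Al V\<^esub> C2"
    unfolding C1_def C2_def by (rule Der_bop[OF V tD[OF y0(1) f] b Xc Yc])
  then have fin: "ten V (ten V (?y 0) f (?b X Y)) (g 0) = ten V C1 (g 0) \<oplus>\<^bsub>Der R P V\<^esub> ten V C2 (g 0)"
    using lin_maps_add[OF ten_linear[OF V g(1)] Tc(3,4)] by simp
  have bXY: "?b X Y \<in> carrier (Al V)" using Xc Yc by (simp add: bc)
  show ?thesis
    unfolding fin
    using D.M.diff_cancel_two[OF tD[OF bXY f] tD[OF Tc(1) g(2)] tD[OF Tc(2) g(3)] tD[OF Tc(3) g(1)] tD[OF Tc(4) g(1)]] li(3)[OF E1 li(3)[OF R1 R2]]
    by simp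
qed

end

section \<open>Commutators of pointed derivations\<close>

lemma (in abelian_group) diff_telescope:
  assumes "x \<in> carrier G" "w \<in> carrier G" "z \<in> carrier G" "v \<in> carrier G"
  shows "(x \<ominus> w) \<ominus> (z \<ominus> w) \<oplus> (z \<ominus> v) = x \<ominus> v"
proof -
  have "(x \<ominus> w) \<ominus> (z \<ominus> w) = x \<ominus> z"
    unfolding minus_eq[of x w] minus_eq[of z w] using assms by (intro diff_add_cancel) simp_all
  then show ?thesis using assms by (simp add: minus_eq a_assoc r_neg1)
qed

context bin_operad
begin

abbreviation "Ptp V \<equiv> carrier (Der_pt_plus R P V)"

lemma Ptp_iff: "p \<in> Ptp V \<longleftrightarrow> p \<in> carrier (Der_pt R P V) \<and> p \<in> carrier (Der_plus R P (pt R V))"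
  by (simp add: Der_pt_plus_def)

lemma submodule_Ptp: "module R V \<Longrightarrow> submodule (Ptp V) R (Der R P (pt R V))"
  unfolding Der_pt_plus_def submod_simps
  by (rule submodule_Int[OF module_Der[OF module_pt] submodule_Der_pt submodule_Der_plus[OF module_pt]])

lemma module_Ptp: "module R V \<Longrightarrow> module R (Der_pt_plus R P V)"
  using module_submod[OF module_Der[OF module_pt] submodule_Ptp, of V] by (simp add: Der_pt_plus_def)

lemma Ptp_bracket:
  assumes V: "module R V" and db: "dual_basis V" and p: "p \<in> Ptp V" and q: "q \<in> Ptp V"
  shows "bracket R P (pt R V) p q \<in> Ptp V"
  using p q Der_pt_bracket[OF V] Der_plus_bracket[OF module_pt[OF V] dual_basis_pt[OF V db]] by (simp add: Ptp_iff)

lemma submodule_comm: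
  assumes V: "module R V" and db: "dual_basis V"
  shows "submodule (Der_pt_comm R P V) R (Der_pt_plus R P V)"
  unfolding Der_pt_comm_def by (rule submodule_mspan[OF module_Ptp[OF V]]) (auto intro: Ptp_bracket[OF V db])

lemma comm_into:
  assumes V: "module R V" and db: "dual_basis V" and N: "module R N"
    and T: "T \<in> lin_maps R (Der R P (pt R V)) N" and H: "submodule H R N"
    and br: "\<And>p q. p \<in> Ptp V \<Longrightarrow> q \<in> Ptp V \<Longrightarrow> T (bracket R P (pt R V) p q) \<in> H"
    and c: "c \<in> Der_pt_comm R P V"
  shows "T c \<in> H"
proof (rule lin_maps_mspan_into[OF module_Ptp[OF V] N _ _ H _ c[unfolded Der_pt_comm_def]])
  have s: "Ptp V \<subseteq> carrier (Der R P (pt R V))"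
    by (rule submodule_facts(1)[OF module_Der[OF module_pt[OF V]] submodule_Ptp[OF V]])
  have "T \<in> lin_maps R (submod (Der R P (pt R V)) (Ptp V)) (submod N (carrier N))"
    by (rule lin_maps_submod[OF T s]) (use lin_maps_closed[OF T] s in auto)
  then show "T \<in> lin_maps R (Der_pt_plus R P V) N" by (simp add: Der_pt_plus_def submod_def)
qed (auto intro: Ptp_bracket[OF V db] br)

lemma Ptp_dec:
  assumes V: "module R V" and db: "dual_basis V" and p: "p \<in> Ptp V"
  shows "p \<in> carrier (Der_pt R P V)" "p \<in> carrier (Der R P (pt R V))" "p (base V) \<in> Lin V" "p (base V) \<in> dec (pt R V)"
proof -
  show P: "p \<in> carrier (Der_pt R P V)" using p by (simp add: Ptp_iff)
  then show "p \<in> carrier (Der R P (pt R V))" "p (base V) \<in> Lin V" by (rule Der_ptD[OF V])+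
  show "p (base V) \<in> dec (pt R V)"
    using p mod_zero[OF V] by (simp add: Ptp_iff Der_plus_iff[OF module_pt[OF V] dual_basis_pt[OF V db]])
qed

lemma Der_map_Ptp:
  assumes V: "module R V" and W: "module R W" and f: "f \<in> SR_hom R V W" and p: "p \<in> Ptp V"
  shows "Der_map R P (pt R V) (pt R W) (ptm f) p \<in> Ptp W"
  using p Der_map_pt[OF V W f] Der_map_plus[OF module_pt[OF V] module_pt[OF W] ptm_hom[OF f]] by (simp add: Ptp_iff)

lemma Der_map_comm:
  assumes V: "module R V" and W: "module R W" and dV: "dual_basis V" and dW: "dual_basis W"
    and f: "f \<in> SR_hom R V W" and c: "c \<in> Der_pt_comm R P V"
  shows "Der_map R P (pt R V) (pt R W) (ptm f) c \<in> Der_pt_comm R P W"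
proof (rule comm_into[OF V dV module_Der[OF module_pt[OF W]] Der_map_lin[OF module_pt[OF V] module_pt[OF W] ptm_hom[OF f]] _ _ c])
  show "submodule (Der_pt_comm R P W) R (Der R P (pt R W))"
    by (rule submodule_submodD[OF module_Der[OF module_pt[OF W]] submodule_Ptp[OF W]])
      (use submodule_comm[OF W dW] in \<open>simp add: Der_pt_plus_def\<close>)
  fix p q assume pq: "p \<in> Ptp V" "q \<in> Ptp V"
  show "Der_map R P (pt R V) (pt R W) (ptm f) (bracket R P (pt R V) p q) \<in> Der_pt_comm R P W"
    unfolding Der_map_bracket[OF module_pt[OF V] module_pt[OF W] ptm_hom[OF f] Ptp_dec(2)[OF V dV pq(1)] Ptp_dec(2)[OF V dV pq(2)]]
    unfolding Der_pt_comm_def using Der_map_Ptp[OF V W f] pq by (intro mspan_memI) blast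
qed

end

text \<open>The setting of both torsion statements, where \<open>W\<close> is \<open>V \<oplus> R\<^sup>n\<close> and the letters form the standard basis of
  the new summand.\<close>
locale fresh_letters = bin_operad R P for R :: "'r ring" (structure) and P :: "('r, 'o) operad" +
  fixes V :: "('r, 'v) module" and W :: "('r, 'w) module" and f :: "('v \<Rightarrow> 'w) \<times> ('w \<Rightarrow> 'v)"
    and y :: "nat \<Rightarrow> 'w" and g :: "nat \<Rightarrow> 'w \<Rightarrow> 'r" and I :: "nat set"
  assumes V: "module R V" and f: "f \<in> SR_hom R V W" and l: "letters W (fst f ` carrier V) y g I"
begin

abbreviation "O\<^sub>i \<equiv> fa_map R P W (fst f)"

text \<open>The substitution of the letter \<open>y\<^sub>a\<close> for the base point.\<close>
definition s :: "nat \<Rightarrow> ('r, 'o, 'r \<times> 'v) fa \<Rightarrow> ('r, 'o, 'w) fa" where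
  "s a = fa_map R P W (\<lambda>u. fst f (snd u) \<oplus>\<^bsub>W\<^esub> fst u \<odot>\<^bsub>W\<^esub> y a)"

lemmas W = lettersD(1)[OF l] and F = SR_homD[OF f] and y_closed = lettersD(3)[OF l] and g_functional = lettersD(4)[OF l]
lemmas pV = module_pt[OF V] and pW = module_pt[OF W]
lemmas Oi_lin = fa_map_lin[OF V W F(1)] and Oi_closed = fa_map_closed[OF V W F(1)] and Oi_bop = fa_map_bop[OF V W F(1)]

lemma subst_lin:
  assumes a: "a \<in> I"
  shows "(\<lambda>u. fst f (snd u) \<oplus>\<^bsub>W\<^esub> fst u \<odot>\<^bsub>W\<^esub> y a) \<in> lin_maps R (pt R V) W"
proof -
  interpret W: module R W by (rule W)
  have "(\<lambda>u. fst u \<odot>\<^bsub>W\<^esub> y a) \<in> lin_maps R (pt R V) W"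
    by (rule lin_mapsI) (auto simp: y_closed[OF a] W.smult_l_distr W.smult_assoc1)
  from lin_maps_plus[OF W lin_maps_comp[OF lin_snd F(1)] this] show ?thesis .
qed

lemma s_facts:
  assumes a: "a \<in> I"
  shows s_lin: "s a \<in> lin_maps R (Al (pt R V)) (Al W)"
    and s_bop: "\<And>b X Y. b \<in> carrier (Op P 2) \<Longrightarrow> X \<in> carrier (Al (pt R V)) \<Longrightarrow> Y \<in> carrier (Al (pt R V)) \<Longrightarrow>
      s a (bop (pt R V) b X Y) = bop W b (s a X) (s a Y)"
    and s_lft: "\<And>X. X \<in> carrier (Al V) \<Longrightarrow> s a (lft V X) = O\<^sub>i X"
    and s_base: "s a (base V) = var W (y a)"
    and s_gen: "\<And>X. X \<in> carrier (Al (pt R V)) \<Longrightarrow> s a X \<in> gen W (insert (y a) (fst f ` carrier V))"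
    and s_dec: "\<And>X. X \<in> dec (pt R V) \<Longrightarrow> s a X \<in> dec W"
proof -
  interpret W: module R W by (rule W)
  interpret AW: module R "Al W" by (rule module_alg[OF W])
  note h = subst_lin[OF a] and yc = y_closed[OF a]
  show "s a \<in> lin_maps R (Al (pt R V)) (Al W)" unfolding s_def by (rule fa_map_lin[OF pV W h])
  show "s a (bop (pt R V) b X Y) = bop W b (s a X) (s a Y)"
    if "b \<in> carrier (Op P 2)" "X \<in> carrier (Al (pt R V))" "Y \<in> carrier (Al (pt R V))" for b X Y
    unfolding s_def by (rule fa_map_bop[OF pV W h that])
  show "s a (lft V X) = O\<^sub>i X" if "X \<in> carrier (Al V)" for X
    unfolding s_def by (rule fa_map_comp[OF V pV W lin_zero_pair[OF V] h F(1) _ that]) (use yc lin_maps_closed[OF F(1)] in simp)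
  show "s a (base V) = var W (y a)"
    unfolding s_def using fa_map_var[OF pV W h, of "(\<one>, \<zero>\<^bsub>V\<^esub>)"] mod_zero[OF V] lin_maps_zero[OF V W F(1)] yc by simp
  show "s a X \<in> dec W" if "X \<in> dec (pt R V)" for X
    unfolding s_def by (rule fa_map_dec[OF pV W h that])
  show "s a X \<in> gen W (insert (y a) (fst f ` carrier V))" if X: "X \<in> carrier (Al (pt R V))" for X
    unfolding s_def
  proof (rule fa_map_gen[OF pV W h _ X])
    fix u assume u: "u \<in> carrier (pt R V)"
    then have "var W (fst f (snd u) \<oplus>\<^bsub>W\<^esub> fst u \<odot>\<^bsub>W\<^esub> y a) = var W (fst f (snd u)) \<oplus>\<^bsub>Al W\<^esub> fst u \<odot>\<^bsub>Al W\<^esub> var W (y a)"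
      using yc lin_maps_closed[OF F(1)] by (simp add: lin_maps_add[OF var_lin[OF W]] lin_maps_smult[OF var_lin[OF W]] mem_Times_iff)
    then show "var W (fst f (snd u) \<oplus>\<^bsub>W\<^esub> fst u \<odot>\<^bsub>W\<^esub> y a) \<in> gen W (insert (y a) (fst f ` carrier V))"
      using u by (auto intro!: gen_add gen_smult gen_var)
  qed
qed

lemma s_closed: "a \<in> I \<Longrightarrow> X \<in> carrier (Al (pt R V)) \<Longrightarrow> s a X \<in> carrier (Al W)"
  by (rule lin_maps_closed[OF s_lin])

lemma Oi_gen: "X \<in> carrier (Al V) \<Longrightarrow> O\<^sub>i X \<in> gen W (fst f ` carrier V)"
  by (rule fa_map_gen[OF V W F(1)]) (auto intro: gen_var)

text \<open>For \<open>m\<close> linear in the base point, \<open>s\<^sub>b m\<close> contains \<open>y\<^sub>b\<close> exactly once, and the left-hand side replaces it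
  by \<open>s\<^sub>a q(\<star>)\<close>. This is how \<open>q\<close> acts at the marked leaf, with the marked leaf of the result named \<open>y\<^sub>a\<close>.\<close>
lemma s_transport:
  assumes a: "a \<in> I" and b: "b \<in> I" and q: "q \<in> carrier (Der_pt R P V)" and m: "m \<in> Lin V"
  shows "ten W (s a (q (base V))) (g b) (s b m) = s a (q m)"
proof -
  let ?x = "s a (q (base V))"
  note Q = Der_ptD[OF V q] and Lc = Lin_sub[OF V]
  have x: "?x \<in> carrier (Al W)" by (rule s_closed[OF a Lc[OF Q(3)]])
  note tD = ten_Der[OF W x g_functional[OF b]] and ql = Der_lin[OF Q(1)]
  note tl = Der_lin[OF tD] and sa = s_lin[OF a] and sb = s_lin[OF b] and sc = s_closed[OF a] s_closed[OF b]
  have k: "ten W ?x (g b) (O\<^sub>i X) = \<zero>\<^bsub>Al W\<^esub>" if "X \<in> carrier (Al V)" for X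
    by (rule ten_letter(4)[OF l b x Oi_gen[OF that]])
  have qc: "q z \<in> carrier (Al (pt R V))" if "z \<in> carrier (Al (pt R V))" for z using lin_maps_closed[OF ql that] .
  have tc: "ten W ?x (g b) z \<in> carrier (Al W)" if "z \<in> carrier (Al W)" for z using lin_maps_closed[OF tl that] .
  interpret AW: module R "Al W" by (rule module_alg[OF W])
  show ?thesis
    using V m
  proof (induction rule: Lin_induct)
    case base
    show ?case unfolding s_base[OF b] by (rule ten_letter(1)[OF l b x])
  next
    case (add z z')
    then show ?case
      by (simp add: Lc lin_maps_add[OF ql] lin_maps_add[OF sa] lin_maps_add[OF sb] lin_maps_add[OF tl] sc qc)
  next
    case (smult c z)
    then show ?case
      by (simp add: Lc lin_maps_smult[OF ql] lin_maps_smult[OF sa] lin_maps_smult[OF sb] lin_maps_smult[OF tl] sc qc)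
  next
    case (left o1 z X)
    note z = Lc[OF left(2)] and lX = lft_closed[OF V left(3)]
    show ?case
      unfolding Der_pt_left_right(1)[OF V q left(1) z left(3)] s_bop[OF b left(1) z lX] s_bop[OF a left(1) qc[OF z] lX]
        s_lft[OF a left(3)] s_lft[OF b left(3)] Der_bop[OF W tD left(1) s_closed[OF b z] Oi_closed[OF left(3)]] left(4) k[OF left(3)]
      using left(1,3) z by (simp add: bop_zero[OF W] sc qc bop_closed[OF W] Oi_closed)
  next
    case (right o1 z X)
    note z = Lc[OF right(2)] and lX = lft_closed[OF V right(3)]
    show ?case
      unfolding Der_pt_left_right(2)[OF V q right(1) z right(3)] s_bop[OF b right(1) lX z] s_bop[OF a right(1) lX qc[OF z]]
        s_lft[OF a right(3)] s_lft[OF b right(3)] Der_bop[OF W tD right(1) Oi_closed[OF right(3)] s_closed[OF b z]] right(4) k[OF right(3)]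
      using right(1,3) z by (simp add: bop_zero[OF W] sc qc bop_closed[OF W] Oi_closed)
  qed
qed

text \<open>The derivation along \<open>g\<^sub>a\<close> that lifts the pointed derivation with value \<open>X\<close> at the base point.\<close>
definition U :: "nat \<Rightarrow> ('r, 'o, 'r \<times> 'v) fa \<Rightarrow> ('r, 'o, 'w) fa \<Rightarrow> ('r, 'o, 'w) fa" where
  "U a X = ten W (s a X) (g a)"

lemma U_lin: "a \<in> I \<Longrightarrow> U a \<in> lin_maps R (Al (pt R V)) (Der R P W)"
  unfolding U_def by (rule lin_maps_comp[OF s_lin ten_linear[OF W g_functional]])

text \<open>Contraction marks the leaves \<open>v\<close> with coefficient \<open>\<phi>(v)\<close>; here the mark is \<open>y\<^sub>a\<close>.\<close>
lemma s_contr: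
  assumes a: "a \<in> I" and \<phi>: "\<phi> \<in> functionals V" and X: "X \<in> carrier (Al V)"
  shows "s a (contr V \<phi> X) = ten W (var W (y a)) (\<lambda>w. \<phi> (snd f w)) (O\<^sub>i X)"
proof -
  have \<phi>': "(\<lambda>w. \<phi> (snd f w)) \<in> functionals W" by (rule lin_maps_comp[OF F(2) \<phi>])
  have yv: "var W (y a) \<in> carrier (Al W)" by (rule var_closed[OF W y_closed[OF a]])
  note tD = ten_Der[OF W yv \<phi>']
  note tl = Der_lin[OF tD] and sl = s_lin[OF a] and cl = contr_lin[OF V \<phi>] and cc = contr_closed[OF V \<phi>]
  show ?thesis
    using V X
  proof (induction rule: alg_induct)
    case (var v)
    have "fst f v \<in> carrier W" using lin_maps_closed[OF F(1) var] .
    then show ?case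
      using F(3)[OF var] functional_closed[OF \<phi> var]
      by (simp add: contr_var[OF V \<phi> var] fa_map_var[OF V W F(1) var] ten_var[OF W yv \<phi>'] lin_maps_smult[OF sl _ base_closed[OF V]] s_base[OF a])
  next
    case (add X Y)
    then show ?case by (simp add: lin_maps_add[OF cl] lin_maps_add[OF sl] lin_maps_add[OF tl] lin_maps_add[OF Oi_lin] cc Oi_closed)
  next
    case (smult c X)
    then show ?case by (simp add: lin_maps_smult[OF cl] lin_maps_smult[OF sl] lin_maps_smult[OF tl] lin_maps_smult[OF Oi_lin] cc Oi_closed)
  next
    case (bop b X Y)
    then show ?case
      by (simp add: contr_bop[OF V \<phi>] lin_maps_add[OF sl] bop_closed[OF pV] cc lft_closed[OF V] s_bop[OF a] s_lft[OF a]
        Oi_bop Der_bop[OF W tD] Oi_closed)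
  qed
qed

text \<open>Contracting along \<open>g\<^sub>a\<close> finds the single occurrence of \<open>y\<^sub>a\<close> and turns it back into the base point.\<close>
lemma contr_s:
  assumes a: "a \<in> I" and m: "m \<in> Lin V"
  shows "contr W (g a) (s a m) = fa_map R P (pt R W) (map_prod id (fst f)) m"
proof -
  define h where "h = map_prod (id :: 'r \<Rightarrow> 'r) (fst f)"
  note ga = g_functional[OF a]
  note C = contr_lin[OF W ga] and cc = contr_closed[OF W ga] and sl = s_lin[OF a] and sc = s_closed[OF a] and Lc = Lin_sub[OF V]
  note PF = SR_homD(1)[OF ptm_hom[OF f], unfolded fst_conv, folded h_def]
  note hl = fa_map_lin[OF pV pW PF] and hb = fa_map_bop[OF pV pW PF] and hc = fa_map_closed[OF pV pW PF]
  interpret AW: module R "Al (pt R W)" by (rule module_alg[OF pW])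
  have z: "contr W (g a) (O\<^sub>i X) = \<zero>\<^bsub>Al (pt R W)\<^esub>" if "X \<in> carrier (Al V)" for X
    using V that
  proof (induction rule: alg_induct)
    case (var v)
    then show ?case
      using lettersD(6)[OF l a, of "fst f v"] lin_maps_closed[OF F(1) var] base_closed[OF W]
      by (simp add: fa_map_var[OF V W F(1)] contr_var[OF W ga] del: var_point)
  next
    case (add X Y)
    then show ?case by (simp add: lin_maps_add[OF Oi_lin] lin_maps_add[OF C] Oi_closed)
  next
    case (smult c X)
    then show ?case by (simp add: lin_maps_smult[OF Oi_lin] lin_maps_smult[OF C] Oi_closed)
  next
    case (bop b X Y)
    then show ?case by (simp add: Oi_bop contr_bop[OF W ga] Oi_closed bop_zero[OF pW] lft_closed[OF W])
  qed
  show ?thesis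
    unfolding h_def[symmetric] using V m
  proof (induction rule: Lin_induct)
    case base
    show ?case
      unfolding ptm_base[OF V W f, folded h_def] s_base[OF a] contr_var[OF W ga y_closed[OF a]] lettersD(5)[OF l a]
      by (rule AW.smult_one[OF base_closed[OF W]])
  next
    case (add x z)
    then show ?case by (simp add: Lc lin_maps_add[OF sl] lin_maps_add[OF C] lin_maps_add[OF hl] sc)
  next
    case (smult c x)
    then show ?case by (simp add: Lc lin_maps_smult[OF sl] lin_maps_smult[OF C] lin_maps_smult[OF hl] sc)
  next
    case (left b x X)
    note x = Lc[OF left(2)] and lX = lft_closed[OF V left(3)]
    show ?case
      unfolding s_bop[OF a left(1) x lX] s_lft[OF a left(3)] hb[OF left(1) x lX] ptm_lft[OF V W f left(3), folded h_def]
        contr_bop[OF W ga left(1) sc[OF x] Oi_closed[OF left(3)]] left(4) z[OF left(3)]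
      using left(1,3) x by (simp add: bop_zero[OF pW] bop_closed[OF pW] hc lft_closed[OF W] sc Oi_closed)
  next
    case (right b x X)
    note x = Lc[OF right(2)] and lX = lft_closed[OF V right(3)]
    show ?case
      unfolding s_bop[OF a right(1) lX x] s_lft[OF a right(3)] hb[OF right(1) lX x] ptm_lft[OF V W f right(3), folded h_def]
        contr_bop[OF W ga right(1) Oi_closed[OF right(3)] sc[OF x]] right(4) z[OF right(3)]
      using right(1,3) x by (simp add: bop_zero[OF pW] bop_closed[OF pW] hc lft_closed[OF W] sc Oi_closed)
  qed
qed

lemma Phi_lift:
  assumes dV: "dual_basis V" and dW: "dual_basis W" and a: "a \<in> I" and p: "p \<in> Ptp V"
  shows "U a (p (base V)) \<in> carrier (Der_plus R P W)"
    and "Phi R P W (U a (p (base V))) = Der_map R P (pt R V) (pt R W) (ptm f) p"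
proof -
  note D = Ptp_dec[OF V dV p] and ga = g_functional[OF a]
  have x: "s a (p (base V)) \<in> carrier (Al W)" by (rule s_closed[OF a Lin_sub[OF V D(3)]])
  show "U a (p (base V)) \<in> carrier (Der_plus R P W)"
    unfolding U_def Der_plus_iff[OF W dW]
  proof (intro conjI ballI ten_Der[OF W x ga])
    fix w assume w: "w \<in> carrier W"
    show "ten W (s a (p (base V))) (g a) (var W w) \<in> dec W"
      unfolding ten_var[OF W x ga w]
      by (rule submodule_facts(4)[OF module_alg[OF W] submodule_dec[OF W] functional_closed[OF ga w] s_dec[OF a D(4)]])
  qed
  have b: "(\<one>, \<zero>\<^bsub>W\<^esub>) \<in> carrier (pt R W)" using mod_zero[OF W] by simp
  have "Der_map R P (pt R V) (pt R W) (ptm f) p (base W) = fa_map R P (pt R W) (map_prod id (fst f)) (p (base V))"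
    using Der_map_var[OF pV pW ptm_hom[OF f] D(2) b] unfolding fst_conv snd_conv map_prod_simp id_apply lin_maps_zero[OF W V F(2)] .
  then show "Phi R P W (U a (p (base V))) = Der_map R P (pt R V) (pt R W) (ptm f) p"
    unfolding U_def Phi_ten[OF W dW x ga] contr_s[OF a D(3)]
    using Der_pt_eq[OF W Der_map_pt[OF V W f D(1)]] by simp
qed

end

text \<open>Four letters: \<open>mixed_Lie\<close> uses one as a variable and then has to leave three for \<open>product_Lie\<close>. The
  letters are killed by \<open>r\<close>, so that functionals pulled back from \<open>V\<close> vanish on them.\<close>
locale four_letters = fresh_letters R P V W f y g "{0, 1, 2, 3}"
  for R :: "'r ring" (structure) and P :: "('r, 'o) operad" and V :: "('r, 'v) module" and W :: "('r, 'w) module" and f y g +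
  assumes r_letter: "\<And>i. i \<in> {0, 1, 2, 3} \<Longrightarrow> snd f (y i) = \<zero>\<^bsub>V\<^esub>" and dV: "dual_basis V"
begin

lemma mixed_Lie:
  assumes a: "a \<in> {0, 1, 2, 3}" and b: "b \<in> {0, 1, 2, 3}" and ab: "a \<noteq> b" and X: "X \<in> dec (pt R V)"
  shows "ten W (s a X) (g b) \<in> Lie W"
proof (rule dec_into[OF pV module_Der[OF W] lin_maps_comp[OF s_lin[OF a] ten_linear[OF W g_functional[OF b]]] submodule_Lie[OF W] _ X])
  fix o1 X Y assume o1: "o1 \<in> carrier (Op P 2)" and X: "X \<in> carrier (Al (pt R V))" and Y: "Y \<in> carrier (Al (pt R V))"
  have t: "three ({0, 1, 2, 3} - {a})"
    using a by (auto simp: insert_Diff_if intro!: three_distinct)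
  show "ten W (s a (bop (pt R V) o1 X Y)) (g b) \<in> Lie W"
    unfolding s_bop[OF a o1 X Y]
    by (rule product_Lie[OF letters_insert[OF l a] t _ o1 s_gen[OF a X] s_gen[OF a Y]]) (use b ab in auto)
qed

text \<open>The two substitutions in the bracket compose the pointed derivations in opposite orders, and each names
  the remaining marked leaf by a different letter.\<close>
lemma swap_Lie:
  assumes a: "a \<in> {0, 1, 2, 3}" and b: "b \<in> {0, 1, 2, 3}" and ab: "a \<noteq> b" and p: "p \<in> Ptp V" and q: "q \<in> Ptp V"
  shows "U a (q (p (base V))) \<ominus>\<^bsub>Der R P W\<^esub> U b (p (q (base V))) \<in> Lie W"
proof -
  note p' = Ptp_dec[OF V dV p] and q' = Ptp_dec[OF V dV q]
  note x = s_closed[OF b Lin_sub[OF V p'(3)]] and x' = s_closed[OF a Lin_sub[OF V q'(3)]]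
  have "bracket R P W (ten W (s b (p (base V))) (g a)) (ten W (s a (q (base V))) (g b)) \<in> Lie W"
    using ab by (intro Lie_bracket[OF W] mixed_Lie[OF b a _ p'(4)] mixed_Lie[OF a b _ q'(4)]) auto
  then show ?thesis
    unfolding bracket_ten[OF W x x' g_functional[OF a] g_functional[OF b]] s_transport[OF a b q'(1) p'(3)] s_transport[OF b a p'(1) q'(3)]
    by (simp add: U_def)
qed

text \<open>Put \<open>A = q(p(\<star>))\<close> and \<open>B = p(q(\<star>))\<close>. Modulo the Lie algebra, \<open>swap_Lie\<close> turns \<open>U\<^sub>0 A\<close> into \<open>U\<^sub>1 B\<close>, this
  into \<open>U\<^sub>2 A\<close>, and this into \<open>U\<^sub>0 B\<close>: a closed walk of odd length on the letters \<open>0, 1, 2\<close>.\<close>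
lemma commutator_Lie:
  assumes p: "p \<in> Ptp V" and q: "q \<in> Ptp V"
  shows "U 0 (bracket R P (pt R V) p q (base V)) \<in> Lie W"
proof -
  interpret D: module R "Der R P W" by (rule module_Der[OF W])
  note p' = Ptp_dec[OF V dV p] and q' = Ptp_dec[OF V dV q]
  let ?A = "q (p (base V))" and ?B = "p (q (base V))"
  have c: "?A \<in> carrier (Al (pt R V))" "?B \<in> carrier (Al (pt R V))"
    using Der_closed[OF q'(2)] Der_closed[OF p'(2)] Lin_sub[OF V p'(3)] Lin_sub[OF V q'(3)] by simp_all
  have u: "U i x \<in> carrier (Der R P W)" if "i \<in> {0, 1, 2, 3}" "x \<in> carrier (Al (pt R V))" for i x
    using lin_maps_closed[OF U_lin[OF that(1)] that(2)] .
  note uc = u[OF _ c(1)] u[OF _ c(2)]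
  note sl = submodule_facts[OF module_Der[OF W] submodule_Lie[OF W]]
  have 1: "U 0 ?A \<ominus>\<^bsub>Der R P W\<^esub> U 1 ?B \<in> Lie W" and 2: "U 2 ?A \<ominus>\<^bsub>Der R P W\<^esub> U 1 ?B \<in> Lie W"
    and 3: "U 2 ?A \<ominus>\<^bsub>Der R P W\<^esub> U 0 ?B \<in> Lie W"
    by (rule swap_Lie[OF _ _ _ p q]; simp)+
  have "(U 0 ?A \<ominus>\<^bsub>Der R P W\<^esub> U 1 ?B) \<ominus>\<^bsub>Der R P W\<^esub> (U 2 ?A \<ominus>\<^bsub>Der R P W\<^esub> U 1 ?B) \<oplus>\<^bsub>Der R P W\<^esub> (U 2 ?A \<ominus>\<^bsub>Der R P W\<^esub> U 0 ?B)
      = U 0 ?A \<ominus>\<^bsub>Der R P W\<^esub> U 0 ?B"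
    using D.diff_telescope uc[of 0] uc[of 1] uc[of 2] by simp
  moreover have "\<dots> = U 0 (bracket R P (pt R V) p q (base V))"
    unfolding bracket_apply[OF pV p'(2) q'(2) base_closed[OF V]]
    by (rule lin_maps_diff[OF module_alg[OF pV] module_Der[OF W] U_lin c, symmetric]) simp
  ultimately show ?thesis using sl(3)[OF sl(5)[OF 1 2] 3] by simp
qed

lemma comm_Lie:
  assumes c: "c \<in> Der_pt_comm R P V"
  shows "U 0 (c (base V)) \<in> Lie W"
  by (rule comm_into[OF V dV module_Der[OF W] lin_maps_comp[OF Der_eval[OF base_closed[OF V]] U_lin] submodule_Lie[OF W] commutator_Lie c]) simp

text \<open>On an elementary derivation with decomposable first factor this is \<open>product_congruent\<close> along the
  functional \<open>\<phi> \<circ> r\<close>, by the description of contractions in \<open>s_contr\<close>; elementary derivations suffice since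
  everything is linear.\<close>
lemma congruent_Phi:
  assumes d: "d \<in> carrier (Der_plus R P V)"
  shows "Der_map R P V W f d \<ominus>\<^bsub>Der R P W\<^esub> U 0 (Phi R P V d (base V)) \<in> Lie W"
proof -
  let ?T = "\<lambda>d. Der_map R P V W f d \<ominus>\<^bsub>Der R P W\<^esub> U 0 (Phi R P V d (base V))"
  have i0: "0 \<in> {0, 1, 2, 3 :: nat}" by simp
  note DV = module_Der[OF V] and DW = module_Der[OF W]
  have T: "?T \<in> lin_maps R (Der R P V) (Der R P W)"
    by (rule lin_maps_minus[OF DW Der_map_lin[OF V W f] lin_maps_comp[OF lin_maps_comp[OF Phi_lin[OF V dV] Der_eval[OF base_closed[OF V]]] U_lin[OF i0]]])
  note H = submodule_preimage[OF DV DW T submodule_Lie[OF W]]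
  have "d \<in> {d \<in> carrier (Der R P V). ?T d \<in> Lie W}"
  proof (rule Der_in_submodule[OF V dV H Der_plus_sub[OF V d]])
    fix v \<phi> assume v: "v \<in> carrier V" and \<phi>: "\<phi> \<in> functionals V"
    have dv: "d (var V v) \<in> dec V" using d v by (simp add: Der_plus_iff[OF V dV])
    show "ten V (d (var V v)) \<phi> \<in> {d \<in> carrier (Der R P V). ?T d \<in> Lie W}"
    proof (rule dec_into[OF V DV ten_linear[OF V \<phi>] H _ dv])
      fix b X Y assume b: "b \<in> carrier (Op P 2)" and X: "X \<in> carrier (Al V)" and Y: "Y \<in> carrier (Al V)"
      note xc = bop_closed[OF V b X Y]
      have \<phi>': "(\<lambda>w. \<phi> (snd f w)) \<in> functionals W" by (rule lin_maps_comp[OF F(2) \<phi>])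
      have z: "\<phi> (snd f (y i)) = \<zero>" if "i \<in> {0, 1, 2, 3}" for i
        using r_letter[OF that] lin_maps_zero[OF V module_self \<phi>] by simp
      have "?T (ten V (bop V b X Y) \<phi>) = ten W (bop W b (O\<^sub>i X) (O\<^sub>i Y)) (\<lambda>w. \<phi> (snd f w)) \<ominus>\<^bsub>Der R P W\<^esub>
          ten W (ten W (var W (y 0)) (\<lambda>w. \<phi> (snd f w)) (bop W b (O\<^sub>i X) (O\<^sub>i Y))) (g 0)"
        unfolding Der_map_ten[OF V W f xc \<phi>] Phi_ten[OF V dV xc \<phi>] Der_pt_ten(2)[OF V contr_Lin[OF V \<phi> xc]] U_def s_contr[OF i0 \<phi> xc] Oi_bop[OF b X Y] ..
      then show "ten V (bop V b X Y) \<phi> \<in> {d \<in> carrier (Der R P V). ?T d \<in> Lie W}"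
        using product_congruent[OF l b Oi_gen[OF X] Oi_gen[OF Y] \<phi>' z] ten_Der[OF V xc \<phi>] by simp
    qed
  qed
  then show ?thesis by simp
qed

theorem Der_map_into_Lie:
  assumes d: "d \<in> carrier (Der_plus R P V)" and c: "Phi R P V d \<in> Der_pt_comm R P V"
  shows "Der_map R P V W f d \<in> Lie W"
proof -
  interpret D: module R "Der R P W" by (rule module_Der[OF W])
  note u = lin_maps_closed[OF U_lin Lin_sub[OF V Der_ptD(3)[OF V Phi_pt[OF V dV Der_plus_sub[OF V d]]]], of 0]
  note m = Der_map_Der[OF V W f Der_plus_sub[OF V d]]
  have "(Der_map R P V W f d \<ominus>\<^bsub>Der R P W\<^esub> U 0 (Phi R P V d (base V))) \<oplus>\<^bsub>Der R P W\<^esub> U 0 (Phi R P V d (base V)) = Der_map R P V W f d"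
    using u m by (simp add: D.minus_eq D.a_assoc D.l_neg)
  then show ?thesis
    using submodule_facts(3)[OF module_Der[OF W] submodule_Lie[OF W] congruent_Phi[OF d] comm_Lie[OF c]] by simp
qed

end

section \<open>The sequence of functors on \<open>S(R)\<close>\<close>

context ground_ring
begin

lemma SR_incl_hom: "module R V \<Longrightarrow> SR_incl R n \<in> SR_hom R V (dsum V (power_module R n))"
  unfolding SR_incl_def SR_hom_def using lin_inl[OF module_power[of n], of V] lin_fst[of V "power_module R n"] by simp

end

context bin_operad
begin

text \<open>The standard basis of the new summand and its coordinates.\<close>
lemma letters_power:
  assumes V: "module R V"
  shows "letters (dsum V (power_module R n)) (fst (SR_incl R n) ` carrier V)
    (\<lambda>a. (\<zero>\<^bsub>V\<^esub>, \<lambda>i\<in>{..<n}. if i = a then \<one> else \<zero>)) (\<lambda>a u. snd u a) {..<n}"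
proof -
  have pr: "(\<lambda>x. x a) \<in> functionals (power_module R n)" if "a < n" for a
    using that by (intro lin_mapsI) (auto simp: PiE_mem)
  show ?thesis
    unfolding letters_def
  proof (intro conjI ballI impI)
    show "fst (SR_incl R n) ` carrier V \<subseteq> carrier (dsum V (power_module R n))"
      using lin_maps_closed[OF SR_homD(1)[OF SR_incl_hom[OF V]]] by blast
    fix a assume a: "a \<in> {..<n}"
    show "(\<zero>\<^bsub>V\<^esub>, \<lambda>i\<in>{..<n}. if i = a then \<one> else \<zero>) \<in> carrier (dsum V (power_module R n))"
      using mod_zero[OF V] by auto
    show "(\<lambda>u. snd u a) \<in> functionals (dsum V (power_module R n))"
      using a by (intro lin_maps_comp[OF lin_snd pr]) simp
  qed (auto simp: SR_incl_def module_dsum[OF V module_power])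
qed

lemma letters_subset: "letters V S y g I \<Longrightarrow> J \<subseteq> I \<Longrightarrow> letters V S y g J"
  unfolding letters_def by (meson subsetD)

lemma Der_plus_submod: "Der_plus R P V = submod (Der R P V) (carrier (Der_plus R P V))"
  and Der_Lie_submod: "Der_Lie R P V = submod (Der R P V) (Lie V)"
  and Der_pt_plus_submod: "Der_pt_plus R P V = submod (Der R P (pt R V)) (Ptp V)"
  by (simp_all add: Der_plus_def Der_Lie_def Der_pt_plus_def)

lemma module_Der_plus: "module R V \<Longrightarrow> module R (Der_plus R P V)"
  by (subst Der_plus_submod) (rule module_submod[OF module_Der submodule_Der_plus])

lemma module_Der_Lie: "module R V \<Longrightarrow> module R (Der_Lie R P V)"
  by (subst Der_Lie_submod) (rule module_submod[OF module_Der submodule_Lie])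

lemma submodule_Lie_plus:
  assumes V: "module R V" and dV: "dual_basis V"
  shows "submodule (Lie V) R (Der_plus R P V)"
  by (subst Der_plus_submod) (rule submodule_submod[OF module_Der[OF V] submodule_Der_plus[OF V] submodule_Lie[OF V] Lie_plus[OF V dV]])

lemma Der_map_plus_lin:
  assumes V: "module R V" and W: "module R W" and f: "f \<in> SR_hom R V W"
  shows "Der_map R P V W f \<in> lin_maps R (Der_plus R P V) (Der_plus R P W)"
  by (rule lin_maps_submod[OF Der_map_lin[OF V W f], of "carrier (Der_plus R P V)" "carrier (Der_plus R P W)", folded Der_plus_submod])
    (use Der_plus_sub[OF V] Der_map_plus[OF V W f] in auto)

lemma Der_map_Lie_lin:
  assumes V: "module R V" and W: "module R W" and f: "f \<in> SR_hom R V W"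
  shows "Der_map R P V W f \<in> lin_maps R (Der_Lie R P V) (Der_Lie R P W)"
  by (rule lin_maps_submod[OF Der_map_lin[OF V W f], of "Lie V" "Lie W", folded Der_Lie_submod])
    (use Lie_sub[OF V] Der_map_Lie[OF V W f] in auto)

lemma Der_map_Ptp_lin:
  assumes V: "module R V" and W: "module R W" and f: "f \<in> SR_hom R V W"
  shows "Der_map R P (pt R V) (pt R W) (ptm f) \<in> lin_maps R (Der_pt_plus R P V) (Der_pt_plus R P W)"
  by (rule lin_maps_submod[OF Der_map_lin[OF module_pt[OF V] module_pt[OF W] ptm_hom[OF f]], of "Ptp V" "Ptp W", folded Der_pt_plus_submod])
    (use submodule_facts(1)[OF module_Der[OF module_pt[OF V]] submodule_Ptp[OF V]] Der_map_Ptp[OF V W f] in auto)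

lemma Phi_plus_lin:
  assumes V: "module R V" and dV: "dual_basis V"
  shows "Phi R P V \<in> lin_maps R (Der_plus R P V) (Der_pt_plus R P V)"
  by (rule lin_maps_submod[OF Phi_lin[OF V dV], of "carrier (Der_plus R P V)" "Ptp V", folded Der_plus_submod Der_pt_plus_submod])
    (use Der_plus_sub[OF V] Phi_pt[OF V dV] Phi_plus[OF V dV] in \<open>auto simp: Ptp_iff\<close>)

lemma Div_lin:
  assumes V: "module R V" and dV: "dual_basis V"
  shows "Div R P V \<in> lin_maps R (Der_plus R P V) (trace_Der R P V)"
proof -
  have "(\<lambda>d. Div R P V d) \<in> lin_maps R (Der_plus R P V) (trace_Der R P V)"
    unfolding Div_def trace_Der_def
    by (rule lin_maps_comp[OF Phi_plus_lin[OF V dV] lin_maps_coset[OF module_Ptp[OF V] submodule_comm[OF V dV]]])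
  then show ?thesis by simp
qed

lemma module_trace: "module R V \<Longrightarrow> dual_basis V \<Longrightarrow> module R (trace_Der R P V)"
  unfolding trace_Der_def by (rule module_quot[OF module_Ptp submodule_comm])

lemma submodule_Im:
  assumes V: "module R V" and dV: "dual_basis V"
  shows "submodule (Im_Div R P V) R (trace_Der R P V)"
  unfolding Im_Div_def
  by (rule submodule_image[OF module_Der_plus[OF V] module_trace[OF V dV] Div_lin[OF V dV] submodule_Lie_plus[OF V dV]])

lemma module_trace_mod: "module R V \<Longrightarrow> dual_basis V \<Longrightarrow> module R (trace_mod_Im R P V)"
  unfolding trace_mod_Im_def by (rule module_quot[OF module_trace submodule_Im])

lemma Div_mod_lin:
  assumes V: "module R V" and dV: "dual_basis V"
  shows "Div_mod_Im R P V \<in> lin_maps R (Der_plus R P V) (trace_mod_Im R P V)"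
proof -
  have "(\<lambda>d. Div_mod_Im R P V d) \<in> lin_maps R (Der_plus R P V) (trace_mod_Im R P V)"
    unfolding Div_mod_Im_def trace_mod_Im_def
    by (rule lin_maps_comp[OF Div_lin[OF V dV] lin_maps_coset[OF module_trace[OF V dV] submodule_Im[OF V dV]]])
  then show ?thesis by simp
qed

lemma trace_cases:
  assumes "C \<in> carrier (trace_Der R P V)"
  obtains p where "p \<in> Ptp V" "C = Der_pt_comm R P V +>\<^bsub>Der_pt_plus R P V\<^esub> p"
  using assms unfolding trace_Der_def by (rule quot_cases)

lemma trace_mod_cases:
  assumes "C \<in> carrier (trace_mod_Im R P V)"
  obtains p where "p \<in> carrier (trace_Der R P V)" "C = Im_Div R P V +>\<^bsub>trace_Der R P V\<^esub> p"
  using assms unfolding trace_mod_Im_def by (rule quot_cases)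

lemma trace_map_facts:
  assumes V: "module R V" and dV: "dual_basis V" and W: "module R W" and dW: "dual_basis W" and f: "f \<in> SR_hom R V W"
  shows trace_map_lin: "trace_map R P V W f \<in> lin_maps R (trace_Der R P V) (trace_Der R P W)"
    and trace_map_coset: "\<And>p. p \<in> Ptp V \<Longrightarrow> trace_map R P V W f (Der_pt_comm R P V +>\<^bsub>Der_pt_plus R P V\<^esub> p) =
      Der_pt_comm R P W +>\<^bsub>Der_pt_plus R P W\<^esub> Der_map R P (pt R V) (pt R W) (ptm f) p"
proof -
  have s: "Der_map R P (pt R V) (pt R W) (ptm f) ` Der_pt_comm R P V \<subseteq> Der_pt_comm R P W"
    using Der_map_comm[OF V W dV dW f] by blast
  note F = module_Ptp[OF V] module_Ptp[OF W] submodule_comm[OF V dV] submodule_comm[OF W dW] Der_map_Ptp_lin[OF V W f] s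
  show "trace_map R P V W f \<in> lin_maps R (trace_Der R P V) (trace_Der R P W)"
    unfolding trace_map_def trace_Der_def by (rule lin_maps_quot_map[OF F])
  show "trace_map R P V W f (Der_pt_comm R P V +>\<^bsub>Der_pt_plus R P V\<^esub> p) =
      Der_pt_comm R P W +>\<^bsub>Der_pt_plus R P W\<^esub> Der_map R P (pt R V) (pt R W) (ptm f) p" if "p \<in> Ptp V" for p
    unfolding trace_map_def by (rule quot_map_coset[OF F that])
qed

lemma Div_natural:
  assumes V: "module R V" and dV: "dual_basis V" and W: "module R W" and dW: "dual_basis W" and f: "f \<in> SR_hom R V W"
    and d: "d \<in> carrier (Der_plus R P V)"
  shows "Div R P W (Der_map R P V W f d) = trace_map R P V W f (Div R P V d)"
  unfolding Div_def trace_map_coset[OF V dV W dW f lin_maps_closed[OF Phi_plus_lin[OF V dV] d]]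
    Phi_natural[OF V W dV dW f Der_plus_sub[OF V d]] ..

lemma trace_mod_map_facts:
  assumes V: "module R V" and dV: "dual_basis V" and W: "module R W" and dW: "dual_basis W" and f: "f \<in> SR_hom R V W"
  shows trace_mod_map_lin: "trace_mod_Im_map R P V W f \<in> lin_maps R (trace_mod_Im R P V) (trace_mod_Im R P W)"
    and trace_mod_map_coset: "\<And>C. C \<in> carrier (trace_Der R P V) \<Longrightarrow> trace_mod_Im_map R P V W f (Im_Div R P V +>\<^bsub>trace_Der R P V\<^esub> C) =
      Im_Div R P W +>\<^bsub>trace_Der R P W\<^esub> trace_map R P V W f C"
proof -
  have s: "trace_map R P V W f ` Im_Div R P V \<subseteq> Im_Div R P W"
    using Div_natural[OF V dV W dW f subsetD[OF Lie_plus[OF V dV]], symmetric] Der_map_Lie[OF V W f] by (auto simp: Im_Div_def)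
  note F = module_trace[OF V dV] module_trace[OF W dW] submodule_Im[OF V dV] submodule_Im[OF W dW] trace_map_lin[OF V dV W dW f] s
  show "trace_mod_Im_map R P V W f \<in> lin_maps R (trace_mod_Im R P V) (trace_mod_Im R P W)"
    unfolding trace_mod_Im_map_def trace_mod_Im_def by (rule lin_maps_quot_map[OF F])
  show "trace_mod_Im_map R P V W f (Im_Div R P V +>\<^bsub>trace_Der R P V\<^esub> C) =
      Im_Div R P W +>\<^bsub>trace_Der R P W\<^esub> trace_map R P V W f C" if "C \<in> carrier (trace_Der R P V)" for C
    unfolding trace_mod_Im_map_def by (rule quot_map_coset[OF F that])
qed

lemma Div_mod_natural:
  assumes V: "module R V" and dV: "dual_basis V" and W: "module R W" and dW: "dual_basis W" and f: "f \<in> SR_hom R V W"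
    and d: "d \<in> carrier (Der_plus R P V)"
  shows "Div_mod_Im R P W (Der_map R P V W f d) = trace_mod_Im_map R P V W f (Div_mod_Im R P V d)"
  unfolding Div_mod_Im_def trace_mod_map_coset[OF V dV W dW f lin_maps_closed[OF Div_lin[OF V dV] d]] Div_natural[OF V dV W dW f d] ..

lemma Div_mod_Lie:
  assumes V: "module R V" and dV: "dual_basis V" and d: "d \<in> carrier (Der_plus R P V)"
  shows "Div_mod_Im R P V d = \<zero>\<^bsub>trace_mod_Im R P V\<^esub> \<longleftrightarrow> (\<exists>e\<in>Lie V. Div R P V d = Div R P V e)"
  unfolding Div_mod_Im_def trace_mod_Im_def quot_simps
    coset_eq_self_iff[OF module_trace[OF V dV] submodule_Im[OF V dV] lin_maps_closed[OF Div_lin[OF V dV] d]]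
  by (auto simp: Im_Div_def)

lemma ident_SR_hom: "(id, id) \<in> SR_hom R V V"
  by (simp add: SR_hom_def lin_maps_id id_def)

lemma ptm_ident: "ptm (id, id) = (id, id)"
  by (simp add: prod.map_id0)

lemma ptm_SR_comp: "ptm (SR_comp g f) = SR_comp (ptm g) (ptm f)"
  by (auto simp: SR_comp_def fun_eq_iff)

lemma trace_map_ident:
  assumes V: "module R V" and dV: "dual_basis V" and C: "C \<in> carrier (trace_Der R P V)"
  shows "trace_map R P V V (id, id) C = C"
proof -
  obtain p where p: "p \<in> Ptp V" "C = Der_pt_comm R P V +>\<^bsub>Der_pt_plus R P V\<^esub> p" using C by (rule trace_cases)
  show ?thesis
    unfolding p(2) trace_map_coset[OF V dV V dV ident_SR_hom p(1)] ptm_ident Der_map_ident[OF module_pt[OF V] Ptp_dec(2)[OF V dV p(1)]] ..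
qed

lemma trace_map_SR_comp:
  assumes U: "module R U" and dU: "dual_basis U" and V: "module R V" and dV: "dual_basis V" and W: "module R W" and dW: "dual_basis W"
    and f: "f \<in> SR_hom R U V" and g: "g \<in> SR_hom R V W" and C: "C \<in> carrier (trace_Der R P U)"
  shows "trace_map R P U W (SR_comp g f) C = trace_map R P V W g (trace_map R P U V f C)"
proof -
  obtain p where p: "p \<in> Ptp U" "C = Der_pt_comm R P U +>\<^bsub>Der_pt_plus R P U\<^esub> p" using C by (rule trace_cases)
  show ?thesis
    unfolding p(2) trace_map_coset[OF U dU V dV f p(1)] trace_map_coset[OF U dU W dW SR_comp_hom[OF f g] p(1)]
      trace_map_coset[OF V dV W dW g Der_map_Ptp[OF U V f p(1)]] ptm_SR_comp
      Der_map_SR_comp[OF module_pt[OF U] module_pt[OF V] module_pt[OF W] ptm_hom[OF f] ptm_hom[OF g] Ptp_dec(2)[OF U dU p(1)]] ..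
qed

lemma trace_mod_map_ident:
  assumes V: "module R V" and dV: "dual_basis V" and C: "C \<in> carrier (trace_mod_Im R P V)"
  shows "trace_mod_Im_map R P V V (id, id) C = C"
proof -
  obtain p where p: "p \<in> carrier (trace_Der R P V)" "C = Im_Div R P V +>\<^bsub>trace_Der R P V\<^esub> p" using C by (rule trace_mod_cases)
  show ?thesis
    unfolding p(2) trace_mod_map_coset[OF V dV V dV ident_SR_hom p(1)] trace_map_ident[OF V dV p(1)] ..
qed

lemma trace_mod_map_SR_comp:
  assumes U: "module R U" and dU: "dual_basis U" and V: "module R V" and dV: "dual_basis V" and W: "module R W" and dW: "dual_basis W"
    and f: "f \<in> SR_hom R U V" and g: "g \<in> SR_hom R V W" and C: "C \<in> carrier (trace_mod_Im R P U)"
  shows "trace_mod_Im_map R P U W (SR_comp g f) C = trace_mod_Im_map R P V W g (trace_mod_Im_map R P U V f C)"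
proof -
  obtain p where p: "p \<in> carrier (trace_Der R P U)" "C = Im_Div R P U +>\<^bsub>trace_Der R P U\<^esub> p" using C by (rule trace_mod_cases)
  show ?thesis
    unfolding p(2) trace_mod_map_coset[OF U dU V dV f p(1)] trace_mod_map_coset[OF U dU W dW SR_comp_hom[OF f g] p(1)]
      trace_mod_map_coset[OF V dV W dW g lin_maps_closed[OF trace_map_lin[OF U dU V dV f] p(1)]]
      trace_map_SR_comp[OF U dU V dV W dW f g p(1)] ..
qed

text \<open>One new variable marks the base point, as in \<open>Phi_lift\<close>.\<close>
lemma Div_mod_hits:
  assumes V: "module R V" and dV: "dual_basis V" and C: "C \<in> carrier (trace_mod_Im R P V)"
  defines "W \<equiv> dsum V (power_module R 1)"
  shows "trace_mod_Im_map R P V W (SR_incl R 1) C \<in> Div_mod_Im R P W ` carrier (Der_plus R P W)"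
proof -
  have W: "module R W" unfolding W_def by (rule module_dsum[OF V module_power])
  have dW: "dual_basis W" unfolding W_def by (rule dual_basis_dsum[OF V module_power dV dual_basis_power])
  have f: "SR_incl R 1 \<in> SR_hom R V W" unfolding W_def by (rule SR_incl_hom[OF V])
  let ?y = "\<lambda>a. (\<zero>\<^bsub>V\<^esub>, \<lambda>i\<in>{..<1::nat}. if i = a then \<one> else \<zero>)" and ?g = "\<lambda>a u. snd u a"
  interpret fresh_letters R P V W "SR_incl R 1" ?y ?g "{..<1}"
    by (rule fresh_letters.intro[OF bin_operad_axioms fresh_letters_axioms.intro[OF V f letters_power[OF V, of 1, folded W_def]]])
  obtain C' where C': "C' \<in> carrier (trace_Der R P V)" "C = Im_Div R P V +>\<^bsub>trace_Der R P V\<^esub> C'" using C by (rule trace_mod_cases)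
  obtain p where p: "p \<in> Ptp V" "C' = Der_pt_comm R P V +>\<^bsub>Der_pt_plus R P V\<^esub> p" using C'(1) by (rule trace_cases)
  have i: "0 \<in> {..<1::nat}" by simp
  note D = Phi_lift[OF dV dW i p(1)]
  have "trace_mod_Im_map R P V W (SR_incl R 1) C = Div_mod_Im R P W (U 0 (p (base V)))"
    unfolding C'(2) trace_mod_map_coset[OF V dV W dW f C'(1)]
    unfolding p(2) trace_map_coset[OF V dV W dW f p(1)] Div_mod_Im_def Div_def D(2) ..
  then show ?thesis using D(1) by (rule image_eqI)
qed

text \<open>The hypothesis says that \<open>d\<close> has the same divergence as some \<open>e\<close> in the Lie algebra. Then \<open>\<Phi>(d - e)\<close> is a
  sum of commutators, so \<open>d - e\<close> lands in the Lie algebra, and so does \<open>e\<close> by functoriality.\<close>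
lemma kernel_into_Lie:
  assumes V: "module R V" and dV: "dual_basis V" and n: "4 \<le> n" and d: "d \<in> carrier (Der_plus R P V)"
    and k: "Div_mod_Im R P V d = \<zero>\<^bsub>trace_mod_Im R P V\<^esub>"
  shows "Der_map R P V (dsum V (power_module R n)) (SR_incl R n) d \<in> Lie (dsum V (power_module R n))"
proof -
  define W where "W = dsum V (power_module R n)"
  have W: "module R W" unfolding W_def by (rule module_dsum[OF V module_power])
  have f: "SR_incl R n \<in> SR_hom R V W" unfolding W_def by (rule SR_incl_hom[OF V])
  let ?y = "\<lambda>a. (\<zero>\<^bsub>V\<^esub>, \<lambda>i\<in>{..<n}. if i = a then \<one> else \<zero>)" and ?g = "\<lambda>a u. snd u a"
  have l: "letters W (fst (SR_incl R n) ` carrier V) ?y ?g {0, 1, 2, 3}"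
    using letters_subset[OF letters_power[OF V, of n], of "{0, 1, 2, 3}"] n by (simp add: W_def)
  have r: "snd (SR_incl R n) (?y i) = \<zero>\<^bsub>V\<^esub>" for i by (simp add: SR_incl_def)
  interpret four_letters R P V W "SR_incl R n" ?y ?g
    by (rule four_letters.intro[OF fresh_letters.intro[OF bin_operad_axioms fresh_letters_axioms.intro[OF V f l]]
          four_letters_axioms.intro[OF r dV]])
  interpret DW: module R "Der R P W" by (rule module_Der[OF W])
  obtain e where e: "e \<in> Lie V" and eq: "Div R P V d = Div R P V e" using k Div_mod_Lie[OF V dV d] by blast
  note DV = module_Der[OF V] and DP = module_Der[OF module_pt[OF V]]
  have e': "e \<in> carrier (Der_plus R P V)" using e Lie_plus[OF V dV] by blast
  note dD = Der_plus_sub[OF V d] and eD = Der_plus_sub[OF V e']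
  note sp = submodule_facts[OF DV submodule_Der_plus[OF V]]
  have pd: "Phi R P V d \<in> Ptp V" "Phi R P V e \<in> Ptp V" using lin_maps_closed[OF Phi_plus_lin[OF V dV]] d e' by auto
  have "Phi R P V d \<ominus>\<^bsub>Der_pt_plus R P V\<^esub> Phi R P V e \<in> Der_pt_comm R P V"
    using eq coset_eq_iff[OF module_Ptp[OF V] submodule_comm[OF V dV] pd] by (simp add: Div_def)
  then have "Phi R P V (d \<ominus>\<^bsub>Der R P V\<^esub> e) \<in> Der_pt_comm R P V"
    using submod_diff[OF DP submodule_Ptp[OF V] pd, folded Der_pt_plus_submod] lin_maps_diff[OF DV DP Phi_lin[OF V dV] dD eD] by simp
  then have 1: "Der_map R P V W (SR_incl R n) (d \<ominus>\<^bsub>Der R P V\<^esub> e) \<in> Lie W"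
    by (rule Der_map_into_Lie[OF sp(5)[OF d e']])
  have 2: "Der_map R P V W (SR_incl R n) e \<in> Lie W" by (rule Der_map_Lie[OF V W f e])
  note m = Der_map_Der[OF V W f]
  have "Der_map R P V W (SR_incl R n) d = Der_map R P V W (SR_incl R n) (d \<ominus>\<^bsub>Der R P V\<^esub> e) \<oplus>\<^bsub>Der R P W\<^esub> Der_map R P V W (SR_incl R n) e"
    unfolding lin_maps_diff[OF DV module_Der[OF W] Der_map_lin[OF V W f] dD eD]
    using m[OF dD] m[OF eD] by (simp add: DW.minus_eq DW.a_assoc DW.l_neg)
  then show ?thesis using submodule_facts(3)[OF module_Der[OF W] submodule_Lie[OF W] 1 2] by (simp add: W_def)
qed

lemma functor_Der_Lie:
  "SR_functor R (Der_Lie R P :: ('r, 'u) module \<Rightarrow> _) (Der_Lie R P :: ('r, 'v) module \<Rightarrow> _)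
    (Der_Lie R P :: ('r, 'w) module \<Rightarrow> _) (Der_map R P) (Der_map R P) (Der_map R P) (Der_map R P)"
  unfolding SR_functor_def
  by (intro conjI allI ballI impI module_Der_Lie Der_map_Lie_lin Der_map_ident Der_map_SR_comp)
    (auto dest: free_fin_rank_dual_basis(1) intro: Lie_sub)

lemma functor_Der_plus:
  "SR_functor R (Der_plus R P :: ('r, 'u) module \<Rightarrow> _) (Der_plus R P :: ('r, 'v) module \<Rightarrow> _)
    (Der_plus R P :: ('r, 'w) module \<Rightarrow> _) (Der_map R P) (Der_map R P) (Der_map R P) (Der_map R P)"
  unfolding SR_functor_def
  by (intro conjI allI ballI impI module_Der_plus Der_map_plus_lin Der_map_ident Der_map_SR_comp)
    (auto dest: free_fin_rank_dual_basis(1) intro: Der_plus_sub)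

lemma functor_trace:
  "SR_functor R (trace_Der R P :: ('r, 'u) module \<Rightarrow> _) (trace_Der R P :: ('r, 'v) module \<Rightarrow> _)
    (trace_Der R P :: ('r, 'w) module \<Rightarrow> _) (trace_map R P) (trace_map R P) (trace_map R P) (trace_map R P)"
  unfolding SR_functor_def
  by (intro conjI allI ballI impI module_trace trace_map_lin trace_map_ident trace_map_SR_comp)
    (auto dest: free_fin_rank_dual_basis)

lemma functor_trace_mod:
  "SR_functor R (trace_mod_Im R P :: ('r, 'u) module \<Rightarrow> _) (trace_mod_Im R P :: ('r, 'v) module \<Rightarrow> _)
    (trace_mod_Im R P :: ('r, 'w) module \<Rightarrow> _)
    (trace_mod_Im_map R P) (trace_mod_Im_map R P) (trace_mod_Im_map R P) (trace_mod_Im_map R P)"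
  unfolding SR_functor_def
  by (intro conjI allI ballI impI module_trace_mod trace_mod_map_lin trace_mod_map_ident trace_mod_map_SR_comp)
    (auto dest: free_fin_rank_dual_basis)

lemma natural_Div:
  "SR_natural R (Der_plus R P :: ('r, 'v) module \<Rightarrow> _) (Der_plus R P :: ('r, 'w) module \<Rightarrow> _) (Der_map R P)
    (trace_Der R P) (trace_Der R P) (trace_map R P) (Div R P) (Div R P)"
  unfolding SR_natural_def
  by (intro conjI allI ballI impI Div_lin Div_natural) (auto dest: free_fin_rank_dual_basis)

lemma natural_Div_mod:
  "SR_natural R (Der_plus R P :: ('r, 'v) module \<Rightarrow> _) (Der_plus R P :: ('r, 'w) module \<Rightarrow> _) (Der_map R P)
    (trace_mod_Im R P) (trace_mod_Im R P) (trace_mod_Im_map R P) (Div_mod_Im R P) (Div_mod_Im R P)"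
  unfolding SR_natural_def
  by (intro conjI allI ballI impI Div_mod_lin Div_mod_natural) (auto dest: free_fin_rank_dual_basis)

lemma natural_incl:
  "SR_natural R (Der_Lie R P :: ('r, 'v) module \<Rightarrow> _) (Der_Lie R P :: ('r, 'w) module \<Rightarrow> _) (Der_map R P)
    (Der_plus R P) (Der_plus R P) (Der_map R P) (Der_incl R P) (Der_incl R P)"
proof -
  have "Der_incl R P V \<in> lin_maps R (Der_Lie R P V) (Der_plus R P V)" if V: "free_fin_rank R V" for V :: "('r, 'v) module"
  proof (rule lin_mapsI)
    show "Der_incl R P V x \<in> carrier (Der_plus R P V)" if "x \<in> Lie V" for x
      using Lie_plus[OF free_fin_rank_dual_basis[OF V]] that by (auto simp: Der_incl_def)
  qed (simp_all add: Der_incl_def Der_Lie_def Der_plus_def)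
  then show ?thesis unfolding SR_natural_def by (simp add: Der_incl_def)
qed

lemma surjective_Div_mod:
  "n_surjective R 1 (Der_plus R P :: ('r, 'v) module \<Rightarrow> _) (Der_plus R P)
    (trace_mod_Im R P) (trace_mod_Im R P) (trace_mod_Im_map R P) (Div_mod_Im R P) (Div_mod_Im R P)"
  unfolding n_surjective_def n_torsion_def Let_def coker_def
proof (intro allI impI ballI)
  fix V :: "('r, 'v) module" and x
  assume "free_fin_rank R V" and x: "x \<in> carrier (quot R (trace_mod_Im R P V) (Div_mod_Im R P V ` carrier (Der_plus R P V)))"
  note V = free_fin_rank_dual_basis[OF this(1)]
  let ?W = "dsum V (power_module R 1)"
  have W: "module R ?W" by (rule module_dsum[OF V(1) module_power])
  have dW: "dual_basis ?W" by (rule dual_basis_dsum[OF V(1) module_power V(2) dual_basis_power])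
  note f = SR_incl_hom[OF V(1), of 1]
  obtain C where C: "C \<in> carrier (trace_mod_Im R P V)"
    and xC: "x = Div_mod_Im R P V ` carrier (Der_plus R P V) +>\<^bsub>trace_mod_Im R P V\<^esub> C" using x by (rule quot_cases)
  have sub: "submodule (Div_mod_Im R P V ` carrier (Der_plus R P V)) R (trace_mod_Im R P V)"
    by (rule submodule_image[OF module_Der_plus[OF V(1)] module_trace_mod[OF V] Div_mod_lin[OF V] submodule_carrier[OF module_Der_plus[OF V(1)]]])
  have subW: "submodule (Div_mod_Im R P ?W ` carrier (Der_plus R P ?W)) R (trace_mod_Im R P ?W)"
    by (rule submodule_image[OF module_Der_plus[OF W] module_trace_mod[OF W dW] Div_mod_lin[OF W dW] submodule_carrier[OF module_Der_plus[OF W]]])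
  have m: "trace_mod_Im_map R P V ?W (SR_incl R 1) ` (Div_mod_Im R P V ` carrier (Der_plus R P V)) \<subseteq> Div_mod_Im R P ?W ` carrier (Der_plus R P ?W)"
    using Div_mod_natural[OF V W dW f, symmetric] Der_map_plus[OF V(1) W f] by (auto simp: image_iff)
  note T = trace_mod_map_lin[OF V W dW f]
  show "quot_map (trace_mod_Im R P ?W) (Div_mod_Im R P ?W ` carrier (Der_plus R P ?W)) (trace_mod_Im_map R P V ?W (SR_incl R 1)) x =
      \<zero>\<^bsub>quot R (trace_mod_Im R P ?W) (Div_mod_Im R P ?W ` carrier (Der_plus R P ?W))\<^esub>"
    unfolding xC quot_map_coset[OF module_trace_mod[OF V] module_trace_mod[OF W dW] sub subW T m C] quot_simps
      coset_eq_self_iff[OF module_trace_mod[OF W dW] subW lin_maps_closed[OF T C]]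
    by (rule Div_mod_hits[OF V C])
qed

lemma torsion_mid_homology: "n_torsion R 6 (mid_homology R P :: ('r, 'v) module \<Rightarrow> _) (mid_homology R P) (mid_homology_map R P)"
  unfolding n_torsion_def Let_def mid_homology_def homology_def
proof (intro allI impI ballI)
  fix V :: "('r, 'v) module" and x
  assume "free_fin_rank R V"
  note V = free_fin_rank_dual_basis[OF this]
  let ?W = "dsum V (power_module R 6)"
  let ?K = "{d \<in> carrier (Der_plus R P V). Div_mod_Im R P V d = \<zero>\<^bsub>trace_mod_Im R P V\<^esub>}"
  assume x: "x \<in> carrier (quot R (submod (Der_plus R P V) ?K) (Der_incl R P V ` Lie V))"
  have W: "module R ?W" by (rule module_dsum[OF V(1) module_power])
  have dW: "dual_basis ?W" by (rule dual_basis_dsum[OF V(1) module_power V(2) dual_basis_power])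
  note f = SR_incl_hom[OF V(1), of 6]
  have incl: "Der_incl R P U ` L = L" for U :: "('r, 'u) module" and L by (simp add: Der_incl_def)
  have K: "submodule ?K R (Der_plus R P V)"
    using submodule_preimage[OF module_Der_plus[OF V(1)] module_trace_mod[OF V] Div_mod_lin[OF V] submodule_zero[OF module_trace_mod[OF V]]] by simp
  have LK: "Lie V \<subseteq> ?K" using Lie_plus[OF V] Div_mod_Lie[OF V] by blast
  note Kmod = module_submod[OF module_Der_plus[OF V(1)] K]
    and LKs = submodule_submod[OF module_Der_plus[OF V(1)] K submodule_Lie_plus[OF V] LK]
  obtain d where d: "d \<in> ?K" and xd: "x = Lie V +>\<^bsub>submod (Der_plus R P V) ?K\<^esub> d"
    using x unfolding incl by (rule quot_cases) simp
  have T: "Der_map R P V ?W (SR_incl R 6) \<in> lin_maps R (submod (Der_plus R P V) ?K) (Der_plus R P ?W)"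
    using lin_maps_closed[OF Der_map_plus_lin[OF V(1) W f]] lin_maps_add[OF Der_map_plus_lin[OF V(1) W f]] lin_maps_smult[OF Der_map_plus_lin[OF V(1) W f]]
    by (intro lin_mapsI) auto
  have m: "Der_map R P V ?W (SR_incl R 6) ` Lie V \<subseteq> Lie ?W" using Der_map_Lie[OF V(1) W f] by blast
  have dK: "d \<in> carrier (submod (Der_plus R P V) ?K)" using d by simp
  have L: "Der_map R P V ?W (SR_incl R 6) d \<in> Lie ?W" by (rule kernel_into_Lie[OF V]) (use d in auto)
  show "mid_homology_map R P V ?W (SR_incl R 6) x =
      \<zero>\<^bsub>quot R (submod (Der_plus R P ?W) {b \<in> carrier (Der_plus R P ?W). Div_mod_Im R P ?W b = \<zero>\<^bsub>trace_mod_Im R P ?W\<^esub>}) (Der_incl R P ?W ` Lie ?W)\<^esub>"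
    unfolding mid_homology_map_def incl xd quot_simps
      quot_map_coset[OF Kmod module_Der_plus[OF W] LKs submodule_Lie_plus[OF W dW] T m dK]
      coset_eq_self_iff[OF module_Der_plus[OF W] submodule_Lie_plus[OF W dW] subsetD[OF Lie_plus[OF W dW] L]]
    by (rule L)
qed

end

theorem theorem12p1:
  fixes R :: "'r ring" and P :: "('r, 'o) operad"
  assumes "cring R" and "fg_stably_free_are_free R" and "binary_operad R P"
  shows
    "(SR_functor R (Der_Lie R P :: ('r, 'u) module \<Rightarrow> _) (Der_Lie R P :: ('r, 'v) module \<Rightarrow> _)
        (Der_Lie R P :: ('r, 'w) module \<Rightarrow> _)
        (Der_map R P) (Der_map R P) (Der_map R P) (Der_map R P) \<and>
      SR_functor R (Der_plus R P :: ('r, 'u) module \<Rightarrow> _) (Der_plus R P :: ('r, 'v) module \<Rightarrow> _)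
        (Der_plus R P :: ('r, 'w) module \<Rightarrow> _)
        (Der_map R P) (Der_map R P) (Der_map R P) (Der_map R P) \<and>
      SR_functor R (trace_Der R P :: ('r, 'u) module \<Rightarrow> _) (trace_Der R P :: ('r, 'v) module \<Rightarrow> _)
        (trace_Der R P :: ('r, 'w) module \<Rightarrow> _)
        (trace_map R P) (trace_map R P) (trace_map R P) (trace_map R P) \<and>
      SR_functor R (trace_mod_Im R P :: ('r, 'u) module \<Rightarrow> _) (trace_mod_Im R P :: ('r, 'v) module \<Rightarrow> _)
        (trace_mod_Im R P :: ('r, 'w) module \<Rightarrow> _)
        (trace_mod_Im_map R P) (trace_mod_Im_map R P) (trace_mod_Im_map R P) (trace_mod_Im_map R P) \<and>
      SR_natural R (Der_plus R P :: ('r, 'v) module \<Rightarrow> _) (Der_plus R P :: ('r, 'w) module \<Rightarrow> _) (Der_map R P)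
        (trace_Der R P) (trace_Der R P) (trace_map R P) (Div R P) (Div R P) \<and>
      SR_natural R (Der_plus R P :: ('r, 'v) module \<Rightarrow> _) (Der_plus R P :: ('r, 'w) module \<Rightarrow> _) (Der_map R P)
        (trace_mod_Im R P) (trace_mod_Im R P) (trace_mod_Im_map R P) (Div_mod_Im R P) (Div_mod_Im R P) \<and>
      (\<forall>V :: ('r, 'v) module. free_fin_rank R V \<longrightarrow> submodule (Im_Div R P V) R (trace_Der R P V) \<and>
        (\<forall>d\<in>carrier (Der_Lie R P V). Div_mod_Im R P V (Der_incl R P V d) = \<zero>\<^bsub>trace_mod_Im R P V\<^esub>))) \<and>
     (SR_natural R (Der_Lie R P :: ('r, 'v) module \<Rightarrow> _) (Der_Lie R P :: ('r, 'w) module \<Rightarrow> _) (Der_map R P)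
        (Der_plus R P) (Der_plus R P) (Der_map R P) (Der_incl R P) (Der_incl R P) \<and>
      (\<forall>V :: ('r, 'v) module. free_fin_rank R V \<longrightarrow> inj_on (Der_incl R P V) (carrier (Der_Lie R P V)))) \<and>
     n_surjective R 1 (Der_plus R P :: ('r, 'v) module \<Rightarrow> _) (Der_plus R P)
       (trace_mod_Im R P) (trace_mod_Im R P) (trace_mod_Im_map R P) (Div_mod_Im R P) (Div_mod_Im R P) \<and>
     n_torsion R 6 (mid_homology R P :: ('r, 'v) module \<Rightarrow> _) (mid_homology R P) (mid_homology_map R P)"
proof -
  interpret bin_operad R P
    using assms(3) by (intro bin_operad.intro bin_operad_axioms.intro) (simp_all add: binary_operad_def)
  have "submodule (Im_Div R P V) R (trace_Der R P V) \<and>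
      (\<forall>d\<in>carrier (Der_Lie R P V). Div_mod_Im R P V (Der_incl R P V d) = \<zero>\<^bsub>trace_mod_Im R P V\<^esub>)"
    if "free_fin_rank R V" for V :: "('r, 'v) module"
  proof -
    note V = free_fin_rank_dual_basis[OF that]
    have "Div_mod_Im R P V d = \<zero>\<^bsub>trace_mod_Im R P V\<^esub>" if d: "d \<in> carrier (Der_Lie R P V)" for d
      using Div_mod_Lie[OF V subsetD[OF Lie_plus[OF V] d]] d by blast
    then show ?thesis using submodule_Im[OF V] by (simp add: Der_incl_def)
  qed
  moreover have "inj_on (Der_incl R P V) (carrier (Der_Lie R P V))" for V :: "('r, 'v) module"
    by (simp add: inj_on_def Der_incl_def)
  ultimately show ?thesis
    by (intro conjI functor_Der_Lie functor_Der_plus functor_trace functor_trace_mod natural_Div natural_Div_mod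
        natural_incl surjective_Div_mod torsion_mid_homology) blast+
qed

end
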